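(* Let $e\in\mathbb{R}$, $t_0\in\mathbb{R}$ and $r\ge 0$. Let $\varphi$ be a differentiable function on $\mathbb{R}^3$ such that $\|\varphi\|_{H^r}<\infty$ and $\|\varphi\|_{H^1}<\infty$, and such that the divergence equations $$\nabla\cdot E=\rho,\qquad \nabla\cdot B=0$$ admit a solution in $(H^r(\mathbb{R}^3))^3\oplus(H^r(\mathbb{R}^3))^3$, where $\rho=e\varphi(\xi-x)$. Furthermore let $\xi_{(0)},v_{(0)}\in\mathbb{R}^3$ and let $E_{(0)},B_{(0)}\in(H^r(\mathbb{R}^3))^3$ satisfy $\nabla\cdot E_{(0)}=e\varphi(\xi_{(0)}-\cdot)$ and $\nabla\cdot B_{(0)}=0$. Then the Maxwell-Newton system $$\partial_tB+\nabla\times E=0,\quad \partial_tE-\nabla\times B=-j,\quad \nabla\cdot E=\rho,\quad \nabla\cdot B=0,$$ $$\dot\xi=v,\quad \dot v=e\big[(\varphi*E)(\xi)+v\times(\varphi*B)(\xi)\big],$$ with $j=ev\,\varphi(\xi-x)$, $\rho=e\varphi(\xi-x)$ and initial data $E(t_0)=E_{(0)}$, $B(t_0)=B_{(0)}$, $\xi(t_0)=\xi_{(0)}$, $v(t_0)=v_{(0)}$, admits a unique solution $(E,B,\xi,v)$ in $$\mathscr{C}^0\big(\mathbb{R},(H^r(\mathbb{R}^3))^3\oplus(H^r(\mathbb{R}^3))^3\oplus\mathbb{R}^3\oplus\mathbb{R}^3\big)\cap\mathscr{C}^1\big(\mathbb{R},(H^{r-1}(\mathbb{R}^3))^3\opl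us(H^{r-1}(\mathbb{R}^3))^3\oplus\mathbb{R}^3\oplus\mathbb{R}^3\big).$$
   Context: All fields and $\varphi$ are real-valued. $\hat f$ is the unitary Fourier transform on $\mathbb{R}^3$. For $\sigma\in\mathbb{R}$, $H^\sigma(\mathbb{R}^3)$ is the non-homogeneous Sobolev space with norm $\|f\|_{H^\sigma}^2=\int_{\mathbb{R}^3}(1+|k|^2)^\sigma|\hat f(k)|^2\,dk$. For $\varphi,f\in L^2(\mathbb{R}^3)$, $(\varphi*f)(x)=\int\varphi(x-y)f(y)\,dy$. Notion of solution: the evolution part of the system together with the initial data is understood in integral (Duhamel) form, $$(E,B)(t)=U(t-t_0)(E_{(0)},B_{(0)})+\int_{t_0}^tU(t-\tau)(-j(\tau),0)\,d\tau,$$ $$(\xi,v)(t)=W(t-t_0)(\xi_{(0)},v_{(0)})+\int_{t_0}^tW(t-\tau)(0,f_{em}(\tau))\,d\tau,$$ where $j(\tau)=ev(\tau)\varphi(\xi(\tau)-\cdot)$, $f_{em}(\tau)=e[(\varphi*E(\tau))(\xi(\tau))+v(\tau)\times(\varphi*B(\tau))(\xi(\tau))]$, $U(t)$ is the unitary one-parameter group on $(L^2)^3\oplus(L^2)^3$ solving the free equations $\partial_tE=\nabla\times B$, $\partial_tB=-\nabla\times E$ (defined by Fourier transform), and $W(t)(\xi,v)=(\xi+tv,v)$. The divergence equations are required to hold in the sense of distributions for every $t$. *)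

theory Defs
  imports "HOL-Analysis.Analysis"
begin

section \<open>The Hilbert space of square integrable fields on three-space\<close>

definition square_integrable :: "(real^3 \<Rightarrow> 'b::euclidean_space) \<Rightarrow> bool" where
  "square_integrable f \<longleftrightarrow>
     f \<in> borel_measurable lborel \<and> integrable lborel (\<lambda>x. (norm (f x))\<^sup>2)"

definition L2_rel :: "(real^3 \<Rightarrow> 'b::euclidean_space) \<Rightarrow> (real^3 \<Rightarrow> 'b) \<Rightarrow> bool" where
  "L2_rel f g \<longleftrightarrow> square_integrable f \<and> square_integrable g \<and> (AE x in lborel. f x = g x)"

lemma square_integrable_zero [simp]: "square_integrable (\<lambda>x. 0)"
  by (simp add: square_integrable_def)

lemma square_integrable_scaleR:
  assumes "square_integrable f"
  shows "square_integrable (\<lambda>x. c *\<^sub>R f x)"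
  using assms unfolding square_integrable_def by (auto simp: power_mult_distrib)

lemma square_integrable_add:
  assumes "square_integrable f" "square_integrable g"
  shows "square_integrable (\<lambda>x. f x + g x)"
proof -
  have [measurable]: "f \<in> borel_measurable lborel" "g \<in> borel_measurable lborel"
    using assms by (auto simp: square_integrable_def)
  have bound: "(norm (f x + g x))\<^sup>2 \<le> 2 * (norm (f x))\<^sup>2 + 2 * (norm (g x))\<^sup>2" for x
  proof -
    have "(norm (f x + g x))\<^sup>2 \<le> (norm (f x) + norm (g x))\<^sup>2"
      by (intro power_mono norm_triangle_ineq) auto
    also have "\<dots> \<le> 2 * (norm (f x))\<^sup>2 + 2 * (norm (g x))\<^sup>2"
      using sum_squares_bound[of "norm (f x)" "norm (g x)"] by (simp add: power2_sum)
    finally show ?thesis .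
  qed
  have "integrable lborel (\<lambda>x. 2 * (norm (f x))\<^sup>2 + 2 * (norm (g x))\<^sup>2)"
    using assms by (auto simp: square_integrable_def)
  then have "integrable lborel (\<lambda>x. (norm (f x + g x))\<^sup>2)"
    by (rule Bochner_Integration.integrable_bound) (use bound in auto)
  then show ?thesis by (simp add: square_integrable_def)
qed

lemma square_integrable_inner:
  assumes "square_integrable f" "square_integrable g"
  shows "integrable lborel (\<lambda>x. f x \<bullet> g x)"
proof -
  have [measurable]: "f \<in> borel_measurable lborel" "g \<in> borel_measurable lborel"
    using assms by (auto simp: square_integrable_def)
  have bound: "\<bar>f x \<bullet> g x\<bar> \<le> (norm (f x))\<^sup>2 + (norm (g x))\<^sup>2" for x
  proof -
    have "\<bar>f x \<bullet> g x\<bar> \<le> norm (f x) * norm (g x)"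
      by (rule Cauchy_Schwarz_ineq2)
    also have "\<dots> \<le> (norm (f x))\<^sup>2 + (norm (g x))\<^sup>2"
      using sum_squares_bound[of "norm (f x)" "norm (g x)"]
        mult_nonneg_nonneg[OF norm_ge_zero[of "f x"] norm_ge_zero[of "g x"]] by linarith
    finally show ?thesis .
  qed
  have "integrable lborel (\<lambda>x. (norm (f x))\<^sup>2 + (norm (g x))\<^sup>2)"
    using assms by (auto simp: square_integrable_def)
  then show ?thesis
    by (rule Bochner_Integration.integrable_bound) (use bound in auto)
qed

quotient_type (overloaded) 'b L2 = "real^3 \<Rightarrow> 'b::euclidean_space" / partial: L2_rel
  morphisms rep_L2 abs_L2
proof (rule part_equivpI)
  show "\<exists>f::real^3 \<Rightarrow> 'b. L2_rel f f"
    by (rule exI[of _ "\<lambda>x. 0"]) (simp add: L2_rel_def)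
  show "symp (L2_rel :: (real^3 \<Rightarrow> 'b) \<Rightarrow> _)"
    by (auto simp: symp_def L2_rel_def)
  show "transp (L2_rel :: (real^3 \<Rightarrow> 'b) \<Rightarrow> _)"
    by (auto simp: transp_def L2_rel_def)
qed

instantiation L2 :: (euclidean_space) real_vector
begin

lift_definition zero_L2 :: "'a L2" is "\<lambda>x. 0"
  by (simp add: L2_rel_def)

lift_definition plus_L2 :: "'a L2 \<Rightarrow> 'a L2 \<Rightarrow> 'a L2" is "\<lambda>f g x. f x + g x"
  by (auto simp: L2_rel_def square_integrable_add)

lift_definition scaleR_L2 :: "real \<Rightarrow> 'a L2 \<Rightarrow> 'a L2" is "\<lambda>c f x. c *\<^sub>R f x"
  by (auto simp: L2_rel_def square_integrable_scaleR)

definition uminus_L2 :: "'a L2 \<Rightarrow> 'a L2" where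
  "- F = (-1) *\<^sub>R (F::'a L2)"

definition minus_L2 :: "'a L2 \<Rightarrow> 'a L2 \<Rightarrow> 'a L2" where
  "F - G = (F::'a L2) + - G"

instance
proof
  fix F G H :: "'a L2" and a b :: real
  show "F + G + H = F + (G + H)"
    by transfer (auto simp: L2_rel_def add.assoc intro!: square_integrable_add)
  show "F + G = G + F"
    by transfer (auto simp: L2_rel_def add.commute intro!: square_integrable_add)
  show "0 + F = F"
    by transfer (auto simp: L2_rel_def)
  show "- F + F = 0"
    unfolding uminus_L2_def
    by transfer (auto simp: L2_rel_def)
  show "F - G = F + - G"
    by (rule minus_L2_def)
  show "a *\<^sub>R (F + G) = a *\<^sub>R F + a *\<^sub>R G"
    by transfer (auto simp: L2_rel_def scaleR_add_right
        intro!: square_integrable_add square_integrable_scaleR)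
  show "(a + b) *\<^sub>R F = a *\<^sub>R F + b *\<^sub>R F"
    by transfer (auto simp: L2_rel_def scaleR_add_left
        intro!: square_integrable_add square_integrable_scaleR)
  show "a *\<^sub>R b *\<^sub>R F = (a * b) *\<^sub>R F"
    by transfer (auto simp: L2_rel_def intro!: square_integrable_scaleR)
  show "1 *\<^sub>R F = F"
    by transfer (auto simp: L2_rel_def)
qed

end

instantiation L2 :: (euclidean_space) real_inner
begin

lift_definition inner_L2 :: "'a L2 \<Rightarrow> 'a L2 \<Rightarrow> real" is
  "\<lambda>f g. LINT x|lborel. f x \<bullet> g x"
proof -
  fix f f' g g' :: "real^3 \<Rightarrow> 'a"
  assume "L2_rel f f'" "L2_rel g g'"
  then show "(LINT x|lborel. f x \<bullet> g x) = (LINT x|lborel. f' x \<bullet> g' x)"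
    by (intro integral_cong_AE) (auto simp: L2_rel_def square_integrable_def)
qed

definition norm_L2 :: "'a L2 \<Rightarrow> real" where
  "norm (F::'a L2) = sqrt (F \<bullet> F)"

definition sgn_L2 :: "'a L2 \<Rightarrow> 'a L2" where
  "sgn F = (F::'a L2) /\<^sub>R norm F"

definition dist_L2 :: "'a L2 \<Rightarrow> 'a L2 \<Rightarrow> real" where
  "dist F G = norm (F - (G::'a L2))"

definition uniformity_L2 :: "('a L2 \<times> 'a L2) filter" where
  "uniformity = (INF e\<in>{0<..}. principal {(F, G::'a L2). dist F G < e})"

definition open_L2 :: "'a L2 set \<Rightarrow> bool" where
  "open (S::'a L2 set) \<longleftrightarrow> (\<forall>F\<in>S. \<forall>\<^sub>F (F', G) in uniformity. F' = F \<longrightarrow> G \<in> S)"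

instance
proof
  fix F G H :: "'a L2" and r :: real and S :: "'a L2 set"
  show "norm F = sqrt (F \<bullet> F)" by (rule norm_L2_def)
  show "sgn F = F /\<^sub>R norm F" by (rule sgn_L2_def)
  show "dist F G = norm (F - G)" by (rule dist_L2_def)
  show "uniformity = (INF e\<in>{0<..}. principal {(F, G::'a L2). dist F G < e})"
    by (rule uniformity_L2_def)
  show "open S \<longleftrightarrow> (\<forall>F\<in>S. \<forall>\<^sub>F (F', G) in uniformity. F' = F \<longrightarrow> G \<in> S)"
    by (rule open_L2_def)
  show "F \<bullet> G = G \<bullet> F"
    by transfer (simp add: inner_commute)
  show "(F + G) \<bullet> H = F \<bullet> H + G \<bullet> H"
    by transfer (auto simp: L2_rel_def inner_add_left square_integrable_inner)
  show "(r *\<^sub>R F) \<bullet> G = r * (F \<bullet> G)"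
    by transfer simp
  show "0 \<le> F \<bullet> F"
    by transfer (simp add: integral_nonneg_AE)
  show "F \<bullet> F = 0 \<longleftrightarrow> F = 0"
  proof transfer
    fix f :: "real^3 \<Rightarrow> 'a"
    assume "L2_rel f f"
    then have f: "square_integrable f" by (simp add: L2_rel_def)
    have "(LINT x|lborel. f x \<bullet> f x) = 0 \<longleftrightarrow> (AE x in lborel. f x \<bullet> f x = 0)"
      by (intro integral_nonneg_eq_0_iff_AE square_integrable_inner f) auto
    then show "((LINT x|lborel. f x \<bullet> f x) = 0) = L2_rel f (\<lambda>x. 0)"
      using f by (simp add: L2_rel_def)
  qed
qed

end


section \<open>Test functions and tempered distributions\<close>

definition pderiv_at :: "3 \<Rightarrow> (real^3 \<Rightarrow> 'b::real_normed_vector) \<Rightarrow> real^3 \<Rightarrow> 'b" where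
  "pderiv_at i f x = frechet_derivative f (at x) (axis i 1)"

primrec iter_pderiv :: "3 list \<Rightarrow> (real^3 \<Rightarrow> 'b::real_normed_vector) \<Rightarrow> real^3 \<Rightarrow> 'b" where
  "iter_pderiv [] f = f"
| "iter_pderiv (i # is) f = pderiv_at i (iter_pderiv is f)"

definition smooth :: "(real^3 \<Rightarrow> 'b::real_normed_vector) \<Rightarrow> bool" where
  "smooth f \<longleftrightarrow> (\<forall>is x. iter_pderiv is f differentiable (at x))"

definition test_function :: "(real^3 \<Rightarrow> real) \<Rightarrow> bool" where
  "test_function \<psi> \<longleftrightarrow> smooth \<psi> \<and> (\<exists>R. \<forall>x. R < norm x \<longrightarrow> \<psi> x = 0)"

definition schwartz :: "(real^3 \<Rightarrow> complex) \<Rightarrow> bool" where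
  "schwartz \<phi> \<longleftrightarrow> smooth \<phi> \<and>
     (\<forall>n is. \<exists>C. \<forall>x. (1 + norm x) ^ n * norm (iter_pderiv is \<phi> x) \<le> C)"

definition schwartz_seminorm :: "nat \<Rightarrow> (real^3 \<Rightarrow> complex) \<Rightarrow> real" where
  "schwartz_seminorm n \<phi> =
     (\<Sum>is\<in>{is. length is \<le> n}. SUP x. (1 + norm x) ^ n * norm (iter_pderiv is \<phi> x))"

text \<open>A distribution is a functional on all functions, but only its values on Schwartz
  functions are ever used.\<close>

type_synonym distribution = "(real^3 \<Rightarrow> complex) \<Rightarrow> complex"

definition tempered :: "distribution \<Rightarrow> bool" where
  "tempered u \<longleftrightarrow>
     (\<forall>\<phi> \<psi> a b. schwartz \<phi> \<longrightarrow> schwartz \<psi> \<longrightarrow>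
        u (\<lambda>x. a * \<phi> x + b * \<psi> x) = a * u \<phi> + b * u \<psi>) \<and>
     (\<exists>C n. \<forall>\<phi>. schwartz \<phi> \<longrightarrow> norm (u \<phi>) \<le> C * schwartz_seminorm n \<phi>)"

definition dist_of :: "(real^3 \<Rightarrow> real) \<Rightarrow> distribution" where
  "dist_of f \<phi> = (LINT x|lborel. complex_of_real (f x) * \<phi> x)"


section \<open>Fourier transform and Sobolev spaces\<close>

definition schwartz_fourier :: "(real^3 \<Rightarrow> complex) \<Rightarrow> real^3 \<Rightarrow> complex" where
  "schwartz_fourier \<phi> k =
     complex_of_real ((2 * pi) powr (-3/2)) * (LINT x|lborel. cis (- (k \<bullet> x)) * \<phi> x)"

text \<open>The Fourier transform of the distribution \<open>u\<close> (acting on test functions by duality)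
  is the function \<open>g\<close>.\<close>

definition has_fourier :: "distribution \<Rightarrow> (real^3 \<Rightarrow> complex) \<Rightarrow> bool" where
  "has_fourier u g \<longleftrightarrow> g \<in> borel_measurable lborel \<and>
     (\<forall>\<phi>. schwartz \<phi> \<longrightarrow>
        integrable lborel (\<lambda>k. g k * \<phi> k) \<and>
        u (schwartz_fourier \<phi>) = (LINT k|lborel. g k * \<phi> k))"

definition in_Hs :: "real \<Rightarrow> distribution \<Rightarrow> bool" where
  "in_Hs \<sigma> u \<longleftrightarrow> tempered u \<and>
     (\<exists>g. has_fourier u g \<and>
        integrable lborel (\<lambda>k. (1 + (norm k)\<^sup>2) powr \<sigma> * (norm (g k))\<^sup>2))"

text \<open>The transform \<open>g\<close> is unique up to null sets, so the choice below is immaterial.\<close>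

definition Hs_norm :: "real \<Rightarrow> distribution \<Rightarrow> real" where
  "Hs_norm \<sigma> u = (let g = (SOME g. has_fourier u g) in
     sqrt (LINT k|lborel. (1 + (norm k)\<^sup>2) powr \<sigma> * (norm (g k))\<^sup>2))"

definition Hs_C0 :: "real \<Rightarrow> (real \<Rightarrow> distribution) \<Rightarrow> bool" where
  "Hs_C0 \<sigma> u \<longleftrightarrow> (\<forall>t. in_Hs \<sigma> (u t)) \<and>
     (\<forall>t. ((\<lambda>s. Hs_norm \<sigma> (\<lambda>\<phi>. u s \<phi> - u t \<phi>)) \<longlongrightarrow> 0) (at t))"

definition Hs_C1 :: "real \<Rightarrow> (real \<Rightarrow> distribution) \<Rightarrow> bool" where
  "Hs_C1 \<sigma> u \<longleftrightarrow> (\<forall>t. in_Hs \<sigma> (u t)) \<and>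
     (\<exists>u'. Hs_C0 \<sigma> u' \<and>
        (\<forall>t. ((\<lambda>h. Hs_norm \<sigma> (\<lambda>\<phi>. (u (t + h) \<phi> - u t \<phi>) / complex_of_real h - u' t \<phi>))
               \<longlongrightarrow> 0) (at 0)))"

definition component :: "(real^3) L2 \<Rightarrow> 3 \<Rightarrow> distribution" where
  "component F i = dist_of (\<lambda>x. rep_L2 F x $ i)"


section \<open>The free Maxwell group\<close>

text \<open>Throughout, \<open>rep_L2\<close> picks an arbitrary representative; it enters only into integrals
  and almost-everywhere statements.\<close>

definition L2_fourier :: "(real^3) L2 \<Rightarrow> (complex^3) L2" where
  "L2_fourier F = (THE G. \<forall>i. has_fourier (component F i) (\<lambda>k. rep_L2 G k $ i))"

definition ccross3 :: "complex^3 \<Rightarrow> complex^3 \<Rightarrow> complex^3" where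
  "ccross3 a b = vector [a$2 * b$3 - a$3 * b$2, a$3 * b$1 - a$1 * b$3, a$1 * b$2 - a$2 * b$1]"

text \<open>The curl acts on the Fourier side as \<open>curl_symbol k\<close>, i.e. as the cross product with \<open>\<i> k\<close>,
  so \<open>curl_symbol k (curl_symbol k w) = |k|\<^sup>2 w - (k \<cdot> w) k\<close>. The free equations therefore turn
  into \<open>e' = curl_symbol k b, b' = - curl_symbol k e\<close> for each \<open>k\<close>, and \<open>maxwell_symbol t k\<close>
  is the flow of this linear system; lemmas \<open>maxwell_symbol_0\<close> and \<open>maxwell_symbol_ode\<close> below
  confirm this for \<open>k \<noteq> 0\<close>.\<close>

definition curl_symbol :: "real^3 \<Rightarrow> complex^3 \<Rightarrow> complex^3" where
  "curl_symbol k w = ccross3 (\<chi> i. \<i> * complex_of_real (k $ i)) w"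

definition maxwell_symbol ::
    "real \<Rightarrow> real^3 \<Rightarrow> (complex^3) \<times> (complex^3) \<Rightarrow> (complex^3) \<times> (complex^3)" where
  "maxwell_symbol t k = (\<lambda>(a, b).
     (a - ((1 - cos (norm k * t)) / (norm k)\<^sup>2) *\<^sub>R curl_symbol k (curl_symbol k a)
        + (sin (norm k * t) / norm k) *\<^sub>R curl_symbol k b,
      b - ((1 - cos (norm k * t)) / (norm k)\<^sup>2) *\<^sub>R curl_symbol k (curl_symbol k b)
        - (sin (norm k * t) / norm k) *\<^sub>R curl_symbol k a))"

lemma maxwell_symbol_0: "maxwell_symbol 0 k p = p"
  by (simp add: maxwell_symbol_def split: prod.split)

lemma curl_symbol_linear:
  "curl_symbol k (a + b) = curl_symbol k a + curl_symbol k b"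
  "curl_symbol k (a - b) = curl_symbol k a - curl_symbol k b"
  "curl_symbol k (c *\<^sub>R a) = c *\<^sub>R curl_symbol k a"
  by (simp_all add: curl_symbol_def ccross3_def vec_eq_iff forall_3 vector_3 algebra_simps
      scaleR_conv_of_real[where 'a = complex])

lemma curl_symbol_3:
  "curl_symbol k (curl_symbol k (curl_symbol k a)) = (norm k)\<^sup>2 *\<^sub>R curl_symbol k a"
proof -
  have n: "(norm k)\<^sup>2 = k$1 * k$1 + k$2 * k$2 + k$3 * k$3"
    by (simp add: power2_norm_eq_inner inner_vec_def sum_3)
  show ?thesis
    unfolding n
    by (simp add: curl_symbol_def ccross3_def vec_eq_iff forall_3 vector_3 algebra_simps
        scaleR_conv_of_real[where 'a = complex])
qed

lemma maxwell_symbol_ode: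
  assumes "k \<noteq> 0"
  shows "((\<lambda>t. maxwell_symbol t k p) has_vector_derivative
           (curl_symbol k (snd (maxwell_symbol t k p)),
            - curl_symbol k (fst (maxwell_symbol t k p)))) (at t)"
proof -
  obtain a b where p: "p = (a, b)" by (cases p)
  have k: "norm k \<noteq> 0" using assms by simp
  have c: "((\<lambda>t. (1 - cos (norm k * t)) / (norm k)\<^sup>2) has_vector_derivative sin (norm k * t) / norm k) (at t)"
    unfolding has_real_derivative_iff_has_vector_derivative[symmetric]
    using k by (auto intro!: derivative_eq_intros simp: field_simps power2_eq_square)
  have s: "((\<lambda>t. sin (norm k * t) / norm k) has_vector_derivative cos (norm k * t)) (at t)"
    unfolding has_real_derivative_iff_has_vector_derivative[symmetric]
    using k by (auto intro!: derivative_eq_intros simp: field_simps)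
  have scale: "((\<lambda>t. f t *\<^sub>R w) has_vector_derivative f' *\<^sub>R w) (at t)"
    if "(f has_vector_derivative f') (at t)" for f f' and w :: "complex^3"
    using bounded_linear.has_vector_derivative[OF bounded_linear_scaleR_left that] .
  have A: "((\<lambda>t. a - ((1 - cos (norm k * t)) / (norm k)\<^sup>2) *\<^sub>R curl_symbol k (curl_symbol k a)
        + (sin (norm k * t) / norm k) *\<^sub>R curl_symbol k b) has_vector_derivative
      curl_symbol k (snd (maxwell_symbol t k p))) (at t)"
    by (rule has_vector_derivative_eq_rhs[OF has_vector_derivative_add[OF
          has_vector_derivative_diff[OF has_vector_derivative_const scale[OF c]] scale[OF s]]])
      (use k in \<open>simp add: p maxwell_symbol_def curl_symbol_linear curl_symbol_3 diff_divide_distrib algebra_simps\<close>)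
  have B: "((\<lambda>t. b - ((1 - cos (norm k * t)) / (norm k)\<^sup>2) *\<^sub>R curl_symbol k (curl_symbol k b)
        - (sin (norm k * t) / norm k) *\<^sub>R curl_symbol k a) has_vector_derivative
      - curl_symbol k (fst (maxwell_symbol t k p))) (at t)"
    by (rule has_vector_derivative_eq_rhs[OF has_vector_derivative_diff[OF
          has_vector_derivative_diff[OF has_vector_derivative_const scale[OF c]] scale[OF s]]])
      (use k in \<open>simp add: p maxwell_symbol_def curl_symbol_linear curl_symbol_3 diff_divide_distrib algebra_simps\<close>)
  show ?thesis
    using has_vector_derivative_Pair[OF A B] by (simp add: p maxwell_symbol_def)
qed

definition maxwell_group ::
    "real \<Rightarrow> (real^3) L2 \<times> (real^3) L2 \<Rightarrow> (real^3) L2 \<times> (real^3) L2" where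
  "maxwell_group t P = (THE Q. AE k in lborel.
     (rep_L2 (L2_fourier (fst Q)) k, rep_L2 (L2_fourier (snd Q)) k) =
       maxwell_symbol t k (rep_L2 (L2_fourier (fst P)) k, rep_L2 (L2_fourier (snd P)) k))"

definition newton_group :: "real \<Rightarrow> (real^3) \<times> (real^3) \<Rightarrow> (real^3) \<times> (real^3)" where
  "newton_group t = (\<lambda>(\<xi>, v). (\<xi> + t *\<^sub>R v, v))"


section \<open>The Maxwell-Newton system\<close>

definition charge_density :: "real \<Rightarrow> (real^3 \<Rightarrow> real) \<Rightarrow> real^3 \<Rightarrow> real^3 \<Rightarrow> real" where
  "charge_density e \<phi> \<xi> x = e * \<phi> (\<xi> - x)"

definition current :: "real \<Rightarrow> (real^3 \<Rightarrow> real) \<Rightarrow> real^3 \<Rightarrow> real^3 \<Rightarrow> (real^3) L2" where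
  "current e \<phi> \<xi> v = abs_L2 (\<lambda>x. (e * \<phi> (\<xi> - x)) *\<^sub>R v)"

definition L2_convolution :: "(real^3 \<Rightarrow> real) \<Rightarrow> (real^3) L2 \<Rightarrow> real^3 \<Rightarrow> real^3" where
  "L2_convolution \<phi> F x = (LINT y|lborel. \<phi> (x - y) *\<^sub>R rep_L2 F y)"

definition lorentz_force ::
    "real \<Rightarrow> (real^3 \<Rightarrow> real) \<Rightarrow> (real^3) L2 \<Rightarrow> (real^3) L2 \<Rightarrow> real^3 \<Rightarrow> real^3 \<Rightarrow> real^3" where
  "lorentz_force e \<phi> E B \<xi> v =
     e *\<^sub>R (L2_convolution \<phi> E \<xi> + cross3 v (L2_convolution \<phi> B \<xi>))"

definition weak_div :: "(real^3) L2 \<Rightarrow> (real^3 \<Rightarrow> real) \<Rightarrow> bool" where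
  "weak_div F \<rho> \<longleftrightarrow> (\<forall>\<psi>. test_function \<psi> \<longrightarrow>
     - (LINT x|lborel. rep_L2 F x \<bullet> (\<chi> i. pderiv_at i \<psi> x)) = (LINT x|lborel. \<rho> x * \<psi> x))"

text \<open>The integral \<open>\<integral>\<^sub>a\<^sup>b f\<close> exists and equals \<open>I\<close>, also for \<open>b < a\<close>. The Duhamel formulas below are
  stated in the form: the integral exists and equals solution minus free evolution of the data.
  For solutions in \<open>solution_space\<close> the integrands are norm continuous.\<close>

definition has_oriented_integral ::
    "(real \<Rightarrow> 'b::real_normed_vector) \<Rightarrow> 'b \<Rightarrow> real \<Rightarrow> real \<Rightarrow> bool" where
  "has_oriented_integral f I a b \<longleftrightarrow>
     (if a \<le> b then (f has_integral I) {a..b} else (f has_integral (- I)) {b..a})"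

definition maxwell_newton_solution ::
    "real \<Rightarrow> (real^3 \<Rightarrow> real) \<Rightarrow> real \<Rightarrow>
     (real^3) L2 \<Rightarrow> (real^3) L2 \<Rightarrow> real^3 \<Rightarrow> real^3 \<Rightarrow>
     (real \<Rightarrow> (real^3) L2) \<Rightarrow> (real \<Rightarrow> (real^3) L2) \<Rightarrow> (real \<Rightarrow> real^3) \<Rightarrow> (real \<Rightarrow> real^3) \<Rightarrow> bool" where
  "maxwell_newton_solution e \<phi> t0 E0 B0 \<xi>0 v0 E B \<xi> v \<longleftrightarrow>
     (\<forall>t. has_oriented_integral
            (\<lambda>\<tau>. maxwell_group (t - \<tau>) (- current e \<phi> (\<xi> \<tau>) (v \<tau>), 0))
            ((E t, B t) - maxwell_group (t - t0) (E0, B0)) t0 t) \<and>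
     (\<forall>t. has_oriented_integral
            (\<lambda>\<tau>. newton_group (t - \<tau>) (0, lorentz_force e \<phi> (E \<tau>) (B \<tau>) (\<xi> \<tau>) (v \<tau>)))
            ((\<xi> t, v t) - newton_group (t - t0) (\<xi>0, v0)) t0 t) \<and>
     (\<forall>t. weak_div (E t) (charge_density e \<phi> (\<xi> t)) \<and> weak_div (B t) (\<lambda>x. 0))"

text \<open>For \<open>r \<ge> 0\<close> the field components are functions, but for \<open>r < 1\<close> their time derivatives
  in \<open>H\<^bsup>r-1\<^esup>\<close> need only be tempered distributions.\<close>

definition solution_space ::
    "real \<Rightarrow> (real \<Rightarrow> (real^3) L2) \<Rightarrow> (real \<Rightarrow> (real^3) L2) \<Rightarrow>
     (real \<Rightarrow> real^3) \<Rightarrow> (real \<Rightarrow> real^3) \<Rightarrow> bool" where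
  "solution_space r E B \<xi> v \<longleftrightarrow>
     (\<forall>i. Hs_C0 r (\<lambda>t. component (E t) i) \<and> Hs_C1 (r - 1) (\<lambda>t. component (E t) i)) \<and>
     (\<forall>i. Hs_C0 r (\<lambda>t. component (B t) i) \<and> Hs_C1 (r - 1) (\<lambda>t. component (B t) i)) \<and>
     \<xi> C1_differentiable_on UNIV \<and> v C1_differentiable_on UNIV"

end

theory Submission
  imports Defs "HOL-Probability.Probability"
begin

text \<open>Plancherel's theorem is obtained by Gaussian regularisation, and the free Maxwell group \<open>U\<close>
  becomes a unitary Fourier multiplier. In the interaction picture \<open>F t = U (t\<^sub>0 - t) (E t, B t)\<close> the
  Duhamel formulas are an ordinary differential equation for \<open>(F, \<xi>, v)\<close>. Its right-hand side is only
  locally Lipschitz, where \<open>\<phi> \<in> H\<^sup>1\<close> gives the Lipschitz dependence on \<open>\<xi>\<close>. But the energy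
  \<open>|F|\<^sup>2 + |v|\<^sup>2\<close> is conserved, because convolution with \<open>\<phi>\<close> is adjoint to the current, so truncating
  the equation radially makes it globally Lipschitz and changes no solution. The Duhamel formula for
  the transforms divided by \<open>(1 + |k|\<^sup>2)\<^bsup>- r / 2\<^esup>\<close> yields continuity in \<open>H\<^sup>r\<close>, and the curl costs one
  derivative. Gradients of test functions are fixed by \<open>U\<close>, so the divergence equations propagate by
  charge conservation.\<close>

section \<open>Square integrable functions and multiplication operators\<close>

text \<open>The definite descriptions in \<open>L2_fourier\<close> and \<open>maxwell_group\<close>
  shape the Fourier part: each must be shown to describe exactly one object. Uniqueness of a
  transform is tested against Gaussians, which are Schwartz functions with explicit transforms and
  separate functions up to null sets. Existence for the group is subtler, because \<open>THE\<close>
  ranges over real fields: the multiplied transform must keep the hermitian symmetry of a real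
  field. The field itself need not be differentiable in \<open>L2\<close>, since its curl need not
  lie there; in the interaction variable only the bounded current remains. The position needs no
  truncation, because the bounds on current and force are uniform in \<xi>: moving the charge only
  changes phases. The conserved energy controls \<open>L2\<close> norms but not higher Sobolev
  norms, so existence and uniqueness are decided in \<open>L2\<close> and regularity is added
  afterwards. The time derivative must be an actual tempered distribution, not merely a weighted
  function of \<open>k\<close>, which is why the curl is also built as a distribution.\<close>

lemma square_integrable_rep_L2 [simp]: "square_integrable (rep_L2 F)"
  using Quotient3_rep_reflp[OF Quotient3_L2, of F] by (simp add: L2_rel_def)

lemma abs_rep_L2 [simp]: "abs_L2 (rep_L2 F) = F"
  by (rule Quotient3_abs_rep[OF Quotient3_L2])

lemma rep_abs_L2:
  assumes "square_integrable f"
  shows "AE x in lborel. rep_L2 (abs_L2 f) x = f x"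
  using Quotient3_rep_abs[OF Quotient3_L2, of f] assms by (simp add: L2_rel_def)

lemma abs_L2_eqI:
  assumes "square_integrable f" "square_integrable g" "AE x in lborel. f x = g x"
  shows "abs_L2 f = abs_L2 g"
  using Quotient3_rel_abs[OF Quotient3_L2, of f g] assms by (simp add: L2_rel_def)

lemma L2_eqI:
  assumes "AE x in lborel. rep_L2 F x = rep_L2 G x"
  shows "F = G"
  using abs_L2_eqI[OF _ _ assms] by simp

lemma square_integrable_measurable [measurable_dest]:
  "square_integrable f \<Longrightarrow> f \<in> borel_measurable borel"
  by (simp add: square_integrable_def)

lemma rep_L2_measurable [measurable]: "rep_L2 F \<in> borel_measurable borel"
  using square_integrable_measurable[OF square_integrable_rep_L2] .

lemma square_integrable_bound:
  assumes "square_integrable f" "g \<in> borel_measurable lborel"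
    and "AE x in lborel. norm (g x) \<le> C * norm (f x)"
  shows "square_integrable g"
proof -
  have [measurable]: "g \<in> borel_measurable borel" using assms(2) by measurable
  have I: "integrable lborel (\<lambda>x. C\<^sup>2 * (norm (f x))\<^sup>2)"
    using assms(1) by (auto simp: square_integrable_def)
  have le: "AE x in lborel. norm ((norm (g x))\<^sup>2) \<le> norm (C\<^sup>2 * (norm (f x))\<^sup>2)"
    using assms(3)
  proof eventually_elim
    case (elim x)
    then have "(norm (g x))\<^sup>2 \<le> (C * norm (f x))\<^sup>2" by (intro power_mono) auto
    then show ?case by (simp add: power_mult_distrib)
  qed
  have "integrable lborel (\<lambda>x. (norm (g x))\<^sup>2)"
    by (rule Bochner_Integration.integrable_bound[OF I _ le]) measurable
  then show ?thesis using assms by (simp add: square_integrable_def)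
qed

lemma square_integrable_diff:
  assumes "square_integrable f" "square_integrable g"
  shows "square_integrable (\<lambda>x. f x - g x)"
  using square_integrable_add[OF assms(1) square_integrable_scaleR[OF assms(2), of "-1"]] by simp

section \<open>Algebra and norm of \<open>L2\<close> in terms of representatives\<close>

lemma abs_L2_add:
  assumes "square_integrable f" "square_integrable g"
  shows "abs_L2 (\<lambda>x. f x + g x) = abs_L2 f + abs_L2 g"
  using assms plus_L2.abs_eq[of f g] by (simp add: L2_rel_def)

lemma abs_L2_scaleR:
  assumes "square_integrable f"
  shows "abs_L2 (\<lambda>x. c *\<^sub>R f x) = c *\<^sub>R abs_L2 f"
  using assms scaleR_L2.abs_eq[of f c] by (simp add: L2_rel_def)

lemma abs_L2_zero [simp]: "abs_L2 (\<lambda>x. 0) = 0"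
  by (simp add: zero_L2_def)

lemma abs_L2_diff:
  assumes "square_integrable f" "square_integrable g"
  shows "abs_L2 (\<lambda>x. f x - g x) = abs_L2 f - abs_L2 g"
  using abs_L2_add[OF assms(1) square_integrable_scaleR[OF assms(2), of "-1"]]
    abs_L2_scaleR[OF assms(2), of "-1"] by simp

lemma rep_L2_add: "AE x in lborel. rep_L2 (F + G) x = rep_L2 F x + rep_L2 G x"
  using rep_abs_L2[of "\<lambda>x. rep_L2 F x + rep_L2 G x"]
  by (simp add: square_integrable_add abs_L2_add)

lemma rep_L2_diff: "AE x in lborel. rep_L2 (F - G) x = rep_L2 F x - rep_L2 G x"
  using rep_abs_L2[of "\<lambda>x. rep_L2 F x - rep_L2 G x"]
  by (simp add: square_integrable_diff abs_L2_diff)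

lemma rep_L2_scaleR: "AE x in lborel. rep_L2 (c *\<^sub>R F) x = c *\<^sub>R rep_L2 F x"
  using rep_abs_L2[of "\<lambda>x. c *\<^sub>R rep_L2 F x"]
  by (simp add: square_integrable_scaleR abs_L2_scaleR)

lemma rep_L2_zero: "AE x in lborel. rep_L2 0 x = 0"
  using rep_abs_L2[of "\<lambda>x. 0"] by simp

lemma inner_abs_L2:
  assumes "square_integrable f" "square_integrable g"
  shows "abs_L2 f \<bullet> abs_L2 g = (LINT x|lborel. f x \<bullet> g x)"
  using assms inner_L2.abs_eq[of f g] by (simp add: L2_rel_def)

lemma norm_abs_L2:
  assumes "square_integrable f"
  shows "(norm (abs_L2 f))\<^sup>2 = (LINT x|lborel. (norm (f x))\<^sup>2)"
  using inner_abs_L2[OF assms assms] by (simp add: power2_norm_eq_inner)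

lemma norm_L2_rep: "(norm F)\<^sup>2 = (LINT x|lborel. (norm (rep_L2 F x))\<^sup>2)"
  using norm_abs_L2[of "rep_L2 F"] by simp

lemma norm_abs_L2_nn:
  assumes "square_integrable f"
  shows "ennreal ((norm (abs_L2 f))\<^sup>2) = (\<integral>\<^sup>+x. ennreal ((norm (f x))\<^sup>2) \<partial>lborel)"
  unfolding norm_abs_L2[OF assms]
  by (subst nn_integral_eq_integral) (use assms in \<open>auto simp: square_integrable_def\<close>)

lemma square_integrableI_nn:
  assumes [measurable]: "f \<in> borel_measurable lborel"
    and "(\<integral>\<^sup>+x. ennreal ((norm (f x))\<^sup>2) \<partial>lborel) < \<infinity>"
  shows "square_integrable f"
  unfolding square_integrable_def
  using assms by (auto intro!: integrableI_bounded)

lemma norm_abs_L2_le: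
  assumes "square_integrable f" "square_integrable g"
    and "AE x in lborel. norm (g x) \<le> C * norm (f x)" "C \<ge> 0"
  shows "norm (abs_L2 g) \<le> C * norm (abs_L2 f)"
proof -
  have "(LINT x|lborel. (norm (g x))\<^sup>2) \<le> (LINT x|lborel. C\<^sup>2 * (norm (f x))\<^sup>2)"
  proof (rule integral_mono_AE)
    show "AE x in lborel. (norm (g x))\<^sup>2 \<le> C\<^sup>2 * (norm (f x))\<^sup>2"
      using assms(3)
      by eventually_elim (metis norm_ge_zero power_mono power_mult_distrib)
  qed (use assms in \<open>auto simp: square_integrable_def\<close>)
  then have "(norm (abs_L2 g))\<^sup>2 \<le> (C * norm (abs_L2 f))\<^sup>2"
    using assms by (simp add: norm_abs_L2 power_mult_distrib)
  then show ?thesis using assms(4) by (auto intro: power2_le_imp_le)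
qed

lemma norm_abs_L2_eq:
  assumes "square_integrable f" "square_integrable g"
    and "AE x in lborel. norm (g x) = norm (f x)"
  shows "norm (abs_L2 g) = norm (abs_L2 f)"
  proof (rule antisym)
  show "norm (abs_L2 g) \<le> norm (abs_L2 f)"
    using norm_abs_L2_le[OF assms(1,2), of 1] by (simp add: eventually_mono[OF assms(3)])
  show "norm (abs_L2 f) \<le> norm (abs_L2 g)"
    using norm_abs_L2_le[OF assms(2,1), of 1] by (simp add: eventually_mono[OF assms(3)])
qed

text \<open>Dominated convergence in mean square: the limit inherits the bound \<open>w\<close>, and
  with it square integrability.\<close>

lemma abs_L2_tendsto:
  assumes f: "\<And>n::nat. f n \<in> borel_measurable lborel" and g: "g \<in> borel_measurable lborel"
    and w: "square_integrable w"
    and bound: "\<And>n. AE x in lborel. norm (f n x) \<le> norm (w x)"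
    and lim: "AE x in lborel. (\<lambda>n. f n x) \<longlonglongrightarrow> g x"
  shows "square_integrable g" "(\<lambda>n. abs_L2 (f n)) \<longlonglongrightarrow> abs_L2 g"
proof -
  note [measurable] = f g w
  have fsq: "square_integrable (f n)" for n
    using square_integrable_bound[OF w f, of n 1] bound[of n] by simp
  have gb: "AE x in lborel. norm (g x) \<le> norm (w x)"
  proof -
    have "AE x in lborel. \<forall>n. norm (f n x) \<le> norm (w x)" using bound by (simp add: AE_all_countable)
    with lim show ?thesis
      by eventually_elim (rule LIMSEQ_le_const2[OF tendsto_norm], auto)
  qed
  show gsq: "square_integrable g"
    using square_integrable_bound[OF w g, of 1] gb by simp
  have "(\<lambda>n. LINT x|lborel. (norm (f n x - g x))\<^sup>2) \<longlonglongrightarrow> (LINT x|(lborel::(real^3) measure). 0)"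
  \<comment> \<open>Approximants and limit are both bounded by \<open>w\<close>, hence their squared
    difference by the square of \<open>2 * norm (w x)\<close>.\<close>
  proof (rule integral_dominated_convergence[where w="\<lambda>x. 4 * (norm (w x))\<^sup>2"])
    show "integrable lborel (\<lambda>x. 4 * (norm (w x))\<^sup>2)"
      using w by (auto simp: square_integrable_def)
    show "AE x in lborel. (\<lambda>n. (norm (f n x - g x))\<^sup>2) \<longlonglongrightarrow> 0"
      using lim
    proof eventually_elim
      case (elim x)
      then have "(\<lambda>n. (norm (f n x - g x))\<^sup>2) \<longlonglongrightarrow> (norm (g x - g x))\<^sup>2"
        by (intro tendsto_intros)
      then show ?case by simp
    qed
    show "AE x in lborel. norm ((norm (f n x - g x))\<^sup>2) \<le> 4 * (norm (w x))\<^sup>2" for n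
      using bound[of n] gb
    proof eventually_elim
      case (elim x)
      have "norm (f n x - g x) \<le> 2 * norm (w x)"
        using norm_triangle_ineq4[of "f n x" "g x"] elim by linarith
      then have "(norm (f n x - g x))\<^sup>2 \<le> (2 * norm (w x))\<^sup>2" by (intro power_mono) auto
      then show ?case by (simp add: power_mult_distrib)
    qed
  qed measurable
  then have "(\<lambda>n. LINT x|lborel. (norm (f n x - g x))\<^sup>2) \<longlonglongrightarrow> 0" by simp
  then have "(\<lambda>n. (norm (abs_L2 (f n) - abs_L2 g))\<^sup>2) \<longlonglongrightarrow> 0"
    using norm_abs_L2[OF square_integrable_diff[OF fsq gsq]] by (simp add: abs_L2_diff fsq gsq)
  then have "(\<lambda>n. sqrt ((norm (abs_L2 (f n) - abs_L2 g))\<^sup>2)) \<longlonglongrightarrow> sqrt 0"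
    by (rule tendsto_real_sqrt)
  then show "(\<lambda>n. abs_L2 (f n)) \<longlonglongrightarrow> abs_L2 g"
    by (simp add: LIM_zero_iff tendsto_norm_zero_iff)
qed

section \<open>Completeness of \<open>L2\<close>\<close>

lemma abs_L2_sum:
  assumes "\<And>i. i \<in> I \<Longrightarrow> square_integrable (f i)"
  shows "square_integrable (\<lambda>x. \<Sum>i\<in>I. f i x) \<and> abs_L2 (\<lambda>x. \<Sum>i\<in>I. f i x) = (\<Sum>i\<in>I. abs_L2 (f i))"
  using assms
  by (induction I rule: infinite_finite_induct)
    (auto simp: abs_L2_add square_integrable_add)

text \<open>The Riesz-Fischer argument. The pointwise increments \<open>g n\<close> have norms
  bounded by a geometric series, so their partial sums stay bounded in \<open>L2\<close>; hence the
  series of increments is finite almost everywhere and the representatives converge almost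
  everywhere.\<close>

lemma L2_fast_Cauchy_convergent:
  fixes X :: "nat \<Rightarrow> 'a::euclidean_space L2"
  assumes fast: "\<And>n. norm (X (Suc n) - X n) \<le> (1/2)^n"
  shows "convergent X"
proof -
  define u where "u n x = rep_L2 (X n) x" for n x
  define g where "g n x = norm (u (Suc n) x - u n x)" for n x
  have um [measurable]: "u n \<in> borel_measurable lborel" for n unfolding u_def by measurable
  have usq: "square_integrable (u n)" and uX: "abs_L2 (u n) = X n" for n
    unfolding u_def by simp_all
  have gsq: "square_integrable (g n)" for n
    unfolding g_def u_def by (rule square_integrable_bound[of "\<lambda>x. rep_L2 (X (Suc n)) x - rep_L2 (X n) x" _ 1])
      (auto intro: square_integrable_diff)
  have gnorm: "norm (abs_L2 (g n)) \<le> (1/2)^n" for n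
  proof -
    have "norm (abs_L2 (g n)) = norm (abs_L2 (\<lambda>x. u (Suc n) x - u n x))"
      by (rule norm_abs_L2_eq) (use gsq in \<open>auto simp: g_def u_def intro: square_integrable_diff\<close>)
    also have "\<dots> = norm (X (Suc n) - X n)" by (simp add: u_def abs_L2_diff)
    finally show ?thesis using fast by simp
  qed
  define S where "S N x = (\<Sum>n<N. g n x)" for N x
  have Ssq: "square_integrable (S N)" and Sabs: "abs_L2 (S N) = (\<Sum>n<N. abs_L2 (g n))" for N
    using abs_L2_sum[of "{..<N}" g] gsq unfolding S_def by auto
  have gm [measurable]: "g n \<in> borel_measurable lborel" for n using gsq by measurable
  have Sm [measurable]: "S N \<in> borel_measurable lborel" for N using Ssq by measurable
  have "norm (abs_L2 (S N)) \<le> 2" for N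
  proof -
    have "norm (abs_L2 (S N)) \<le> (\<Sum>n<N. (1/2)^n)"
      unfolding Sabs by (rule sum_norm_le) (use gnorm in auto)
    also have "\<dots> \<le> (\<Sum>n. (1/2)^n)" by (rule sum_le_suminf) auto
    also have "\<dots> = (2::real)" by (simp add: suminf_geometric)
    finally show ?thesis .
  qed
  then have "(norm (abs_L2 (S N)))\<^sup>2 \<le> 2\<^sup>2" for N by (intro power_mono) auto
  then have Sle: "(norm (abs_L2 (S N)))\<^sup>2 \<le> 4" for N by simp
  have Sint: "(\<integral>\<^sup>+x. ennreal ((S N x)\<^sup>2) \<partial>lborel) \<le> 4" for N
    using norm_abs_L2_nn[OF Ssq, of N] ennreal_leI[OF Sle[of N]] by simp
  have S0: "0 \<le> S N x" for N x by (simp add: S_def g_def sum_nonneg)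
  have Sinc: "incseq (\<lambda>N. S N x)" for x
    by (rule incseq_SucI) (simp add: S_def g_def)
  have "(\<integral>\<^sup>+x. (SUP N. ennreal ((S N x)\<^sup>2)) \<partial>lborel) = (SUP N. \<integral>\<^sup>+x. ennreal ((S N x)\<^sup>2) \<partial>lborel)"
    by (rule nn_integral_monotone_convergence_SUP)
      (use Sinc S0 in \<open>auto simp: incseq_def le_fun_def intro!: ennreal_leI power_mono\<close>)
  also have "\<dots> \<le> 4" by (intro SUP_least Sint)
  finally have "(\<integral>\<^sup>+x. (SUP N. ennreal ((S N x)\<^sup>2)) \<partial>lborel) \<noteq> \<infinity>" by (auto simp: top_unique)
  then have fin: "AE x in lborel. (SUP N. ennreal ((S N x)\<^sup>2)) \<noteq> \<infinity>"
    by (intro nn_integral_PInf_AE) auto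
  \<comment> \<open>A finite supremum bounds the partial sums of the increments, which makes the
    increments absolutely summable.\<close>
  have conv: "AE x in lborel. convergent (\<lambda>n. u n x)"
    using fin
  proof eventually_elim
    case (elim x)
    then obtain c where c: "c \<ge> 0" "(SUP N. ennreal ((S N x)\<^sup>2)) = ennreal c"
      by (cases "SUP N. ennreal ((S N x)\<^sup>2)") auto
    have "ennreal ((S N x)\<^sup>2) \<le> ennreal c" for N
      unfolding c(2)[symmetric] by (rule SUP_upper) simp
    then have "(S N x)\<^sup>2 \<le> c" for N using c(1) by simp
    then have "S N x \<le> sqrt c" for N by (simp add: real_le_rsqrt)
    then have "summable (\<lambda>n. g n x)"
      by (intro summableI_nonneg_bounded[where x="sqrt c"]) (auto simp: S_def g_def)
    then have "summable (\<lambda>n. u (Suc n) x - u n x)"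
      unfolding g_def by (rule summable_norm_cancel)
    then have "convergent (\<lambda>N. \<Sum>n<N. u (Suc n) x - u n x)"
      by (simp add: summable_iff_convergent)
    then have "convergent (\<lambda>N. u N x - u 0 x)"
      unfolding sum_lessThan_telescope[of "\<lambda>n. u n x"] .
    then show ?case by (simp add: convergent_diff_const_right_iff)
  qed
  define f where "f x = lim (\<lambda>n. u n x)" for x
  have fm [measurable]: "f \<in> borel_measurable lborel" unfolding f_def by measurable
  have ulim: "AE x in lborel. (\<lambda>n. u n x) \<longlonglongrightarrow> f x"
    using conv by eventually_elim (simp add: f_def convergent_LIMSEQ_iff)
  have tail: "norm (X m - X n) \<le> 2 * (1/2)^n" if "n \<le> m" for m n
  proof -
    have "X m - X n = (\<Sum>k=n..<m. X (Suc k) - X k)" using that by (simp add: sum_Suc_diff')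
    then have "norm (X m - X n) \<le> (\<Sum>k=n..<m. (1/2)^k)"
      using sum_norm_le[of "{n..<m}" "\<lambda>k. X (Suc k) - X k" "\<lambda>k. (1/2)^k"] fast by simp
    also have "\<dots> = (\<Sum>k<m-n. (1/2)^(k+n))"
      using sum.shift_bounds_nat_ivl[of "\<lambda>k. (1/2::real)^k" 0 n "m-n"] that
      by (simp add: atLeast0LessThan add.commute)
    also have "\<dots> = (1/2)^n * (\<Sum>k<m-n. (1/2)^k)" by (simp add: power_add sum_distrib_left mult.commute)
    also have "\<dots> \<le> (1/2)^n * (\<Sum>k. (1/2)^k)" by (intro mult_left_mono sum_le_suminf) auto
    also have "\<dots> = 2 * (1/2::real)^n" by (simp add: suminf_geometric)
    finally show ?thesis .
  qed
  \<comment> \<open>Fatou's lemma turns the Cauchy estimate \<open>tail\<close> into an estimate for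
    the pointwise limit, whose square integrability is not known before.\<close>
  have fbound: "(\<integral>\<^sup>+x. ennreal ((norm (f x - u n x))\<^sup>2) \<partial>lborel) \<le> ennreal ((2 * (1/2)^n)\<^sup>2)" for n
  proof -
    have "(\<integral>\<^sup>+x. ennreal ((norm (f x - u n x))\<^sup>2) \<partial>lborel)
        = (\<integral>\<^sup>+x. liminf (\<lambda>m. ennreal ((norm (u m x - u n x))\<^sup>2)) \<partial>lborel)"
    proof (rule nn_integral_cong_AE, use ulim in eventually_elim)
      case (elim x)
      then have "(\<lambda>m. ennreal ((norm (u m x - u n x))\<^sup>2)) \<longlonglongrightarrow> ennreal ((norm (f x - u n x))\<^sup>2)"
        by (intro tendsto_intros)
      then show ?case by (intro lim_imp_Liminf[symmetric]) auto
    qed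
    also have "\<dots> \<le> liminf (\<lambda>m. \<integral>\<^sup>+x. ennreal ((norm (u m x - u n x))\<^sup>2) \<partial>lborel)"
      by (rule nn_integral_liminf) measurable
    also have "\<dots> = liminf (\<lambda>m. ennreal ((norm (X m - X n))\<^sup>2))"
    proof -
      have "(\<integral>\<^sup>+x. ennreal ((norm (u m x - u n x))\<^sup>2) \<partial>lborel) = ennreal ((norm (X m - X n))\<^sup>2)" for m
        using norm_abs_L2_nn[OF square_integrable_diff[OF usq usq], of m n]
        by (simp add: abs_L2_diff usq uX)
      then show ?thesis by simp
    qed
    also have "\<dots> \<le> liminf (\<lambda>m. ennreal ((2 * (1/2)^n)\<^sup>2))"
    proof (rule Liminf_mono)
      show "\<forall>\<^sub>F m in sequentially. ennreal ((norm (X m - X n))\<^sup>2) \<le> ennreal ((2 * (1/2)^n)\<^sup>2)"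
        using eventually_ge_at_top[of n]
        by eventually_elim (intro ennreal_leI power_mono tail, auto)
    qed
    finally show ?thesis by (simp add: Liminf_const)
  qed
  have dsq: "square_integrable (\<lambda>x. f x - u n x)" for n
    by (rule square_integrableI_nn) (measurable, rule le_less_trans[OF fbound], simp)
  have fsq: "square_integrable f"
    using square_integrable_add[OF dsq[of 0] usq[of 0]] by simp
  have "norm (abs_L2 f - X n) \<le> 2 * (1/2)^n" for n
  proof -
    have "ennreal ((norm (abs_L2 f - X n))\<^sup>2) \<le> ennreal ((2 * (1/2)^n)\<^sup>2)"
      using norm_abs_L2_nn[OF dsq[of n]] fbound[of n] by (simp only: abs_L2_diff usq uX fsq)
    then have "(norm (abs_L2 f - X n))\<^sup>2 \<le> (2 * (1/2)^n)\<^sup>2"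
      by (subst (asm) ennreal_le_iff) simp_all
    then show ?thesis by (rule power2_le_imp_le) simp
  qed
  then have le: "\<forall>n. norm (abs_L2 f - X n) \<le> 2 * (1/2)^n" by blast
  have "(\<lambda>n. 2 * (1/2::real)^n) \<longlonglongrightarrow> 0"
    by (intro tendsto_mult_right_zero LIMSEQ_power_zero) simp
  then have "(\<lambda>n. abs_L2 f - X n) \<longlonglongrightarrow> 0"
    by (rule Lim_null_comparison[OF always_eventually[OF le]])
  then have "(\<lambda>n. abs_L2 f - (abs_L2 f - X n)) \<longlonglongrightarrow> abs_L2 f - 0"
    by (intro tendsto_diff tendsto_const)
  then show ?thesis by (auto simp: convergent_def)
qed

instance L2 :: (euclidean_space) banach
proof
  fix X :: "nat \<Rightarrow> 'a L2"
  assume X: "Cauchy X"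
  have "\<forall>n. \<exists>N. \<forall>i\<ge>N. \<forall>j\<ge>N. norm (X i - X j) < (1/2)^n"
    using X by (simp add: Cauchy_iff)
  then obtain N where N: "\<And>n i j. i \<ge> N n \<Longrightarrow> j \<ge> N n \<Longrightarrow> norm (X i - X j) < (1/2)^n"
    by metis
  \<comment> \<open>Summing \<open>Suc (N k)\<close> makes \<open>r\<close> strictly increasing and
    at the same time at least \<open>N n\<close> at every \<open>n\<close>.\<close>
  define r where "r n = (\<Sum>k\<le>n. Suc (N k))" for n
  have rN: "N n \<le> r n" for n
  proof -
    have "Suc (N n) \<le> r n" unfolding r_def by (rule member_le_sum) auto
    then show ?thesis by simp
  qed
  have r: "strict_mono r" by (auto simp: r_def strict_mono_Suc_iff)
  have "norm ((X \<circ> r) (Suc n) - (X \<circ> r) n) \<le> (1/2)^n" for n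
  proof -
    have "r n \<le> r (Suc n)" using strict_monoD[OF r, of n "Suc n"] by simp
    then have "N n \<le> r (Suc n)" using rN[of n] by simp
    from N[OF this rN[of n]] show ?thesis by simp
  qed
  then have "convergent (X \<circ> r)" by (rule L2_fast_Cauchy_convergent)
  then obtain L where "(X \<circ> r) \<longlonglongrightarrow> L" by (auto simp: convergent_def)
  then have "X \<longlonglongrightarrow> L" by (rule Cauchy_converges_subseq[OF X r])
  then show "convergent X" by (auto simp: convergent_def)
qed

section \<open>Fibrewise linear multiplication operators\<close>

definition bounded_symbol :: "(real^3 \<Rightarrow> 'a::euclidean_space \<Rightarrow> 'b::euclidean_space) \<Rightarrow> real \<Rightarrow> bool" where
  "bounded_symbol m C \<longleftrightarrow> (\<forall>k. linear (m k)) \<and> (\<forall>w. (\<lambda>k. m k w) \<in> borel_measurable borel) \<and>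
     (\<forall>k w. norm (m k w) \<le> C * norm w)"

text \<open>One operation serves constant maps of the values (projections, embeddings, conjugation)
  and genuine Fourier multipliers. Symbols are only real linear in the value, which admits
  conjugation and real parts.\<close>

definition l2_mult :: "(real^3 \<Rightarrow> 'a::euclidean_space \<Rightarrow> 'b::euclidean_space) \<Rightarrow> 'a L2 \<Rightarrow> 'b L2" where
  "l2_mult m F = abs_L2 (\<lambda>k. m k (rep_L2 F k))"

lemma bounded_symbolI:
  assumes "\<And>k. linear (m k)" "\<And>w. (\<lambda>k. m k w) \<in> borel_measurable borel"
    "\<And>k w. norm (m k w) \<le> C * norm w"
  shows "bounded_symbol m C"
  using assms by (simp add: bounded_symbol_def)

lemma bounded_symbol_nonneg:
  fixes m :: "real^3 \<Rightarrow> 'a::euclidean_space \<Rightarrow> 'b::euclidean_space"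
  assumes "bounded_symbol m C" shows "C \<ge> 0"
proof -
  obtain b :: 'a where "b \<in> Basis" using nonempty_Basis by blast
  then have "norm (m 0 b) \<le> C" using assms unfolding bounded_symbol_def
    by (metis mult.right_neutral norm_Basis)
  then show ?thesis using norm_ge_zero[of "m 0 b"] by linarith
qed

text \<open>A symbol is measurable in \<open>k\<close> only for each fixed value \<open>w\<close>;
  expanding \<open>f k\<close> in the finite basis reduces a varying argument to finitely many fixed
  ones.\<close>

lemma bounded_symbol_measurable:
  assumes "bounded_symbol m C" and [measurable]: "f \<in> borel_measurable borel"
  shows "(\<lambda>k. m k (f k)) \<in> borel_measurable borel"
proof -
  have [measurable]: "(\<lambda>k. m k w) \<in> borel_measurable borel" for w
    using assms(1) by (simp add: bounded_symbol_def)
  have "m k (f k) = (\<Sum>b\<in>Basis. (f k \<bullet> b) *\<^sub>R m k b)" for k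
  proof -
    have "linear (m k)" using assms(1) by (simp add: bounded_symbol_def)
    then have "m k (\<Sum>b\<in>Basis. (f k \<bullet> b) *\<^sub>R b) = (\<Sum>b\<in>Basis. (f k \<bullet> b) *\<^sub>R m k b)"
      by (simp add: linear_sum linear_cmul)
    then show ?thesis by (simp add: euclidean_representation)
  qed
  then show ?thesis by simp
qed

lemma square_integrable_mult:
  assumes "bounded_symbol m C" "square_integrable f"
  shows "square_integrable (\<lambda>k. m k (f k))"
proof (rule square_integrable_bound[OF assms(2), of _ C])
  show "(\<lambda>k. m k (f k)) \<in> borel_measurable lborel"
    using bounded_symbol_measurable[OF assms(1) square_integrable_measurable[OF assms(2)]] by simp
  show "AE x in lborel. norm (m x (f x)) \<le> C * norm (f x)"
    using assms(1) by (simp add: bounded_symbol_def)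
qed

lemma l2_mult_abs:
  assumes "bounded_symbol m C" "square_integrable f"
  shows "l2_mult m (abs_L2 f) = abs_L2 (\<lambda>k. m k (f k))"
  unfolding l2_mult_def
proof (rule abs_L2_eqI)
  show "AE x in lborel. m x (rep_L2 (abs_L2 f) x) = m x (f x)"
    using rep_abs_L2[OF assms(2)] by eventually_elim simp
qed (use assms square_integrable_mult[OF assms(1)] in auto)

lemma rep_l2_mult:
  assumes "bounded_symbol m C"
  shows "AE k in lborel. rep_L2 (l2_mult m F) k = m k (rep_L2 F k)"
  unfolding l2_mult_def by (rule rep_abs_L2[OF square_integrable_mult[OF assms]]) simp

lemma l2_mult_norm_le:
  assumes "bounded_symbol m C"
  shows "norm (l2_mult m F) \<le> C * norm F"
  using norm_abs_L2_le[OF _ square_integrable_mult[OF assms], of "rep_L2 F" "rep_L2 F" C]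
    assms bounded_symbol_nonneg[OF assms]
  by (simp add: l2_mult_def bounded_symbol_def)

lemma bounded_linear_l2_mult:
  assumes "bounded_symbol m C"
  shows "bounded_linear (l2_mult m)"
proof (rule bounded_linear_intro[where K=C])
  have lin: "linear (m k)" for k using assms by (simp add: bounded_symbol_def)
  show "l2_mult m (F + G) = l2_mult m F + l2_mult m G" for F G
  proof (rule L2_eqI)
    show "AE x in lborel. rep_L2 (l2_mult m (F + G)) x = rep_L2 (l2_mult m F + l2_mult m G) x"
      using rep_l2_mult[OF assms, of F] rep_l2_mult[OF assms, of G] rep_l2_mult[OF assms, of "F + G"]
        rep_L2_add[of F G] rep_L2_add[of "l2_mult m F" "l2_mult m G"]
      by eventually_elim (simp add: linear_add[OF lin])
  qed
  show "l2_mult m (c *\<^sub>R F) = c *\<^sub>R l2_mult m F" for c F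
  proof (rule L2_eqI)
    show "AE x in lborel. rep_L2 (l2_mult m (c *\<^sub>R F)) x = rep_L2 (c *\<^sub>R l2_mult m F) x"
      using rep_l2_mult[OF assms, of F] rep_l2_mult[OF assms, of "c *\<^sub>R F"]
        rep_L2_scaleR[of c F] rep_L2_scaleR[of c "l2_mult m F"]
      by eventually_elim (simp add: linear_cmul[OF lin])
  qed
  show "norm (l2_mult m F) \<le> norm F * C" for F
    using l2_mult_norm_le[OF assms, of F] by (simp add: mult.commute)
qed

lemma bounded_symbol_comp:
  assumes "bounded_symbol m C" "bounded_symbol n D"
  shows "bounded_symbol (\<lambda>k w. m k (n k w)) (C * D)"
proof (rule bounded_symbolI)
  show "linear (\<lambda>w. m k (n k w))" for k
    using assms linear_compose[of "n k" "m k"] by (simp add: bounded_symbol_def o_def)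
  show "(\<lambda>k. m k (n k w)) \<in> borel_measurable borel" for w
    by (rule bounded_symbol_measurable[OF assms(1)]) (use assms(2) in \<open>simp add: bounded_symbol_def\<close>)
  show "norm (m k (n k w)) \<le> C * D * norm w" for k w
  proof -
    have "norm (m k (n k w)) \<le> C * norm (n k w)" using assms by (simp add: bounded_symbol_def)
    also have "\<dots> \<le> C * (D * norm w)"
      using assms bounded_symbol_nonneg[OF assms(1)] by (intro mult_left_mono) (auto simp: bounded_symbol_def)
    finally show ?thesis by simp
  qed
qed

lemma l2_mult_comp:
  assumes "bounded_symbol m C" "bounded_symbol n D"
  shows "l2_mult m (l2_mult n F) = l2_mult (\<lambda>k w. m k (n k w)) F"
  unfolding l2_mult_def[of n] by (subst l2_mult_abs[OF assms(1) square_integrable_mult[OF assms(2)]])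
    (simp_all add: l2_mult_def)

lemma l2_mult_id [simp]: "l2_mult (\<lambda>k w. w) F = F"
  by (simp add: l2_mult_def)

lemma l2_mult_isometry:
  assumes "bounded_symbol m C" "\<And>k w. norm (m k w) = norm w"
  shows "norm (l2_mult m F) = norm F"
  using norm_abs_L2_eq[OF _ square_integrable_mult[OF assms(1)], of "rep_L2 F" "rep_L2 F"] assms(2)
  by (simp add: l2_mult_def)

text \<open>Strong operator convergence. The symbols need not converge uniformly in
  \<open>k\<close>; the common bound \<open>C\<close> provides the dominating function for each
  fixed \<open>F\<close>.\<close>

lemma l2_mult_tendsto:
  fixes m :: "nat \<Rightarrow> real^3 \<Rightarrow> 'a::euclidean_space \<Rightarrow> 'b::euclidean_space"
  assumes m: "\<And>j. bounded_symbol (m j) C" and l: "bounded_symbol l D"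
    and lim: "AE k in lborel. \<forall>w. (\<lambda>j. m j k w) \<longlonglongrightarrow> l k w"
  shows "(\<lambda>j. l2_mult (m j) F) \<longlonglongrightarrow> l2_mult l F"
  unfolding l2_mult_def
proof (rule abs_L2_tendsto(2))
  note C = bounded_symbol_nonneg[OF m]
  show "(\<lambda>k. m j k (rep_L2 F k)) \<in> borel_measurable lborel" for j
    using bounded_symbol_measurable[OF m rep_L2_measurable] by simp
  show "(\<lambda>k. l k (rep_L2 F k)) \<in> borel_measurable lborel"
    using bounded_symbol_measurable[OF l rep_L2_measurable] by simp
  show "square_integrable (\<lambda>k. C *\<^sub>R rep_L2 F k)" by (simp add: square_integrable_scaleR)
  show "AE x in lborel. norm (m j x (rep_L2 F x)) \<le> norm (C *\<^sub>R rep_L2 F x)" for j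
    using m[of j] C by (simp add: bounded_symbol_def)
  show "AE x in lborel. (\<lambda>j. m j x (rep_L2 F x)) \<longlonglongrightarrow> l x (rep_L2 F x)"
    using lim by eventually_elim simp
qed

text \<open>Dominated convergence is sequential, so a limit over a real parameter is tested along
  all sequences that approach \<open>t\<close>.\<close>

lemma l2_mult_tendsto_at:
  fixes m :: "real \<Rightarrow> real^3 \<Rightarrow> 'a::euclidean_space \<Rightarrow> 'b::euclidean_space"
  assumes m: "\<And>s. bounded_symbol (m s) C" and l: "bounded_symbol l D"
    and lim: "AE k in lborel. \<forall>w. ((\<lambda>s. m s k w) \<longlongrightarrow> l k w) (at t)"
  shows "((\<lambda>s. l2_mult (m s) F) \<longlongrightarrow> l2_mult l F) (at t)"
  unfolding tendsto_at_iff_sequentially o_def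
proof (intro allI impI)
  fix X assume X: "\<forall>i. X i \<in> UNIV - {t}" "X \<longlonglongrightarrow> t"
  show "(\<lambda>i. l2_mult (m (X i)) F) \<longlonglongrightarrow> l2_mult l F"
  proof (rule l2_mult_tendsto[OF m l])
    show "AE k in lborel. \<forall>w. (\<lambda>j. m (X j) k w) \<longlonglongrightarrow> l k w"
      using lim by eventually_elim (use X in \<open>auto simp: tendsto_at_iff_sequentially o_def\<close>)
  qed
qed

section \<open>Gaussians\<close>

text \<open>Unnormalised, with centre \<open>p\<close>; the parameter is the rate \<open>a\<close>
  and not a variance, so that the rates add when two Gaussians are multiplied.\<close>

definition gauss :: "real \<Rightarrow> real^3 \<Rightarrow> real^3 \<Rightarrow> real" where
  "gauss a p x = exp (- (a * (norm (x - p))\<^sup>2))"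

lemma gauss_measurable [measurable]: "gauss a p \<in> borel_measurable borel"
  unfolding gauss_def by measurable

lemma gauss_pos [simp]: "0 < gauss a p x" "0 \<le> gauss a p x"
  by (simp_all add: gauss_def)

lemma gauss_commute: "gauss a p x = gauss a x p"
  by (simp add: gauss_def norm_minus_commute)

section \<open>Changes of variables and product integrals\<close>

lemma lborel_integral_affine:
  fixes f :: "'a::euclidean_space \<Rightarrow> 'b::{banach, second_countable_topology}"
  assumes c: "c \<noteq> 0"
  shows "integrable lborel (\<lambda>x. f (t + c *\<^sub>R x)) \<longleftrightarrow> integrable lborel f"
    and "(LINT x|lborel. f x) = \<bar>c\<bar> ^ DIM('a) *\<^sub>R (LINT x|lborel. f (t + c *\<^sub>R x))"
proof -
  have imp: "integrable lborel (\<lambda>x. g (s + d *\<^sub>R x))" if "integrable lborel g" "d \<noteq> 0"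
    for g :: "'a \<Rightarrow> 'b" and s d
  proof -
    have [measurable]: "g \<in> borel_measurable borel" using that(1) by measurable
    have "integrable lborel (\<lambda>x. \<bar>d\<bar> ^ DIM('a) *\<^sub>R g (s + d *\<^sub>R x))"
      using that(1) by (subst (asm) lborel_affine[OF that(2), of s])
        (simp add: integrable_density integrable_distr_eq that)
    then have "integrable lborel (\<lambda>x. inverse (\<bar>d\<bar> ^ DIM('a)) *\<^sub>R \<bar>d\<bar> ^ DIM('a) *\<^sub>R g (s + d *\<^sub>R x))"
      by (rule integrable_scaleR_right)
    then show ?thesis using that(2) by simp
  qed
  show *: "integrable lborel (\<lambda>x. f (t + c *\<^sub>R x)) \<longleftrightarrow> integrable lborel f"
  proof
    assume "integrable lborel (\<lambda>x. f (t + c *\<^sub>R x))"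
    from imp[OF this, of "inverse c" "- (inverse c *\<^sub>R t)"] c
    show "integrable lborel f" by (simp add: scaleR_diff_right)
  qed (use imp[OF _ c] in auto)
  show "(LINT x|lborel. f x) = \<bar>c\<bar> ^ DIM('a) *\<^sub>R (LINT x|lborel. f (t + c *\<^sub>R x))"
  proof (cases "integrable lborel f")
    case True
    then have [measurable]: "f \<in> borel_measurable borel" by measurable
    show ?thesis
      by (subst lborel_affine[OF c, of t]) (simp add: integral_density integral_distr)
  next
    \<comment> \<open>Without integrability both integrals have the default value 0, so the identity
      needs no assumption on \<open>f\<close>.\<close>
    case False
    then show ?thesis using * by (simp add: not_integrable_integral_eq)
  qed
qed

lemma lborel_integral_translate:
  fixes f :: "'a::euclidean_space \<Rightarrow> 'b::{banach, second_countable_topology}"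
  shows "integrable lborel (\<lambda>x. f (x + t)) \<longleftrightarrow> integrable lborel f"
    "(LINT x|lborel. f (x + t)) = (LINT x|lborel. f x)"
  using lborel_integral_affine[of 1 f t] by (simp_all add: add.commute)

lemma lborel_integral_reflect:
  fixes f :: "'a::euclidean_space \<Rightarrow> 'b::{banach, second_countable_topology}"
  shows "integrable lborel (\<lambda>x. f (t - x)) \<longleftrightarrow> integrable lborel f"
    "(LINT x|lborel. f (t - x)) = (LINT x|lborel. f x)"
  using lborel_integral_affine[of "-1" f t] by simp_all

text \<open>Lebesgue measure is the image of a finite product of line measures, which factorises the
  integral of a product of functions of single coordinates.\<close>

lemma lborel_integral_prod:
  fixes f :: "'a::euclidean_space \<Rightarrow> real \<Rightarrow> complex"
  assumes "\<And>b. b \<in> Basis \<Longrightarrow> integrable lborel (f b)"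
  shows "integrable lborel (\<lambda>x. \<Prod>b\<in>Basis. f b (x \<bullet> b))"
    "(LINT x|lborel. (\<Prod>b\<in>Basis. f b (x \<bullet> b))) = (\<Prod>b\<in>Basis. (LINT y|lborel. f b y))"
proof -
  interpret product_sigma_finite "\<lambda>_::'a. lborel :: real measure" by standard
  have m [measurable]: "f b \<in> borel_measurable borel" if "b \<in> Basis" for b
    using assms[OF that] by measurable
  have [measurable]: "(\<lambda>x::'a. \<Prod>b\<in>Basis. f b (x \<bullet> b)) \<in> borel_measurable borel"
    by (intro borel_measurable_prod) measurable
  have T [measurable]: "(\<lambda>g. \<Sum>b\<in>Basis. g b *\<^sub>R b) \<in> (\<Pi>\<^sub>M b\<in>(Basis::'a set). lborel) \<rightarrow>\<^sub>M borel"
    by measurable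
  have eq: "(\<Prod>b\<in>Basis. f b ((\<Sum>c\<in>Basis. g c *\<^sub>R c) \<bullet> b)) = (\<Prod>b\<in>(Basis::'a set). f b (g b))" for g
    by (intro prod.cong refl) (simp add: inner_sum_left inner_Basis if_distrib sum.delta cong: if_cong)
  show "integrable lborel (\<lambda>x. \<Prod>b\<in>Basis. f b (x \<bullet> b))"
    by (subst lborel_eq) (simp add: integrable_distr_eq eq product_integrable_prod assms)
  show "(LINT x|lborel. (\<Prod>b\<in>Basis. f b (x \<bullet> b))) = (\<Prod>b\<in>Basis. (LINT y|lborel. f b y))"
    by (subst lborel_eq) (simp add: integral_distr eq product_integral_prod assms)
qed

section \<open>Fourier integrals of Gaussians\<close>

lemma cis_measurable [measurable]: "cis \<in> borel_measurable borel"
  by (intro borel_measurable_continuous_onI continuous_on_cis continuous_on_id)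

lemma sqrt_cubed:
  assumes "c > 0" shows "sqrt c ^ 3 = c powr (3/2)"
proof -
  have "sqrt c ^ 3 = (c powr (1/2)) powr (real 3)"
    using assms by (subst powr_realpow) (simp_all add: powr_half_sqrt)
  also have "\<dots> = c powr (3/2)" by (subst powr_powr) simp
  finally show ?thesis .
qed

text \<open>This is the characteristic function of the standard normal distribution at
  \<open>- t\<close>, freed of the normalising factor of the density.\<close>

lemma std_gauss_fourier_1:
  "integrable lborel (\<lambda>x. cis (- (t * x)) * of_real (exp (- x\<^sup>2 / 2)))"
  "(LINT x|lborel. cis (- (t * x)) * of_real (exp (- x\<^sup>2 / 2))) = of_real (sqrt (2 * pi) * exp (- t\<^sup>2 / 2))"
proof -
  have d: "std_normal_density x = exp (- x\<^sup>2 / 2) / sqrt (2 * pi)" for x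
    by (simp add: std_normal_density_def)
  have int: "integrable lborel (\<lambda>x. std_normal_density x)"
    by (rule integrable_normal_density) simp
  then have "integrable lborel (\<lambda>x. sqrt (2 * pi) * std_normal_density x)" by simp
  then have int': "integrable lborel (\<lambda>x::real. exp (- x\<^sup>2 / 2))" by (simp add: d)
  show "integrable lborel (\<lambda>x. cis (- (t * x)) * of_real (exp (- x\<^sup>2 / 2)))"
    by (rule Bochner_Integration.integrable_bound[OF int']) (auto simp: norm_mult)
  have "char std_normal_distribution (- t) = of_real (exp (- t\<^sup>2 / 2))"
    by (simp add: char_std_normal_distribution)
  also have "char std_normal_distribution (- t) =
      (LINT x|lborel. std_normal_density x *\<^sub>R iexp (- t * x))"
    unfolding char_def by (subst integral_density) (auto simp: normal_density_nonneg)
  also have "\<dots> = (LINT x|lborel. of_real (1 / sqrt (2 * pi)) * (cis (- (t * x)) * of_real (exp (- x\<^sup>2 / 2))))"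
    by (intro Bochner_Integration.integral_cong refl)
      (simp add: d cis_conv_exp scaleR_conv_of_real)
  also have "\<dots> = of_real (1 / sqrt (2 * pi)) * (LINT x|lborel. cis (- (t * x)) * of_real (exp (- x\<^sup>2 / 2)))"
    by (rule integral_mult_right_zero)
  finally show "(LINT x|lborel. cis (- (t * x)) * of_real (exp (- x\<^sup>2 / 2))) = of_real (sqrt (2 * pi) * exp (- t\<^sup>2 / 2))"
    by (simp add: field_simps)
qed

lemma std_gauss_fourier_3:
  fixes k :: "real^3"
  shows "integrable lborel (\<lambda>x. cis (- (k \<bullet> x)) * of_real (exp (- (norm x)\<^sup>2 / 2)))"
  "(LINT x|lborel. cis (- (k \<bullet> x)) * of_real (exp (- (norm x)\<^sup>2 / 2))) =
     of_real ((2 * pi) powr (3/2) * exp (- (norm k)\<^sup>2 / 2))"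
proof -
  have n: "(norm x)\<^sup>2 = (\<Sum>b\<in>Basis. (x \<bullet> b)\<^sup>2)" for x :: "real^3"
    by (subst power2_norm_eq_inner, subst euclidean_inner) (simp add: power2_eq_square)
  have c: "cis (\<Sum>i\<in>I. u i) = (\<Prod>i\<in>I. cis (u i))" for u and I :: "(real^3) set"
    by (induction I rule: infinite_finite_induct) (auto simp: cis_mult[symmetric])
  have e: "exp (- (norm x)\<^sup>2 / 2) = (\<Prod>b\<in>Basis. exp (- (x \<bullet> b)\<^sup>2 / 2))" for x :: "real^3"
  proof -
    have "- (norm x)\<^sup>2 / 2 = (\<Sum>b\<in>Basis. - (x \<bullet> b)\<^sup>2 / 2)"
      unfolding n by (simp only: sum_divide_distrib sum_negf[symmetric])
    then show ?thesis by (simp only: exp_sum finite_Basis)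
  qed
  have "- (k \<bullet> x) = (\<Sum>b\<in>Basis. - (k \<bullet> b * (x \<bullet> b)))" for x
    by (simp only: euclidean_inner[of k x] sum_negf)
  then have ck: "cis (- (k \<bullet> x)) = (\<Prod>b\<in>Basis. cis (- (k \<bullet> b * (x \<bullet> b))))" for x
    by (simp only: c)
  have eq: "cis (- (k \<bullet> x)) * of_real (exp (- (norm x)\<^sup>2 / 2)) =
      (\<Prod>b\<in>Basis. cis (- (k \<bullet> b * (x \<bullet> b))) * of_real (exp (- (x \<bullet> b)\<^sup>2 / 2)))" for x
    by (simp only: ck e of_real_prod prod.distrib)
  show "integrable lborel (\<lambda>x. cis (- (k \<bullet> x)) * of_real (exp (- (norm x)\<^sup>2 / 2)))"
    unfolding eq by (rule lborel_integral_prod(1)) (rule std_gauss_fourier_1)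
  show "(LINT x|lborel. cis (- (k \<bullet> x)) * of_real (exp (- (norm x)\<^sup>2 / 2))) =
     of_real ((2 * pi) powr (3/2) * exp (- (norm k)\<^sup>2 / 2))"
    unfolding eq lborel_integral_prod(2)[OF std_gauss_fourier_1(1)] std_gauss_fourier_1(2) unfolding e
    by (simp add: prod.distrib) (simp add: sqrt_cubed flip: of_real_power)
qed

lemma gauss_fourier:
  fixes k :: "real^3"
  assumes a: "a > 0"
  shows "integrable lborel (\<lambda>x. cis (- (k \<bullet> x)) * of_real (gauss a p x))"
  "(LINT x|lborel. cis (- (k \<bullet> x)) * of_real (gauss a p x)) =
     cis (- (k \<bullet> p)) * of_real ((pi / a) powr (3/2) * gauss (1 / (4 * a)) 0 k)"
proof -
  \<comment> \<open>The scale for which \<open>a * s^2 = 1/2\<close>, so that the substitution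
    \<open>p + s x\<close> leads to the standard Gaussian.\<close>
  define s where "s = 1 / sqrt (2 * a)"
  have s: "s > 0" and s0: "s \<noteq> 0" using a by (simp_all add: s_def)
  have s2: "s\<^sup>2 = 1 / (2 * a)" using a by (simp add: s_def power_divide)
  have eq: "cis (- (k \<bullet> (p + s *\<^sub>R x))) * of_real (gauss a p (p + s *\<^sub>R x)) =
      cis (- (k \<bullet> p)) * (cis (- ((s *\<^sub>R k) \<bullet> x)) * of_real (exp (- (norm x)\<^sup>2 / 2)))" for x
  proof -
    have "gauss a p (p + s *\<^sub>R x) = exp (- (norm x)\<^sup>2 / 2)"
      using a s2 by (simp add: gauss_def power_mult_distrib)
    moreover have "cis (- (k \<bullet> (p + s *\<^sub>R x))) = cis (- (k \<bullet> p)) * cis (- ((s *\<^sub>R k) \<bullet> x))"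
      unfolding cis_mult by (simp add: inner_add_right)
    ultimately show ?thesis by simp
  qed
  show "integrable lborel (\<lambda>x. cis (- (k \<bullet> x)) * of_real (gauss a p x))"
    unfolding lborel_integral_affine(1)[OF s0, of "\<lambda>x. cis (- (k \<bullet> x)) * of_real (gauss a p x)" p, symmetric] eq
    by (intro integrable_mult_right std_gauss_fourier_3)
  have "(LINT x|lborel. cis (- (k \<bullet> x)) * of_real (gauss a p x)) =
     s ^ 3 *\<^sub>R (cis (- (k \<bullet> p)) * of_real ((2 * pi) powr (3/2) * exp (- (norm (s *\<^sub>R k))\<^sup>2 / 2)))"
    unfolding lborel_integral_affine(2)[OF s0, of "\<lambda>x. cis (- (k \<bullet> x)) * of_real (gauss a p x)" p] eq
      integral_mult_right_zero std_gauss_fourier_3 using s by simp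
  also have "exp (- (norm (s *\<^sub>R k))\<^sup>2 / 2) = gauss (1 / (4 * a)) 0 k"
    using s2 by (simp add: gauss_def power_mult_distrib)
  also have "s ^ 3 *\<^sub>R (cis (- (k \<bullet> p)) * of_real ((2 * pi) powr (3/2) * gauss (1 / (4 * a)) 0 k)) =
      cis (- (k \<bullet> p)) * of_real (s^3 * (2 * pi) powr (3/2) * gauss (1 / (4 * a)) 0 k)"
    by (simp add: scaleR_conv_of_real)
  also have "s^3 * (2 * pi) powr (3/2) = (pi / a) powr (3/2)"
  proof -
    have "s^3 = (1 / (2 * a)) powr (3/2)"
      using a sqrt_cubed[of "1 / (2 * a)"] by (simp add: s_def real_sqrt_divide)
    then show ?thesis using a by (simp add: powr_mult[symmetric])
  qed
  finally show "(LINT x|lborel. cis (- (k \<bullet> x)) * of_real (gauss a p x)) =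
     cis (- (k \<bullet> p)) * of_real ((pi / a) powr (3/2) * gauss (1 / (4 * a)) 0 k)" .
qed

lemma gauss_integral:
  assumes "a > 0"
  shows "integrable lborel (gauss a p)" "(LINT x|lborel. gauss a p x) = (pi / a) powr (3/2)"
proof -
  have "integrable lborel (\<lambda>x. complex_of_real (gauss a p x))"
    using gauss_fourier(1)[OF assms, of 0 p] by simp
  then show "integrable lborel (gauss a p)"
    using integrable_Re by fastforce
  have "complex_of_real (LINT x|lborel. gauss a p x) = of_real ((pi / a) powr (3/2))"
    using gauss_fourier(2)[OF assms, of 0 p] by (simp add: gauss_def)
  then show "(LINT x|lborel. gauss a p x) = (pi / a) powr (3/2)"
    by (simp only: of_real_eq_iff)
qed

lemma gauss_square_integrable:
  assumes "a > 0"
  shows "square_integrable (\<lambda>x. complex_of_real (gauss a p x))"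
proof -
  have "(norm (complex_of_real (gauss a p x)))\<^sup>2 = gauss (2 * a) p x" for x
    by (simp add: gauss_def flip: exp_double)
  then show ?thesis using gauss_integral(1)[of "2 * a"] assms by (simp add: square_integrable_def)
qed

text \<open>The positive and negative parts of \<open>h\<close> are densities of two measures that
  agree on boxes. Boxes form an intersection-stable generator, so the measures and then their
  densities agree, and a number with equal positive and negative part is 0.\<close>

lemma AE_eq_0_if_box_integrals_0:
  fixes h :: "'a::euclidean_space \<Rightarrow> real"
  assumes h: "integrable lborel h"
    and box: "\<And>a b. (LINT x|lborel. h x * indicator (box a b) x) = 0"
  shows "AE x in lborel. h x = 0"
proof -
  have [measurable]: "h \<in> borel_measurable borel" using h by measurable
  have fin: "(\<integral>\<^sup>+x. ennreal (h x) \<partial>lborel) \<noteq> \<infinity>" "(\<integral>\<^sup>+x. ennreal (- h x) \<partial>lborel) \<noteq> \<infinity>"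
    using h by (auto simp: real_integrable_def)
  have le: "(\<integral>\<^sup>+x. ennreal (h x) * indicator S x \<partial>lborel) \<le> (\<integral>\<^sup>+x. ennreal (h x) \<partial>lborel)"
    "(\<integral>\<^sup>+x. ennreal (- h x) * indicator S x \<partial>lborel) \<le> (\<integral>\<^sup>+x. ennreal (- h x) \<partial>lborel)" for S
    by (auto intro!: nn_integral_mono simp: indicator_def)
  have eq: "(\<integral>\<^sup>+x. ennreal (h x) * indicator (box a b) x \<partial>lborel) =
      (\<integral>\<^sup>+x. ennreal (- h x) * indicator (box a b) x \<partial>lborel)" (is "?P = ?N") for a b
  proof -
    have e: "ennreal (h x * indicator (box a b) x) = ennreal (h x) * indicator (box a b) x"
      "ennreal (- (h x * indicator (box a b) x)) = ennreal (- h x) * indicator (box a b) x" for x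
      by (auto simp: indicator_def)
    have int: "integrable lborel (\<lambda>x. h x * indicator (box a b) x)"
      using integrable_mult_indicator[OF _ h, of "box a b"] by (simp add: mult.commute)
    from real_lebesgue_integral_def[OF int] have "enn2real ?P = enn2real ?N"
      unfolding e box by simp
    moreover have "?P < \<infinity>" "?N < \<infinity>"
      using le[of "box a b"] fin by (auto simp: less_top top_unique)
    ultimately show ?thesis
      by (metis ennreal_enn2real infinity_ennreal_def)
  qed
  have "density lborel (\<lambda>x. ennreal (h x)) = density lborel (\<lambda>x. ennreal (- h x))" (is "?M = ?N")
  proof (rule measure_eqI_generator_eq)
    let ?E = "range (\<lambda>(a, b). box a b::'a set)"
    show "Int_stable ?E" by (auto simp: Int_stable_def box_Int_box)
    show "?E \<subseteq> Pow UNIV" "sets ?M = sigma_sets UNIV ?E" "sets ?N = sigma_sets UNIV ?E"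
      by (simp_all add: borel_eq_box)
    let ?A = "\<lambda>n::nat. box (- (real n *\<^sub>R One)) (real n *\<^sub>R One) :: 'a set"
    show "range ?A \<subseteq> ?E" "(\<Union>i. ?A i) = UNIV" unfolding UN_box_eq_UNIV by auto
    show "emeasure ?M (?A i) \<noteq> \<infinity>" for i
      using le(1)[of "?A i"] fin(1) by (auto simp: emeasure_density top_unique)
    show "emeasure ?M X = emeasure ?N X" if "X \<in> ?E" for X
      using that eq by (auto simp: emeasure_density)
  qed
  then have "AE x in lborel. ennreal (h x) = ennreal (- h x)"
    by (intro sigma_finite_measure.density_unique[OF lborel.sigma_finite_measure_axioms]) auto
  then show ?thesis
    by eventually_elim (smt (verit) ennreal_eq_0_iff)
qed

text \<open>Gaussians with growing rate are an approximate identity. Convergence to the indicator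
  can be expected only where the indicator is continuous, that is, off the frontier.\<close>

lemma gauss_box_integral_limit:
  fixes x :: "real^3"
  assumes S: "S \<in> sets borel" and x: "x \<notin> frontier S"
  shows "(\<lambda>n. (real (Suc n) / pi) powr (3/2) * (LINT p|lborel. indicator S p * gauss (real (Suc n)) p x)) \<longlonglongrightarrow> indicator S x"
proof -
  note [measurable] = S
  \<comment> \<open>The width of the Gaussian; in the variable scaled by \<open>s n\<close> the
    Gaussian no longer depends on \<open>n\<close>, and only the indicator does.\<close>
  define s where "s n = 1 / sqrt (real (Suc n))" for n
  have s0: "s n \<noteq> 0" and s2: "(s n)\<^sup>2 = 1 / real (Suc n)" and spos: "s n > 0" for n
    by (simp_all add: s_def power_divide)
  have "s = (\<lambda>n. sqrt (1 / real (Suc n)))" by (simp add: s_def real_sqrt_divide fun_eq_iff)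
  then have slim: "s \<longlonglongrightarrow> 0" using tendsto_real_sqrt[OF LIMSEQ_Suc[OF lim_1_over_n]] by simp
  have eq: "(real (Suc n) / pi) powr (3/2) * (LINT p|lborel. indicator S p * gauss (real (Suc n)) p x) =
      pi powr (-3/2) * (LINT y|lborel. indicator S (x + s n *\<^sub>R y) * gauss 1 0 y)" for n
  proof -
    have g: "gauss (real (Suc n)) (x + s n *\<^sub>R y) x = gauss 1 0 y" for y
    proof -
      have "real (Suc n) * (s n)\<^sup>2 = 1" unfolding s2 by simp
      then show ?thesis by (simp add: gauss_def power_mult_distrib mult.assoc[symmetric] del: of_nat_Suc)
    qed
    have "(LINT p|lborel. indicator S p * gauss (real (Suc n)) p x) =
        s n ^ 3 * (LINT y|lborel. indicator S (x + s n *\<^sub>R y) * gauss 1 0 y)"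
      unfolding lborel_integral_affine(2)[OF s0[of n], of "\<lambda>p. indicator S p * gauss (real (Suc n)) p x" x] g
      using spos[of n] by simp
    moreover have "(real (Suc n) / pi) powr (3/2) * s n ^ 3 = pi powr (-3/2)"
    proof -
      have "s n ^ 3 = (1 / real (Suc n)) powr (3/2)"
        using sqrt_cubed[of "1 / real (Suc n)"] by (simp add: s_def real_sqrt_divide del: of_nat_Suc)
      then have "(real (Suc n) / pi) powr (3/2) * s n ^ 3 = (1 / pi) powr (3/2)"
        by (simp add: powr_mult[symmetric] del: of_nat_Suc)
      then show ?thesis by (simp add: powr_divide powr_minus_divide)
    qed
    ultimately show ?thesis by (simp only: mult.assoc[symmetric])
  qed
  have "(\<lambda>n. LINT y|lborel. indicator S (x + s n *\<^sub>R y) * gauss 1 0 y) \<longlonglongrightarrow>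
      (LINT y|lborel. indicator S x * gauss 1 0 y)"
  proof (rule integral_dominated_convergence[where w="gauss 1 0"])
    show "integrable lborel (gauss 1 0)" by (rule gauss_integral) simp
    show "AE y in lborel. (\<lambda>n. indicator S (x + s n *\<^sub>R y) * gauss 1 0 y) \<longlonglongrightarrow> indicator S x * gauss 1 0 y"
    proof (rule AE_I2)
      fix y
      have lim: "(\<lambda>n. x + s n *\<^sub>R y) \<longlonglongrightarrow> x"
        using tendsto_add[OF tendsto_const[of x] tendsto_scaleR[OF slim tendsto_const[of y]]] by simp
      have "\<forall>\<^sub>F n in sequentially. indicator S (x + s n *\<^sub>R y) = (indicator S x :: real)"
      proof (cases "x \<in> interior S")
        case True
        have "\<forall>\<^sub>F n in sequentially. x + s n *\<^sub>R y \<in> interior S"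
          by (rule topological_tendstoD[OF lim open_interior True])
        then show ?thesis by eventually_elim (use True interior_subset in \<open>auto simp: indicator_def\<close>)
      next
        case False
        then have o: "x \<in> - closure S" using x by (auto simp: frontier_def)
        have "\<forall>\<^sub>F n in sequentially. x + s n *\<^sub>R y \<in> - closure S"
          by (rule topological_tendstoD[OF lim _ o]) auto
        then show ?thesis by eventually_elim (use o closure_subset in \<open>auto simp: indicator_def\<close>)
      qed
      then show "(\<lambda>n. indicator S (x + s n *\<^sub>R y) * gauss 1 0 y) \<longlonglongrightarrow> indicator S x * gauss 1 0 y"
        by (intro tendsto_mult tendsto_const tendsto_eventually)
    qed
    show "AE y in lborel. norm (indicator S (x + s n *\<^sub>R y) * gauss 1 0 y) \<le> gauss 1 0 y" for n
      by (auto simp: indicator_def less_imp_le)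
  qed measurable
  then have "(\<lambda>n. pi powr (-3/2) * (LINT y|lborel. indicator S (x + s n *\<^sub>R y) * gauss 1 0 y)) \<longlonglongrightarrow>
      pi powr (-3/2) * (LINT y|lborel. indicator S x * gauss 1 0 y)"
    by (intro tendsto_intros)
  also have "(LINT y|lborel. indicator S x * gauss 1 0 y) = indicator S x * pi powr (3/2)"
    using gauss_integral(2)[of 1 0] by simp
  finally show ?thesis unfolding eq by (simp add: powr_minus field_simps)
qed

text \<open>By Fubini, integrating the hypothesis over the centres \<open>p\<close> in a box makes
  \<open>h\<close> orthogonal to the smoothed indicator of the box. Removing the smoothing gives
  vanishing box integrals.\<close>

lemma AE_eq_0_if_gauss_integrals_0:
  fixes h :: "real^3 \<Rightarrow> complex"
  assumes h: "integrable lborel h"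
    and zero: "\<And>n p. (LINT x|lborel. of_real (gauss (real (Suc n)) p x) * h x) = 0"
  shows "AE x in lborel. h x = 0"
proof -
  have [measurable]: "h \<in> borel_measurable borel" using h by measurable
  have box0: "(LINT x|lborel. of_real (indicator (box a b) x) * h x) = 0" for a b
  proof -
    let ?S = "box a b"
    define w where "w n x = (real (Suc n) / pi) powr (3/2) * (LINT p|lborel. indicator ?S p * gauss (real (Suc n)) p x)" for n x
    have gi: "integrable lborel (\<lambda>p. gauss (real (Suc n)) p x)" for n x
      unfolding gauss_commute[of _ _ x] using gauss_integral(1)[of "real (Suc n)" x] by simp
    have igi: "integrable lborel (\<lambda>p. indicator ?S p * gauss (real (Suc n)) p x)" for n x
      using integrable_mult_indicator[OF _ gi, of ?S] by simp
    have gm [measurable]: "(\<lambda>(x, p). gauss r p x) \<in> borel_measurable (borel \<Otimes>\<^sub>M borel)" for r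
      unfolding gauss_def by measurable
    have wm [measurable]: "w n \<in> borel_measurable borel" for n
      unfolding w_def by measurable
    have w0: "0 \<le> w n x" for n x unfolding w_def by (intro mult_nonneg_nonneg integral_nonneg_AE) auto
    have w1: "w n x \<le> 1" for n x
    proof -
      have "(LINT p|lborel. indicator ?S p * gauss (real (Suc n)) p x) \<le> (LINT p|lborel. gauss (real (Suc n)) p x)"
        by (intro integral_mono igi gi) (auto simp: indicator_def less_imp_le)
      also have "\<dots> = (pi / real (Suc n)) powr (3/2)"
        unfolding gauss_commute[of _ _ x] using gauss_integral(2)[of "real (Suc n)" x] by simp
      finally have "w n x \<le> (real (Suc n) / pi) powr (3/2) * (pi / real (Suc n)) powr (3/2)"
        unfolding w_def by (intro mult_left_mono) auto
      also have "\<dots> = 1" by (simp add: powr_mult[symmetric] del: of_nat_Suc)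
      finally show ?thesis .
    qed
    have wz: "(LINT x|lborel. of_real (w n x) * h x) = 0" for n
    proof -
      let ?f = "\<lambda>x p. of_real (indicator ?S p * gauss (real (Suc n)) p x) * h x"
      let ?c = "(real (Suc n) / pi) powr (3/2)"
      have int2: "integrable lborel (?f x)" for x
        using igi[of n x] by (intro integrable_mult_left integrable_of_real)
      have in1: "(LINT p|lborel. norm (?f x p)) = (w n x / ?c) * norm (h x)" for x
      proof -
        have "norm (?f x p) = (indicator ?S p * gauss (real (Suc n)) p x) * norm (h x)" for p
          by (simp add: norm_mult)
        then have "(LINT p|lborel. norm (?f x p)) = (LINT p|lborel. (indicator ?S p * gauss (real (Suc n)) p x) * norm (h x))"
          by simp
        also have "\<dots> = (LINT p|lborel. indicator ?S p * gauss (real (Suc n)) p x) * norm (h x)"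
          by (rule integral_mult_left_zero)
        finally show ?thesis by (simp add: w_def)
      qed
      have int1: "integrable lborel (\<lambda>x. LINT p|lborel. norm (?f x p))"
        unfolding in1
      proof (rule Bochner_Integration.integrable_bound[of _ "\<lambda>x. (1 / ?c) * norm (h x)"])
        show "AE x in lborel. norm (w n x / ?c * norm (h x)) \<le> norm (1 / ?c * norm (h x))"
          using w0 w1 by (auto simp: abs_mult intro!: divide_right_mono mult_left_le_one_le)
      qed (use h in \<open>auto simp del: of_nat_Suc\<close>)
      have "integrable (lborel \<Otimes>\<^sub>M lborel) (case_prod ?f)"
        by (rule lborel_pair.Fubini_integrable) (use int1 int2 in auto)
      from lborel_pair.Fubini_integral[OF this]
      have F: "(LINT x|lborel. LINT p|lborel. ?f x p) = (LINT p|lborel. LINT x|lborel. ?f x p)" by simp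
      have "(LINT x|lborel. ?f x p) = of_real (indicator ?S p) * (LINT x|lborel. of_real (gauss (real (Suc n)) p x) * h x)" for p
        unfolding integral_mult_right_zero[symmetric] by (simp add: mult.assoc)
      then have R: "(LINT p|lborel. LINT x|lborel. ?f x p) = 0" by (simp only: zero) simp
      have L: "(LINT p|lborel. ?f x p) = of_real (w n x / ?c) * h x" for x
      proof -
        have "(LINT p|lborel. ?f x p) = (LINT p|lborel. of_real (indicator ?S p * gauss (real (Suc n)) p x)) * h x"
          by (rule integral_mult_left_zero)
        also have "\<dots> = of_real (LINT p|lborel. indicator ?S p * gauss (real (Suc n)) p x) * h x"
          by (simp only: integral_complex_of_real)
        finally show ?thesis unfolding w_def by simp
      qed
      have "(LINT x|lborel. of_real (w n x / ?c) * h x) = 0" using F unfolding L R .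
      then have "of_real ?c * (LINT x|lborel. of_real (w n x / ?c) * h x) = 0" by simp
      then show ?thesis
        unfolding integral_mult_right_zero[symmetric] by (simp del: of_nat_Suc)
    qed
    have "(\<lambda>n. LINT x|lborel. of_real (w n x) * h x) \<longlonglongrightarrow> (LINT x|lborel. of_real (indicator ?S x) * h x)"
    proof (rule integral_dominated_convergence[where w="\<lambda>x. norm (h x)"])
      \<comment> \<open>The smoothed indicators converge only off the frontier, which is a null set
        for a box.\<close>
      have "frontier ?S \<in> null_sets lborel"
        using negligible_convex_frontier[OF convex_box(2)[of a b]]
        unfolding negligible_iff_null_sets by (subst (asm) null_sets_completion_iff) auto
      then have "AE x in lborel. x \<notin> frontier ?S" by (rule AE_not_in)
      then show "AE x in lborel. (\<lambda>n. of_real (w n x) * h x) \<longlonglongrightarrow> of_real (indicator ?S x) * h x"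
        by eventually_elim (intro tendsto_mult tendsto_of_real tendsto_const,
            unfold w_def, intro gauss_box_integral_limit, simp_all del: of_nat_Suc)
      show "AE x in lborel. norm (of_real (w n x) * h x) \<le> norm (h x)" for n
        using w0 w1 by (auto simp: norm_mult intro!: mult_left_le_one_le)
    qed (use h in auto)
    then show ?thesis unfolding wz by (simp add: LIMSEQ_const_iff)
  qed
  have int: "integrable lborel (\<lambda>x. of_real (indicator (box a b) x) * h x)" for a b
    using integrable_mult_indicator[OF _ h, of "box a b"] by (simp add: scaleR_conv_of_real)
  have "AE x in lborel. Re (h x) = 0"
  proof (rule AE_eq_0_if_box_integrals_0)
    fix a b
    show "(LINT x|lborel. Re (h x) * indicator (box a b) x) = 0"
      using integral_Re[OF int, of a b] box0[of a b] by (simp add: mult.commute)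
  qed (use h in simp)
  moreover have "AE x in lborel. Im (h x) = 0"
  proof (rule AE_eq_0_if_box_integrals_0)
    fix a b
    show "(LINT x|lborel. Im (h x) * indicator (box a b) x) = 0"
      using integral_Im[OF int, of a b] box0[of a b] by (simp add: mult.commute)
  qed (use h in simp)
  ultimately show ?thesis by eventually_elim (simp add: complex_eq_iff)
qed

text \<open>Completing the square: the new centre is the mean of \<open>p\<close> and 0 with weights
  \<open>a\<close> and 1.\<close>

lemma gauss_mult_gauss:
  assumes "a > 0"
  shows "gauss a p x * gauss 1 0 x = gauss a p (inverse (a + 1) *\<^sub>R (a *\<^sub>R p)) * gauss 1 0 (inverse (a + 1) *\<^sub>R (a *\<^sub>R p)) * gauss (a + 1) (inverse (a + 1) *\<^sub>R (a *\<^sub>R p)) x"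
proof -
  define q where "q = inverse (a + 1) *\<^sub>R (a *\<^sub>R p)"
  have q: "(a + 1) *\<^sub>R q = a *\<^sub>R p" using assms by (simp add: q_def)
  have qx: "(a + 1) * (q \<bullet> y) = a * (p \<bullet> y)" for y
    using arg_cong[OF q, of "\<lambda>z. z \<bullet> y"] by simp
  have 1: "(norm (x - y))\<^sup>2 = x \<bullet> x - 2 * (y \<bullet> x) + y \<bullet> y" for x y :: "real^3"
    by (simp add: power2_norm_eq_inner inner_diff_left inner_diff_right inner_commute)
  have "a * (norm (x - p))\<^sup>2 + 1 * (norm (x - 0))\<^sup>2 = a * (norm (q - p))\<^sup>2 + 1 * (norm (q - 0))\<^sup>2 + (a + 1) * (norm (x - q))\<^sup>2"
    unfolding 1 using qx[of x] qx[of q] by (simp add: algebra_simps inner_commute)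
  then show ?thesis unfolding q_def[symmetric] gauss_def exp_add[symmetric] by simp
qed

text \<open>Here \<open>g\<close> itself need not be integrable. Its product with the unit Gaussian
  is, and a product of Gaussians is a constant times a Gaussian, so the hypothesis passes to the
  product; the unit Gaussian vanishes nowhere.\<close>

lemma gauss_test_unique:
  fixes g :: "real^3 \<Rightarrow> complex"
  assumes g: "\<And>a p. a > 0 \<Longrightarrow> integrable lborel (\<lambda>x. g x * of_real (gauss a p x))"
    and zero: "\<And>a p. a > 0 \<Longrightarrow> (LINT x|lborel. g x * of_real (gauss a p x)) = 0"
  shows "AE x in lborel. g x = 0"
proof -
  have "AE x in lborel. g x * of_real (gauss 1 0 x) = 0"
  proof (rule AE_eq_0_if_gauss_integrals_0)
    show "integrable lborel (\<lambda>x. g x * of_real (gauss 1 0 x))" by (rule g) simp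
    fix n and p :: "real^3"
    let ?a = "real (Suc n)"
    let ?q = "inverse (?a + 1) *\<^sub>R (?a *\<^sub>R p)"
    have "of_real (gauss ?a p x) * (g x * of_real (gauss 1 0 x)) =
        of_real (gauss ?a p ?q * gauss 1 0 ?q) * (g x * of_real (gauss (?a + 1) ?q x))" for x
      using arg_cong[OF gauss_mult_gauss[of ?a p x], of complex_of_real]
      by (simp only: of_real_mult mult_ac)
    then have "(LINT x|lborel. of_real (gauss ?a p x) * (g x * of_real (gauss 1 0 x))) =
        of_real (gauss ?a p ?q * gauss 1 0 ?q) * (LINT x|lborel. g x * of_real (gauss (?a + 1) ?q x))"
      by (simp only: integral_mult_right_zero)
    also have "\<dots> = 0" by (subst zero) auto
    finally show "(LINT x|lborel. of_real (gauss ?a p x) * (g x * of_real (gauss 1 0 x))) = 0" .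
  qed
  then show ?thesis by eventually_elim (simp add: gauss_def)
qed

section \<open>The Fourier transform on $L^1 \cap L^2$\<close>

lemma cnj_measurable [measurable]: "cnj \<in> borel_measurable borel"
  by (intro borel_measurable_continuous_onI continuous_on_cnj continuous_on_id)

lemma integrable_cis_mult [simp]:
  fixes f :: "'a \<Rightarrow> complex"
  assumes [measurable]: "u \<in> borel_measurable M" and f: "integrable M f"
  shows "integrable M (\<lambda>x. cis (u x) * f x)"
proof -
  have [measurable]: "f \<in> borel_measurable M" using f by measurable
  show ?thesis by (rule Bochner_Integration.integrable_bound[OF f]) (auto simp: norm_mult)
qed

lemma schwartz_fourier_measurable [measurable]:
  assumes [measurable]: "f \<in> borel_measurable borel"
  shows "schwartz_fourier f \<in> borel_measurable borel"
  unfolding schwartz_fourier_def[abs_def] by measurable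

lemma schwartz_fourier_bound:
  "norm (schwartz_fourier f k) \<le> (2 * pi) powr (-3/2) * (LINT x|lborel. norm (f x))"
proof -
  have "norm (LINT x|lborel. cis (- (k \<bullet> x)) * f x) \<le> (LINT x|lborel. norm (f x))"
    using integral_norm_bound[of lborel "\<lambda>x. cis (- (k \<bullet> x)) * f x"] by (simp add: norm_mult)
  then show ?thesis
    by (simp add: schwartz_fourier_def norm_mult mult_left_mono)
qed

lemma integrable_bounded_mult:
  fixes f g :: "'a \<Rightarrow> complex"
  assumes f: "integrable M f" and [measurable]: "g \<in> borel_measurable M" and b: "\<And>x. norm (g x) \<le> C"
  shows "integrable M (\<lambda>x. g x * f x)"
proof -
  have [measurable]: "f \<in> borel_measurable M" using f by measurable
  have I: "integrable M (\<lambda>x. C * norm (f x))" using f by simp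
  show ?thesis
  proof (rule Bochner_Integration.integrable_bound[OF I])
    show "AE x in M. norm (g x * f x) \<le> norm (C * norm (f x))"
    proof (rule AE_I2)
      fix x
      have "norm (g x) * norm (f x) \<le> C * norm (f x)" by (intro mult_right_mono b) simp
      then show "norm (g x * f x) \<le> norm (C * norm (f x))"
        using abs_ge_self[of "C * norm (f x)"] by (simp add: norm_mult del: abs_mult)
    qed
  qed measurable
qed

lemma schwartz_fourier_linear:
  assumes "integrable lborel f" "integrable lborel g"
  shows "schwartz_fourier (\<lambda>x. f x + g x) k = schwartz_fourier f k + schwartz_fourier g k"
    "schwartz_fourier (\<lambda>x. f x - g x) k = schwartz_fourier f k - schwartz_fourier g k"
  unfolding schwartz_fourier_def using assms
  by (simp_all add: distrib_left right_diff_distrib)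

lemma schwartz_fourier_cmult:
  "schwartz_fourier (\<lambda>x. c * f x) k = c * schwartz_fourier f k"
  unfolding schwartz_fourier_def mult.left_commute[of _ c] by simp

lemma schwartz_fourier_cong_AE:
  assumes "AE x in lborel. f x = g x"
    and [measurable]: "f \<in> borel_measurable borel" "g \<in> borel_measurable borel"
  shows "schwartz_fourier f = schwartz_fourier g"
proof
  fix k
  have "(LINT x|lborel. cis (- (k \<bullet> x)) * f x) = (LINT x|lborel. cis (- (k \<bullet> x)) * g x)"
    by (intro integral_cong_AE) (use assms(1) in auto)
  then show "schwartz_fourier f k = schwartz_fourier g k" by (simp add: schwartz_fourier_def)
qed

text \<open>Fubini, since the kernel is symmetric in \<open>k\<close> and \<open>x\<close>. This
  identity is what later moves every transform onto a test function.\<close>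

lemma schwartz_fourier_multiplication:
  assumes f: "integrable lborel f" and g: "integrable lborel g"
  shows "(LINT k|lborel. schwartz_fourier f k * g k) = (LINT x|lborel. f x * schwartz_fourier g x)"
proof -
  have [measurable]: "f \<in> borel_measurable borel" "g \<in> borel_measurable borel" using f g by measurable
  let ?h = "\<lambda>k x. cis (- (k \<bullet> x)) * f x * g k"
  have "integrable (lborel \<Otimes>\<^sub>M lborel) (case_prod ?h)"
  proof (rule lborel_pair.Fubini_integrable)
    have "(LINT x|lborel. norm (case_prod ?h (k, x))) = (LINT x|lborel. norm (f x)) * norm (g k)" for k
      by (simp add: norm_mult)
    then show "integrable lborel (\<lambda>k. LINT x|lborel. norm (case_prod ?h (k, x)))"
      using g by simp
    show "AE k in lborel. integrable lborel (\<lambda>x. case_prod ?h (k, x))"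
      using f by simp
  qed measurable
  from lborel_pair.Fubini_integral[OF this]
  have F: "(LINT x|lborel. LINT k|lborel. ?h k x) = (LINT k|lborel. LINT x|lborel. ?h k x)" .
  let ?c = "complex_of_real ((2 * pi) powr (-3/2))"
  have "(LINT k|lborel. schwartz_fourier f k * g k) = (LINT k|lborel. ?c * (LINT x|lborel. ?h k x))"
    unfolding integral_mult_left_zero by (simp only: schwartz_fourier_def mult.assoc)
  also have "\<dots> = ?c * (LINT x|lborel. LINT k|lborel. ?h k x)"
    unfolding F by (rule integral_mult_right_zero)
  also have "\<dots> = (LINT x|lborel. ?c * (LINT k|lborel. ?h k x))"
    by (rule integral_mult_right_zero[symmetric])
  also have "\<dots> = (LINT x|lborel. f x * schwartz_fourier g x)"
  proof (intro Bochner_Integration.integral_cong refl)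
    fix x
    have "?h k x = f x * (cis (- (x \<bullet> k)) * g k)" for k
      by (simp add: inner_commute[of k x])
    then have "(LINT k|lborel. ?h k x) = f x * (LINT k|lborel. cis (- (x \<bullet> k)) * g k)"
      by (simp only: integral_mult_right_zero)
    then show "?c * (LINT k|lborel. ?h k x) = f x * schwartz_fourier g x"
      by (simp add: schwartz_fourier_def)
  qed
  finally show ?thesis .
qed

lemma schwartz_fourier_gauss:
  assumes "a > 0"
  shows "schwartz_fourier (\<lambda>x. of_real (gauss a p x)) k =
    cis (- (k \<bullet> p)) * of_real ((2 * a) powr (-3/2) * gauss (1 / (4 * a)) 0 k)"
proof -
  have "(2 * pi) powr (-3/2) * (pi / a) powr (3/2) = (2 * a) powr (-3/2)"
  proof -
    have "(2 * pi) powr (-3/2) = (1 / (2 * pi)) powr (3/2)" "(2 * a) powr (-3/2) = (1 / (2 * a)) powr (3/2)"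
      using assms by (simp_all add: powr_minus_divide powr_divide)
    then show ?thesis using assms by (simp add: powr_mult[symmetric])
  qed
  then have "(pi / a) powr (3/2) * (2 * pi) powr (-3/2) = (2 * a) powr (-3/2)"
    by (simp add: mult.commute)
  then show ?thesis
    unfolding schwartz_fourier_def gauss_fourier(2)[OF assms]
    by (simp add: mult.left_commute mult.assoc[symmetric] flip: of_real_mult)
qed

lemma schwartz_fourier_modulate:
  "schwartz_fourier (\<lambda>x. cis (p \<bullet> x) * f x) k = schwartz_fourier f (k - p)"
  unfolding schwartz_fourier_def by (simp add: inner_diff_left cis_mult mult.assoc[symmetric])

lemma schwartz_fourier_translate:
  "schwartz_fourier (\<lambda>x. f (x - h)) k = cis (- (k \<bullet> h)) * schwartz_fourier f k"
proof -
  have "(LINT x|lborel. cis (- (k \<bullet> x)) * f (x - h)) = (LINT x|lborel. cis (- (k \<bullet> (x + h))) * f x)"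
    using lborel_integral_translate(2)[of "\<lambda>x. cis (- (k \<bullet> x)) * f (x - h)" h] by simp
  also have "\<dots> = (LINT x|lborel. cis (- (k \<bullet> h)) * (cis (- (k \<bullet> x)) * f x))"
    by (intro Bochner_Integration.integral_cong refl)
      (simp add: inner_add_right cis_mult mult.assoc[symmetric] add.commute)
  also have "\<dots> = cis (- (k \<bullet> h)) * (LINT x|lborel. cis (- (k \<bullet> x)) * f x)"
    by (rule integral_mult_right_zero)
  finally show ?thesis by (simp add: schwartz_fourier_def)
qed

lemma schwartz_fourier_cnj:
  "schwartz_fourier (\<lambda>x. cnj (f x)) k = cnj (schwartz_fourier f (- k))"
  by (simp add: schwartz_fourier_def cis_cnj flip: Bochner_Integration.integral_cnj)

text \<open>The inversion formula where it can be computed: the first transform is a modulated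
  Gaussian, and modulation becomes translation under the second.\<close>

lemma schwartz_fourier_schwartz_fourier_gauss:
  assumes "a > 0"
  shows "schwartz_fourier (schwartz_fourier (\<lambda>x. of_real (gauss a p x))) k = of_real (gauss a p (- k))"
proof -
  have 1: "schwartz_fourier (\<lambda>x. of_real (gauss a p x)) =
      (\<lambda>k. of_real ((2 * a) powr (-3/2)) * (cis ((- p) \<bullet> k) * of_real (gauss (1 / (4 * a)) 0 k)))"
    using assms by (auto simp: schwartz_fourier_gauss inner_commute)
  have "(2 * a) powr (-3/2) * (1 / (2 * a)) powr (-3/2) = 1"
    using assms by (simp add: powr_mult[symmetric])
  then have "complex_of_real ((2 * a) powr (-3/2)) * of_real ((1 / (2 * a)) powr (-3/2)) = 1"
    by (simp only: of_real_mult[symmetric] of_real_1)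
  then show ?thesis
    unfolding 1 schwartz_fourier_cmult schwartz_fourier_modulate
    using assms schwartz_fourier_gauss[of "1 / (4 * a)" 0 "k + p"]
    by (simp add: mult.assoc[symmetric] gauss_def norm_minus_commute)
      (metis add.commute minus_add_distrib norm_minus_cancel uminus_add_conv_diff)
qed

text \<open>The Gaussian weight supplies the integrability that the squared transform of an
  integrable function lacks a priori. By the multiplication formula the weighted energy is a
  quadratic form in \<open>f\<close> whose kernel is a probability density in each variable, so
  Schur's test bounds it by the energy of \<open>f\<close>.\<close>

lemma gauss_weighted_fourier_bound:
  assumes f: "integrable lborel f" and f2: "square_integrable f" and e: "\<epsilon> > 0"
  shows "(\<integral>\<^sup>+k. ennreal (gauss \<epsilon> 0 k * (norm (schwartz_fourier f k))\<^sup>2) \<partial>lborel)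
    \<le> (\<integral>\<^sup>+x. ennreal ((norm (f x))\<^sup>2) \<partial>lborel)"
proof -
  have [measurable]: "f \<in> borel_measurable borel" using f by measurable
  define F where "F = schwartz_fourier f"
  define b where "b = 1 / (4 * \<epsilon>)"
  have b: "b > 0" using e by (simp add: b_def)
  have Fm [measurable]: "F \<in> borel_measurable borel" unfolding F_def by measurable
  \<comment> \<open>The product of the two normalising factors equals
    \<open>(4 * pi * \<epsilon>) powr (-3/2)\<close>, for which the kernel \<open>K\<close> below
    has total mass 1.\<close>
  define c where "c = (2 * pi) powr (-3/2) * (2 * \<epsilon>) powr (-3/2)"
  have c0: "c \<ge> 0" by (simp add: c_def)
  have cb: "c * (pi / b) powr (3/2) = 1"
  proof -
    have "(2 * pi) powr (-3/2) = (1 / (2 * pi)) powr (3/2)" "(2 * \<epsilon>) powr (-3/2) = (1 / (2 * \<epsilon>)) powr (3/2)"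
      using e by (simp_all add: powr_minus_divide powr_divide)
    then show ?thesis using e by (simp add: c_def b_def powr_mult[symmetric])
  qed
  define C where "C = (2 * pi) powr (-3/2) * (LINT x|lborel. norm (f x))"
  have FC: "norm (F k) \<le> C" for k unfolding F_def C_def by (rule schwartz_fourier_bound)
  have gint: "integrable lborel (\<lambda>k. complex_of_real (gauss \<epsilon> 0 k))"
    using gauss_integral(1)[OF e] by (rule integrable_of_real)
  \<comment> \<open>Pairing \<open>F\<close> with \<open>u\<close> gives the weighted energy, and
    \<open>u\<close> is integrable, which the multiplication formula demands.\<close>
  define u where "u k = cnj (F k) * of_real (gauss \<epsilon> 0 k)" for k
  have uint: "integrable lborel u"
    unfolding u_def by (rule integrable_bounded_mult[OF gint, of _ C]) (auto simp: FC)
  \<comment> \<open>The heat kernel at time \<epsilon>.\<close>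
  define K where "K x y = c * gauss b x y" for x y
  have Km [measurable]: "(\<lambda>(x, y). K x y) \<in> borel_measurable (borel \<Otimes>\<^sub>M borel)"
    unfolding K_def gauss_def by measurable
  have K0: "0 \<le> K x y" for x y using c0 by (simp add: K_def less_imp_le)
  have K1: "(\<integral>\<^sup>+y. ennreal (K x y) \<partial>lborel) = 1" for x
  proof -
    have "(\<integral>\<^sup>+y. ennreal (K x y) \<partial>lborel) = ennreal (LINT y|lborel. K x y)"
      unfolding K_def by (rule nn_integral_eq_integral) (use gauss_integral(1)[OF b] c0 in \<open>auto simp: less_imp_le\<close>)
    also have "(LINT y|lborel. K x y) = 1"
      using cb gauss_integral(2)[OF b, of x] by (simp add: K_def)
    finally show ?thesis by simp
  qed
  have K2: "(\<integral>\<^sup>+x. ennreal (K x y) \<partial>lborel) = 1" for y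
    using K1[of y] by (simp add: K_def gauss_commute[of b y])
  have fu: "schwartz_fourier u x = cnj (LINT y|lborel. f y * of_real (K x y))" for x
  proof -
    let ?v = "\<lambda>k. cis (x \<bullet> k) * of_real (gauss \<epsilon> 0 k) :: complex"
    have v: "schwartz_fourier ?v y = of_real ((2 * \<epsilon>) powr (-3/2) * gauss b x y)" for y
      unfolding schwartz_fourier_modulate schwartz_fourier_gauss[OF e]
      by (simp add: gauss_def b_def)
    have "cnj (schwartz_fourier u x) = of_real ((2 * pi) powr (-3/2)) * (LINT k|lborel. F k * ?v k)"
      unfolding schwartz_fourier_def u_def
      by (simp add: cis_cnj mult_ac flip: Bochner_Integration.integral_cnj)
    also have "(LINT k|lborel. F k * ?v k) = (LINT y|lborel. f y * schwartz_fourier ?v y)"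
      unfolding F_def by (intro schwartz_fourier_multiplication f integrable_cis_mult gint) measurable
    also have "of_real ((2 * pi) powr (-3/2)) * (LINT y|lborel. f y * schwartz_fourier ?v y) =
        (LINT y|lborel. f y * of_real (K x y))"
      unfolding v integral_mult_right_zero[symmetric] by (simp add: K_def c_def mult_ac)
    finally show ?thesis by (metis complex_cnj_cnj)
  qed
  have "(\<integral>\<^sup>+k. ennreal (gauss \<epsilon> 0 k * (norm (F k))\<^sup>2) \<partial>lborel) = ennreal (LINT k|lborel. gauss \<epsilon> 0 k * (norm (F k))\<^sup>2)"
  proof (rule nn_integral_eq_integral)
    show "integrable lborel (\<lambda>k. gauss \<epsilon> 0 k * (norm (F k))\<^sup>2)"
    proof (rule Bochner_Integration.integrable_bound[of _ "\<lambda>k. C\<^sup>2 * gauss \<epsilon> 0 k"])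
      show "integrable lborel (\<lambda>k. C\<^sup>2 * gauss \<epsilon> 0 k)" using gauss_integral(1)[OF e] by simp
      show "AE x in lborel. norm (gauss \<epsilon> 0 x * (norm (F x))\<^sup>2) \<le> norm (C\<^sup>2 * gauss \<epsilon> 0 x)"
        using FC by (auto simp: abs_mult less_imp_le intro!: mult_mono power_mono)
    qed measurable
  qed (auto simp: less_imp_le)
  also have "(LINT k|lborel. gauss \<epsilon> 0 k * (norm (F k))\<^sup>2) = Re (LINT k|lborel. F k * u k)"
  proof -
    have "F k * u k = of_real (gauss \<epsilon> 0 k * (norm (F k))\<^sup>2)" for k
    proof -
      have "F k * u k = F k * cnj (F k) * of_real (gauss \<epsilon> 0 k)" by (simp add: u_def)
      also have "F k * cnj (F k) = of_real ((norm (F k))\<^sup>2)" by (rule complex_norm_square[symmetric])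
      finally show ?thesis by (simp only: of_real_mult[symmetric] mult.commute)
    qed
    then show ?thesis by (simp del: of_real_mult of_real_power)
  qed
  also have "(LINT k|lborel. F k * u k) = (LINT x|lborel. f x * schwartz_fourier u x)"
    unfolding F_def by (rule schwartz_fourier_multiplication[OF f uint])
  also have "ennreal (Re (LINT x|lborel. f x * schwartz_fourier u x)) \<le>
      ennreal (norm (LINT x|lborel. f x * schwartz_fourier u x))"
    by (intro ennreal_leI complex_Re_le_cmod)
  also have "\<dots> \<le> (\<integral>\<^sup>+x. ennreal (norm (f x * schwartz_fourier u x)) \<partial>lborel)"
  proof (cases "integrable lborel (\<lambda>x. f x * schwartz_fourier u x)")
    case True
    then show ?thesis by (rule integral_norm_bound_ennreal)
  qed (simp add: not_integrable_integral_eq)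
  also have "\<dots> \<le> (\<integral>\<^sup>+x. (\<integral>\<^sup>+y. ennreal (norm (f x) * norm (f y) * K x y) \<partial>lborel) \<partial>lborel)"
  proof (rule nn_integral_mono)
    fix x
    have "ennreal (norm (schwartz_fourier u x)) \<le> (\<integral>\<^sup>+y. ennreal (norm (f y * of_real (K x y))) \<partial>lborel)"
    proof (cases "integrable lborel (\<lambda>y. f y * of_real (K x y))")
      case True
      then show ?thesis unfolding fu complex_mod_cnj by (rule integral_norm_bound_ennreal)
    qed (simp add: fu not_integrable_integral_eq)
    then have "ennreal (norm (f x)) * ennreal (norm (schwartz_fourier u x)) \<le>
        ennreal (norm (f x)) * (\<integral>\<^sup>+y. ennreal (norm (f y * of_real (K x y))) \<partial>lborel)"
      by (rule mult_left_mono) simp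
    also have "\<dots> = (\<integral>\<^sup>+y. ennreal (norm (f x)) * ennreal (norm (f y * of_real (K x y))) \<partial>lborel)"
      by (rule nn_integral_cmult[symmetric]) measurable
    also have "\<dots> = (\<integral>\<^sup>+y. ennreal (norm (f x) * norm (f y) * K x y) \<partial>lborel)"
      using K0 by (intro nn_integral_cong) (simp add: norm_mult mult.assoc flip: ennreal_mult)
    finally show "ennreal (norm (f x * schwartz_fourier u x)) \<le> \<dots>"
      by (simp add: norm_mult ennreal_mult)
  qed
  \<comment> \<open>The product is bounded by half the sum of the squares; each half is then
    integrated in the variable in which \<open>K\<close> has mass 1.\<close>
  also have "\<dots> \<le> (\<integral>\<^sup>+x. (\<integral>\<^sup>+y. ennreal ((norm (f x))\<^sup>2 / 2) * ennreal (K x y) + ennreal ((norm (f y))\<^sup>2 / 2) * ennreal (K x y) \<partial>lborel) \<partial>lborel)"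
  proof (intro nn_integral_mono)
    fix x y
    have "norm (f x) * norm (f y) \<le> (norm (f x))\<^sup>2 / 2 + (norm (f y))\<^sup>2 / 2"
      using sum_squares_bound[of "norm (f x)" "norm (f y)"] by simp
    then have "norm (f x) * norm (f y) * K x y \<le> ((norm (f x))\<^sup>2 / 2) * K x y + ((norm (f y))\<^sup>2 / 2) * K x y"
      using mult_right_mono[OF _ K0] by (metis distrib_right)
    then show "ennreal (norm (f x) * norm (f y) * K x y) \<le> ennreal ((norm (f x))\<^sup>2 / 2) * ennreal (K x y) + ennreal ((norm (f y))\<^sup>2 / 2) * ennreal (K x y)"
      using K0 by (simp add: ennreal_leI flip: ennreal_mult ennreal_plus)
  qed
  also have "\<dots> = (\<integral>\<^sup>+x. (\<integral>\<^sup>+y. ennreal ((norm (f x))\<^sup>2 / 2) * ennreal (K x y) \<partial>lborel) \<partial>lborel) +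
      (\<integral>\<^sup>+x. (\<integral>\<^sup>+y. ennreal ((norm (f y))\<^sup>2 / 2) * ennreal (K x y) \<partial>lborel) \<partial>lborel)"
    by (subst nn_integral_add[symmetric]) (auto intro!: nn_integral_cong nn_integral_add)
  also have "(\<integral>\<^sup>+x. (\<integral>\<^sup>+y. ennreal ((norm (f y))\<^sup>2 / 2) * ennreal (K x y) \<partial>lborel) \<partial>lborel) =
      (\<integral>\<^sup>+y. (\<integral>\<^sup>+x. ennreal ((norm (f y))\<^sup>2 / 2) * ennreal (K x y) \<partial>lborel) \<partial>lborel)"
    by (rule lborel_pair.Fubini'[symmetric]) measurable
  also have "(\<integral>\<^sup>+x. (\<integral>\<^sup>+y. ennreal ((norm (f x))\<^sup>2 / 2) * ennreal (K x y) \<partial>lborel) \<partial>lborel) +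
      (\<integral>\<^sup>+y. (\<integral>\<^sup>+x. ennreal ((norm (f y))\<^sup>2 / 2) * ennreal (K x y) \<partial>lborel) \<partial>lborel) =
      (\<integral>\<^sup>+x. ennreal ((norm (f x))\<^sup>2 / 2) \<partial>lborel) + (\<integral>\<^sup>+x. ennreal ((norm (f x))\<^sup>2 / 2) \<partial>lborel)"
    by (simp add: nn_integral_cmult K1 K2)
  also have "\<dots> = (\<integral>\<^sup>+x. ennreal ((norm (f x))\<^sup>2 / 2) + ennreal ((norm (f x))\<^sup>2 / 2) \<partial>lborel)"
    by (rule nn_integral_add[symmetric]) measurable
  also have "\<dots> = (\<integral>\<^sup>+x. ennreal ((norm (f x))\<^sup>2) \<partial>lborel)"
    by (intro nn_integral_cong) (simp flip: ennreal_plus)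
  finally show ?thesis unfolding F_def .
qed

text \<open>The weight tends to 1 and Fatou's lemma keeps the bound. An inequality suffices here:
  inversion turns it into an equality later.\<close>

lemma schwartz_fourier_contraction:
  assumes f: "integrable lborel f" and f2: "square_integrable f"
  shows "square_integrable (schwartz_fourier f)"
    "norm (abs_L2 (schwartz_fourier f)) \<le> norm (abs_L2 f)"
proof -
  have [measurable]: "f \<in> borel_measurable borel" using f by measurable
  let ?F = "schwartz_fourier f"
  have "(\<integral>\<^sup>+k. ennreal ((norm (?F k))\<^sup>2) \<partial>lborel) =
      (\<integral>\<^sup>+k. liminf (\<lambda>n. ennreal (gauss (1 / real (Suc n)) 0 k * (norm (?F k))\<^sup>2)) \<partial>lborel)"
  proof (intro nn_integral_cong)
    fix k :: "real^3"
    have "(\<lambda>n. exp (- (1 / real (Suc n) * (norm (k - 0))\<^sup>2)) * (norm (?F k))\<^sup>2) \<longlonglongrightarrow> exp (- (0 * (norm (k - 0))\<^sup>2)) * (norm (?F k))\<^sup>2"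
      by (intro tendsto_intros lim_1_over_n LIMSEQ_Suc[OF lim_1_over_n])
    then have "(\<lambda>n. gauss (1 / real (Suc n)) 0 k * (norm (?F k))\<^sup>2) \<longlonglongrightarrow> (norm (?F k))\<^sup>2"
      by (simp add: gauss_def)
    then have "(\<lambda>n. ennreal (gauss (1 / real (Suc n)) 0 k * (norm (?F k))\<^sup>2)) \<longlonglongrightarrow> ennreal ((norm (?F k))\<^sup>2)"
      by (rule tendsto_ennrealI)
    then show "ennreal ((norm (?F k))\<^sup>2) = liminf (\<lambda>n. ennreal (gauss (1 / real (Suc n)) 0 k * (norm (?F k))\<^sup>2))"
      by (intro lim_imp_Liminf[symmetric]) auto
  qed
  also have "\<dots> \<le> liminf (\<lambda>n. \<integral>\<^sup>+k. ennreal (gauss (1 / real (Suc n)) 0 k * (norm (?F k))\<^sup>2) \<partial>lborel)"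
    by (rule nn_integral_liminf) measurable
  also have "\<dots> \<le> liminf (\<lambda>n::nat. \<integral>\<^sup>+x. ennreal ((norm (f x))\<^sup>2) \<partial>lborel)"
    by (intro Liminf_mono always_eventually allI gauss_weighted_fourier_bound f f2) simp
  also have "\<dots> = ennreal ((norm (abs_L2 f))\<^sup>2)"
    by (simp add: Liminf_const norm_abs_L2_nn[OF f2])
  finally have le: "(\<integral>\<^sup>+k. ennreal ((norm (?F k))\<^sup>2) \<partial>lborel) \<le> ennreal ((norm (abs_L2 f))\<^sup>2)" .
  show sq: "square_integrable ?F"
    by (rule square_integrableI_nn) (use le in \<open>auto intro: le_less_trans[OF le]\<close>)
  have "ennreal ((norm (abs_L2 ?F))\<^sup>2) \<le> ennreal ((norm (abs_L2 f))\<^sup>2)"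
    using le norm_abs_L2_nn[OF sq] by simp
  then show "norm (abs_L2 ?F) \<le> norm (abs_L2 f)"
    by (subst (asm) ennreal_le_iff) (auto intro: power2_le_imp_le)
qed

section \<open>The Fourier transform on $L^2$\<close>

text \<open>Cutting off outside balls gives an explicit integrable sequence that tends to
  \<open>f\<close> in mean square, so that the extension to \<open>L2\<close> needs no choice of
  approximants.\<close>

definition ball_cut :: "nat \<Rightarrow> (real^3 \<Rightarrow> complex) \<Rightarrow> real^3 \<Rightarrow> complex" where
  "ball_cut n f x = indicator (ball 0 (real n)) x * f x"

lemma cut_L1_L2:
  assumes f: "square_integrable f"
  shows "integrable lborel (ball_cut n f)" "square_integrable (ball_cut n f)"
proof -
  have [measurable]: "f \<in> borel_measurable borel" using f by measurable
  have [measurable]: "ball 0 (real n) \<in> sets (borel :: (real^3) measure)" by simp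
  have [measurable]: "ball_cut n f \<in> borel_measurable borel" unfolding ball_cut_def[abs_def] by measurable
  show "square_integrable (ball_cut n f)"
    by (rule square_integrable_bound[OF f, of _ 1]) (auto simp: ball_cut_def norm_mult indicator_def)
  have i: "integrable lborel (indicator (ball 0 (real n)) :: real^3 \<Rightarrow> real)"
    by (rule integrable_real_indicator) (use emeasure_bounded_finite[OF bounded_ball] in auto)
  have I: "integrable lborel (\<lambda>x. indicator (ball 0 (real n)) x + (norm (f x))\<^sup>2)"
    using f i by (auto simp: square_integrable_def)
  show "integrable lborel (ball_cut n f)"
  proof (rule Bochner_Integration.integrable_bound[OF I])
    show "AE x in lborel. norm (ball_cut n f x) \<le> norm (indicator (ball 0 (real n)) x + (norm (f x))\<^sup>2)"
    proof (rule AE_I2)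
      fix x :: "real^3"
      \<comment> \<open>On the ball the constant 1 is integrable, and the square of
        \<open>norm (f x)\<close> controls the rest.\<close>
      have "norm (f x) \<le> 1 + (norm (f x))\<^sup>2"
        using sum_squares_bound[of "norm (f x)" 1] zero_le_power2[of "norm (f x)"] norm_ge_zero[of "f x"]
        unfolding power_one mult_1_right by linarith
      then show "norm (ball_cut n f x) \<le> norm (indicator (ball 0 (real n)) x + (norm (f x))\<^sup>2)"
        by (auto simp: ball_cut_def norm_mult indicator_def)
    qed
  qed measurable
qed

lemma cut_tendsto:
  assumes f: "square_integrable f"
  shows "(\<lambda>n. abs_L2 (ball_cut n f)) \<longlonglongrightarrow> abs_L2 f"
proof (rule abs_L2_tendsto(2)[OF _ _ f])
  show "ball_cut n f \<in> borel_measurable lborel" for n using cut_L1_L2(2)[OF f, of n] by measurable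
  show "f \<in> borel_measurable lborel" using f by measurable
  show "AE x in lborel. norm (ball_cut n f x) \<le> norm (f x)" for n
    by (auto simp: ball_cut_def norm_mult indicator_def)
  show "AE x in lborel. (\<lambda>n. ball_cut n f x) \<longlonglongrightarrow> f x"
  proof (rule AE_I2)
    fix x :: "real^3"
    obtain N where N: "norm x < real N" using reals_Archimedean2 by blast
    have "\<forall>\<^sub>F n in sequentially. ball_cut n f x = f x"
      using eventually_ge_at_top[of N] by eventually_elim (use N in \<open>simp add: ball_cut_def\<close>)
    then show "(\<lambda>n. ball_cut n f x) \<longlonglongrightarrow> f x" by (rule tendsto_eventually)
  qed
qed

text \<open>The density principle by which identities are transported from integral transforms to
  \<open>L2\<close>.\<close>

lemma bounded_linear_eqI_L1_L2:
  fixes S T :: "complex L2 \<Rightarrow> 'b::real_normed_vector"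
  assumes S: "bounded_linear S" and T: "bounded_linear T"
    and eq: "\<And>f. integrable lborel f \<Longrightarrow> square_integrable f \<Longrightarrow> S (abs_L2 f) = T (abs_L2 f)"
  shows "S F = T F"
proof -
  have lim: "(\<lambda>n. abs_L2 (ball_cut n (rep_L2 F))) \<longlonglongrightarrow> F" using cut_tendsto[of "rep_L2 F"] by simp
  have "S (abs_L2 (ball_cut n (rep_L2 F))) = T (abs_L2 (ball_cut n (rep_L2 F)))" for n
    by (intro eq cut_L1_L2) simp_all
  then show ?thesis
    using bounded_linear.tendsto[OF S lim] bounded_linear.tendsto[OF T lim] by (simp add: LIMSEQ_unique)
qed

text \<open>The limit exists because the integral transform is a contraction and the cut-off
  functions converge; until this is shown, \<open>lim\<close> is only a formal value.\<close>

definition fourier_L2 :: "complex L2 \<Rightarrow> complex L2" where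
  "fourier_L2 F = lim (\<lambda>n. abs_L2 (schwartz_fourier (ball_cut n (rep_L2 F))))"

lemma schwartz_fourier_dist:
  assumes "integrable lborel f" "square_integrable f" "integrable lborel g" "square_integrable g"
  shows "dist (abs_L2 (schwartz_fourier f)) (abs_L2 (schwartz_fourier g)) \<le> dist (abs_L2 f) (abs_L2 g)"
proof -
  have eq: "schwartz_fourier (\<lambda>x. f x - g x) = (\<lambda>k. schwartz_fourier f k - schwartz_fourier g k)"
    using assms by (auto simp: schwartz_fourier_linear)
  have "norm (abs_L2 (schwartz_fourier (\<lambda>x. f x - g x))) \<le> norm (abs_L2 (\<lambda>x. f x - g x))"
    using assms by (intro schwartz_fourier_contraction) (auto intro: square_integrable_diff)
  then show ?thesis
    unfolding eq using assms schwartz_fourier_contraction(1)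
    by (simp add: abs_L2_diff dist_norm)
qed

lemma fourier_L2_lim: "(\<lambda>n. abs_L2 (schwartz_fourier (ball_cut n (rep_L2 F)))) \<longlonglongrightarrow> fourier_L2 F"
proof -
  let ?X = "\<lambda>n. abs_L2 (schwartz_fourier (ball_cut n (rep_L2 F)))"
  have "Cauchy (\<lambda>n. abs_L2 (ball_cut n (rep_L2 F)))"
    using cut_tendsto[of "rep_L2 F"] by (intro LIMSEQ_imp_Cauchy) simp
  then have "Cauchy ?X"
    unfolding Cauchy_def
    by (meson le_less_trans schwartz_fourier_dist cut_L1_L2 square_integrable_rep_L2)
  from convergent_LIMSEQ_iff[THEN iffD1, OF Cauchy_convergent[OF this]] show ?thesis
    unfolding fourier_L2_def .
qed

lemma fourier_L2_abs:
  assumes f: "integrable lborel f" "square_integrable f"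
  shows "fourier_L2 (abs_L2 f) = abs_L2 (schwartz_fourier f)"
proof -
  have eq: "schwartz_fourier (ball_cut n (rep_L2 (abs_L2 f))) = schwartz_fourier (ball_cut n f)" for n
  proof (rule schwartz_fourier_cong_AE)
    show "AE x in lborel. ball_cut n (rep_L2 (abs_L2 f)) x = ball_cut n f x"
      using rep_abs_L2[OF f(2)] by eventually_elim (simp add: ball_cut_def)
    show "ball_cut n (rep_L2 (abs_L2 f)) \<in> borel_measurable borel" "ball_cut n f \<in> borel_measurable borel"
      using cut_L1_L2(2)[of "rep_L2 (abs_L2 f)" n] cut_L1_L2(2)[OF f(2), of n] by measurable
  qed
  have "(\<lambda>n. dist (abs_L2 (ball_cut n f)) (abs_L2 f)) \<longlonglongrightarrow> 0"
    by (rule tendsto_dist_iff[THEN iffD1, OF cut_tendsto[OF f(2)]])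
  then have "(\<lambda>n. dist (abs_L2 (schwartz_fourier (ball_cut n f))) (abs_L2 (schwartz_fourier f))) \<longlonglongrightarrow> 0"
    by (rule Lim_null_comparison[rotated])
      (intro always_eventually allI, simp, intro schwartz_fourier_dist cut_L1_L2 f)
  then have "(\<lambda>n. abs_L2 (schwartz_fourier (ball_cut n f))) \<longlonglongrightarrow> abs_L2 (schwartz_fourier f)"
    by (rule tendsto_dist_iff[THEN iffD2])
  then show ?thesis
    using fourier_L2_lim[of "abs_L2 f"] unfolding eq by (rule LIMSEQ_unique[rotated])
qed

lemma fourier_L2_norm_le: "norm (fourier_L2 F) \<le> norm F"
proof (rule LIMSEQ_le[OF tendsto_norm[OF fourier_L2_lim]])
  show "(\<lambda>n. norm (abs_L2 (ball_cut n (rep_L2 F)))) \<longlonglongrightarrow> norm F"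
    using tendsto_norm[OF cut_tendsto[of "rep_L2 F"]] by simp
  show "\<exists>N. \<forall>n\<ge>N. norm (abs_L2 (schwartz_fourier (ball_cut n (rep_L2 F)))) \<le> norm (abs_L2 (ball_cut n (rep_L2 F)))"
    by (intro exI allI impI schwartz_fourier_contraction cut_L1_L2) simp_all
qed

lemma bounded_linear_fourier_L2: "bounded_linear fourier_L2"
proof (rule bounded_linear_intro[where K=1])
  fix F G :: "complex L2" and c :: real
  let ?r = "\<lambda>F n. schwartz_fourier (ball_cut n (rep_L2 F))"
  have m: "ball_cut n (rep_L2 F) \<in> borel_measurable borel" for n and F :: "complex L2"
  proof -
    have [measurable]: "ball 0 (real n) \<in> sets (borel :: (real^3) measure)" by simp
    show ?thesis unfolding ball_cut_def[abs_def] by measurable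
  qed
  have sq: "square_integrable (?r F n)" for F n
    by (intro schwartz_fourier_contraction cut_L1_L2) simp_all
  have "?r (F + G) n = (\<lambda>k. ?r F n k + ?r G n k)" for n
  proof -
    have "?r (F + G) n = schwartz_fourier (\<lambda>x. ball_cut n (rep_L2 F) x + ball_cut n (rep_L2 G) x)"
    proof (rule schwartz_fourier_cong_AE)
      show "AE x in lborel. ball_cut n (rep_L2 (F + G)) x = ball_cut n (rep_L2 F) x + ball_cut n (rep_L2 G) x"
        using rep_L2_add[of F G] by eventually_elim (simp add: ball_cut_def distrib_left)
    qed (use m in \<open>auto intro!: borel_measurable_add\<close>)
    also have "\<dots> = (\<lambda>k. ?r F n k + ?r G n k)"
      by (rule ext, rule schwartz_fourier_linear) (auto intro!: cut_L1_L2)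
    finally show ?thesis .
  qed
  then have "(\<lambda>n. abs_L2 (?r (F + G) n)) = (\<lambda>n. abs_L2 (?r F n) + abs_L2 (?r G n))"
    by (simp add: abs_L2_add sq)
  then show "fourier_L2 (F + G) = fourier_L2 F + fourier_L2 G"
    using fourier_L2_lim[of "F + G"] tendsto_add[OF fourier_L2_lim[of F] fourier_L2_lim[of G]]
    by (metis LIMSEQ_unique)
  have "?r (c *\<^sub>R F) n = (\<lambda>k. c *\<^sub>R ?r F n k)" for n
  proof -
    have "?r (c *\<^sub>R F) n = schwartz_fourier (\<lambda>x. of_real c * ball_cut n (rep_L2 F) x)"
    proof (rule schwartz_fourier_cong_AE)
      show "AE x in lborel. ball_cut n (rep_L2 (c *\<^sub>R F)) x = of_real c * ball_cut n (rep_L2 F) x"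
        using rep_L2_scaleR[of c F] by eventually_elim (simp add: ball_cut_def scaleR_conv_of_real)
    qed (use m in \<open>auto intro!: borel_measurable_times\<close>)
    also have "\<dots> = (\<lambda>k. c *\<^sub>R ?r F n k)"
      by (rule ext) (simp add: schwartz_fourier_cmult scaleR_conv_of_real)
    finally show ?thesis .
  qed
  then have "(\<lambda>n. abs_L2 (?r (c *\<^sub>R F) n)) = (\<lambda>n. c *\<^sub>R abs_L2 (?r F n))"
    by (simp add: abs_L2_scaleR sq)
  then show "fourier_L2 (c *\<^sub>R F) = c *\<^sub>R fourier_L2 F"
    using fourier_L2_lim[of "c *\<^sub>R F"] tendsto_scaleR[OF tendsto_const[of c] fourier_L2_lim[of F]]
    by (metis LIMSEQ_unique)
  show "norm (fourier_L2 F) \<le> norm F * 1" using fourier_L2_norm_le by simp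
qed

lemma integrable_mult_L2:
  fixes f g :: "real^3 \<Rightarrow> complex"
  assumes "square_integrable f" "square_integrable g"
  shows "integrable lborel (\<lambda>x. f x * g x)"
    "norm (LINT x|lborel. f x * g x) \<le> norm (abs_L2 f) * norm (abs_L2 g)"
proof -
  have [measurable]: "f \<in> borel_measurable borel" "g \<in> borel_measurable borel" using assms by measurable
  have nf: "square_integrable (\<lambda>x. norm (f x))" and ng: "square_integrable (\<lambda>x. norm (g x))"
    using assms by (auto simp: square_integrable_def)
  have I: "integrable lborel (\<lambda>x. norm (f x) * norm (g x))"
    using square_integrable_inner[OF nf ng] by simp
  show "integrable lborel (\<lambda>x. f x * g x)"
    by (rule Bochner_Integration.integrable_bound[OF I]) (auto simp: norm_mult)
  have "norm (LINT x|lborel. f x * g x) \<le> (LINT x|lborel. norm (f x) * norm (g x))"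
    using integral_norm_bound[of lborel "\<lambda>x. f x * g x"] by (simp add: norm_mult)
  also have "\<dots> = abs_L2 (\<lambda>x. norm (f x)) \<bullet> abs_L2 (\<lambda>x. norm (g x))"
    using inner_abs_L2[OF nf ng] by simp
  also have "\<dots> \<le> norm (abs_L2 (\<lambda>x. norm (f x))) * norm (abs_L2 (\<lambda>x. norm (g x)))"
    by (rule norm_cauchy_schwarz)
  also have "norm (abs_L2 (\<lambda>x. norm (f x))) = norm (abs_L2 f)"
    by (rule norm_abs_L2_eq[OF assms(1) nf]) simp
  also have "norm (abs_L2 (\<lambda>x. norm (g x))) = norm (abs_L2 g)"
    by (rule norm_abs_L2_eq[OF assms(2) ng]) simp
  finally show "norm (LINT x|lborel. f x * g x) \<le> norm (abs_L2 f) * norm (abs_L2 g)" .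
qed

lemma bounded_linear_L2_pairing:
  assumes g: "square_integrable g"
  shows "bounded_linear (\<lambda>F::complex L2. LINT x|lborel. rep_L2 F x * g x)"
proof (rule bounded_linear_intro[where K="norm (abs_L2 g)"])
  have [measurable]: "g \<in> borel_measurable borel" using g by measurable
  fix F G :: "complex L2" and c :: real
  have "(LINT x|lborel. rep_L2 (F + G) x * g x) = (LINT x|lborel. rep_L2 F x * g x + rep_L2 G x * g x)"
    by (rule integral_cong_AE, measurable)
      (use rep_L2_add[of F G] in \<open>eventually_elim, simp add: distrib_right\<close>)
  then show "(LINT x|lborel. rep_L2 (F + G) x * g x) =
      (LINT x|lborel. rep_L2 F x * g x) + (LINT x|lborel. rep_L2 G x * g x)"
    by (simp add: integrable_mult_L2 g)
  have "(LINT x|lborel. rep_L2 (c *\<^sub>R F) x * g x) = (LINT x|lborel. c *\<^sub>R (rep_L2 F x * g x))"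
    by (rule integral_cong_AE, measurable)
      (use rep_L2_scaleR[of c F] in \<open>eventually_elim, simp\<close>)
  then show "(LINT x|lborel. rep_L2 (c *\<^sub>R F) x * g x) = c *\<^sub>R (LINT x|lborel. rep_L2 F x * g x)"
    by simp
  show "norm (LINT x|lborel. rep_L2 F x * g x) \<le> norm F * norm (abs_L2 g)"
    using integrable_mult_L2(2)[OF _ g, of "rep_L2 F"] by simp
qed

text \<open>Both sides are bounded in \<open>F\<close>, since \<open>h\<close> and its transform are
  square integrable, so density extends the integrable case.\<close>

lemma fourier_L2_multiplication:
  assumes h: "integrable lborel h" "square_integrable h"
  shows "(LINT k|lborel. rep_L2 (fourier_L2 F) k * h k) = (LINT x|lborel. rep_L2 F x * schwartz_fourier h x)"
proof (rule bounded_linear_eqI_L1_L2[of "\<lambda>F. LINT k|lborel. rep_L2 (fourier_L2 F) k * h k"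
      "\<lambda>F. LINT x|lborel. rep_L2 F x * schwartz_fourier h x"])
  note sq = schwartz_fourier_contraction(1)[OF h]
  have [measurable]: "h \<in> borel_measurable borel" using h by measurable
  show "bounded_linear (\<lambda>F. LINT k|lborel. rep_L2 (fourier_L2 F) k * h k)"
    using bounded_linear_compose[OF bounded_linear_L2_pairing[OF h(2)] bounded_linear_fourier_L2] .
  show "bounded_linear (\<lambda>F. LINT x|lborel. rep_L2 F x * schwartz_fourier h x)"
    by (rule bounded_linear_L2_pairing[OF sq])
  fix f :: "real^3 \<Rightarrow> complex" assume f: "integrable lborel f" "square_integrable f"
  then have [measurable]: "f \<in> borel_measurable borel" by measurable
  have "(LINT k|lborel. rep_L2 (fourier_L2 (abs_L2 f)) k * h k) = (LINT k|lborel. schwartz_fourier f k * h k)"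
    unfolding fourier_L2_abs[OF f]
    by (rule integral_cong_AE, measurable)
      (use rep_abs_L2[OF schwartz_fourier_contraction(1)[OF f]] in \<open>eventually_elim, simp\<close>)
  also have "\<dots> = (LINT x|lborel. f x * schwartz_fourier h x)"
    by (rule schwartz_fourier_multiplication[OF f(1) h(1)])
  also have "\<dots> = (LINT x|lborel. rep_L2 (abs_L2 f) x * schwartz_fourier h x)"
    by (rule integral_cong_AE, measurable)
      (use rep_abs_L2[OF f(2)] in \<open>eventually_elim, simp\<close>)
  finally show "(LINT k|lborel. rep_L2 (fourier_L2 (abs_L2 f)) k * h k) =
      (LINT x|lborel. rep_L2 (abs_L2 f) x * schwartz_fourier h x)" .
qed

section \<open>Translations and reflections on \<open>L2\<close>\<close>

lemma AE_lborel_affine: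
  fixes P :: "'a::euclidean_space \<Rightarrow> bool"
  assumes P: "AE x in lborel. P x" and c: "c \<noteq> 0"
  shows "AE x in lborel. P (t + c *\<^sub>R x)"
proof -
  obtain N where N: "N \<in> null_sets lborel" "\<And>x. x \<notin> N \<Longrightarrow> P x"
    using P unfolding eventually_ae_filter by auto
  have [measurable]: "N \<in> sets borel" using N(1) by auto
  have "AE x in lborel. x \<notin> N" by (rule AE_not_in[OF N(1)])
  then have "AE x in lborel. t + c *\<^sub>R x \<notin> N"
    using c by (subst (asm) lborel_affine[OF c, of t]) (simp add: AE_density AE_distr_iff)
  then show ?thesis by eventually_elim (use N(2) in auto)
qed

text \<open>One family for translations, \<open>s = 1\<close>, and reflections,
  \<open>s = -1\<close>, both of which are isometries.\<close>

definition l2_affine :: "real \<Rightarrow> real^3 \<Rightarrow> 'a::euclidean_space L2 \<Rightarrow> 'a L2" where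
  "l2_affine s h F = abs_L2 (\<lambda>x. rep_L2 F (h + s *\<^sub>R x))"

lemma square_integrable_affine:
  assumes f: "square_integrable f" and s: "s \<noteq> 0"
  shows "square_integrable (\<lambda>x. f (h + s *\<^sub>R x))"
proof -
  have [measurable]: "f \<in> borel_measurable borel" using f by measurable
  show ?thesis
    using f lborel_integral_affine(1)[OF s, of "\<lambda>x. (norm (f x))\<^sup>2" h] by (simp add: square_integrable_def)
qed

lemma l2_affine_abs:
  assumes f: "square_integrable f" and s: "s \<noteq> 0"
  shows "l2_affine s h (abs_L2 f) = abs_L2 (\<lambda>x. f (h + s *\<^sub>R x))"
  unfolding l2_affine_def
  by (intro abs_L2_eqI square_integrable_affine f s square_integrable_rep_L2
      AE_lborel_affine[OF rep_abs_L2[OF f] s])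

lemma rep_l2_affine:
  assumes "s \<noteq> 0"
  shows "AE x in lborel. rep_L2 (l2_affine s h F) x = rep_L2 F (h + s *\<^sub>R x)"
  unfolding l2_affine_def by (rule rep_abs_L2[OF square_integrable_affine]) (use assms in simp_all)

lemma norm_l2_affine:
  assumes "\<bar>s\<bar> = 1"
  shows "norm (l2_affine s h F) = norm F"
proof -
  have s: "s \<noteq> 0" using assms by auto
  have "(norm (l2_affine s h F))\<^sup>2 = (norm F)\<^sup>2"
    using lborel_integral_affine(2)[OF s, of "\<lambda>x. (norm (rep_L2 F x))\<^sup>2" h] assms
    by (simp add: l2_affine_def norm_abs_L2 square_integrable_affine s norm_L2_rep[of F])
  then show ?thesis by (rule power2_eq_imp_eq) simp_all
qed

lemma bounded_linear_l2_affine: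
  assumes s: "\<bar>s\<bar> = 1"
  shows "bounded_linear (l2_affine s h)"
proof (rule bounded_linear_intro[where K=1])
  have s0: "s \<noteq> 0" using s by auto
  show "l2_affine s h (F + G) = l2_affine s h F + l2_affine s h G" for F G
  proof -
    have "abs_L2 (\<lambda>x. rep_L2 (F + G) (h + s *\<^sub>R x)) = abs_L2 (\<lambda>x. rep_L2 F (h + s *\<^sub>R x) + rep_L2 G (h + s *\<^sub>R x))"
      using AE_lborel_affine[OF rep_L2_add s0]
      by (intro abs_L2_eqI) (auto intro!: square_integrable_affine square_integrable_add s0)
    then show ?thesis
      by (simp add: l2_affine_def abs_L2_add square_integrable_affine s0)
  qed
  show "l2_affine s h (c *\<^sub>R F) = c *\<^sub>R l2_affine s h F" for c F
  proof -
    have "abs_L2 (\<lambda>x. rep_L2 (c *\<^sub>R F) (h + s *\<^sub>R x)) = abs_L2 (\<lambda>x. c *\<^sub>R rep_L2 F (h + s *\<^sub>R x))"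
      using AE_lborel_affine[OF rep_L2_scaleR s0]
      by (intro abs_L2_eqI) (auto intro!: square_integrable_affine square_integrable_scaleR s0)
    then show ?thesis
      by (simp add: l2_affine_def abs_L2_scaleR square_integrable_affine s0)
  qed
qed (simp add: norm_l2_affine s)

section \<open>Inversion and Plancherel's theorem\<close>

lemma gauss_test_unique_L2:
  fixes F G :: "complex L2"
  assumes "\<And>a p. a > 0 \<Longrightarrow> (LINT x|lborel. rep_L2 F x * of_real (gauss a p x)) =
    (LINT x|lborel. rep_L2 G x * of_real (gauss a p x))"
  shows "F = G"
proof -
  have "AE x in lborel. rep_L2 (F - G) x = 0"
  proof (rule gauss_test_unique)
    fix a :: real and p :: "real^3" assume a: "a > 0"
    note g = gauss_square_integrable[OF a, of p]
    show "integrable lborel (\<lambda>x. rep_L2 (F - G) x * of_real (gauss a p x))"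
      by (intro integrable_mult_L2 g) simp
    show "(LINT x|lborel. rep_L2 (F - G) x * of_real (gauss a p x)) = 0"
      using linear_diff[OF bounded_linear.linear[OF bounded_linear_L2_pairing[OF g]], of F G] assms[OF a]
      by simp
  qed
  then have "AE x in lborel. rep_L2 (F - G) x = rep_L2 0 x"
    using rep_L2_zero[where 'a=complex] by eventually_elim simp
  then have "F - G = 0" by (rule L2_eqI)
  then show ?thesis by simp
qed

text \<open>Two applications of the multiplication formula move both transforms onto a Gaussian,
  where the double transform is an explicit reflection; Gaussians separate the elements of
  \<open>L2\<close>.\<close>

lemma fourier_L2_fourier_L2: "fourier_L2 (fourier_L2 F) = l2_affine (-1) 0 F"
proof (rule gauss_test_unique_L2)
  fix a :: real and p :: "real^3" assume a: "a > 0"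
  let ?g = "\<lambda>x. complex_of_real (gauss a p x)"
  note g2 = gauss_square_integrable[OF a, of p]
  have g1: "integrable lborel ?g" using gauss_integral(1)[OF a] by (rule integrable_of_real)
  have h: "schwartz_fourier ?g = (\<lambda>k. cis (- (k \<bullet> p)) * (of_real ((2 * a) powr (-3/2)) * of_real (gauss (1 / (4 * a)) 0 k)))"
    using a by (auto simp: schwartz_fourier_gauss)
  have h1: "integrable lborel (schwartz_fourier ?g)"
    unfolding h using a gauss_integral(1)[of "1 / (4 * a)" 0] by simp
  have h2: "square_integrable (schwartz_fourier ?g)" by (rule schwartz_fourier_contraction(1)[OF g1 g2])
  have "(LINT x|lborel. rep_L2 (fourier_L2 (fourier_L2 F)) x * ?g x) =
      (LINT x|lborel. rep_L2 F x * schwartz_fourier (schwartz_fourier ?g) x)"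
    unfolding fourier_L2_multiplication[OF g1 g2] fourier_L2_multiplication[OF h1 h2] ..
  also have "\<dots> = (LINT x|lborel. rep_L2 F x * ?g (- x))"
    using a by (simp add: schwartz_fourier_schwartz_fourier_gauss)
  also have "\<dots> = (LINT x|lborel. rep_L2 F (- x) * ?g x)"
    using lborel_integral_reflect(2)[of "\<lambda>x. rep_L2 F x * ?g (- x)" 0] by simp
  finally have E: "(LINT x|lborel. rep_L2 (fourier_L2 (fourier_L2 F)) x * ?g x) = (LINT x|lborel. rep_L2 F (- x) * ?g x)" .
  have refl: "AE x in lborel. rep_L2 (l2_affine (-1) 0 F) x = rep_L2 F (- x)"
    using rep_l2_affine[of "-1" 0 F] by simp
  have "(LINT x|lborel. rep_L2 F (- x) * ?g x) = (LINT x|lborel. rep_L2 (l2_affine (-1) 0 F) x * ?g x)"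
  proof (rule integral_cong_AE)
    show "AE x in lborel. rep_L2 F (- x) * ?g x = rep_L2 (l2_affine (-1) 0 F) x * ?g x"
      using refl by eventually_elim simp
  qed measurable
  then show "(LINT x|lborel. rep_L2 (fourier_L2 (fourier_L2 F)) x * ?g x) =
      (LINT x|lborel. rep_L2 (l2_affine (-1) 0 F) x * ?g x)" using E by simp
qed

lemma l2_affine_reflect_reflect: "l2_affine (-1) 0 (l2_affine (-1) 0 F) = F"
  unfolding l2_affine_def[of _ _ F]
  by (subst l2_affine_abs) (auto intro: square_integrable_affine[of _ "-1" 0, simplified])

text \<open>Two transforms make a reflection, and a reflection is an involution. Hence three
  transforms are the inverse of one, and no separate inverse transform is introduced.\<close>

lemma fourier_L2_inverse: "fourier_L2 (fourier_L2 (fourier_L2 (fourier_L2 F))) = F"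
  by (simp add: fourier_L2_fourier_L2 l2_affine_reflect_reflect)

text \<open>A contraction whose fourth power is the identity cannot decrease any norm.\<close>

lemma fourier_L2_norm: "norm (fourier_L2 F) = norm F"
proof (rule antisym[OF fourier_L2_norm_le])
  show "norm F \<le> norm (fourier_L2 F)"
    using fourier_L2_norm_le[of "fourier_L2 F"] fourier_L2_norm_le[of "fourier_L2 (fourier_L2 F)"]
      fourier_L2_norm_le[of "fourier_L2 (fourier_L2 (fourier_L2 F))"]
    by (simp add: fourier_L2_inverse)
qed

lemma fourier_L2_inj: "fourier_L2 F = fourier_L2 G \<longleftrightarrow> F = G"
  by (metis fourier_L2_inverse)

section \<open>Translation, reflection and conjugation under the Fourier transform\<close>

lemma bounded_symbol_mult:
  assumes [measurable]: "m \<in> borel_measurable borel" and "\<And>k. norm (m k) \<le> C"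
  shows "bounded_symbol (\<lambda>k w::complex. m k * w) C"
proof (rule bounded_symbolI)
  show "linear ((*) (m k))" for k by (simp add: linear_times)
  show "norm (m k * w) \<le> C * norm w" for k w
    using assms(2)[of k] by (simp add: norm_mult mult_right_mono)
qed measurable

lemma bounded_symbol_cnj: "bounded_symbol (\<lambda>k. cnj) 1"
  by (rule bounded_symbolI) (auto intro: bounded_linear.linear[OF bounded_linear_cnj])

lemma fourier_L2_translate:
  "fourier_L2 (l2_affine 1 (- h) F) = l2_mult (\<lambda>k w. cis (- (k \<bullet> h)) * w) (fourier_L2 F)"
proof (rule bounded_linear_eqI_L1_L2[of "\<lambda>F. fourier_L2 (l2_affine 1 (- h) F)"])
  have s: "bounded_symbol (\<lambda>k w. cis (- (k \<bullet> h)) * w) 1"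
    by (rule bounded_symbol_mult) auto
  show "bounded_linear (\<lambda>F. fourier_L2 (l2_affine 1 (- h) F))"
    by (intro bounded_linear_compose[OF bounded_linear_fourier_L2] bounded_linear_l2_affine) simp
  show "bounded_linear (\<lambda>F. l2_mult (\<lambda>k w. cis (- (k \<bullet> h)) * w) (fourier_L2 F))"
    by (intro bounded_linear_compose[OF bounded_linear_l2_mult[OF s]] bounded_linear_fourier_L2)
  fix f :: "real^3 \<Rightarrow> complex" assume f: "integrable lborel f" "square_integrable f"
  have "l2_affine 1 (- h) (abs_L2 f) = abs_L2 (\<lambda>x. f (x - h))"
    by (simp add: l2_affine_abs f)
  moreover have "integrable lborel (\<lambda>x. f (x - h))" "square_integrable (\<lambda>x. f (x - h))"
    using lborel_integral_translate(1)[of f "- h"] square_integrable_affine[OF f(2), of 1 "- h"] f by simp_all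
  ultimately show "fourier_L2 (l2_affine 1 (- h) (abs_L2 f)) =
      l2_mult (\<lambda>k w. cis (- (k \<bullet> h)) * w) (fourier_L2 (abs_L2 f))"
    by (simp add: fourier_L2_abs f l2_mult_abs[OF s] schwartz_fourier_contraction(1) schwartz_fourier_translate[abs_def])
qed

lemma fourier_L2_reflect: "fourier_L2 (l2_affine (-1) 0 F) = l2_affine (-1) 0 (fourier_L2 F)"
  by (simp flip: fourier_L2_fourier_L2)

text \<open>The source of the hermitian symmetry that characterises transforms of real
  functions.\<close>

lemma fourier_L2_cnj:
  "fourier_L2 (l2_mult (\<lambda>_. cnj) F) = l2_mult (\<lambda>_. cnj) (l2_affine (-1) 0 (fourier_L2 F))"
proof (rule bounded_linear_eqI_L1_L2[of "\<lambda>F. fourier_L2 (l2_mult (\<lambda>_. cnj) F)"])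
  note s = bounded_symbol_cnj
  show "bounded_linear (\<lambda>F. fourier_L2 (l2_mult (\<lambda>_. cnj) F))"
    by (intro bounded_linear_compose[OF bounded_linear_fourier_L2] bounded_linear_l2_mult[OF s])
  show "bounded_linear (\<lambda>F. l2_mult (\<lambda>_. cnj) (l2_affine (-1) 0 (fourier_L2 F)))"
    by (intro bounded_linear_compose[OF bounded_linear_l2_mult[OF s]]
        bounded_linear_compose[OF bounded_linear_l2_affine] bounded_linear_fourier_L2) simp
  fix f :: "real^3 \<Rightarrow> complex" assume f: "integrable lborel f" "square_integrable f"
  have c: "integrable lborel (\<lambda>x. cnj (f x))" "square_integrable (\<lambda>x. cnj (f x))"
    using f square_integrable_mult[OF s f(2)] by auto
  have r: "square_integrable (\<lambda>x. schwartz_fourier f (- x))"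
    using square_integrable_affine[OF schwartz_fourier_contraction(1)[OF f], of "-1" 0] by simp
  have "fourier_L2 (l2_mult (\<lambda>_. cnj) (abs_L2 f)) = abs_L2 (\<lambda>k. cnj (schwartz_fourier f (- k)))"
    by (simp add: l2_mult_abs[OF s] f fourier_L2_abs[OF c] schwartz_fourier_cnj[abs_def])
  moreover have "l2_affine (-1) 0 (fourier_L2 (abs_L2 f)) = abs_L2 (\<lambda>k. schwartz_fourier f (- k))"
    by (simp add: l2_affine_abs fourier_L2_abs f schwartz_fourier_contraction(1))
  ultimately show "fourier_L2 (l2_mult (\<lambda>_. cnj) (abs_L2 f)) =
      l2_mult (\<lambda>_. cnj) (l2_affine (-1) 0 (fourier_L2 (abs_L2 f)))"
    by (simp add: l2_mult_abs[OF s] r)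
qed

section \<open>Schwartz functions\<close>

text \<open>Complex polynomials in the coordinates, given by closure rules: induction then yields at
  once that derivatives stay in the class and that growth is polynomial.\<close>

inductive coord_poly :: "(real^3 \<Rightarrow> complex) \<Rightarrow> bool" where
  const: "coord_poly (\<lambda>x. c)"
| coord: "coord_poly (\<lambda>x. of_real (x $ i))"
| add: "coord_poly f \<Longrightarrow> coord_poly g \<Longrightarrow> coord_poly (\<lambda>x. f x + g x)"
| mult: "coord_poly f \<Longrightarrow> coord_poly g \<Longrightarrow> coord_poly (\<lambda>x. f x * g x)"

lemma coord_poly_has_derivative:
  assumes "coord_poly f"
  shows "\<exists>f'. (\<forall>i. coord_poly (f' i)) \<and>
    (\<forall>x. (f has_derivative (\<lambda>h. \<Sum>i\<in>UNIV. of_real (h $ i) * f' i x)) (at x))"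
  using assms
proof induction
  case (const c)
  show ?case
    by (rule exI[of _ "\<lambda>i x. 0"]) (auto intro: coord_poly.const)
next
  case (coord i)
  have "((\<lambda>x. complex_of_real (x $ i)) has_derivative (\<lambda>h. of_real (h $ i))) (at x)" for x :: "real^3"
    by (rule bounded_linear_imp_has_derivative)
      (rule bounded_linear_compose[OF bounded_linear_of_real bounded_linear_vec_nth])
  moreover have "(\<Sum>j\<in>UNIV. complex_of_real (h $ j) * (if j = i then 1 else 0)) = of_real (h $ i)" for h :: "real^3"
    by (simp add: if_distrib cong: if_cong)
  ultimately show ?case
    by (intro exI[of _ "\<lambda>j x. if j = i then 1 else 0"]) (simp add: coord_poly.const)
next
  case (add f g)
  then obtain f' g' where f: "\<forall>i. coord_poly (f' i)"
      "\<forall>x. (f has_derivative (\<lambda>h. \<Sum>i\<in>UNIV. of_real (h $ i) * f' i x)) (at x)"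
    and g: "\<forall>i. coord_poly (g' i)"
      "\<forall>x. (g has_derivative (\<lambda>h. \<Sum>i\<in>UNIV. of_real (h $ i) * g' i x)) (at x)" by blast
  show ?case
  proof (intro exI[of _ "\<lambda>i x. f' i x + g' i x"] conjI allI)
    show "coord_poly (\<lambda>x. f' i x + g' i x)" for i using f g by (intro coord_poly.add) auto
    show "((\<lambda>x. f x + g x) has_derivative (\<lambda>h. \<Sum>i\<in>UNIV. of_real (h $ i) * (f' i x + g' i x))) (at x)" for x
      using has_derivative_add[OF f(2)[rule_format, of x] g(2)[rule_format, of x]]
      by (simp add: distrib_left sum.distrib)
  qed
next
  case (mult f g)
  then obtain f' g' where f: "\<forall>i. coord_poly (f' i)"
      "\<forall>x. (f has_derivative (\<lambda>h. \<Sum>i\<in>UNIV. of_real (h $ i) * f' i x)) (at x)"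
    and g: "\<forall>i. coord_poly (g' i)"
      "\<forall>x. (g has_derivative (\<lambda>h. \<Sum>i\<in>UNIV. of_real (h $ i) * g' i x)) (at x)" by blast
  show ?case
  proof (intro exI[of _ "\<lambda>i x. f x * g' i x + f' i x * g x"] conjI allI)
    show "coord_poly (\<lambda>x. f x * g' i x + f' i x * g x)" for i
      using f g mult by (intro coord_poly.add coord_poly.mult) auto
    show "((\<lambda>x. f x * g x) has_derivative (\<lambda>h. \<Sum>i\<in>UNIV. of_real (h $ i) * (f x * g' i x + f' i x * g x))) (at x)" for x
      by (rule has_derivative_eq_rhs[OF has_derivative_mult[OF f(2)[rule_format, of x] g(2)[rule_format, of x]]])
        (auto simp: distrib_left sum.distrib sum_distrib_left sum_distrib_right mult_ac)
  qed
qed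

lemma coord_poly_growth:
  assumes "coord_poly f"
  shows "\<exists>C m. C \<ge> 0 \<and> (\<forall>x. norm (f x) \<le> C * (1 + norm x) ^ m)"
  using assms
proof induction
  case (const c)
  show ?case by (intro exI[of _ "norm c"] exI[of _ 0]) simp
next
  case (coord i)
  have "norm (complex_of_real (x $ i)) \<le> 1 * (1 + norm x) ^ 1" for x :: "real^3"
    using component_le_norm_cart[of x i] by simp
  then show ?case by (intro exI[of _ 1]) auto
next
  case (add f g)
  then obtain C m D n where C: "C \<ge> 0" "\<And>x. norm (f x) \<le> C * (1 + norm x) ^ m"
    and D: "D \<ge> 0" "\<And>x. norm (g x) \<le> D * (1 + norm x) ^ n" by blast
  have "norm (f x + g x) \<le> (C + D) * (1 + norm x) ^ (m + n)" for x
  proof -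
    have "norm (f x) \<le> C * (1 + norm x) ^ (m + n)"
      by (rule order_trans[OF C(2)]) (intro mult_left_mono power_increasing C, auto)
    moreover have "norm (g x) \<le> D * (1 + norm x) ^ (m + n)"
      by (rule order_trans[OF D(2)]) (intro mult_left_mono power_increasing D, auto)
    ultimately show ?thesis
      using norm_triangle_ineq[of "f x" "g x"] by (simp add: distrib_right)
  qed
  then show ?case using C D by (intro exI[of _ "C + D"] exI[of _ "m + n"]) auto
next
  case (mult f g)
  then obtain C m D n where C: "C \<ge> 0" "\<And>x. norm (f x) \<le> C * (1 + norm x) ^ m"
    and D: "D \<ge> 0" "\<And>x. norm (g x) \<le> D * (1 + norm x) ^ n" by blast
  have "norm (f x * g x) \<le> (C * D) * (1 + norm x) ^ (m + n)" for x
  proof -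
    have "norm (f x) * norm (g x) \<le> (C * (1 + norm x) ^ m) * (D * (1 + norm x) ^ n)"
      using C D by (intro mult_mono) auto
    then show ?thesis by (simp add: norm_mult power_add mult_ac)
  qed
  then show ?case using C D by (intro exI[of _ "C * D"] exI[of _ "m + n"]) auto
qed

lemma power_le_fact_exp:
  fixes y :: real assumes "y \<ge> 0" shows "y ^ N \<le> fact N * exp y"
proof -
  have "(\<Sum>n\<in>{N}. y ^ n /\<^sub>R fact n) \<le> (\<Sum>n. y ^ n /\<^sub>R fact n)"
    by (rule sum_le_suminf) (use assms summable_exp[of y] in auto)
  then show ?thesis by (simp add: exp_def field_simps)
qed

lemma gauss_decay:
  assumes a: "a > 0"
  shows "\<exists>C. \<forall>x. (1 + norm x) ^ N * gauss a p x \<le> C"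
proof (intro exI allI)
  fix x
  define t where "t = norm (x - p)"
  have t: "t \<ge> 0" by (simp add: t_def)
  have "norm x \<le> t + norm p" using norm_triangle_ineq[of "x - p" p] by (simp add: t_def)
  moreover have "0 \<le> norm p * t" using t by simp
  ultimately have "1 + norm x \<le> (1 + norm p) * (1 + t)" by (simp add: algebra_simps)
  then have "(1 + norm x) ^ N \<le> (1 + norm p) ^ N * (1 + t) ^ N"
    by (metis add_nonneg_nonneg norm_ge_zero power_mono power_mult_distrib zero_le_one)
  also have "\<dots> \<le> (1 + norm p) ^ N * (fact N * exp (1 + t))"
    using t by (intro mult_left_mono power_le_fact_exp) auto
  finally have "(1 + norm x) ^ N * gauss a p x \<le> (1 + norm p) ^ N * (fact N * exp (1 + t)) * gauss a p x"
    by (intro mult_right_mono) auto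
  also have "\<dots> = (1 + norm p) ^ N * fact N * exp (1 + t - a * t\<^sup>2)"
  proof -
    have "exp (1 + t - a * t\<^sup>2) = exp (1 + t) * gauss a p x" by (simp add: gauss_def t_def flip: exp_add)
    then show ?thesis by simp
  qed
  also have "\<dots> \<le> (1 + norm p) ^ N * fact N * exp (1 + 1 / (4 * a))"
  proof -
    \<comment> \<open>The maximum of the parabola, attained at
      \<open>t = 1 / (2 * a)\<close>.\<close>
    have "t - a * t\<^sup>2 \<le> 1 / (4 * a)"
    proof -
      have "0 \<le> (2 * a * t - 1)\<^sup>2" by simp
      then have "4 * a * (t - a * t\<^sup>2) \<le> 1" by (simp add: power2_eq_square algebra_simps)
      then show ?thesis using a by (simp add: field_simps)
    qed
    then show ?thesis by (intro mult_left_mono) auto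
  qed
  finally show "(1 + norm x) ^ N * gauss a p x \<le> (1 + norm p) ^ N * fact N * exp (1 + 1 / (4 * a))" .
qed

lemma frechet_derivative_sum_axis:
  assumes "(f has_derivative (\<lambda>h. \<Sum>i\<in>UNIV. of_real (h $ i) * (f' i :: complex))) (at x)"
  shows "pderiv_at j f x = f' j"
proof -
  have "pderiv_at j f x = (\<Sum>i\<in>UNIV. of_real (axis j 1 $ i) * f' i)"
    by (simp add: pderiv_at_def frechet_derivative_at[OF assms, symmetric])
  also have "\<dots> = (\<Sum>i\<in>UNIV. if i = j then f' i else 0)"
    by (intro sum.cong) (auto simp: axis_def)
  finally show ?thesis by simp
qed

lemma coord_poly_gauss_pderiv:
  assumes "coord_poly f"
  shows "\<exists>g. (\<forall>i. coord_poly (g i)) \<and>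
    (\<forall>x. ((\<lambda>x. f x * of_real (gauss a p x)) has_derivative
       (\<lambda>h. \<Sum>i\<in>UNIV. of_real (h $ i) * (g i x * of_real (gauss a p x)))) (at x))"
proof -
  obtain f' where f': "\<forall>i. coord_poly (f' i)"
      "\<forall>x. (f has_derivative (\<lambda>h. \<Sum>i\<in>UNIV. of_real (h $ i) * f' i x)) (at x)"
    using coord_poly_has_derivative[OF assms] by blast
  let ?g = "\<lambda>i x. f' i x + f x * (of_real (- (2 * a)) * (of_real (x $ i) + of_real (- (p $ i))))"
  have G: "((\<lambda>x. complex_of_real (gauss a p x)) has_derivative
      (\<lambda>h. of_real (gauss a p x * (- (a * (2 * ((x - p) \<bullet> h))))))) (at x)" for x
  proof -
    have 1: "gauss a p = (\<lambda>x. exp (- (a * ((x - p) \<bullet> (x - p)))))"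
      by (simp add: gauss_def fun_eq_iff power2_norm_eq_inner)
    have "(gauss a p has_derivative (\<lambda>h. gauss a p x * (- (a * (2 * ((x - p) \<bullet> h)))))) (at x)"
      unfolding 1 by (auto intro!: derivative_eq_intros simp: inner_commute)
    then show ?thesis by (rule has_derivative_of_real)
  qed
  show ?thesis
  proof (intro exI[of _ ?g] conjI allI)
    show "coord_poly (?g i)" for i using f' assms by (intro coord_poly.intros) auto
    show "((\<lambda>x. f x * of_real (gauss a p x)) has_derivative
       (\<lambda>h. \<Sum>i\<in>UNIV. of_real (h $ i) * (?g i x * of_real (gauss a p x)))) (at x)" for x
      by (rule has_derivative_eq_rhs[OF has_derivative_mult[OF f'(2)[rule_format, of x] G]])
        (auto simp: inner_vec_def sum_3 algebra_simps)
  qed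
qed

lemma iter_pderiv_gauss:
  assumes "coord_poly f"
  shows "\<exists>g. coord_poly g \<and> iter_pderiv is (\<lambda>x. f x * of_real (gauss a p x)) = (\<lambda>x. g x * of_real (gauss a p x))"
proof (induction "is")
  case Nil
  then show ?case using assms by auto
next
  case (Cons i "is")
  then obtain g where g: "coord_poly g"
    "iter_pderiv is (\<lambda>x. f x * of_real (gauss a p x)) = (\<lambda>x. g x * of_real (gauss a p x))" by blast
  obtain g' where g': "\<forall>i. coord_poly (g' i)"
    "\<forall>x. ((\<lambda>x. g x * of_real (gauss a p x)) has_derivative
       (\<lambda>h. \<Sum>i\<in>UNIV. of_real (h $ i) * (g' i x * of_real (gauss a p x)))) (at x)"
    using coord_poly_gauss_pderiv[OF g(1)] by blast
  have "iter_pderiv (i # is) (\<lambda>x. f x * of_real (gauss a p x)) = (\<lambda>x. g' i x * of_real (gauss a p x))"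
    using frechet_derivative_sum_axis[OF g'(2)[rule_format]] by (simp add: g(2) fun_eq_iff)
  then show ?case using g'(1) by blast
qed

text \<open>\<open>has_fourier\<close> is tested on Schwartz functions only; this makes Gaussians
  admissible tests, so that uniqueness of transforms becomes available. Every derivative is a
  polynomial times the same Gaussian, which absorbs any polynomial growth.\<close>

lemma schwartz_gauss:
  assumes a: "a > 0"
  shows "schwartz (\<lambda>x. of_real (gauss a p x))"
  unfolding schwartz_def smooth_def
proof (intro conjI allI)
  have it: "\<exists>g. coord_poly g \<and> iter_pderiv is (\<lambda>x. of_real (gauss a p x)) = (\<lambda>x. g x * of_real (gauss a p x))" for "is"
    using iter_pderiv_gauss[OF coord_poly.const[of 1], of "is" a p] by simp
  fix "is"
  obtain g where g: "coord_poly g"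
    "iter_pderiv is (\<lambda>x. complex_of_real (gauss a p x)) = (\<lambda>x. g x * of_real (gauss a p x))"
    using it by blast
  show "iter_pderiv is (\<lambda>x. complex_of_real (gauss a p x)) differentiable (at x)" for x
    unfolding g(2) using coord_poly_gauss_pderiv[OF g(1), of a p] by (auto simp: differentiable_def)
  fix n
  obtain C m where C: "C \<ge> 0" "\<And>x. norm (g x) \<le> C * (1 + norm x) ^ m"
    using coord_poly_growth[OF g(1)] by blast
  obtain D where D: "\<And>x. (1 + norm x) ^ (n + m) * gauss a p x \<le> D"
    using gauss_decay[OF a] by blast
  have "(1 + norm x) ^ n * norm (g x * of_real (gauss a p x)) \<le> C * D" for x
  proof -
    have "(1 + norm x) ^ n * norm (g x * of_real (gauss a p x)) =
        (1 + norm x) ^ n * gauss a p x * norm (g x)"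
      by (simp add: norm_mult less_imp_le)
    also have "\<dots> \<le> (1 + norm x) ^ n * gauss a p x * (C * (1 + norm x) ^ m)"
      by (intro mult_left_mono C) (auto simp: less_imp_le)
    also have "\<dots> = C * ((1 + norm x) ^ (n + m) * gauss a p x)" by (simp add: power_add mult_ac)
    also have "\<dots> \<le> C * D" by (intro mult_left_mono D C)
    finally show ?thesis .
  qed
  then show "\<exists>C. \<forall>x. (1 + norm x) ^ n * norm (iter_pderiv is (\<lambda>x. complex_of_real (gauss a p x)) x) \<le> C"
    unfolding g(2) by blast
qed

section \<open>Integrability and decay of Schwartz functions\<close>

lemma schwartz_differentiable: "schwartz \<phi> \<Longrightarrow> iter_pderiv is \<phi> differentiable (at x)"
  by (simp add: schwartz_def smooth_def)

lemma schwartz_iter_pderiv_measurable: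
  assumes "schwartz \<phi>" shows "iter_pderiv is \<phi> \<in> borel_measurable borel"
  using schwartz_differentiable[OF assms]
  by (intro borel_measurable_continuous_onI continuous_at_imp_continuous_on ballI differentiable_imp_continuous_within) auto

text \<open>There are finitely many index lists of bounded length and each supremum is over a
  bounded set, so the sum and the suprema in the seminorm have their intended values and dominate
  each single term.\<close>

lemma schwartz_seminorm_bound:
  assumes \<phi>: "schwartz \<phi>" and l: "length is \<le> n"
  shows "(1 + norm x) ^ n * norm (iter_pderiv is \<phi> x) \<le> schwartz_seminorm n \<phi>"
proof -
  let ?s = "\<lambda>is. SUP x. (1 + norm x) ^ n * norm (iter_pderiv is \<phi> x)"
  have bdd: "bdd_above (range (\<lambda>x. (1 + norm x) ^ n * norm (iter_pderiv is \<phi> x)))" for "is"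
    using \<phi> by (force simp: schwartz_def bdd_above_def)
  have le: "(1 + norm x) ^ n * norm (iter_pderiv is \<phi> x) \<le> ?s is" for x "is"
    by (rule cSUP_upper[OF _ bdd]) simp
  have "0 \<le> ?s is" for "is"
    by (rule order_trans[OF _ le[of 0]]) simp
  moreover have "finite {is :: 3 list. length is \<le> n}"
    using finite_lists_length_le[of "UNIV :: 3 set" n] by simp
  ultimately have "?s is \<le> schwartz_seminorm n \<phi>"
    unfolding schwartz_seminorm_def using l by (intro member_le_sum) auto
  then show ?thesis using le[of x "is"] by linarith
qed

text \<open>The exponent 6 is two for each coordinate: the sixth power of \<open>1 + norm x\<close>
  dominates the product of the three factors \<open>1 + (x \<bullet> b)^2\<close>, whose reciprocals
  are integrable on the line.\<close>

lemma integrable_decay_3: "integrable lborel (\<lambda>x::real^3. 1 / (1 + norm x) ^ 6)"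
proof -
  have 1: "integrable lborel (\<lambda>y::real. complex_of_real (1 / (1 + y\<^sup>2)))"
  proof -
    have "integrable lborel (\<lambda>y::real. 1 / (1 + y\<^sup>2))"
      using integrable_inverse_1_plus_square by (simp add: set_integrable_def inverse_eq_divide)
    then show ?thesis by (rule integrable_of_real)
  qed
  have "integrable lborel (\<lambda>x::real^3. \<Prod>b\<in>Basis. complex_of_real (1 / (1 + (x \<bullet> b)\<^sup>2)))"
    by (rule lborel_integral_prod(1)[OF 1])
  then show ?thesis
  proof (rule Bochner_Integration.integrable_bound)
    show "AE x in lborel. norm (1 / (1 + norm (x::real^3)) ^ 6) \<le> norm (\<Prod>b\<in>Basis. complex_of_real (1 / (1 + (x \<bullet> b)\<^sup>2)))"
    proof (rule AE_I2)
      fix x :: "real^3"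
      have "1 / (1 + norm x) ^ 6 = (\<Prod>b\<in>(Basis :: (real^3) set). 1 / (1 + norm x)\<^sup>2)"
        by (simp add: power_divide flip: power_mult)
      also have "\<dots> \<le> (\<Prod>b\<in>Basis. 1 / (1 + (x \<bullet> b)\<^sup>2))"
      proof (intro prod_mono conjI)
        fix b :: "real^3" assume "b \<in> Basis"
        then have "(x \<bullet> b)\<^sup>2 \<le> (norm x)\<^sup>2" using Basis_le_norm[of b x] by (metis abs_norm_cancel abs_le_square_iff)
        also have "\<dots> \<le> (1 + norm x)\<^sup>2 - 1" by (simp add: power2_eq_square algebra_simps)
        finally show "1 / (1 + norm x)\<^sup>2 \<le> 1 / (1 + (x \<bullet> b)\<^sup>2)"
          by (intro divide_left_mono mult_pos_pos zero_less_power add_pos_nonneg) (auto intro: add_pos_nonneg)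
      qed auto
      also have "\<dots> \<le> norm (\<Prod>b\<in>Basis. complex_of_real (1 / (1 + (x \<bullet> b)\<^sup>2)))"
        by (simp only: of_real_prod[symmetric] norm_of_real abs_ge_self)
      finally show "norm (1 / (1 + norm (x::real^3)) ^ 6) \<le> norm (\<Prod>b\<in>Basis. complex_of_real (1 / (1 + (x \<bullet> b)\<^sup>2)))"
        by simp
    qed
  qed measurable
qed

text \<open>The third conclusion is the quantitative one: it bounds an \<open>L2\<close> norm by a
  seminorm, from which temperedness of square integrable functions follows. For the square one of
  the two decay factors is simply bounded by 1.\<close>

lemma decay_integrable:
  fixes f :: "real^3 \<Rightarrow> 'b::euclidean_space"
  assumes m [measurable]: "f \<in> borel_measurable borel" and b: "\<And>x. (1 + norm x) ^ 6 * norm (f x) \<le> C"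
  shows "integrable lborel f" "square_integrable f"
    "norm (abs_L2 f) \<le> sqrt (LINT x|(lborel :: (real^3) measure). 1 / (1 + norm x) ^ 6) * C"
proof -
  have C: "C \<ge> 0" by (rule order_trans[OF _ b[of 0]]) simp
  have le: "norm (f x) \<le> C * (1 / (1 + norm x) ^ 6)" for x
  proof -
    have "0 < (1 + norm x) ^ 6" by (intro zero_less_power add_pos_nonneg) auto
    then show ?thesis using b[of x] by (simp add: pos_le_divide_eq mult.commute)
  qed
  have I: "integrable lborel (\<lambda>x::real^3. C * (1 / (1 + norm x) ^ 6))"
    by (rule integrable_mult_right[OF integrable_decay_3])
  show "integrable lborel f"
    by (rule Bochner_Integration.integrable_bound[OF I]) (use le C in auto)
  have le2: "(norm (f x))\<^sup>2 \<le> C\<^sup>2 * (1 / (1 + norm x) ^ 6)" for x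
  proof -
    have "(norm (f x))\<^sup>2 \<le> (C * (1 / (1 + norm x) ^ 6))\<^sup>2" using le by (intro power_mono) auto
    also have "\<dots> = C\<^sup>2 * ((1 / (1 + norm x) ^ 6) * (1 / (1 + norm x) ^ 6))"
      by (simp add: power2_eq_square)
    also have "\<dots> \<le> C\<^sup>2 * ((1 / (1 + norm x) ^ 6) * 1)"
    proof (intro mult_left_mono)
      have "1 \<le> (1 + norm x) ^ 6" by (intro one_le_power) simp
      moreover have "0 < (1 + norm x) ^ 6" by (intro zero_less_power add_pos_nonneg) auto
      ultimately show "1 / (1 + norm x) ^ 6 \<le> 1" by (simp only: divide_le_eq_1_pos)
    qed auto
    finally show ?thesis by simp
  qed
  have I2: "integrable lborel (\<lambda>x::real^3. C\<^sup>2 * (1 / (1 + norm x) ^ 6))"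
    by (rule integrable_mult_right[OF integrable_decay_3])
  have i2: "integrable lborel (\<lambda>x. (norm (f x))\<^sup>2)"
    by (rule Bochner_Integration.integrable_bound[OF I2]) (use le2 in auto)
  then show sq: "square_integrable f" by (simp add: square_integrable_def)
  have "(norm (abs_L2 f))\<^sup>2 \<le> (LINT x|lborel. C\<^sup>2 * (1 / (1 + norm (x::real^3)) ^ 6))"
    unfolding norm_abs_L2[OF sq] by (intro integral_mono i2 I2 le2)
  also have "\<dots> = C\<^sup>2 * (LINT x|lborel. 1 / (1 + norm (x::real^3)) ^ 6)" by (rule integral_mult_right_zero)
  finally have "sqrt ((norm (abs_L2 f))\<^sup>2) \<le> sqrt (C\<^sup>2 * (LINT x|lborel. 1 / (1 + norm (x::real^3)) ^ 6))"
    by (rule real_sqrt_le_mono)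
  then show "norm (abs_L2 f) \<le> sqrt (LINT x|(lborel :: (real^3) measure). 1 / (1 + norm x) ^ 6) * C"
    using C by (simp add: real_sqrt_mult mult.commute)
qed

lemma schwartz_L1_L2:
  assumes "schwartz \<phi>"
  shows "integrable lborel (iter_pderiv is \<phi>)" "square_integrable (iter_pderiv is \<phi>)"
proof -
  obtain C where "\<And>x. (1 + norm x) ^ 6 * norm (iter_pderiv is \<phi> x) \<le> C"
    using assms unfolding schwartz_def by blast
  then show "integrable lborel (iter_pderiv is \<phi>)" "square_integrable (iter_pderiv is \<phi>)"
    using decay_integrable schwartz_iter_pderiv_measurable[OF assms] by blast+
qed

lemma schwartz_power_mult_L1_L2:
  assumes "schwartz \<phi>" and [measurable]: "m \<in> borel_measurable borel"
    and m: "\<And>x. norm (m x) \<le> (1 + norm x) ^ n"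
  shows "integrable lborel (\<lambda>x. m x * \<phi> x)" "square_integrable (\<lambda>x. m x * \<phi> x)"
proof -
  have [measurable]: "\<phi> \<in> borel_measurable borel"
    using schwartz_iter_pderiv_measurable[OF assms(1), of "[]"] by simp
  obtain C where C: "\<And>x. (1 + norm x) ^ (6 + n) * norm (\<phi> x) \<le> C"
    using assms(1) unfolding schwartz_def by (metis iter_pderiv.simps(1))
  have "(1 + norm x) ^ 6 * norm (m x * \<phi> x) \<le> C" for x
  proof -
    have "(1 + norm x) ^ 6 * norm (m x * \<phi> x) = norm (m x) * ((1 + norm x) ^ 6 * norm (\<phi> x))"
      by (simp add: norm_mult)
    also have "\<dots> \<le> (1 + norm x) ^ n * ((1 + norm x) ^ 6 * norm (\<phi> x))"
      by (intro mult_right_mono m) auto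
    also have "\<dots> \<le> C" using C[of x] by (simp add: power_add mult_ac)
    finally show ?thesis .
  qed
  note d = decay_integrable[OF _ this]
  show "integrable lborel (\<lambda>x. m x * \<phi> x)" "square_integrable (\<lambda>x. m x * \<phi> x)"
    by (rule d(1), measurable) (rule d(2), measurable)
qed

lemma pderiv_at_linear:
  fixes \<phi> \<psi> :: "real^3 \<Rightarrow> complex"
  assumes "\<phi> differentiable (at x)" "\<psi> differentiable (at x)"
  shows "pderiv_at i (\<lambda>x. a * \<phi> x + b * \<psi> x) x = a * pderiv_at i \<phi> x + b * pderiv_at i \<psi> x"
proof -
  have "((\<lambda>x. a * \<phi> x + b * \<psi> x) has_derivative
      (\<lambda>h. a * frechet_derivative \<phi> (at x) h + b * frechet_derivative \<psi> (at x) h)) (at x)"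
    using assms by (auto intro!: derivative_eq_intros simp: frechet_derivative_works)
  from frechet_derivative_at[OF this] show ?thesis by (simp add: pderiv_at_def fun_eq_iff)
qed

section \<open>Sobolev norms of distributions with square integrable transform\<close>

lemma square_integrable_of_real:
  assumes "square_integrable f" shows "square_integrable (\<lambda>x. complex_of_real (f x))"
proof -
  have [measurable]: "f \<in> borel_measurable borel" using assms by measurable
  show ?thesis using assms by (simp add: square_integrable_def)
qed

text \<open>Cauchy-Schwarz against the decay bound, whence the seminorm of order 6. Lists of length
  at most 1 cover functions and their first distributional derivatives, which is all that a curl
  requires.\<close>

lemma tempered_L2_pairing:
  fixes f :: "real^3 \<Rightarrow> real"
  assumes f: "square_integrable f" and l: "length is \<le> 1"
  shows "tempered (\<lambda>\<phi>. LINT x|lborel. of_real (f x) * iter_pderiv is \<phi> x)"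
  unfolding tempered_def
proof (intro conjI allI impI)
  have fc: "square_integrable (\<lambda>x. complex_of_real (f x))" by (rule square_integrable_of_real[OF f])
  fix \<phi> \<psi> and a b :: complex assume s: "schwartz \<phi>" "schwartz \<psi>"
  have lin: "iter_pderiv is (\<lambda>x. a * \<phi> x + b * \<psi> x) x = a * iter_pderiv is \<phi> x + b * iter_pderiv is \<psi> x" for x
    using l pderiv_at_linear[of \<phi> x \<psi>] schwartz_differentiable[OF s(1), of "[]"] schwartz_differentiable[OF s(2), of "[]"]
    by (cases "is") auto
  have "(LINT x|lborel. of_real (f x) * iter_pderiv is (\<lambda>x. a * \<phi> x + b * \<psi> x) x) =
      (LINT x|lborel. a * (of_real (f x) * iter_pderiv is \<phi> x) + b * (of_real (f x) * iter_pderiv is \<psi> x))"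
    unfolding lin by (simp add: algebra_simps)
  also have "\<dots> = (LINT x|lborel. a * (of_real (f x) * iter_pderiv is \<phi> x)) + (LINT x|lborel. b * (of_real (f x) * iter_pderiv is \<psi> x))"
    by (intro Bochner_Integration.integral_add integrable_mult_right integrable_mult_L2(1)[OF fc] schwartz_L1_L2 s)
  finally show "(LINT x|lborel. of_real (f x) * iter_pderiv is (\<lambda>x. a * \<phi> x + b * \<psi> x) x) =
      a * (LINT x|lborel. of_real (f x) * iter_pderiv is \<phi> x) + b * (LINT x|lborel. of_real (f x) * iter_pderiv is \<psi> x)"
    by simp
next
  have fc: "square_integrable (\<lambda>x. complex_of_real (f x))" by (rule square_integrable_of_real[OF f])
  let ?K = "sqrt (LINT x|(lborel :: (real^3) measure). 1 / (1 + norm x) ^ 6)"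
  show "\<exists>C n. \<forall>\<phi>. schwartz \<phi> \<longrightarrow> norm (LINT x|lborel. of_real (f x) * iter_pderiv is \<phi> x) \<le> C * schwartz_seminorm n \<phi>"
  proof (intro exI allI impI)
    fix \<phi> assume s: "schwartz \<phi>"
    have "norm (LINT x|lborel. of_real (f x) * iter_pderiv is \<phi> x) \<le>
        norm (abs_L2 (\<lambda>x. complex_of_real (f x))) * norm (abs_L2 (iter_pderiv is \<phi>))"
      by (intro integrable_mult_L2(2) fc schwartz_L1_L2 s)
    also have "\<dots> \<le> norm (abs_L2 (\<lambda>x. complex_of_real (f x))) * (?K * schwartz_seminorm 6 \<phi>)"
      by (intro mult_left_mono decay_integrable schwartz_seminorm_bound schwartz_iter_pderiv_measurable s)
        (use l in auto)
    finally show "norm (LINT x|lborel. of_real (f x) * iter_pderiv is \<phi> x) \<le>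
      (norm (abs_L2 (\<lambda>x. complex_of_real (f x))) * ?K) * schwartz_seminorm 6 \<phi>" by (simp add: mult.assoc)
  qed
qed

lemma tempered_dist_of:
  assumes "square_integrable f" shows "tempered (dist_of f)"
  using tempered_L2_pairing[OF assms, of "[]"] by (simp add: dist_of_def[abs_def])

text \<open>The two bounds may refer to seminorms of different orders, which are compared through
  monotonicity in the order. The constants are replaced by absolute values because nothing forces
  them to be nonnegative.\<close>

lemma tempered_add:
  assumes "tempered u" "tempered v" shows "tempered (\<lambda>\<phi>. u \<phi> + v \<phi>)"
proof -
  obtain C n D m where C: "\<And>\<phi>. schwartz \<phi> \<Longrightarrow> norm (u \<phi>) \<le> C * schwartz_seminorm n \<phi>"
    and D: "\<And>\<phi>. schwartz \<phi> \<Longrightarrow> norm (v \<phi>) \<le> D * schwartz_seminorm m \<phi>"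
    using assms unfolding tempered_def by blast
  have nn: "0 \<le> schwartz_seminorm n \<phi>" if "schwartz \<phi>" for \<phi> n
    by (rule order_trans[OF _ schwartz_seminorm_bound[OF that, of "[]" n 0]]) auto
  have mono: "schwartz_seminorm n \<phi> \<le> schwartz_seminorm k \<phi>" if s: "schwartz \<phi>" and nk: "n \<le> k" for \<phi> n k
  proof -
    have bdd: "bdd_above (range (\<lambda>x. (1 + norm x) ^ j * norm (iter_pderiv is \<phi> x)))" for j "is"
      using s by (force simp: schwartz_def bdd_above_def)
    have "schwartz_seminorm n \<phi> \<le> (\<Sum>is\<in>{is. length is \<le> n}. SUP x. (1 + norm x) ^ k * norm (iter_pderiv is \<phi> x))"
      unfolding schwartz_seminorm_def
    proof (intro sum_mono cSUP_mono bdd)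
      show "\<exists>m\<in>UNIV. (1 + norm x) ^ n * norm (iter_pderiv is \<phi> x) \<le> (1 + norm m) ^ k * norm (iter_pderiv is \<phi> m)" for x "is"
        by (intro bexI[of _ x] mult_right_mono power_increasing nk) auto
    qed simp
    also have "\<dots> \<le> schwartz_seminorm k \<phi>"
      unfolding schwartz_seminorm_def
    proof (intro sum_mono2)
      show "finite {is :: 3 list. length is \<le> k}"
        using finite_lists_length_le[of "UNIV :: 3 set" k] by simp
      show "0 \<le> (SUP x. (1 + norm x) ^ k * norm (iter_pderiv b \<phi> x))" for b
        by (rule order_trans[OF _ cSUP_upper[OF UNIV_I bdd, of 0]]) simp
    qed (use nk in auto)
    finally show ?thesis .
  qed
  have "norm (u \<phi> + v \<phi>) \<le> (\<bar>C\<bar> + \<bar>D\<bar>) * schwartz_seminorm (max n m) \<phi>" if s: "schwartz \<phi>" for \<phi>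
  proof -
    have "norm (u \<phi>) \<le> \<bar>C\<bar> * schwartz_seminorm (max n m) \<phi>"
      by (rule order_trans[OF C[OF s]]) (intro mult_mono mono s nn, auto)
    moreover have "norm (v \<phi>) \<le> \<bar>D\<bar> * schwartz_seminorm (max n m) \<phi>"
      by (rule order_trans[OF D[OF s]]) (intro mult_mono mono s nn, auto)
    ultimately show ?thesis using norm_triangle_ineq[of "u \<phi>" "v \<phi>"] by (simp add: distrib_right)
  qed
  moreover have "\<forall>\<phi> \<psi> a b. schwartz \<phi> \<longrightarrow> schwartz \<psi> \<longrightarrow>
    u (\<lambda>x. a * \<phi> x + b * \<psi> x) + v (\<lambda>x. a * \<phi> x + b * \<psi> x) = a * (u \<phi> + v \<phi>) + b * (u \<psi> + v \<psi>)"
    using assms unfolding tempered_def by (simp add: algebra_simps)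
  ultimately show ?thesis unfolding tempered_def by blast
qed

lemma tempered_uminus:
  assumes "tempered u" shows "tempered (\<lambda>\<phi>. - u \<phi>)"
  using assms unfolding tempered_def by (auto simp: algebra_simps)

section \<open>Distributions whose Fourier transform is a function\<close>

lemma has_fourier_add:
  assumes "has_fourier u g" "has_fourier v h"
  shows "has_fourier (\<lambda>\<phi>. u \<phi> + v \<phi>) (\<lambda>k. g k + h k)"
  using assms unfolding has_fourier_def by (auto simp: distrib_right)

lemma has_fourier_uminus:
  assumes "has_fourier u g"
  shows "has_fourier (\<lambda>\<phi>. - u \<phi>) (\<lambda>k. - g k)"
  using assms unfolding has_fourier_def by auto

lemma has_fourier_cmult:
  assumes "has_fourier u g"
  shows "has_fourier (\<lambda>\<phi>. c * u \<phi>) (\<lambda>k. c * g k)"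
  using assms unfolding has_fourier_def by (auto simp: mult.assoc)

lemma has_fourier_cong_AE:
  assumes u: "has_fourier u g" and eq: "AE k in lborel. g k = h k" and [measurable]: "h \<in> borel_measurable borel"
  shows "has_fourier u h"
  unfolding has_fourier_def
proof (intro conjI allI impI)
  have [measurable]: "g \<in> borel_measurable borel" using u by (simp add: has_fourier_def)
  show "h \<in> borel_measurable lborel" by simp
  fix \<phi> assume s: "schwartz \<phi>"
  have [measurable]: "\<phi> \<in> borel_measurable borel"
    using schwartz_iter_pderiv_measurable[OF s, of "[]"] by simp
  have e: "AE k in lborel. g k * \<phi> k = h k * \<phi> k" using eq by eventually_elim simp
  show "integrable lborel (\<lambda>k. h k * \<phi> k)"
    using u s integrable_cong_AE[OF _ _ e] by (simp add: has_fourier_def)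
  show "u (schwartz_fourier \<phi>) = (LINT k|lborel. h k * \<phi> k)"
    using u s integral_cong_AE[OF _ _ e] by (simp add: has_fourier_def)
qed

text \<open>Gaussians are Schwartz functions, and the two transforms have equal integrals against
  all of them.\<close>

lemma has_fourier_unique:
  assumes "has_fourier u g" "has_fourier u h"
  shows "AE k in lborel. g k = h k"
proof -
  have "AE k in lborel. g k - h k = 0"
  proof (rule gauss_test_unique)
    fix a :: real and p :: "real^3" assume "a > 0"
    note s = schwartz_gauss[OF this, of p]
    show "integrable lborel (\<lambda>x. (g x - h x) * of_real (gauss a p x))"
      and "(LINT x|lborel. (g x - h x) * of_real (gauss a p x)) = 0"
      using assms s unfolding has_fourier_def by (simp_all add: left_diff_distrib)
  qed
  then show ?thesis by eventually_elim simp
qed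

text \<open>The multiplication formula identifies the transform defined by duality with the
  Plancherel transform.\<close>

lemma has_fourier_dist_of:
  assumes f: "square_integrable f"
  shows "has_fourier (dist_of f) (rep_L2 (fourier_L2 (abs_L2 (\<lambda>x. of_real (f x)))))"
  unfolding has_fourier_def
proof (intro conjI allI impI)
  have fc: "square_integrable (\<lambda>x. complex_of_real (f x))" by (rule square_integrable_of_real[OF f])
  have [measurable]: "f \<in> borel_measurable borel" using f by measurable
  show "rep_L2 (fourier_L2 (abs_L2 (\<lambda>x. of_real (f x)))) \<in> borel_measurable lborel" by simp
  fix \<phi> assume "schwartz \<phi>"
  from schwartz_L1_L2[OF this, of "[]"] have s: "integrable lborel \<phi>" "square_integrable \<phi>" by simp_all
  then have [measurable]: "\<phi> \<in> borel_measurable borel" by measurable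
  show "integrable lborel (\<lambda>k. rep_L2 (fourier_L2 (abs_L2 (\<lambda>x. complex_of_real (f x)))) k * \<phi> k)"
    by (intro integrable_mult_L2 s) simp
  show "dist_of f (schwartz_fourier \<phi>) =
      (LINT k|lborel. rep_L2 (fourier_L2 (abs_L2 (\<lambda>x. complex_of_real (f x)))) k * \<phi> k)"
    unfolding dist_of_def fourier_L2_multiplication[OF s]
  proof (rule integral_cong_AE)
    show "AE x in lborel. of_real (f x) * schwartz_fourier \<phi> x =
        rep_L2 (abs_L2 (\<lambda>x. complex_of_real (f x))) x * schwartz_fourier \<phi> x"
      using rep_abs_L2[OF fc] by eventually_elim simp
  qed measurable
qed

lemma Hs_norm_eq:
  assumes u: "has_fourier u g"
  shows "Hs_norm \<sigma> u = sqrt (LINT k|lborel. (1 + (norm k)\<^sup>2) powr \<sigma> * (norm (g k))\<^sup>2)"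
proof -
  define h where "h = (SOME g. has_fourier u g)"
  have h: "has_fourier u h" unfolding h_def by (rule someI[of _ g]) (rule u)
  have [measurable]: "g \<in> borel_measurable borel" "h \<in> borel_measurable borel"
    using u h by (simp_all add: has_fourier_def)
  have "(LINT k|lborel. (1 + (norm k)\<^sup>2) powr \<sigma> * (norm (h k))\<^sup>2) =
      (LINT k|lborel. (1 + (norm k)\<^sup>2) powr \<sigma> * (norm (g k))\<^sup>2)"
    by (rule integral_cong_AE, measurable)
      (use has_fourier_unique[OF u h] in \<open>eventually_elim, simp\<close>)
  then show ?thesis by (simp add: Hs_norm_def h_def)
qed

lemma in_Hs_iff:
  assumes u: "has_fourier u g"
  shows "in_Hs \<sigma> u \<longleftrightarrow> tempered u \<and> integrable lborel (\<lambda>k. (1 + (norm k)\<^sup>2) powr \<sigma> * (norm (g k))\<^sup>2)"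
proof
  assume "in_Hs \<sigma> u"
  then obtain h where t: "tempered u" and h: "has_fourier u h"
    and i: "integrable lborel (\<lambda>k. (1 + (norm k)\<^sup>2) powr \<sigma> * (norm (h k))\<^sup>2)"
    by (auto simp: in_Hs_def)
  have [measurable]: "g \<in> borel_measurable borel" "h \<in> borel_measurable borel"
    using u h by (simp_all add: has_fourier_def)
  have e: "AE k in lborel. (1 + (norm k)\<^sup>2) powr \<sigma> * (norm (h k))\<^sup>2 = (1 + (norm k)\<^sup>2) powr \<sigma> * (norm (g k))\<^sup>2"
    using has_fourier_unique[OF u h] by eventually_elim simp
  have "integrable lborel (\<lambda>k. (1 + (norm k)\<^sup>2) powr \<sigma> * (norm (g k))\<^sup>2)"
    using i by (subst (asm) integrable_cong_AE[OF _ _ e]) measurable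
  with t show "tempered u \<and> integrable lborel (\<lambda>k. (1 + (norm k)\<^sup>2) powr \<sigma> * (norm (g k))\<^sup>2)" by simp
qed (use u in \<open>auto simp: in_Hs_def\<close>)

section \<open>Vector fields and the free Maxwell group\<close>

lemma borel_measurable_vec3:
  fixes f :: "'x \<Rightarrow> 'b::euclidean_space ^ 3"
  assumes [measurable]: "\<And>i. (\<lambda>x. f x $ i) \<in> borel_measurable M"
  shows "f \<in> borel_measurable M"
proof (rule borel_measurable_euclidean_space[THEN iffD2], intro ballI)
  fix b :: "'b^3" assume "b \<in> Basis"
  then obtain i u where "b = axis i u" by (auto simp: Basis_vec_def)
  then show "(\<lambda>x. f x \<bullet> b) \<in> borel_measurable M" by (simp add: inner_axis)
qed

lemma bounded_symbol_const:
  fixes L :: "'a::euclidean_space \<Rightarrow> 'b::euclidean_space"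
  assumes "linear L" "\<And>w. norm (L w) \<le> C * norm w"
  shows "bounded_symbol (\<lambda>_. L) C"
  by (rule bounded_symbolI) (use assms in auto)

lemma linear_axis: "linear (\<lambda>w::'b::real_normed_vector. axis i w :: 'b^3)"
  by (rule linearI) (auto simp: vec_eq_iff axis_def)

lemma norm_vec3_sum: "(norm (w :: 'b::real_normed_vector ^ 3))\<^sup>2 = (\<Sum>i\<in>UNIV. (norm (w $ i))\<^sup>2)"
  by (simp add: norm_vec_def L2_set_def sum_nonneg)

lemma norm_axis3: "norm (axis i w :: 'b::real_normed_vector ^ 3) = norm w"
proof -
  have "(norm (axis i w :: 'b ^ 3))\<^sup>2 = (\<Sum>j\<in>UNIV. if j = i then (norm w)\<^sup>2 else 0)"
    unfolding norm_vec3_sum by (intro sum.cong) (auto simp: axis_def)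
  then show ?thesis by (simp add: power2_eq_iff_nonneg)
qed

abbreviation l2_nth :: "3 \<Rightarrow> ('b::euclidean_space ^ 3) L2 \<Rightarrow> 'b L2" where
  "l2_nth i \<equiv> l2_mult (\<lambda>_ w. w $ i)"

lemma bounded_symbol_nth: "bounded_symbol (\<lambda>_ w :: 'b::euclidean_space ^ 3. w $ i) 1"
  by (rule bounded_symbol_const) (auto simp: Finite_Cartesian_Product.norm_nth_le intro: linearI)

lemma bounded_symbol_axis: "bounded_symbol (\<lambda>_ w :: 'b::euclidean_space. axis i w :: 'b ^ 3) 1"
  by (rule bounded_symbol_const[OF linear_axis]) (simp add: norm_axis3)

lemma bounded_symbol_of_real_nth: "bounded_symbol (\<lambda>_ w :: real ^ 3. complex_of_real (w $ i)) 1"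
proof (rule bounded_symbol_const)
  show "linear (\<lambda>w :: real ^ 3. complex_of_real (w $ i))"
    by (rule linearI) (simp_all add: scaleR_conv_of_real[where 'a = complex])
qed (simp add: component_le_norm_cart)

lemma bounded_symbol_fst: "bounded_symbol (\<lambda>_ w :: 'a::euclidean_space \<times> 'b::euclidean_space. fst w) 1"
  by (rule bounded_symbol_const) (auto intro: linearI norm_fst_le)

lemma bounded_symbol_snd: "bounded_symbol (\<lambda>_ w :: 'a::euclidean_space \<times> 'b::euclidean_space. snd w) 1"
  by (rule bounded_symbol_const) (auto intro: linearI norm_snd_le)

lemma bounded_symbol_Pair1: "bounded_symbol (\<lambda>_ w :: 'a::euclidean_space. (w, 0 :: 'b::euclidean_space)) 1"
  by (rule bounded_symbol_const) (auto intro: linearI)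

lemma bounded_symbol_Pair2: "bounded_symbol (\<lambda>_ w :: 'b::euclidean_space. (0 :: 'a::euclidean_space, w)) 1"
  by (rule bounded_symbol_const) (auto intro: linearI)

lemma l2_mult_zero [simp]: "l2_mult (\<lambda>_ w. 0) F = 0"
  by (simp add: l2_mult_def)

lemma integrable_norm_rep_L2 [simp]: "integrable lborel (\<lambda>x. (norm (rep_L2 F x))\<^sup>2)"
  using square_integrable_rep_L2[of F] unfolding square_integrable_def by blast

lemma norm_L2_vec3: "(norm (F :: ('b::euclidean_space ^ 3) L2))\<^sup>2 = (\<Sum>i\<in>UNIV. (norm (l2_nth i F))\<^sup>2)"
proof -
  have 1: "(norm (l2_nth i F))\<^sup>2 = (LINT x|lborel. (norm (rep_L2 F x $ i))\<^sup>2)" for i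
    unfolding l2_mult_def by (rule norm_abs_L2[OF square_integrable_mult[OF bounded_symbol_nth]]) simp
  have "integrable lborel (\<lambda>x. (norm (rep_L2 F x $ i))\<^sup>2)" for i
    using square_integrable_mult[OF bounded_symbol_nth, of "rep_L2 F" i] by (simp add: square_integrable_def)
  then show ?thesis
    unfolding norm_L2_rep[of F] norm_vec3_sum 1 by (rule Bochner_Integration.integral_sum)
qed

lemma norm_L2_Pair:
  fixes F :: "('a::euclidean_space \<times> 'b::euclidean_space) L2"
  shows "(norm F)\<^sup>2 = (norm (l2_mult (\<lambda>_. fst) F))\<^sup>2 + (norm (l2_mult (\<lambda>_. snd) F))\<^sup>2"
proof -
  have n: "(norm w)\<^sup>2 = (norm (fst w))\<^sup>2 + (norm (snd w))\<^sup>2" for w :: "'a \<times> 'b"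
    by (cases w) (simp add: norm_Pair)
  have 1: "(norm (l2_mult (\<lambda>_. fst) F))\<^sup>2 = (LINT x|lborel. (norm (fst (rep_L2 F x)))\<^sup>2)"
    unfolding l2_mult_def by (rule norm_abs_L2[OF square_integrable_mult[OF bounded_symbol_fst]]) simp
  have 2: "(norm (l2_mult (\<lambda>_. snd) F))\<^sup>2 = (LINT x|lborel. (norm (snd (rep_L2 F x)))\<^sup>2)"
    unfolding l2_mult_def by (rule norm_abs_L2[OF square_integrable_mult[OF bounded_symbol_snd]]) simp
  show ?thesis
    unfolding norm_L2_rep[of F] n 1 2
    by (rule Bochner_Integration.integral_add)
      (use square_integrable_mult[OF bounded_symbol_fst, of "rep_L2 F"]
         square_integrable_mult[OF bounded_symbol_snd, of "rep_L2 F"] in \<open>simp_all add: square_integrable_def\<close>)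
qed

lemma L2_vec3_eqI:
  assumes "\<And>i. l2_nth i F = l2_nth i G" shows "F = G"
proof -
  have "l2_nth i (F - G) = 0" for i
    using linear_diff[OF bounded_linear.linear[OF bounded_linear_l2_mult[OF bounded_symbol_nth]], of i F G] assms
    by simp
  then have "(norm (F - G))\<^sup>2 = 0" by (simp add: norm_L2_vec3)
  then show ?thesis by simp
qed

lemma L2_Pair_eqI:
  fixes F G :: "('a::euclidean_space \<times> 'b::euclidean_space) L2"
  assumes "l2_mult (\<lambda>_. fst) F = l2_mult (\<lambda>_. fst) G" "l2_mult (\<lambda>_. snd) F = l2_mult (\<lambda>_. snd) G"
  shows "F = G"
proof -
  have "l2_mult (\<lambda>_. fst) (F - G) = 0" "l2_mult (\<lambda>_. snd) (F - G) = 0"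
    using linear_diff[OF bounded_linear.linear[OF bounded_linear_l2_mult[OF bounded_symbol_fst]], of F G]
      linear_diff[OF bounded_linear.linear[OF bounded_linear_l2_mult[OF bounded_symbol_snd]], of F G] assms
    by simp_all
  then have "(norm (F - G))\<^sup>2 = 0" by (simp add: norm_L2_Pair)
  then show ?thesis by simp
qed

text \<open>The componentwise transform, assembled from bounded operators so that linearity and
  boundedness follow from composition.\<close>

definition vec_fourier :: "(real^3) L2 \<Rightarrow> (complex^3) L2" where
  "vec_fourier F = (\<Sum>i\<in>UNIV. l2_mult (\<lambda>_. axis i) (fourier_L2 (l2_mult (\<lambda>_ w. of_real (w $ i)) F)))"

lemma l2_nth_sum_axis:
  fixes G :: "3 \<Rightarrow> 'b::euclidean_space L2"
  shows "l2_nth i (\<Sum>j\<in>UNIV. l2_mult (\<lambda>_. axis j) (G j)) = G i"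
proof -
  have "l2_nth i (l2_mult (\<lambda>_. axis j) (G j)) = (if j = i then G j else 0)" for j
    by (simp add: l2_mult_comp[OF bounded_symbol_nth bounded_symbol_axis] axis_def)
  then have "(\<Sum>j\<in>UNIV. l2_nth i (l2_mult (\<lambda>_. axis j) (G j))) = G i" by simp
  then show ?thesis
    by (simp only: linear_sum[OF bounded_linear.linear[OF bounded_linear_l2_mult[OF bounded_symbol_nth]]])
qed

lemma l2_nth_vec_fourier: "l2_nth i (vec_fourier F) = fourier_L2 (l2_mult (\<lambda>_ w. of_real (w $ i)) F)"
  unfolding vec_fourier_def by (rule l2_nth_sum_axis)

lemma bounded_linear_vec_fourier: "bounded_linear vec_fourier"
  unfolding vec_fourier_def[abs_def]
  by (intro bounded_linear_sum bounded_linear_compose[OF bounded_linear_l2_mult[OF bounded_symbol_axis]]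
      bounded_linear_compose[OF bounded_linear_fourier_L2] bounded_linear_l2_mult[OF bounded_symbol_of_real_nth])

lemma norm_vec_fourier: "norm (vec_fourier F) = norm F"
proof -
  have "(norm (l2_mult (\<lambda>_ w. complex_of_real (w $ i)) F)) = norm (l2_nth i F)" for i
    unfolding l2_mult_def
    by (rule norm_abs_L2_eq) (use square_integrable_mult[OF bounded_symbol_nth, of "rep_L2 F"]
      square_integrable_mult[OF bounded_symbol_of_real_nth, of "rep_L2 F"] in auto)
  then have "(norm (vec_fourier F))\<^sup>2 = (norm F)\<^sup>2"
    by (simp add: norm_L2_vec3 l2_nth_vec_fourier fourier_L2_norm)
  then show ?thesis by (rule power2_eq_imp_eq) simp_all
qed

lemma has_fourier_component:
  "has_fourier (component F i) (\<lambda>k. rep_L2 (vec_fourier F) k $ i)"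
proof -
  have "square_integrable (\<lambda>x. rep_L2 F x $ i)"
    by (rule square_integrable_mult[OF bounded_symbol_nth]) simp
  from has_fourier_dist_of[OF this]
  have "has_fourier (component F i) (rep_L2 (fourier_L2 (l2_mult (\<lambda>_ w. of_real (w $ i)) F)))"
    by (simp add: component_def l2_mult_def)
  then have h: "has_fourier (component F i) (rep_L2 (l2_nth i (vec_fourier F)))"
    by (simp only: l2_nth_vec_fourier)
  have [measurable]: "(\<lambda>k. rep_L2 (vec_fourier F) k $ i) \<in> borel_measurable borel"
    by (rule bounded_symbol_measurable[OF bounded_symbol_nth rep_L2_measurable])
  show ?thesis
    by (rule has_fourier_cong_AE[OF h rep_l2_mult[OF bounded_symbol_nth]]) measurable
qed

text \<open>This discharges the definite description: the componentwise transform qualifies, and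
  almost everywhere uniqueness in each component makes it the only candidate in the
  quotient.\<close>

lemma L2_fourier_eq: "L2_fourier F = vec_fourier F"
  unfolding L2_fourier_def
proof (rule the_equality)
  show "\<forall>i. has_fourier (component F i) (\<lambda>k. rep_L2 (vec_fourier F) k $ i)"
    using has_fourier_component by blast
  fix G assume G: "\<forall>i. has_fourier (component F i) (\<lambda>k. rep_L2 G k $ i)"
  show "G = vec_fourier F"
  proof (rule L2_vec3_eqI, rule L2_eqI)
    fix i
    show "AE x in lborel. rep_L2 (l2_nth i G) x = rep_L2 (l2_nth i (vec_fourier F)) x"
      using has_fourier_unique[OF G[rule_format, of i] has_fourier_component]
        rep_l2_mult[OF bounded_symbol_nth, of i G] rep_l2_mult[OF bounded_symbol_nth, of i "vec_fourier F"]
      by eventually_elim simp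
  qed
qed

text \<open>Both transforms form one function with values in pairs, on which the free evolution acts
  as a single multiplication operator.\<close>

definition pair_fourier :: "(real^3) L2 \<times> (real^3) L2 \<Rightarrow> ((complex^3) \<times> (complex^3)) L2" where
  "pair_fourier P = l2_mult (\<lambda>_ w. (w, 0)) (vec_fourier (fst P)) + l2_mult (\<lambda>_ w. (0, w)) (vec_fourier (snd P))"

lemma bounded_linear_pair_fourier: "bounded_linear pair_fourier"
  unfolding pair_fourier_def[abs_def]
  by (intro bounded_linear_add bounded_linear_compose[OF bounded_linear_l2_mult[OF bounded_symbol_Pair1]]
      bounded_linear_compose[OF bounded_linear_l2_mult[OF bounded_symbol_Pair2]]
      bounded_linear_compose[OF bounded_linear_vec_fourier] bounded_linear_fst bounded_linear_snd)

lemma fst_pair_fourier: "l2_mult (\<lambda>_. fst) (pair_fourier P) = vec_fourier (fst P)"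
  unfolding pair_fourier_def
  by (simp add: linear_add[OF bounded_linear.linear[OF bounded_linear_l2_mult[OF bounded_symbol_fst]]]
    l2_mult_comp[OF bounded_symbol_fst bounded_symbol_Pair1] l2_mult_comp[OF bounded_symbol_fst bounded_symbol_Pair2])

lemma snd_pair_fourier: "l2_mult (\<lambda>_. snd) (pair_fourier P) = vec_fourier (snd P)"
  unfolding pair_fourier_def
  by (simp add: linear_add[OF bounded_linear.linear[OF bounded_linear_l2_mult[OF bounded_symbol_snd]]]
    l2_mult_comp[OF bounded_symbol_snd bounded_symbol_Pair1] l2_mult_comp[OF bounded_symbol_snd bounded_symbol_Pair2])

lemma rep_pair_fourier:
  "AE k in lborel. rep_L2 (pair_fourier P) k = (rep_L2 (vec_fourier (fst P)) k, rep_L2 (vec_fourier (snd P)) k)"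
  using rep_l2_mult[OF bounded_symbol_fst, of "pair_fourier P"] rep_l2_mult[OF bounded_symbol_snd, of "pair_fourier P"]
  unfolding fst_pair_fourier snd_pair_fourier by eventually_elim simp

lemma norm_pair_fourier: "norm (pair_fourier P) = norm P"
proof -
  have "(norm (pair_fourier P))\<^sup>2 = (norm P)\<^sup>2"
    by (cases P) (simp add: norm_L2_Pair fst_pair_fourier snd_pair_fourier norm_vec_fourier norm_Pair)
  then show ?thesis by (rule power2_eq_imp_eq) simp_all
qed

lemma pair_fourier_inj: "pair_fourier P = pair_fourier Q \<longleftrightarrow> P = Q"
proof
  assume "pair_fourier P = pair_fourier Q"
  then have "norm (pair_fourier (P - Q)) = 0"
    by (simp add: linear_diff[OF bounded_linear.linear[OF bounded_linear_pair_fourier]])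
  then show "P = Q" by (simp add: norm_pair_fourier)
qed simp

text \<open>Conjugation of a function becomes conjugation and reflection of its transform, and the
  transform is injective; so the symmetry on the right side of Fourier space detects real functions
  in both directions.\<close>

lemma fourier_L2_real_iff:
  "(AE k in lborel. rep_L2 (fourier_L2 F) (- k) = cnj (rep_L2 (fourier_L2 F) k)) \<longleftrightarrow> l2_mult (\<lambda>_. cnj) F = F"
proof -
  let ?H = "l2_mult (\<lambda>_. cnj) (l2_affine (-1) 0 (fourier_L2 F))"
  have H: "AE k in lborel. rep_L2 ?H k = cnj (rep_L2 (fourier_L2 F) (- k))"
  proof -
    have "AE k in lborel. rep_L2 (l2_affine (-1) 0 (fourier_L2 F)) k = rep_L2 (fourier_L2 F) (- k)"
      using rep_l2_affine[of "-1" 0 "fourier_L2 F"] by simp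
    with rep_l2_mult[OF bounded_symbol_cnj, of "l2_affine (-1) 0 (fourier_L2 F)"]
    show ?thesis by eventually_elim simp
  qed
  have "(AE k in lborel. rep_L2 (fourier_L2 F) (- k) = cnj (rep_L2 (fourier_L2 F) k)) \<longleftrightarrow> ?H = fourier_L2 F"
  proof
    assume *: "AE k in lborel. rep_L2 (fourier_L2 F) (- k) = cnj (rep_L2 (fourier_L2 F) k)"
    show "?H = fourier_L2 F"
      by (rule L2_eqI) (use H * in \<open>eventually_elim, simp\<close>)
  next
    assume "?H = fourier_L2 F"
    with H have "AE k in lborel. rep_L2 (fourier_L2 F) k = cnj (rep_L2 (fourier_L2 F) (- k))" by simp
    then show "AE k in lborel. rep_L2 (fourier_L2 F) (- k) = cnj (rep_L2 (fourier_L2 F) k)"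
      by eventually_elim simp
  qed
  also have "\<dots> \<longleftrightarrow> l2_mult (\<lambda>_. cnj) F = F"
    unfolding fourier_L2_cnj[symmetric] fourier_L2_inj ..
  finally show ?thesis .
qed

definition vec_cnj :: "complex^3 \<Rightarrow> complex^3" where
  "vec_cnj w = (\<chi> i. cnj (w $ i))"

text \<open>The range condition of \<open>pair_fourier\<close>: it singles out those pairs of
  complex functions that are transforms of real fields.\<close>

definition hermitian :: "((complex^3) \<times> (complex^3)) L2 \<Rightarrow> bool" where
  "hermitian G \<longleftrightarrow> (AE k in lborel. rep_L2 G (- k) = map_prod vec_cnj vec_cnj (rep_L2 G k))"

lemma AE_reflect:
  assumes "AE k in lborel. P (k :: real^3)" shows "AE k in lborel. P (- k)"
  using AE_lborel_affine[OF assms, of "-1" 0] by simp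

lemma vec_fourier_hermitian:
  "AE k in lborel. rep_L2 (vec_fourier F) (- k) = vec_cnj (rep_L2 (vec_fourier F) k)"
proof -
  have "AE k in lborel. rep_L2 (vec_fourier F) (- k) $ i = cnj (rep_L2 (vec_fourier F) k $ i)" for i
  proof -
    let ?f = "l2_mult (\<lambda>_ w. complex_of_real (w $ i)) F"
    have "l2_mult (\<lambda>_. cnj) ?f = ?f"
      by (simp add: l2_mult_comp[OF bounded_symbol_cnj bounded_symbol_of_real_nth])
    then have "AE k in lborel. rep_L2 (l2_nth i (vec_fourier F)) (- k) = cnj (rep_L2 (l2_nth i (vec_fourier F)) k)"
      by (simp add: fourier_L2_real_iff l2_nth_vec_fourier)
    moreover note rep_l2_mult[OF bounded_symbol_nth, of i "vec_fourier F"]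
      AE_reflect[OF rep_l2_mult[OF bounded_symbol_nth, of i "vec_fourier F"]]
    ultimately show ?thesis by eventually_elim simp
  qed
  from this[of 1] this[of 2] this[of 3] show ?thesis
    by eventually_elim (simp add: vec_eq_iff forall_3 vec_cnj_def)
qed

lemma hermitian_pair_fourier: "hermitian (pair_fourier P)"
  unfolding hermitian_def
  using rep_pair_fourier[of P] AE_reflect[OF rep_pair_fourier[of P]]
    vec_fourier_hermitian[of "fst P"] vec_fourier_hermitian[of "snd P"]
  by eventually_elim simp

text \<open>Each component is inverted in the complex space; the symmetry makes the result equal to
  its conjugate, so that taking real parts afterwards loses nothing.\<close>

lemma vec_fourier_surj:
  assumes G: "AE k in lborel. rep_L2 G (- k) = vec_cnj (rep_L2 G k)"
  shows "\<exists>F. vec_fourier F = G"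
proof -
  \<comment> \<open>Three transforms invert one.\<close>
  define f where "f i = fourier_L2 (fourier_L2 (fourier_L2 (l2_nth i G)))" for i
  have ff: "fourier_L2 (f i) = l2_nth i G" for i by (simp add: f_def fourier_L2_inverse)
  have real: "l2_mult (\<lambda>_. cnj) (f i) = f i" for i
  proof (rule fourier_L2_real_iff[THEN iffD1])
    show "AE k in lborel. rep_L2 (fourier_L2 (f i)) (- k) = cnj (rep_L2 (fourier_L2 (f i)) k)"
      unfolding ff using G rep_l2_mult[OF bounded_symbol_nth, of i G] AE_reflect[OF rep_l2_mult[OF bounded_symbol_nth, of i G]]
      by eventually_elim (simp add: vec_cnj_def)
  qed
  define F where "F = (\<Sum>i\<in>UNIV. l2_mult (\<lambda>_. axis i) (l2_mult (\<lambda>_. Re) (f i)))"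
  have Re: "bounded_symbol (\<lambda>_. Re) 1"
    by (rule bounded_symbol_const) (auto intro: linearI abs_Re_le_cmod)
  have oR: "bounded_symbol (\<lambda>_. complex_of_real) 1"
    by (rule bounded_symbol_const) (auto intro: linearI)
  have comp: "l2_mult (\<lambda>_ w. of_real (w $ i)) F = f i" for i
  proof -
    have "l2_mult (\<lambda>_ w. complex_of_real (w $ i)) F = l2_mult (\<lambda>_. complex_of_real) (l2_nth i F)"
      by (simp add: l2_mult_comp[OF oR bounded_symbol_nth])
    also have "\<dots> = l2_mult (\<lambda>_. complex_of_real) (l2_mult (\<lambda>_. Re) (f i))"
      unfolding F_def l2_nth_sum_axis ..
    also have "\<dots> = f i"
    proof (rule L2_eqI)
      show "AE x in lborel. rep_L2 (l2_mult (\<lambda>_. complex_of_real) (l2_mult (\<lambda>_. Re) (f i))) x = rep_L2 (f i) x"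
        using rep_l2_mult[OF oR, of "l2_mult (\<lambda>_. Re) (f i)"] rep_l2_mult[OF Re, of "f i"]
          rep_l2_mult[OF bounded_symbol_cnj, of "f i"] unfolding real
        by eventually_elim (metis Reals_cnj_iff of_real_Re)
    qed
    finally show ?thesis .
  qed
  have "vec_fourier F = G"
    by (rule L2_vec3_eqI) (simp add: l2_nth_vec_fourier comp ff)
  then show ?thesis by blast
qed

lemma pair_fourier_surj:
  assumes "hermitian G" shows "\<exists>P. pair_fourier P = G"
proof -
  note rf = rep_l2_mult[OF bounded_symbol_fst, of G] AE_reflect[OF rep_l2_mult[OF bounded_symbol_fst, of G]]
  note rs = rep_l2_mult[OF bounded_symbol_snd, of G] AE_reflect[OF rep_l2_mult[OF bounded_symbol_snd, of G]]
  have "AE k in lborel. rep_L2 (l2_mult (\<lambda>_. fst) G) (- k) = vec_cnj (rep_L2 (l2_mult (\<lambda>_. fst) G) k)"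
    using rf assms unfolding hermitian_def by eventually_elim simp
  then obtain E where E: "vec_fourier E = l2_mult (\<lambda>_. fst) G" using vec_fourier_surj by blast
  have "AE k in lborel. rep_L2 (l2_mult (\<lambda>_. snd) G) (- k) = vec_cnj (rep_L2 (l2_mult (\<lambda>_. snd) G) k)"
    using rs assms unfolding hermitian_def by eventually_elim simp
  then obtain B where B: "vec_fourier B = l2_mult (\<lambda>_. snd) G" using vec_fourier_surj by blast
  have "pair_fourier (E, B) = G"
    by (rule L2_Pair_eqI) (simp_all add: fst_pair_fourier snd_pair_fourier E B)
  then show ?thesis by blast
qed

section \<open>The Maxwell symbol as a unitary flow\<close>

lemma curl_symbol_self_adjoint: "curl_symbol k a \<bullet> b = a \<bullet> curl_symbol k b"
  by (simp add: curl_symbol_def ccross3_def inner_vec_def sum_3 vector_3 inner_complex_def algebra_simps)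

lemma norm_curl_symbol_le: "norm (curl_symbol k w) \<le> norm k * norm w"
proof -
  have "0 \<le> (norm (\<Sum>i\<in>UNIV. of_real (k $ i) * w $ i))\<^sup>2" by simp
  \<comment> \<open>Lagrange's identity for a real \<open>k\<close> and a complex
    \<open>w\<close>.\<close>
  have "(norm (curl_symbol k w))\<^sup>2 = (norm k)\<^sup>2 * (norm w)\<^sup>2 - (norm (\<Sum>i\<in>UNIV. of_real (k $ i) * w $ i))\<^sup>2"
    unfolding power2_norm_eq_inner
    by (simp add: curl_symbol_def ccross3_def inner_vec_def sum_3 vector_3 inner_complex_def algebra_simps)
  then have "(norm (curl_symbol k w))\<^sup>2 \<le> (norm k * norm w)\<^sup>2" by (simp add: power_mult_distrib)
  then show ?thesis by (rule power2_le_imp_le) simp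
qed

lemma linear_curl_symbol: "linear (curl_symbol k)"
  by (rule linearI) (simp_all add: curl_symbol_linear)

lemma curl_symbol_measurable [measurable]:
  assumes [measurable]: "f \<in> borel_measurable borel"
  shows "(\<lambda>k. curl_symbol k (f k)) \<in> borel_measurable borel"
proof (rule borel_measurable_vec3)
  fix i :: 3
  have [measurable]: "(\<lambda>k. f k $ j) \<in> borel_measurable borel" for j
    using bounded_symbol_measurable[OF bounded_symbol_nth assms] by simp
  have [measurable]: "(\<lambda>k. k $ j) \<in> borel_measurable (borel :: (real^3) measure)" for j
    using bounded_symbol_measurable[OF bounded_symbol_nth, of "\<lambda>k. k" j] by simp
  have "(\<lambda>k. curl_symbol k (f k) $ 1) \<in> borel_measurable borel"
    "(\<lambda>k. curl_symbol k (f k) $ 2) \<in> borel_measurable borel"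
    "(\<lambda>k. curl_symbol k (f k) $ 3) \<in> borel_measurable borel"
    unfolding curl_symbol_def ccross3_def by (simp_all add: vector_3)
  then show "(\<lambda>k. curl_symbol k (f k) $ i) \<in> borel_measurable borel"
    using exhaust_3[of i] by auto
qed

lemma curl_symbol_0 [simp]: "curl_symbol k 0 = 0"
  using linear_0[OF linear_curl_symbol] .

lemma curl_symbol_0_left [simp]: "curl_symbol 0 w = 0"
  using norm_curl_symbol_le[of 0 w] by simp

lemma curl_symbol_hermitian: "curl_symbol (- k) (vec_cnj w) = vec_cnj (curl_symbol k w)"
  by (simp add: curl_symbol_def ccross3_def vec_cnj_def vec_eq_iff forall_3 vector_3)

lemma vec_cnj_linear:
  "vec_cnj (a + b) = vec_cnj a + vec_cnj b" "vec_cnj (a - b) = vec_cnj a - vec_cnj b"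
  "vec_cnj (c *\<^sub>R a) = c *\<^sub>R vec_cnj a"
  by (simp_all add: vec_cnj_def vec_eq_iff)

lemma maxwell_symbol_hermitian:
  "maxwell_symbol t (- k) (map_prod vec_cnj vec_cnj p) = map_prod vec_cnj vec_cnj (maxwell_symbol t k p)"
  by (cases p) (simp add: maxwell_symbol_def curl_symbol_hermitian vec_cnj_linear)

text \<open>The addition theorems of sine and cosine, since \<open>curl_symbol_3\<close> reduces
  every higher power of the curl to the first two. At \<open>k = 0\<close> the curl vanishes and the
  symbol is the identity, so this case is separate from the divisions by
  \<open>norm k\<close>.\<close>

lemma maxwell_symbol_add: "maxwell_symbol s k (maxwell_symbol t k p) = maxwell_symbol (s + t) k p"
proof (cases "k = 0")
  case True
  then show ?thesis by (cases p) (simp add: maxwell_symbol_def)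
next
  case False
  define n where "n = norm k"
  have n: "n \<noteq> 0" using False by (simp add: n_def)
  define c where "c t = (1 - cos (n * t)) / n\<^sup>2" for t
  define s' where "s' t = sin (n * t) / n" for t
  obtain a b where p: "p = (a, b)" by (cases p)
  have cc: "c (s + t) = c s + c t - c s * c t * n\<^sup>2 + s' s * s' t"
    using n by (simp add: c_def s'_def distrib_left cos_add field_simps power2_eq_square)
  have ss: "s' (s + t) = s' s + s' t - c s * s' t * n\<^sup>2 - s' s * c t * n\<^sup>2"
    using n by (simp add: c_def s'_def distrib_left sin_add field_simps power2_eq_square)
  have M: "maxwell_symbol t k (a, b) =
      (a - c t *\<^sub>R curl_symbol k (curl_symbol k a) + s' t *\<^sub>R curl_symbol k b,
       b - c t *\<^sub>R curl_symbol k (curl_symbol k b) - s' t *\<^sub>R curl_symbol k a)" for a b t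
    by (simp add: maxwell_symbol_def c_def s'_def n_def)
  show ?thesis
    unfolding p M cc ss
    by (simp add: curl_symbol_linear curl_symbol_3 n_def[symmetric] algebra_simps)
qed

lemma linear_maxwell_symbol: "linear (maxwell_symbol t k)"
  by (rule linearI) (auto simp: maxwell_symbol_def curl_symbol_linear algebra_simps split: prod.splits)

text \<open>The curl is symmetric; the cosine coefficient is even in \<open>t\<close>, while the
  sine terms have opposite signs in the two components and are odd in \<open>t\<close>. Together
  with the group law this makes the flow isometric.\<close>

lemma maxwell_symbol_adjoint: "maxwell_symbol t k p \<bullet> q = p \<bullet> maxwell_symbol (- t) k q"
proof -
  have C2: "curl_symbol k (curl_symbol k a) \<bullet> b = a \<bullet> curl_symbol k (curl_symbol k b)" for a b
    by (simp add: curl_symbol_self_adjoint)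
  show ?thesis
    by (cases p, cases q)
      (simp add: maxwell_symbol_def inner_add_left inner_add_right inner_diff_left inner_diff_right
        C2 curl_symbol_self_adjoint)
qed

lemma norm_maxwell_symbol: "norm (maxwell_symbol t k p) = norm p"
  by (simp add: norm_eq_sqrt_inner maxwell_symbol_adjoint[of t] maxwell_symbol_add maxwell_symbol_0)

lemma maxwell_symbol_measurable: "(\<lambda>k. maxwell_symbol t k p) \<in> borel_measurable borel"
  by (cases p) (simp add: maxwell_symbol_def)

lemma bounded_symbol_maxwell: "bounded_symbol (maxwell_symbol t) 1"
  by (rule bounded_symbolI) (simp_all add: linear_maxwell_symbol maxwell_symbol_measurable norm_maxwell_symbol)

text \<open>The described pair has to consist of real fields. It exists because the symbol commutes
  with conjugation combined with \<open>k\<close> to \<open>- k\<close>, so the multiplied transform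
  is again hermitian and has a preimage; injectivity makes it unique.\<close>

lemma maxwell_group_pair_fourier: "pair_fourier (maxwell_group t P) = l2_mult (maxwell_symbol t) (pair_fourier P)"
proof -
  let ?G = "l2_mult (maxwell_symbol t) (pair_fourier P)"
  note r = rep_l2_mult[OF bounded_symbol_maxwell, of t "pair_fourier P"]
  have "hermitian ?G"
    unfolding hermitian_def
    using hermitian_pair_fourier[of P, unfolded hermitian_def] r AE_reflect[OF r]
    by eventually_elim (simp add: maxwell_symbol_hermitian)
  then obtain Q where Q: "pair_fourier Q = ?G" using pair_fourier_surj by blast
  have iff: "(AE k in lborel.
     (rep_L2 (vec_fourier (fst R)) k, rep_L2 (vec_fourier (snd R)) k) =
       maxwell_symbol t k (rep_L2 (vec_fourier (fst P)) k, rep_L2 (vec_fourier (snd P)) k)) \<longleftrightarrow> pair_fourier R = ?G" for R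
  proof
    assume *: "AE k in lborel. (rep_L2 (vec_fourier (fst R)) k, rep_L2 (vec_fourier (snd R)) k) =
       maxwell_symbol t k (rep_L2 (vec_fourier (fst P)) k, rep_L2 (vec_fourier (snd P)) k)"
    show "pair_fourier R = ?G"
    proof (rule L2_eqI)
      show "AE x in lborel. rep_L2 (pair_fourier R) x = rep_L2 ?G x"
        using * r rep_pair_fourier[of R] rep_pair_fourier[of P] by eventually_elim simp
    qed
  next
    assume *: "pair_fourier R = ?G"
    show "AE k in lborel. (rep_L2 (vec_fourier (fst R)) k, rep_L2 (vec_fourier (snd R)) k) =
       maxwell_symbol t k (rep_L2 (vec_fourier (fst P)) k, rep_L2 (vec_fourier (snd P)) k)"
      using r rep_pair_fourier[of R] rep_pair_fourier[of P] unfolding * by eventually_elim simp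
  qed
  have "maxwell_group t P = Q"
    unfolding maxwell_group_def L2_fourier_eq iff
    by (rule the_equality, rule Q) (simp add: Q[symmetric] pair_fourier_inj)
  then show ?thesis using Q by simp
qed

lemma maxwell_group_eqI:
  "pair_fourier Q = l2_mult (maxwell_symbol t) (pair_fourier P) \<Longrightarrow> maxwell_group t P = Q"
  by (metis maxwell_group_pair_fourier pair_fourier_inj)

lemma norm_maxwell_group: "norm (maxwell_group t P) = norm P"
  by (metis bounded_symbol_maxwell l2_mult_isometry maxwell_group_pair_fourier norm_maxwell_symbol norm_pair_fourier)

lemma bounded_linear_maxwell_group: "bounded_linear (maxwell_group t)"
proof (rule bounded_linear_intro[where K=1])
  note L = bounded_linear.linear[OF bounded_linear_pair_fourier]
    bounded_linear.linear[OF bounded_linear_l2_mult[OF bounded_symbol_maxwell]]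
  show "maxwell_group t (P + Q) = maxwell_group t P + maxwell_group t Q" for P Q
    by (rule maxwell_group_eqI) (simp add: linear_add[OF L(1)] linear_add[OF L(2)] maxwell_group_pair_fourier)
  show "maxwell_group t (c *\<^sub>R P) = c *\<^sub>R maxwell_group t P" for c P
    by (rule maxwell_group_eqI) (simp add: linear_cmul[OF L(1)] linear_cmul[OF L(2)] maxwell_group_pair_fourier)
  show "norm (maxwell_group t P) \<le> norm P * 1" for P by (simp add: norm_maxwell_group)
qed

lemma l2_mult_maxwell_add:
  "l2_mult (maxwell_symbol s) (l2_mult (maxwell_symbol t) F) = l2_mult (maxwell_symbol (s + t)) F"
  by (simp add: l2_mult_comp[OF bounded_symbol_maxwell bounded_symbol_maxwell] maxwell_symbol_add)

lemma maxwell_group_add: "maxwell_group s (maxwell_group t P) = maxwell_group (s + t) P"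
  by (rule maxwell_group_eqI) (simp add: maxwell_group_pair_fourier l2_mult_maxwell_add)

lemma maxwell_group_0 [simp]: "maxwell_group 0 P = P"
  by (rule maxwell_group_eqI) (simp add: maxwell_symbol_0[abs_def])

text \<open>Strong continuity, by dominated convergence: the angle \<open>norm k * t\<close> is not
  controlled uniformly in \<open>k\<close>, so no operator norm estimate stands behind it.\<close>

lemma l2_mult_maxwell_continuous: "isCont (\<lambda>t. l2_mult (maxwell_symbol t) F) t"
  unfolding isCont_def
proof (rule l2_mult_tendsto_at[OF bounded_symbol_maxwell bounded_symbol_maxwell], intro AE_I2 allI)
  fix k w
  show "((\<lambda>s. maxwell_symbol s k w) \<longlongrightarrow> maxwell_symbol t k w) (at t)"
    by (cases w) (auto simp: maxwell_symbol_def divide_inverse intro!: tendsto_intros)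
qed

lemma maxwell_group_continuous: "isCont (\<lambda>t. maxwell_group t P) t"
proof -
  have "(\<lambda>s. dist (maxwell_group s P) (maxwell_group t P)) =
      (\<lambda>s. dist (l2_mult (maxwell_symbol s) (pair_fourier P)) (l2_mult (maxwell_symbol t) (pair_fourier P)))"
    by (simp add: dist_norm norm_pair_fourier[symmetric, of "maxwell_group _ P - maxwell_group t P"]
        linear_diff[OF bounded_linear.linear[OF bounded_linear_pair_fourier]] maxwell_group_pair_fourier)
  moreover have "((\<lambda>s. dist (l2_mult (maxwell_symbol s) (pair_fourier P)) (l2_mult (maxwell_symbol t) (pair_fourier P))) \<longlongrightarrow> 0) (at t)"
    using l2_mult_maxwell_continuous[of t "pair_fourier P"] unfolding isCont_def by (rule tendsto_dist_iff[THEN iffD1])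
  ultimately have "((\<lambda>s. dist (maxwell_group s P) (maxwell_group t P)) \<longlongrightarrow> 0) (at t)" by simp
  then show ?thesis unfolding isCont_def by (rule tendsto_dist_iff[THEN iffD2])
qed

text \<open>By polarisation the inner product is determined by norms, and applying the isometry at
  time \<open>- t\<close> leaves these norms unchanged.\<close>

lemma maxwell_group_adjoint: "maxwell_group t P \<bullet> Q = P \<bullet> maxwell_group (- t) Q"
proof -
  have pol: "P \<bullet> Q = ((norm (P + Q))\<^sup>2 - (norm P)\<^sup>2 - (norm Q)\<^sup>2) / 2" for P Q :: "(real^3) L2 \<times> (real^3) L2"
    by (simp add: power2_norm_eq_inner inner_add_left inner_add_right inner_commute)
  have e: "norm (maxwell_group t P + Q) = norm (P + maxwell_group (- t) Q)"
  proof -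
    have "norm (maxwell_group t P + Q) = norm (maxwell_group (- t) (maxwell_group t P + Q))"
      by (simp add: norm_maxwell_group)
    also have "maxwell_group (- t) (maxwell_group t P + Q) = P + maxwell_group (- t) Q"
      by (simp add: linear_add[OF bounded_linear.linear[OF bounded_linear_maxwell_group]] maxwell_group_add)
    finally show ?thesis .
  qed
  show ?thesis
    unfolding pol[of "maxwell_group t P" Q] pol[of P "maxwell_group (- t) Q"] e by (simp add: norm_maxwell_group)
qed

section \<open>Ordinary differential equations in Banach spaces\<close>

lemma antiderivative_exists:
  fixes g :: "real \<Rightarrow> 'a::banach"
  assumes g: "continuous_on UNIV g"
  shows "\<exists>G. G c = 0 \<and> (\<forall>t. (G has_vector_derivative g t) (at t))"
proof -
  \<comment> \<open>One of the two integrals always runs over an empty or degenerate interval and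
    vanishes, so this is the signed integral from \<open>c\<close> to \<open>t\<close>.\<close>
  define G where "G t = integral {c..t} g - integral {t..c} g" for t
  have int: "g integrable_on {a..b}" for a b
    using g by (intro integrable_continuous_real) (auto intro: continuous_on_subset)
  have "(G has_vector_derivative g t) (at t)" for t
  proof -
    define a where "a = min t c - 1"
    define b where "b = max t c + 1"
    have t: "t \<in> {a<..<b}" and ac: "a < c" "c < b" by (auto simp: a_def b_def)
    have eq: "G s = integral {a..s} g - integral {a..c} g" if "s \<in> {a<..<b}" for s
    proof (cases "c \<le> s")
      case True
      then have "integral {a..c} g + integral {c..s} g = integral {a..s} g"
        using ac by (intro Henstock_Kurzweil_Integration.integral_combine int) auto
      moreover have "integral {s..c} g = 0" using True by (cases "s = c") auto
      ultimately show ?thesis by (simp add: G_def algebra_simps)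
    next
      case False
      then have "integral {a..s} g + integral {s..c} g = integral {a..c} g"
        using that by (intro Henstock_Kurzweil_Integration.integral_combine int) auto
      then show ?thesis using False by (simp add: G_def algebra_simps)
    qed
    have "((\<lambda>s. integral {a..s} g) has_vector_derivative g t) (at t within {a..b})"
      using g t by (intro integral_has_vector_derivative) (auto intro: continuous_on_subset)
    then have "((\<lambda>s. integral {a..s} g) has_vector_derivative g t) (at t)"
      using t at_within_interior[of t "{a..b}"] by simp
    then have "((\<lambda>s. integral {a..s} g - integral {a..c} g) has_vector_derivative g t) (at t)"
      using has_vector_derivative_diff[OF _ has_vector_derivative_const] by fastforce
    then show ?thesis
      by (rule has_vector_derivative_transform_within_open[OF _ open_greaterThanLessThan t]) (simp add: eq)
  qed
  moreover have "G c = 0" by (simp add: G_def)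
  ultimately show ?thesis by blast
qed

text \<open>Integrating the exponential weight gains the factor \<open>1 / L\<close>, which is the
  source of contraction in the Picard iteration. The two sides of \<open>c\<close> are treated
  separately because the weight has a kink there.\<close>

lemma exp_weight_bound:
  fixes G :: "real \<Rightarrow> 'a::banach"
  assumes G: "\<And>t. (G has_vector_derivative g t) (at t)" and G0: "G c = 0"
    and L: "L > 0" and D: "D \<ge> 0" and g: "\<And>t. norm (g t) \<le> D * exp (L * \<bar>t - c\<bar>)"
  shows "norm (G t) \<le> D / L * exp (L * \<bar>t - c\<bar>)"
proof (cases "t = c")
  case True then show ?thesis using L D G0 by simp
next
  case False
  have cont: "continuous_on S G" for S
    by (intro continuous_at_imp_continuous_on ballI has_vector_derivative_continuous[OF G])
  have e: "((\<lambda>s. D / L * exp (L * (s - c))) has_vector_derivative D * exp (L * (s - c))) (at s)"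
    "((\<lambda>s. - (D / L * exp (L * (c - s)))) has_vector_derivative D * exp (L * (c - s))) (at s)" for s
    using L unfolding has_real_derivative_iff_has_vector_derivative[symmetric]
    by (auto intro!: derivative_eq_intros simp: field_simps)
  show ?thesis
  proof (cases "c < t")
    case True
    have "norm (G t - G c) \<le> D / L * exp (L * (t - c)) - D / L * exp (L * (c - c))"
    proof (rule differentiable_bound_general[OF True cont])
      show "continuous_on {c..t} (\<lambda>s. D / L * exp (L * (s - c)))" by (intro continuous_intros)
      show "norm (g s) \<le> D * exp (L * (s - c))" if "c < s" "s < t" for s
        using g[of s] that by simp
    qed (use G e in auto)
    moreover have "0 \<le> D / L" using L D by simp
    ultimately show ?thesis using True G0 by simp
  next
    case F: False
    then have lt: "t < c" using False by simp
    have "norm (G c - G t) \<le> - (D / L * exp (L * (c - c))) - - (D / L * exp (L * (c - t)))"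
    proof (rule differentiable_bound_general[OF lt cont])
      show "continuous_on {t..c} (\<lambda>s. - (D / L * exp (L * (c - s))))" by (intro continuous_intros)
      show "norm (g s) \<le> D * exp (L * (c - s))" if "t < s" "s < c" for s
        using g[of s] that by simp
    qed (use G e in auto)
    moreover have "0 \<le> D / L" using L D by simp
    ultimately show ?thesis using lt G0 by simp
  qed
qed

text \<open>Picard iteration is a contraction for the weighted supremum norm with weight \<open>exp (2 L |t - c|)\<close>.\<close>

lemma ode_global_existence:
  fixes f :: "real \<Rightarrow> 'a::banach \<Rightarrow> 'a"
  assumes L: "L > 0" and lip: "\<And>t x y. norm (f t x - f t y) \<le> L * norm (x - y)"
    and cont: "\<And>z. continuous_on UNIV z \<Longrightarrow> continuous_on UNIV (\<lambda>t. f t (z t))"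
    and bdd: "\<And>t x. norm (f t x) \<le> C"
  shows "\<exists>z. z c = z0 \<and> (\<forall>t. (z has_vector_derivative f t (z t)) (at t))"
proof -
  define w where "w t = exp (2 * L * \<bar>t - c\<bar>)" for t
  have wpos: "w t > 0" and w1: "w t \<ge> 1" for t using L by (simp_all add: w_def)
  have wcont: "continuous_on UNIV w" unfolding w_def by (intro continuous_intros)
  \<comment> \<open>The unknown is \<open>(z - z0) / w\<close>; in this form the weighted norm is
    the ordinary supremum norm of bounded continuous functions. The bound \<open>C\<close> on
    \<open>f\<close> keeps the iterates in that space.\<close>
  define h where "h y t = f t (z0 + w t *\<^sub>R apply_bcontfun y t)" for y t
  have hcont: "continuous_on UNIV (h y)" for y
    unfolding h_def by (intro cont continuous_intros wcont) simp
  define G where "G y = (SOME G. G c = 0 \<and> (\<forall>t. (G has_vector_derivative h y t) (at t)))" for y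
  have G: "G y c = 0" "(G y has_vector_derivative h y t) (at t)" for y t
    using someI_ex[OF antiderivative_exists[OF hcont, of c y]] unfolding G_def by auto
  have Gcont: "continuous_on UNIV (G y)" for y
    by (intro continuous_at_imp_continuous_on ballI has_vector_derivative_continuous[OF G(2)])
  have C: "C \<ge> 0" using bdd[of 0 0] norm_ge_zero order_trans by blast
  have Gb: "norm (G y t) \<le> C / (2 * L) * w t" for y t
    unfolding w_def
  proof (rule exp_weight_bound[OF G(2) G(1)])
    show "norm (h y s) \<le> C * exp (2 * L * \<bar>s - c\<bar>)" for s
      using bdd[of s "z0 + w s *\<^sub>R apply_bcontfun y s"] mult_left_mono[OF w1[of s] C] by (simp add: h_def w_def)
  qed (use L C in auto)
  define T where "T y = Bcontfun (\<lambda>t. inverse (w t) *\<^sub>R G y t)" for y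
  have Tin: "(\<lambda>t. inverse (w t) *\<^sub>R G y t) \<in> bcontfun" for y
  proof (rule bcontfun_normI)
    show "continuous_on UNIV (\<lambda>t. inverse (w t) *\<^sub>R G y t)"
      using wpos by (intro continuous_intros wcont Gcont) (metis less_irrefl)
    show "norm (inverse (w t) *\<^sub>R G y t) \<le> C / (2 * L)" for t
      using Gb[of y t] wpos[of t] by (simp add: field_simps)
  qed
  have T: "apply_bcontfun (T y) t = inverse (w t) *\<^sub>R G y t" for y t
    unfolding T_def using Bcontfun_inverse[OF Tin] by simp
  have "\<exists>!y. T y = y"
  proof (rule banach_fix_type)
    show "0 \<le> (1/2::real)" "(1/2::real) < 1" by simp_all
    show "\<forall>y y'. dist (T y) (T y') \<le> 1/2 * dist y y'"
    proof (intro allI dist_bound)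
      fix y y' t
      \<comment> \<open>The Lipschitz constant \<open>L\<close> against the weight rate
        \<open>2 * L\<close> leaves the contraction factor 1/2.\<close>
      have "norm (G y t - G y' t) \<le> (L * dist y y') / (2 * L) * w t"
        unfolding w_def
      proof (rule exp_weight_bound[where G = "\<lambda>t. G y t - G y' t"])
        show "((\<lambda>t. G y t - G y' t) has_vector_derivative h y t - h y' t) (at t)" for t
          by (intro has_vector_derivative_diff G)
        show "norm (h y s - h y' s) \<le> L * dist y y' * exp (2 * L * \<bar>s - c\<bar>)" for s
        proof -
          have "norm (h y s - h y' s) \<le> L * norm (w s *\<^sub>R (apply_bcontfun y s - apply_bcontfun y' s))"
            using lip[of s "z0 + w s *\<^sub>R apply_bcontfun y s" "z0 + w s *\<^sub>R apply_bcontfun y' s"]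
            by (simp add: h_def scaleR_diff_right)
          also have "norm (w s *\<^sub>R (apply_bcontfun y s - apply_bcontfun y' s)) = w s * dist (apply_bcontfun y s) (apply_bcontfun y' s)"
            using wpos[of s] by (simp add: dist_norm)
          also have "L * (w s * dist (apply_bcontfun y s) (apply_bcontfun y' s)) \<le> L * (w s * dist y y')"
            using L wpos[of s] by (intro mult_left_mono dist_bounded) auto
          finally show ?thesis by (simp add: w_def mult_ac)
        qed
      qed (use L G in auto)
      then have "norm (G y t - G y' t) \<le> dist y y' / 2 * w t" using L by simp
      then show "dist (apply_bcontfun (T y) t) (apply_bcontfun (T y') t) \<le> 1/2 * dist y y'"
      proof -
        assume "norm (G y t - G y' t) \<le> dist y y' / 2 * w t"
        then have "inverse (w t) * norm (G y t - G y' t) \<le> inverse (w t) * (dist y y' / 2 * w t)"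
          using wpos[of t] by (intro mult_left_mono) auto
        moreover have "norm (inverse (w t) *\<^sub>R G y t - inverse (w t) *\<^sub>R G y' t) = inverse (w t) * norm (G y t - G y' t)"
          using wpos[of t] by (simp only: scaleR_diff_right[symmetric] norm_scaleR) simp
        moreover have "inverse (w t) * (dist y y' / 2 * w t) = 1/2 * dist y y'"
          using wpos[of t] by simp
        ultimately show ?thesis by (simp only: T dist_norm)
      qed
    qed
  qed
  then have "\<exists>y. T y = y" by (rule ex1_implies_ex)
  then obtain y where y: "T y = y" ..
  define z where "z t = z0 + G y t" for t
  have zw: "z t = z0 + w t *\<^sub>R apply_bcontfun y t" for t
  proof -
    have wn: "w t \<noteq> 0" using wpos[of t] by simp
    have "apply_bcontfun y t = inverse (w t) *\<^sub>R G y t" using T[of y t] unfolding y .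
    then have "w t *\<^sub>R apply_bcontfun y t = G y t"
      by (simp only: scaleR_scaleR right_inverse[OF wn] scaleR_one)
    then show ?thesis by (simp only: z_def)
  qed
  have "(z has_vector_derivative f t (z t)) (at t)" for t
  proof -
    have "((\<lambda>t. z0 + G y t) has_vector_derivative 0 + h y t) (at t)"
      by (rule has_vector_derivative_add[OF has_vector_derivative_const G(2)])
    moreover have "h y t = f t (z t)" by (simp only: h_def zw)
    moreover have "z = (\<lambda>t. z0 + G y t)" by (rule ext) (rule z_def)
    ultimately show ?thesis by (simp only: add_0_left)
  qed
  then show ?thesis by (intro exI[of _ z]) (simp add: z_def G)
qed

text \<open>Gronwall's argument on the squared distance \<open>N\<close>, which is differentiable
  thanks to the inner product. From \<open>\<bar>N'\<bar> \<le> 2 L N\<close> the product of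
  \<open>N\<close> with a suitable exponential is monotone away from \<open>c\<close> in either time
  direction.\<close>

lemma ode_unique:
  fixes f :: "real \<Rightarrow> 'a::real_inner \<Rightarrow> 'a"
  assumes lip: "\<And>t x y. norm (f t x - f t y) \<le> L * norm (x - y)"
    and x: "\<And>t. (x has_vector_derivative f t (x t)) (at t)"
    and y: "\<And>t. (y has_vector_derivative f t (y t)) (at t)"
    and init: "x c = y c"
  shows "x t = y t"
proof -
  define d where "d t = x t - y t" for t
  define N where "N t = d t \<bullet> d t" for t
  have N0: "N t \<ge> 0" for t by (simp add: N_def)
  have Nc: "N c = 0" by (simp add: N_def d_def init)
  have dd: "(d has_vector_derivative f t (x t) - f t (y t)) (at t)" for t
    unfolding d_def by (intro has_vector_derivative_diff x y)
  have dN: "(N has_real_derivative 2 * (d t \<bullet> (f t (x t) - f t (y t)))) (at t)" for t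
  proof -
    have "(N has_derivative (\<lambda>h. d t \<bullet> (h *\<^sub>R (f t (x t) - f t (y t))) + (h *\<^sub>R (f t (x t) - f t (y t))) \<bullet> d t)) (at t)"
      unfolding N_def using dd[of t] unfolding has_vector_derivative_def by (intro has_derivative_inner)
    then show ?thesis
      unfolding has_field_derivative_def by (rule has_derivative_eq_rhs) (auto simp: inner_commute algebra_simps)
  qed
  have b: "\<bar>2 * (d t \<bullet> (f t (x t) - f t (y t)))\<bar> \<le> 2 * L * N t" for t
  proof -
    have "\<bar>d t \<bullet> (f t (x t) - f t (y t))\<bar> \<le> norm (d t) * norm (f t (x t) - f t (y t))"
      by (rule Cauchy_Schwarz_ineq2)
    also have "\<dots> \<le> norm (d t) * (L * norm (d t))"
      unfolding d_def by (intro mult_left_mono lip) simp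
    also have "\<dots> = L * N t" by (simp add: N_def dot_square_norm power2_eq_square)
    finally show ?thesis by (simp add: abs_mult)
  qed
  have "N t \<le> 0"
  proof (cases "c \<le> t")
    case True
    have "exp (- (2 * L * t)) * N t \<le> exp (- (2 * L * c)) * N c"
    proof (rule DERIV_nonpos_imp_nonincreasing[OF True])
      fix s
      have "((\<lambda>s. exp (- (2 * L * s)) * N s) has_real_derivative
          exp (- (2 * L * s)) * (2 * (d s \<bullet> (f s (x s) - f s (y s))) - 2 * L * N s)) (at s)"
        by (auto intro!: derivative_eq_intros dN simp: algebra_simps)
      moreover have "exp (- (2 * L * s)) * (2 * (d s \<bullet> (f s (x s) - f s (y s))) - 2 * L * N s) \<le> 0"
        using b[of s] by (intro mult_nonneg_nonpos) auto
      ultimately show "\<exists>y. ((\<lambda>s. exp (- (2 * L * s)) * N s) has_real_derivative y) (at s) \<and> y \<le> 0" by blast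
    qed
    then show ?thesis using Nc by (simp add: mult_le_0_iff)
  next
    case False
    then have le: "t \<le> c" by simp
    have "exp (2 * L * t) * N t \<le> exp (2 * L * c) * N c"
    proof (rule DERIV_nonneg_imp_nondecreasing[OF le])
      fix s
      have "((\<lambda>s. exp (2 * L * s) * N s) has_real_derivative
          exp (2 * L * s) * (2 * (d s \<bullet> (f s (x s) - f s (y s))) + 2 * L * N s)) (at s)"
        by (auto intro!: derivative_eq_intros dN simp: algebra_simps)
      moreover have "0 \<le> exp (2 * L * s) * (2 * (d s \<bullet> (f s (x s) - f s (y s))) + 2 * L * N s)"
        using b[of s] by (intro mult_nonneg_nonneg) auto
      ultimately show "\<exists>y. ((\<lambda>s. exp (2 * L * s) * N s) has_real_derivative y) (at s) \<and> 0 \<le> y" by blast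
    qed
    then show ?thesis using Nc by (simp add: mult_le_0_iff)
  qed
  then have "N t = 0" using N0[of t] by simp
  then have "d t = 0" unfolding N_def by (simp only: inner_eq_zero_iff)
  then show ?thesis by (simp add: d_def)
qed

section \<open>Radial truncation\<close>

definition radial_trunc :: "real \<Rightarrow> 'a::real_normed_vector \<Rightarrow> 'a" where
  "radial_trunc R y = (if norm y \<le> R then y else (R / norm y) *\<^sub>R y)"

lemma norm_radial_trunc: "R \<ge> 0 \<Longrightarrow> norm (radial_trunc R y) \<le> R"
  by (auto simp: radial_trunc_def)

text \<open>The triangle inequality alone gives the constant 2; one term measures the displacement
  of the points, the other the difference of their norms.\<close>

lemma radial_trunc_lipschitz:
  assumes R: "R > 0"
  shows "norm (radial_trunc R x - radial_trunc R y) \<le> 2 * norm (x - y)"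
proof -
  have mixed: "norm (x - (R / norm y) *\<^sub>R y) \<le> 2 * norm (x - y)" if "norm x \<le> R" "norm y > R" for x y :: 'a
  proof -
    have "y - (R / norm y) *\<^sub>R y = (1 - R / norm y) *\<^sub>R y" by (simp add: algebra_simps)
    then have "norm (y - (R / norm y) *\<^sub>R y) = \<bar>1 - R / norm y\<bar> * norm y" by simp
    also have "\<bar>1 - R / norm y\<bar> = 1 - R / norm y" using that R
      by (intro abs_of_nonneg) (simp add: divide_le_eq_1)
    also have "(1 - R / norm y) * norm y = norm y - R" using that R by (auto simp add: left_diff_distrib)
    finally have "norm (y - (R / norm y) *\<^sub>R y) = norm y - R" .
    moreover have "norm y - norm x \<le> norm (x - y)" using norm_triangle_ineq2[of y x] by (simp add: norm_minus_commute)
    ultimately show ?thesis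
      using norm_triangle_ineq[of "x - y" "y - (R / norm y) *\<^sub>R y"] that by simp
  qed
  consider "norm x \<le> R" "norm y \<le> R" | "norm x \<le> R" "norm y > R" | "norm x > R" "norm y \<le> R" | "norm x > R" "norm y > R"
    by linarith
  then show ?thesis
  proof cases
    case 1 then show ?thesis by (simp add: radial_trunc_def)
  next
    case 2 then show ?thesis using mixed[of x y] by (simp add: radial_trunc_def)
  next
    case 3 then show ?thesis using mixed[of y x] by (simp add: radial_trunc_def norm_minus_commute)
  next
    case 4
    have nz: "norm x > 0" "norm y > 0" using 4 R by auto
    \<comment> \<open>Factoring out \<open>R / norm x\<close>, which is at most 1, leaves the
      displacement plus a radial correction of size
      \<open>\<bar>norm y - norm x\<bar>\<close>.\<close>
    have "(R / norm x) *\<^sub>R x - (R / norm y) *\<^sub>R y = (R / norm x) *\<^sub>R ((x - y) + ((norm y - norm x) / norm y) *\<^sub>R y)"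
    proof -
      have "(R / norm x) * ((norm y - norm x) / norm y) = R / norm x - R / norm y"
        using nz by (simp add: field_simps)
      then show ?thesis by (simp add: scaleR_right_distrib scaleR_diff_right scaleR_diff_left)
    qed
    then have "norm ((R / norm x) *\<^sub>R x - (R / norm y) *\<^sub>R y) = R / norm x * norm ((x - y) + ((norm y - norm x) / norm y) *\<^sub>R y)"
      using R nz by (simp only: norm_scaleR) simp
    also have "\<dots> \<le> 1 * norm ((x - y) + ((norm y - norm x) / norm y) *\<^sub>R y)"
      using 4 nz by (intro mult_right_mono) auto
    also have "\<dots> \<le> norm (x - y) + \<bar>norm y - norm x\<bar>"
      using norm_triangle_ineq[of "x - y" "((norm y - norm x) / norm y) *\<^sub>R y"] nz by simp
    also have "\<dots> \<le> 2 * norm (x - y)"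
      using norm_triangle_ineq3[of y x] by (simp add: norm_minus_commute)
    finally show ?thesis using 4 by (simp add: radial_trunc_def)
  qed
qed

text \<open>The direction is kept, so a vector orthogonal to the truncated point is orthogonal to
  the point itself; this carries energy conservation over to the truncated equation.\<close>

lemma radial_trunc_scale:
  assumes "R > 0" shows "\<exists>s>0. y = s *\<^sub>R radial_trunc R y"
proof (cases "norm y \<le> R")
  case True
  then show ?thesis by (intro exI[of _ 1]) (simp add: radial_trunc_def)
next
  case False
  then show ?thesis using assms by (intro exI[of _ "norm y / R"]) (auto simp: radial_trunc_def)
qed

section \<open>Oriented integrals\<close>

lemma has_oriented_integral_FTC:
  fixes G :: "real \<Rightarrow> 'a::banach"
  assumes "\<And>s. (G has_vector_derivative g s) (at s)"
  shows "has_oriented_integral g (G b - G a) a b"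
proof -
  have "(g has_integral (G y - G x)) {x..y}" if "x \<le> y" for x y
    using that by (rule fundamental_theorem_of_calculus) (rule has_vector_derivative_at_within[OF assms])
  from this[of a b] this[of b a] show ?thesis by (simp add: has_oriented_integral_def)
qed

lemma has_oriented_integral_unique:
  assumes "has_oriented_integral g I a b" "has_oriented_integral g J a b"
  shows "I = J"
  using assms by (auto simp: has_oriented_integral_def split: if_splits dest: has_integral_unique)

lemma has_oriented_integral_linear:
  assumes "has_oriented_integral g I a b" "bounded_linear T"
  shows "has_oriented_integral (\<lambda>s. T (g s)) (T I) a b"
proof -
  have "T (- I) = - T I" by (rule linear_neg[OF bounded_linear.linear[OF assms(2)]])
  then show ?thesis
    using assms(1) has_integral_linear[OF _ assms(2), of g I] has_integral_linear[OF _ assms(2), of g "- I"]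
    by (auto simp: has_oriented_integral_def o_def split: if_splits)
qed

section \<open>A particle coupled to a field with unitary free evolution\<close>

lemma norm_cross3_le: "norm (cross3 x y) \<le> norm x * norm y"
proof -
  have "(norm (cross3 x y))\<^sup>2 \<le> (norm x * norm y)\<^sup>2"
    by (simp add: norm_cross power_mult_distrib)
  then show ?thesis by (rule power2_le_imp_le) simp
qed

lemma norm_constant_if_orthogonal:
  fixes y :: "real \<Rightarrow> 'a::real_inner"
  assumes "\<And>t. (y has_vector_derivative y' t) (at t)" "\<And>t. y t \<bullet> y' t = 0"
  shows "norm (y s) = norm (y t)"
proof -
  have "((\<lambda>t. y t \<bullet> y t) has_real_derivative 0) (at t)" for t
  proof -
    have "((\<lambda>t. y t \<bullet> y t) has_derivative (\<lambda>h. y t \<bullet> (h *\<^sub>R y' t) + (h *\<^sub>R y' t) \<bullet> y t)) (at t)"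
      using assms(1)[of t] unfolding has_vector_derivative_def by (intro has_derivative_inner)
    then show ?thesis
      unfolding has_field_derivative_def
      by (rule has_derivative_eq_rhs) (auto simp: assms(2) inner_commute)
  qed
  then have "y s \<bullet> y s = y t \<bullet> y t" by (intro DERIV_isconst_all[of "\<lambda>t. y t \<bullet> y t"]) simp
  then show ?thesis by (simp add: norm_eq_sqrt_inner)
qed

lemma norm_fst_snd_le: "norm (fst p) \<le> norm p" "norm (snd p) \<le> norm p"
  by (cases p, simp add: norm_fst_le norm_snd_le)+

text \<open>Here \<open>S\<close> is the current map, \<open>D\<close> the field felt by the
  particle including the charge factor, and \<open>c\<close> the initial time. The adjointness
  \<open>D_adj\<close> serves twice: it makes the exchange of energy between field and particle
  balance, and it transfers the bounds on \<open>S\<close> to \<open>D\<close>. The constant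
  \<open>C\<close> is uniform in the position.\<close>

locale particle_field =
  fixes U :: "real \<Rightarrow> 'k::{real_inner,banach} \<times> 'k \<Rightarrow> 'k \<times> 'k"
    and S :: "real^3 \<Rightarrow> real^3 \<Rightarrow> 'k"
    and D :: "real^3 \<Rightarrow> 'k \<Rightarrow> real^3"
    and C c :: real
  assumes U_bounded_linear: "bounded_linear (U t)"
    and U_adj: "U t P \<bullet> Q = P \<bullet> U (- t) Q"
    and U_add: "U s (U t P) = U (s + t) P"
    and U_0: "U 0 P = P"
    and U_cont: "isCont (\<lambda>t. U t P) t"
    and S_linear: "linear (S \<xi>)"
    and S_bound: "norm (S \<xi> w) \<le> C * norm w"
    and S_lip: "norm (S \<xi> w - S \<xi>' w) \<le> C * norm (\<xi> - \<xi>') * norm w"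
    and D_adj: "w \<bullet> D \<xi> E = S \<xi> w \<bullet> E"
    and C_pos: "C > 0"
begin

lemma U_linear: "linear (U t)" using U_bounded_linear by (rule bounded_linear.linear)

lemma U_norm: "norm (U t P) = norm P"
  by (simp add: norm_eq_sqrt_inner U_adj[of t] U_add U_0)

lemma U_inverse: "U (a - b) (U (b - a) P) = P" by (simp add: U_add U_0)

text \<open>Linearity of \<open>D\<close> is not an axiom of the locale; an adjoint is automatically
  linear.\<close>

lemma D_diff: "D \<xi> (E - F) = D \<xi> E - D \<xi> F"
  by (rule vector_eq_ldot[THEN iffD1]) (simp add: D_adj inner_diff_right)

text \<open>Duality: adjointness is applied to the vector \<open>D \<xi> E\<close> itself and one
  factor of its norm is cancelled.\<close>

lemma D_bound: "norm (D \<xi> E) \<le> C * norm E"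
proof -
  have "(norm (D \<xi> E))\<^sup>2 = S \<xi> (D \<xi> E) \<bullet> E"
    by (simp add: power2_norm_eq_inner D_adj)
  also have "\<dots> \<le> norm (S \<xi> (D \<xi> E)) * norm E" by (rule norm_cauchy_schwarz)
  also have "\<dots> \<le> (C * norm (D \<xi> E)) * norm E" by (intro mult_right_mono S_bound) simp
  finally have "norm (D \<xi> E) * norm (D \<xi> E) \<le> norm (D \<xi> E) * (C * norm E)"
    by (simp add: power2_eq_square mult_ac)
  then show ?thesis using C_pos by (cases "D \<xi> E = 0") auto
qed

lemma D_lip: "norm (D \<xi> E - D \<xi>' E) \<le> C * norm (\<xi> - \<xi>') * norm E"
proof -
  let ?d = "D \<xi> E - D \<xi>' E"
  have "(norm ?d)\<^sup>2 = (S \<xi> ?d - S \<xi>' ?d) \<bullet> E"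
    unfolding power2_norm_eq_inner inner_diff_left[of "S \<xi> ?d"] D_adj[symmetric] inner_diff_right[of ?d] ..
  also have "\<dots> \<le> norm (S \<xi> ?d - S \<xi>' ?d) * norm E" by (rule norm_cauchy_schwarz)
  also have "\<dots> \<le> (C * norm (\<xi> - \<xi>') * norm ?d) * norm E" by (intro mult_right_mono S_lip) simp
  finally have "norm ?d * norm ?d \<le> norm ?d * (C * norm (\<xi> - \<xi>') * norm E)"
    by (simp add: power2_eq_square mult_ac)
  then show ?thesis using C_pos by (cases "?d = 0") auto
qed

definition force :: "real^3 \<Rightarrow> real^3 \<Rightarrow> 'k \<times> 'k \<Rightarrow> real^3" where
  "force \<xi> w P = D \<xi> (fst P) + cross3 w (D \<xi> (snd P))"

text \<open>The vector field in the interaction picture: the field variable is \<open>F t = U (c - t) (P t)\<close>,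
  which is differentiable although \<open>P\<close> in general is not.\<close>

definition field :: "real \<Rightarrow> real^3 \<Rightarrow> ('k \<times> 'k) \<times> (real^3) \<Rightarrow> ('k \<times> 'k) \<times> (real^3)" where
  "field t \<xi> y = (U (c - t) (- S \<xi> (snd y), 0), force \<xi> (snd y) (U (t - c) (fst y)))"

text \<open>Energy conservation; it keeps solutions of the radially truncated equation inside the region
  where the truncation is inactive.\<close>

lemma field_orthogonal: "y \<bullet> field t \<xi> y = 0"
proof -
  obtain F w where y: "y = (F, w)" by (cases y)
  obtain E B where P: "U (t - c) F = (E, B)" by (cases "U (t - c) F")
  have "F \<bullet> U (c - t) (- S \<xi> w, 0) = U (t - c) F \<bullet> (- S \<xi> w, 0)" by (simp add: U_adj[of "t - c"])
  also have "\<dots> = - (w \<bullet> D \<xi> E)" by (simp add: P D_adj inner_commute)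
  finally show ?thesis
    by (simp add: y field_def force_def P inner_add_right dot_cross_self)
qed

lemma S_diff_bound:
  assumes "norm w' \<le> R"
  shows "norm (S \<xi> w - S \<xi>' w') \<le> C * norm (w - w') + C * norm (\<xi> - \<xi>') * R"
proof -
  have "S \<xi> w - S \<xi>' w' = S \<xi> (w - w') + (S \<xi> w' - S \<xi>' w')"
    by (simp add: linear_diff[OF S_linear])
  then have "norm (S \<xi> w - S \<xi>' w') \<le> norm (S \<xi> (w - w')) + norm (S \<xi> w' - S \<xi>' w')"
    by (metis norm_triangle_ineq)
  also have "\<dots> \<le> C * norm (w - w') + C * norm (\<xi> - \<xi>') * norm w'"
    by (intro add_mono S_bound S_lip)
  also have "\<dots> \<le> C * norm (w - w') + C * norm (\<xi> - \<xi>') * R"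
    using assms C_pos by (intro add_left_mono mult_left_mono) auto
  finally show ?thesis .
qed

lemma D_diff_bound:
  assumes "norm E' \<le> R"
  shows "norm (D \<xi> E - D \<xi>' E') \<le> C * norm (E - E') + C * norm (\<xi> - \<xi>') * R"
proof -
  have "D \<xi> E - D \<xi>' E' = D \<xi> (E - E') + (D \<xi> E' - D \<xi>' E')" by (simp add: D_diff)
  then have "norm (D \<xi> E - D \<xi>' E') \<le> norm (D \<xi> (E - E')) + norm (D \<xi> E' - D \<xi>' E')"
    by (metis norm_triangle_ineq)
  also have "\<dots> \<le> C * norm (E - E') + C * norm (\<xi> - \<xi>') * norm E'"
    by (intro add_mono D_bound D_lip)
  also have "\<dots> \<le> C * norm (E - E') + C * norm (\<xi> - \<xi>') * R"
    using assms C_pos by (intro add_left_mono mult_left_mono) auto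
  finally show ?thesis .
qed

lemma norm_fst_diff_le: "norm (fst P - fst Q) \<le> norm (P - Q)"
  by (metis fst_diff norm_fst_snd_le(1))

lemma norm_snd_diff_le: "norm (snd P - snd Q) \<le> norm (P - Q)"
  by (metis snd_diff norm_fst_snd_le(2))

text \<open>The magnetic term is a product of velocity and field, so the estimate is confined to a
  ball of radius \<open>R\<close>. The factor \<open>(1 + R)^2\<close> dominates each of the
  coefficients \<open>R + R^2\<close>, \<open>R\<close> and \<open>1 + R\<close> that arise.\<close>

lemma force_diff_bound:
  assumes w: "norm w' \<le> R" and P: "norm P \<le> R" "norm P' \<le> R"
  shows "norm (force \<xi> w P - force \<xi>' w' P') \<le> C * (1 + R)\<^sup>2 * (norm (\<xi> - \<xi>') + norm (w - w') + norm (P - P'))"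
proof -
  have R: "R \<ge> 0" using w norm_ge_zero order_trans by blast
  let ?x = "norm (\<xi> - \<xi>')" and ?w = "norm (w - w')" and ?P = "norm (P - P')"
  have fs: "norm (fst P') \<le> R" "norm (snd P') \<le> R" "norm (snd P) \<le> R"
    using P norm_fst_snd_le(1)[of P'] norm_fst_snd_le(2)[of P'] norm_fst_snd_le(2)[of P] by linarith+
  have 1: "norm (D \<xi> (fst P) - D \<xi>' (fst P')) \<le> C * ?P + C * ?x * R"
    using D_diff_bound[OF fs(1), of \<xi> "fst P" \<xi>'] mult_left_mono[OF norm_fst_diff_le[of P P'] less_imp_le[OF C_pos]] by linarith
  have 2: "norm (D \<xi> (snd P) - D \<xi>' (snd P')) \<le> C * ?P + C * ?x * R"
    using D_diff_bound[OF fs(2), of \<xi> "snd P" \<xi>'] mult_left_mono[OF norm_snd_diff_le[of P P'] less_imp_le[OF C_pos]] by linarith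
  have 3: "norm (D \<xi> (snd P)) \<le> C * R"
    using D_bound[of \<xi> "snd P"] mult_left_mono[OF fs(3) less_imp_le[OF C_pos]] by linarith
  have "cross3 w (D \<xi> (snd P)) - cross3 w' (D \<xi>' (snd P')) =
      cross3 (w - w') (D \<xi> (snd P)) + cross3 w' (D \<xi> (snd P) - D \<xi>' (snd P'))"
    by (simp add: Cross3.left_diff_distrib Cross3.right_diff_distrib)
  then have "norm (cross3 w (D \<xi> (snd P)) - cross3 w' (D \<xi>' (snd P'))) \<le>
      ?w * norm (D \<xi> (snd P)) + norm w' * norm (D \<xi> (snd P) - D \<xi>' (snd P'))"
    by (metis add_mono norm_cross3_le norm_triangle_le)
  also have "\<dots> \<le> ?w * (C * R) + R * (C * ?P + C * ?x * R)"
    by (intro add_mono mult_mono 2 3 w R) auto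
  finally have 4: "norm (cross3 w (D \<xi> (snd P)) - cross3 w' (D \<xi>' (snd P'))) \<le> ?w * (C * R) + R * (C * ?P + C * ?x * R)" .
  have "norm (force \<xi> w P - force \<xi>' w' P') \<le> norm (D \<xi> (fst P) - D \<xi>' (fst P')) +
      norm (cross3 w (D \<xi> (snd P)) - cross3 w' (D \<xi>' (snd P')))"
    unfolding force_def by (metis add_diff_add norm_triangle_ineq)
  also have "\<dots> \<le> (C * ?P + C * ?x * R) + (?w * (C * R) + R * (C * ?P + C * ?x * R))"
    by (intro add_mono 1 4)
  also have "\<dots> = C * ((R + R\<^sup>2) * ?x + R * ?w + (1 + R) * ?P)"
    by (simp add: algebra_simps power2_eq_square)
  also have "\<dots> \<le> C * ((1 + R)\<^sup>2 * ?x + (1 + R)\<^sup>2 * ?w + (1 + R)\<^sup>2 * ?P)"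
    using C_pos R by (intro mult_left_mono add_mono mult_right_mono) (auto simp: power2_eq_square algebra_simps)
  finally show ?thesis by (simp add: algebra_simps)
qed

lemma field_diff_bound:
  assumes y: "norm y \<le> R" "norm y' \<le> R"
  shows "norm (field t \<xi> y - field t \<xi>' y') \<le> 4 * (C * (1 + R)\<^sup>2) * (norm (\<xi> - \<xi>') + norm (y - y'))"
proof -
  have R: "R \<ge> 0" using y(1) norm_ge_zero order_trans by blast
  let ?K = "C * (1 + R)\<^sup>2"
  let ?x = "norm (\<xi> - \<xi>')" and ?w = "norm (snd y - snd y')" and ?F = "norm (fst y - fst y')"
  have K: "C \<le> ?K" "C * R \<le> ?K"
    using C_pos R by (auto simp: power2_eq_square algebra_simps)
  have w: "norm (snd y') \<le> R" "norm (U (t - c) (fst y)) \<le> R" "norm (U (t - c) (fst y')) \<le> R"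
    using y norm_fst_snd_le(2)[of y'] norm_fst_snd_le(1)[of y] norm_fst_snd_le(1)[of y'] unfolding U_norm by linarith+
  have "U (c - t) (- S \<xi> (snd y), 0) - U (c - t) (- S \<xi>' (snd y'), 0) = U (c - t) (- (S \<xi> (snd y) - S \<xi>' (snd y')), 0)"
    by (simp flip: linear_diff[OF U_linear])
  then have "norm (U (c - t) (- S \<xi> (snd y), 0) - U (c - t) (- S \<xi>' (snd y'), 0)) = norm (S \<xi> (snd y) - S \<xi>' (snd y'))"
    by (simp only: U_norm norm_Pair) (simp add: norm_minus_commute)
  also have "\<dots> \<le> C * ?w + C * ?x * R" by (rule S_diff_bound[OF w(1)])
  also have "\<dots> = C * ?w + (C * R) * ?x" by simp
  also have "\<dots> \<le> ?K * ?w + ?K * ?x"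
    by (intro add_mono mult_right_mono K) auto
  finally have 1: "norm (U (c - t) (- S \<xi> (snd y), 0) - U (c - t) (- S \<xi>' (snd y'), 0)) \<le> ?K * ?w + ?K * ?x" .
  have "norm (U (t - c) (fst y) - U (t - c) (fst y')) = ?F"
    by (simp add: U_norm flip: linear_diff[OF U_linear])
  with force_diff_bound[OF w, of \<xi> "snd y" \<xi>']
  have 2: "norm (force \<xi> (snd y) (U (t - c) (fst y)) - force \<xi>' (snd y') (U (t - c) (fst y'))) \<le> ?K * (?x + ?w + ?F)"
    by simp
  have "norm (field t \<xi> y - field t \<xi>' y') \<le> (?K * ?w + ?K * ?x) + ?K * (?x + ?w + ?F)"
    unfolding field_def diff_Pair by (rule order_trans[OF norm_Pair_le add_mono[OF 1 2]])
  also have "\<dots> = ?K * (2 * ?x + 2 * ?w + ?F)" by (simp add: algebra_simps)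
  \<comment> \<open>Both components of a difference are bounded by its norm, so at most three copies
    of \<open>norm (y - y')\<close> occur; 4 is a convenient upper bound.\<close>
  also have "\<dots> \<le> ?K * (4 * (?x + norm (y - y')))"
  proof (rule mult_left_mono)
    show "2 * ?x + 2 * ?w + ?F \<le> 4 * (?x + norm (y - y'))"
      using norm_fst_diff_le[of y y'] norm_snd_diff_le[of y y'] norm_ge_zero[of "\<xi> - \<xi>'"] norm_ge_zero[of "y - y'"]
      by argo
  qed (use C_pos in simp)
  also have "\<dots> = 4 * ?K * (?x + norm (y - y'))" by (simp only: mult_ac)
  finally show ?thesis .
qed

text \<open>Strong continuity handles the moving time at a frozen vector, and the isometry handles
  the moving vector uniformly in time; together they give joint continuity.\<close>

lemma continuous_on_U:
  fixes h :: "'z::metric_space \<Rightarrow> real"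
  assumes "continuous_on UNIV h" "continuous_on UNIV p"
  shows "continuous_on UNIV (\<lambda>t. U (h t) (p t))"
  unfolding continuous_on_def
proof (intro ballI)
  fix t :: 'z
  have h: "(h \<longlongrightarrow> h t) (at t)" and p: "(p \<longlongrightarrow> p t) (at t)"
    using assms by (simp_all add: continuous_on_def)
  have "((\<lambda>s. U (h s) (p t)) \<longlongrightarrow> U (h t) (p t)) (at t)"
    by (rule isCont_tendsto_compose[OF U_cont h])
  moreover have "((\<lambda>s. U (h s) (p s - p t)) \<longlongrightarrow> 0) (at t)"
  proof (rule tendsto_norm_zero_cancel)
    show "((\<lambda>s. norm (U (h s) (p s - p t))) \<longlongrightarrow> 0) (at t)"
      unfolding U_norm using p by (simp add: LIM_zero tendsto_norm_zero)
  qed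
  ultimately have "((\<lambda>s. U (h s) (p t) + U (h s) (p s - p t)) \<longlongrightarrow> U (h t) (p t) + 0) (at t)"
    by (rule tendsto_add)
  moreover have "U (h s) (p t) + U (h s) (p s - p t) = U (h s) (p s)" for s
    by (simp add: linear_diff[OF U_linear])
  ultimately show "((\<lambda>t. U (h t) (p t)) \<longlongrightarrow> U (h t) (p t)) (at t within UNIV)" by simp
qed

lemma continuous_on_S:
  fixes x w :: "'z::metric_space \<Rightarrow> real^3"
  assumes x: "continuous_on UNIV x" and w: "continuous_on UNIV w"
  shows "continuous_on UNIV (\<lambda>t. S (x t) (w t))"
  unfolding continuous_on_def
proof (intro ballI)
  fix t
  have X: "(x \<longlongrightarrow> x t) (at t)" and W: "(w \<longlongrightarrow> w t) (at t)"
    using assms by (simp_all add: continuous_on_def)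
  have "((\<lambda>s. C * norm (w s - w t) + C * norm (x s - x t) * norm (w t)) \<longlongrightarrow> C * norm (w t - w t) + C * norm (x t - x t) * norm (w t)) (at t)"
    by (intro tendsto_intros X W)
  then have "((\<lambda>s. C * norm (w s - w t) + C * norm (x s - x t) * norm (w t)) \<longlongrightarrow> 0) (at t)" by simp
  then have "((\<lambda>s. S (x s) (w s) - S (x t) (w t)) \<longlongrightarrow> 0) (at t)"
    by (rule Lim_null_comparison[rotated]) (simp add: always_eventually S_diff_bound)
  then show "((\<lambda>t. S (x t) (w t)) \<longlongrightarrow> S (x t) (w t)) (at t within UNIV)"
    by (simp add: LIM_zero_cancel)
qed

lemma continuous_on_D:
  fixes x :: "'z::metric_space \<Rightarrow> real^3"
  assumes x: "continuous_on UNIV x" and p: "continuous_on UNIV p"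
  shows "continuous_on UNIV (\<lambda>t. D (x t) (p t))"
  unfolding continuous_on_def
proof (intro ballI)
  fix t
  have X: "(x \<longlongrightarrow> x t) (at t)" and W: "(p \<longlongrightarrow> p t) (at t)"
    using assms by (simp_all add: continuous_on_def)
  have "((\<lambda>s. C * norm (p s - p t) + C * norm (x s - x t) * norm (p t)) \<longlongrightarrow> C * norm (p t - p t) + C * norm (x t - x t) * norm (p t)) (at t)"
    by (intro tendsto_intros X W)
  then have "((\<lambda>s. C * norm (p s - p t) + C * norm (x s - x t) * norm (p t)) \<longlongrightarrow> 0) (at t)" by simp
  then have "((\<lambda>s. D (x s) (p s) - D (x t) (p t)) \<longlongrightarrow> 0) (at t)"
    by (rule Lim_null_comparison[rotated]) (simp add: always_eventually D_diff_bound)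
  then show "((\<lambda>t. D (x t) (p t)) \<longlongrightarrow> D (x t) (p t)) (at t within UNIV)"
    by (simp add: LIM_zero_cancel)
qed

lemma continuous_on_force:
  fixes x w :: "'z::metric_space \<Rightarrow> real^3"
  assumes "continuous_on UNIV x" "continuous_on UNIV w" "continuous_on UNIV P"
  shows "continuous_on UNIV (\<lambda>t. force (x t) (w t) (P t))"
  unfolding force_def
  by (intro continuous_on_add continuous_on_cross continuous_on_D assms continuous_on_fst continuous_on_snd)

lemma continuous_on_field:
  fixes h :: "real \<Rightarrow> real"
  assumes "continuous_on UNIV x" "continuous_on UNIV y"
  shows "continuous_on UNIV (\<lambda>t. field t (x t) (y t))"
  unfolding field_def
  by (intro continuous_on_Pair continuous_on_U continuous_on_force continuous_on_minus continuous_on_S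
      continuous_on_fst continuous_on_snd continuous_on_const continuous_on_diff continuous_on_id assms)

text \<open>The position is kept apart from the pair of field and velocity, because only the latter
  enters the conserved energy.\<close>

definition solves :: "(real \<Rightarrow> 'k \<times> 'k) \<Rightarrow> (real \<Rightarrow> real^3) \<Rightarrow> (real \<Rightarrow> real^3) \<Rightarrow> bool" where
  "solves F \<xi> v \<longleftrightarrow> (\<forall>t. (\<xi> has_vector_derivative v t) (at t) \<and>
     ((\<lambda>t. (F t, v t)) has_vector_derivative field t (\<xi> t) (F t, v t)) (at t))"

text \<open>The velocity in the position equation is truncated as well: this makes the entire right
  side bounded, as global existence requires.\<close>

definition trunc_field :: "real \<Rightarrow> real \<Rightarrow> (real^3) \<times> (('k \<times> 'k) \<times> (real^3)) \<Rightarrow> (real^3) \<times> (('k \<times> 'k) \<times> (real^3))" where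
  "trunc_field R t z = (snd (radial_trunc R (snd z)), field t (fst z) (radial_trunc R (snd z)))"

text \<open>The truncation contributes a factor 2. In the position equation this gives the summand
  2; in the field equation the constant 4 meets \<open>1 + 2\<close>, one unit for the position and
  two for the truncated pair, hence 12.\<close>

lemma trunc_field_lipschitz:
  assumes R: "R > 0"
  shows "norm (trunc_field R t z - trunc_field R t z') \<le> (2 + 12 * (C * (1 + R)\<^sup>2)) * norm (z - z')"
proof -
  let ?K = "C * (1 + R)\<^sup>2"
  let ?y = "radial_trunc R (snd z)" and ?y' = "radial_trunc R (snd z')"
  have K: "?K \<ge> 0" using C_pos by simp
  have "norm (snd z - snd z') \<le> norm (z - z')" by (metis snd_diff norm_fst_snd_le(2))
  then have 1: "norm (?y - ?y') \<le> 2 * norm (z - z')"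
    using radial_trunc_lipschitz[OF R, of "snd z" "snd z'"] by linarith
  have 2: "norm (fst z - fst z') \<le> norm (z - z')" by (metis fst_diff norm_fst_snd_le(1))
  have "norm (trunc_field R t z - trunc_field R t z') \<le>
      norm (snd ?y - snd ?y') + norm (field t (fst z) ?y - field t (fst z') ?y')"
    unfolding trunc_field_def diff_Pair by (rule norm_Pair_le)
  also have "\<dots> \<le> 2 * norm (z - z') + 4 * ?K * (norm (fst z - fst z') + norm (?y - ?y'))"
    using R 1 norm_fst_snd_le(2)[of "?y - ?y'"] by (intro add_mono field_diff_bound norm_radial_trunc) (auto simp: snd_diff)
  also have "\<dots> \<le> 2 * norm (z - z') + 4 * ?K * (norm (z - z') + 2 * norm (z - z'))"
    using 1 2 K by (intro add_left_mono mult_left_mono add_mono) auto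
  finally show ?thesis by (simp add: algebra_simps)
qed

text \<open>The vector field vanishes at \<open>y = 0\<close> for every position, so its Lipschitz
  bound on the ball is also a bound on its size.\<close>

lemma trunc_field_bound:
  assumes R: "R > 0"
  shows "norm (trunc_field R t z) \<le> R + 4 * (C * (1 + R)\<^sup>2) * R"
proof -
  let ?y = "radial_trunc R (snd z)"
  have y: "norm ?y \<le> R" using R by (simp add: norm_radial_trunc)
  have f0: "field t (fst z) 0 = 0"
  proof -
    have "force \<xi> 0 (0, 0) = 0" for \<xi> using D_bound[of \<xi> 0] by (simp add: force_def)
    moreover have "U s (0, 0) = (0, 0)" for s using linear_0[OF U_linear, of s] by (simp add: zero_prod_def)
    ultimately show ?thesis by (simp add: field_def linear_0[OF S_linear] zero_prod_def)
  qed
  have "norm (trunc_field R t z) \<le> norm (snd ?y) + norm (field t (fst z) ?y)"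
    unfolding trunc_field_def by (rule norm_Pair_le)
  also have "\<dots> \<le> R + 4 * (C * (1 + R)\<^sup>2) * norm ?y"
    using field_diff_bound[OF y, of 0 t "fst z" "fst z"] y norm_fst_snd_le(2)[of ?y] R by (simp add: f0)
  also have "\<dots> \<le> R + 4 * (C * (1 + R)\<^sup>2) * R"
    using y C_pos by (intro add_left_mono mult_left_mono) auto
  finally show ?thesis .
qed

lemma continuous_on_radial_trunc:
  assumes R: "R > 0" and y: "continuous_on UNIV y"
  shows "continuous_on UNIV (\<lambda>t. radial_trunc R (y t))"
  unfolding continuous_on_def
proof (intro ballI)
  fix t
  have "((\<lambda>s. 2 * norm (y s - y t)) \<longlongrightarrow> 2 * norm (y t - y t)) (at t)"
    using y by (intro tendsto_intros) (simp add: continuous_on_def)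
  then have "((\<lambda>s. 2 * norm (y s - y t)) \<longlongrightarrow> 0) (at t)" by simp
  then have "((\<lambda>s. radial_trunc R (y s) - radial_trunc R (y t)) \<longlongrightarrow> 0) (at t)"
    by (rule Lim_null_comparison[rotated]) (simp add: always_eventually radial_trunc_lipschitz[OF R])
  then show "((\<lambda>t. radial_trunc R (y t)) \<longlongrightarrow> radial_trunc R (y t)) (at t within UNIV)"
    by (simp add: LIM_zero_cancel)
qed

text \<open>By energy conservation a solution keeps the norm of its initial pair and therefore never
  meets the truncation.\<close>

lemma solves_trunc:
  assumes s: "solves F \<xi> v" and R: "norm (F c, v c) \<le> R"
  shows "((\<lambda>t. (\<xi> t, (F t, v t))) has_vector_derivative trunc_field R t (\<xi> t, (F t, v t))) (at t)"
proof -
  have "norm (F t, v t) = norm (F c, v c)"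
    by (rule norm_constant_if_orthogonal[where y = "\<lambda>t. (F t, v t)" and y' = "\<lambda>t. field t (\<xi> t) (F t, v t)"])
      (use s in \<open>auto simp: solves_def field_orthogonal\<close>)
  then have "radial_trunc R (F t, v t) = (F t, v t)" using R by (simp add: radial_trunc_def)
  then show ?thesis
    using s unfolding solves_def trunc_field_def by (auto intro: has_vector_derivative_Pair)
qed

lemma solves_unique:
  assumes s: "solves F \<xi> v" and s': "solves F' \<xi>' v'"
    and init: "F c = F' c" "\<xi> c = \<xi>' c" "v c = v' c"
  shows "F t = F' t \<and> \<xi> t = \<xi>' t \<and> v t = v' t"
proof -
  define R where "R = norm (F c, v c) + 1"
  \<comment> \<open>The common initial value fixes one radius for both solutions; adding 1 in its
    definition makes it positive even for zero data.\<close>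
  have R: "R > 0" "norm (F c, v c) \<le> R" "norm (F' c, v' c) \<le> R"
    using init by (simp_all add: R_def add_nonneg_pos)
  have "(\<xi> t, (F t, v t)) = (\<xi>' t, (F' t, v' t))"
    by (rule ode_unique[where f = "trunc_field R" and c = c and x = "\<lambda>t. (\<xi> t, (F t, v t))" and y = "\<lambda>t. (\<xi>' t, (F' t, v' t))",
        OF trunc_field_lipschitz[OF R(1)] solves_trunc[OF s R(2)] solves_trunc[OF s' R(3)]])
      (simp add: init)
  then show ?thesis by simp
qed

text \<open>The truncated equation also conserves \<open>norm (y t)\<close>, although its right side
  is evaluated at the truncated point. So the solution stays where truncation is the identity and
  solves the original equation.\<close>

lemma solves_exists:
  "\<exists>F \<xi> v. solves F \<xi> v \<and> F c = P0 \<and> \<xi> c = \<xi>0 \<and> v c = v0"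
proof -
  define R where "R = norm (P0, v0) + 1"
  have R: "R > 0" by (simp add: R_def add_nonneg_pos)
  have "\<exists>z. z c = (\<xi>0, (P0, v0)) \<and> (\<forall>t. (z has_vector_derivative trunc_field R t (z t)) (at t))"
  proof (rule ode_global_existence)
    show "norm (trunc_field R t x - trunc_field R t y) \<le> (2 + 12 * (C * (1 + R)\<^sup>2)) * norm (x - y)" for t x y
      by (rule trunc_field_lipschitz[OF R])
    show "0 < 2 + 12 * (C * (1 + R)\<^sup>2)" using C_pos by (simp add: add_pos_nonneg)
    show "norm (trunc_field R t x) \<le> R + 4 * (C * (1 + R)\<^sup>2) * R" for t x by (rule trunc_field_bound[OF R])
    show "continuous_on UNIV (\<lambda>t. trunc_field R t (z t))" if z: "continuous_on UNIV z" for z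
      unfolding trunc_field_def
      by (intro continuous_on_Pair continuous_on_snd continuous_on_fst continuous_on_field continuous_on_radial_trunc R z)
  qed
  then obtain z where z0: "z c = (\<xi>0, (P0, v0))"
    and z: "\<And>t. (z has_vector_derivative trunc_field R t (z t)) (at t)" by blast
  define \<xi> where "\<xi> t = fst (z t)" for t
  define y where "y t = snd (z t)" for t
  have dy: "(y has_vector_derivative field t (\<xi> t) (radial_trunc R (y t))) (at t)" for t
    using bounded_linear.has_vector_derivative[OF bounded_linear_snd z[of t]]
    by (simp add: y_def[abs_def] \<xi>_def trunc_field_def)
  have "norm (y t) = norm (y c)" for t
  proof (rule norm_constant_if_orthogonal[OF dy])
    fix t
    \<comment> \<open>\<open>y t\<close> is a multiple of its truncation, to which the vector field
      is orthogonal.\<close>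
    obtain s where "y t = s *\<^sub>R radial_trunc R (y t)" using radial_trunc_scale[OF R] by blast
    then have "y t \<bullet> field t (\<xi> t) (radial_trunc R (y t)) = s * (radial_trunc R (y t) \<bullet> field t (\<xi> t) (radial_trunc R (y t)))"
      by (metis inner_scaleR_left)
    then show "y t \<bullet> field t (\<xi> t) (radial_trunc R (y t)) = 0" by (simp add: field_orthogonal)
  qed
  then have tr: "radial_trunc R (y t) = y t" for t
    by (simp add: radial_trunc_def R_def y_def z0)
  have d\<xi>: "(\<xi> has_vector_derivative snd (y t)) (at t)" for t
    using bounded_linear.has_vector_derivative[OF bounded_linear_fst z[of t]] tr[of t]
    by (simp add: y_def \<xi>_def[abs_def] trunc_field_def)
  have "solves (\<lambda>t. fst (y t)) \<xi> (\<lambda>t. snd (y t))"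
    unfolding solves_def using dy d\<xi> by (simp add: tr)
  then show ?thesis
    by (intro exI[of _ "\<lambda>t. fst (y t)"] exI[of _ \<xi>] exI[of _ "\<lambda>t. snd (y t)"]) (simp add: y_def \<xi>_def z0)
qed

section \<open>Equivalence of the differential and the integral form\<close>

lemma solvesD:
  assumes "solves F \<xi> v"
  shows "(F has_vector_derivative U (c - t) (- S (\<xi> t) (v t), 0)) (at t)"
    "(\<xi> has_vector_derivative v t) (at t)"
    "(v has_vector_derivative force (\<xi> t) (v t) (U (t - c) (F t))) (at t)"
proof -
  have d: "((\<lambda>t. (F t, v t)) has_vector_derivative field t (\<xi> t) (F t, v t)) (at t)"
    using assms by (simp add: solves_def)
  show "(F has_vector_derivative U (c - t) (- S (\<xi> t) (v t), 0)) (at t)"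
    "(v has_vector_derivative force (\<xi> t) (v t) (U (t - c) (F t))) (at t)"
    using bounded_linear.has_vector_derivative[OF bounded_linear_fst d]
      bounded_linear.has_vector_derivative[OF bounded_linear_snd d] by (simp_all add: field_def)
  show "(\<xi> has_vector_derivative v t) (at t)" using assms by (simp add: solves_def)
qed

text \<open>The free evolution from time \<tau> to time \<open>t\<close> of the state at \<tau> is
  an antiderivative of the integrand, because its transport term cancels the derivative of the
  position.\<close>

lemma newton_duhamel:
  assumes \<xi>: "\<And>t. (\<xi> has_vector_derivative v t) (at t)" and v: "\<And>t. (v has_vector_derivative a t) (at t)"
  shows "has_oriented_integral (\<lambda>\<tau>. newton_group (t - \<tau>) (0, a \<tau>))
    ((\<xi> t, v t) - newton_group (t - c) (\<xi> c, v c)) c t"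
proof -
  have "((\<lambda>\<tau>. ((t - \<tau>) *\<^sub>R v \<tau> + \<xi> \<tau>, v \<tau>)) has_vector_derivative newton_group (t - s) (0, a s)) (at s)" for s
  proof -
    have "((\<lambda>\<tau>. (t - \<tau>) *\<^sub>R v \<tau> + \<xi> \<tau>) has_vector_derivative ((t - s) *\<^sub>R a s + (0 - 1) *\<^sub>R v s) + v s) (at s)"
      by (intro has_vector_derivative_add has_vector_derivative_scaleR v \<xi>) (auto intro!: derivative_eq_intros)
    then show ?thesis
      using has_vector_derivative_Pair[OF _ v[of s]] by (fastforce simp: newton_group_def)
  qed
  from has_oriented_integral_FTC[OF this, of t c] show ?thesis
    by (simp add: newton_group_def algebra_simps)
qed

lemma solves_duhamel:
  assumes s: "solves F \<xi> v"
  defines "P \<equiv> \<lambda>t. U (t - c) (F t)"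
  shows "has_oriented_integral (\<lambda>\<tau>. U (t - \<tau>) (- S (\<xi> \<tau>) (v \<tau>), 0)) (P t - U (t - c) (F c)) c t"
    "has_oriented_integral (\<lambda>\<tau>. newton_group (t - \<tau>) (0, force (\<xi> \<tau>) (v \<tau>) (P \<tau>)))
      ((\<xi> t, v t) - newton_group (t - c) (\<xi> c, v c)) c t"
proof -
  have "has_oriented_integral (\<lambda>\<tau>. U (t - c) (U (c - \<tau>) (- S (\<xi> \<tau>) (v \<tau>), 0))) (U (t - c) (F t - F c)) c t"
    by (rule has_oriented_integral_linear[OF has_oriented_integral_FTC[OF solvesD(1)[OF s]] U_bounded_linear])
  then show "has_oriented_integral (\<lambda>\<tau>. U (t - \<tau>) (- S (\<xi> \<tau>) (v \<tau>), 0)) (P t - U (t - c) (F c)) c t"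
    by (simp add: U_add P_def linear_diff[OF U_linear])
  show "has_oriented_integral (\<lambda>\<tau>. newton_group (t - \<tau>) (0, force (\<xi> \<tau>) (v \<tau>) (P \<tau>)))
      ((\<xi> t, v t) - newton_group (t - c) (\<xi> c, v c)) c t"
    unfolding P_def by (rule newton_duhamel[OF solvesD(2,3)[OF s]])
qed

text \<open>Continuity gives the integrand an antiderivative \<open>G\<close>, and uniqueness of the
  integral identifies the interaction field with \<open>P0 + G t\<close>, which is thereby seen to
  be differentiable. The initial values follow from the formulas at \<open>t = c\<close>.\<close>

lemma duhamel_solves:
  assumes P: "continuous_on UNIV P" and \<xi>: "continuous_on UNIV \<xi>" and v: "continuous_on UNIV v"
    and mw: "\<And>t. has_oriented_integral (\<lambda>\<tau>. U (t - \<tau>) (- S (\<xi> \<tau>) (v \<tau>), 0)) (P t - U (t - c) P0) c t"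
    and nw: "\<And>t. has_oriented_integral (\<lambda>\<tau>. newton_group (t - \<tau>) (0, force (\<xi> \<tau>) (v \<tau>) (P \<tau>)))
      ((\<xi> t, v t) - newton_group (t - c) (\<xi>0, v0)) c t"
  shows "solves (\<lambda>t. U (c - t) (P t)) \<xi> v" "P c = P0" "\<xi> c = \<xi>0" "v c = v0"
proof -
  have "continuous_on UNIV (\<lambda>\<tau>. U (c - \<tau>) (- S (\<xi> \<tau>) (v \<tau>), 0))"
    by (intro continuous_on_U continuous_on_Pair continuous_on_minus continuous_on_S \<xi> v continuous_on_const
        continuous_on_diff continuous_on_id)
  then obtain G where G0: "G c = 0" and G: "\<And>t. (G has_vector_derivative U (c - t) (- S (\<xi> t) (v t), 0)) (at t)"
    using antiderivative_exists by blast
  have PG: "P t = U (t - c) (P0 + G t)" for t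
  proof -
    have "has_oriented_integral (\<lambda>\<tau>. U (t - c) (U (c - \<tau>) (- S (\<xi> \<tau>) (v \<tau>), 0))) (U (t - c) (G t - G c)) c t"
      by (rule has_oriented_integral_linear[OF has_oriented_integral_FTC[OF G] U_bounded_linear])
    then have "has_oriented_integral (\<lambda>\<tau>. U (t - \<tau>) (- S (\<xi> \<tau>) (v \<tau>), 0)) (U (t - c) (G t)) c t"
      by (simp add: U_add G0)
    from has_oriented_integral_unique[OF mw[of t] this] show ?thesis
      by (simp add: linear_add[OF U_linear] algebra_simps)
  qed
  then have F: "U (c - t) (P t) = P0 + G t" for t by (simp add: U_inverse)
  have dF: "((\<lambda>t. U (c - t) (P t)) has_vector_derivative U (c - t) (- S (\<xi> t) (v t), 0)) (at t)" for t
    using has_vector_derivative_add[OF has_vector_derivative_const[of P0] G[of t]] by (simp add: F)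
  show "P c = P0" using PG[of c] by (simp add: G0 U_0)
  let ?a = "\<lambda>t. force (\<xi> t) (v t) (P t)"
  have "continuous_on UNIV ?a" by (intro continuous_on_force \<xi> v P)
  then obtain G1 where G1: "G1 c = 0" "\<And>t. (G1 has_vector_derivative ?a t) (at t)"
    using antiderivative_exists by blast
  \<comment> \<open>Two integrations of the force produce a trajectory with the prescribed initial
    values; it satisfies the same Newton Duhamel formula and hence equals the given one.\<close>
  define v' where "v' t = v0 + G1 t" for t
  have dv': "(v' has_vector_derivative ?a t) (at t)" for t
    using has_vector_derivative_add[OF has_vector_derivative_const[of v0] G1(2)[of t]] by (simp add: v'_def[abs_def])
  then have "continuous_on UNIV v'"
    by (intro continuous_at_imp_continuous_on ballI has_vector_derivative_continuous)
  then obtain G2 where G2: "G2 c = 0" "\<And>t. (G2 has_vector_derivative v' t) (at t)"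
    using antiderivative_exists by blast
  define \<xi>' where "\<xi>' t = \<xi>0 + G2 t" for t
  have d\<xi>': "(\<xi>' has_vector_derivative v' t) (at t)" for t
    using has_vector_derivative_add[OF has_vector_derivative_const[of \<xi>0] G2(2)[of t]] by (simp add: \<xi>'_def[abs_def])
  have c: "\<xi>' c = \<xi>0" "v' c = v0" by (simp_all add: \<xi>'_def v'_def G1 G2)
  have "(\<xi> t, v t) = (\<xi>' t, v' t)" for t
    using has_oriented_integral_unique[OF nw[of t] newton_duhamel[OF d\<xi>' dv', of t, unfolded c]] by simp
  then have eq: "\<xi> = \<xi>'" "v = v'" by auto
  show "\<xi> c = \<xi>0" "v c = v0" using c eq by simp_all
  have "((\<lambda>t. (U (c - t) (P t), v t)) has_vector_derivative field t (\<xi> t) (U (c - t) (P t), v t)) (at t)" for t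
    using has_vector_derivative_Pair[OF dF[of t] dv'[of t]] by (simp add: field_def U_inverse flip: eq(2))
  moreover have "(\<xi> has_vector_derivative v t) (at t)" for t using d\<xi>'[of t] eq by simp
  ultimately show "solves (\<lambda>t. U (c - t) (P t)) \<xi> v" by (simp add: solves_def)
qed

end

section \<open>Sobolev weights\<close>

text \<open>The reciprocal square root of the weight in the Sobolev norm: transforms of elements of
  order \<sigma> are this function times a square integrable one, and the Sobolev norm is the
  \<open>L2\<close> norm of that factor.\<close>

definition sobolev_weight :: "real \<Rightarrow> real^3 \<Rightarrow> real" where
  "sobolev_weight \<sigma> k = (1 + (norm k)\<^sup>2) powr (- \<sigma> / 2)"

lemma sobolev_weight_measurable [measurable]: "sobolev_weight \<sigma> \<in> borel_measurable borel"
  unfolding sobolev_weight_def by measurable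

lemma one_plus_norm_sq_pos: "0 < 1 + (norm k)\<^sup>2"
  by (simp add: add_pos_nonneg)

lemma sobolev_weight_pos: "0 < sobolev_weight \<sigma> k"
  using one_plus_norm_sq_pos[of k] by (simp add: sobolev_weight_def)

lemma sobolev_weight_le_1: "\<sigma> \<ge> 0 \<Longrightarrow> sobolev_weight \<sigma> k \<le> 1"
  unfolding sobolev_weight_def by (simp add: powr_minus_divide ge_one_powr_ge_zero divide_le_eq_1)

lemma sobolev_weight_add: "sobolev_weight \<sigma> k * sobolev_weight \<tau> k = sobolev_weight (\<sigma> + \<tau>) k"
proof -
  have e: "- \<sigma> / 2 + - \<tau> / 2 = - (\<sigma> + \<tau>) / 2" by (simp add: field_simps)
  show ?thesis by (simp only: sobolev_weight_def powr_add[symmetric] e)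
qed

lemma sobolev_weight_square: "(1 + (norm k)\<^sup>2) powr \<sigma> * (norm (sobolev_weight \<sigma> k *\<^sub>R z))\<^sup>2 = (norm z)\<^sup>2"
proof -
  have "(sobolev_weight \<sigma> k)\<^sup>2 = (1 + (norm k)\<^sup>2) powr (- \<sigma>)"
    using sobolev_weight_add[of \<sigma> k \<sigma>] by (simp add: power2_eq_square sobolev_weight_def)
  then show ?thesis
    using one_plus_norm_sq_pos[of k] by (simp add: power_mult_distrib powr_minus_divide)
qed

lemma norm_times_sobolev_weight_le: "norm k * sobolev_weight 1 k \<le> 1"
proof -
  have "(norm k * sobolev_weight 1 k)\<^sup>2 = (norm k)\<^sup>2 * (1 + (norm k)\<^sup>2) powr (- 1)"
  proof -
    have "(sobolev_weight 1 k)\<^sup>2 = (1 + (norm k)\<^sup>2) powr (- 1)"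
      using sobolev_weight_add[of 1 k 1] by (simp add: power2_eq_square sobolev_weight_def)
    then show ?thesis by (simp only: power_mult_distrib)
  qed
  also have "\<dots> \<le> 1" using one_plus_norm_sq_pos[of k] by (simp add: powr_minus_divide divide_le_eq_1)
  finally have "(norm k * sobolev_weight 1 k)\<^sup>2 \<le> 1\<^sup>2" by simp
  then show ?thesis by (rule power2_le_imp_le) simp
qed

abbreviation weight_op :: "real \<Rightarrow> 'a::euclidean_space L2 \<Rightarrow> 'a L2" where
  "weight_op \<sigma> \<equiv> l2_mult (\<lambda>k w. sobolev_weight \<sigma> k *\<^sub>R w)"

lemma bounded_symbol_scaleR:
  assumes [measurable]: "m \<in> borel_measurable borel" and "\<And>k. \<bar>m k\<bar> \<le> C"
  shows "bounded_symbol (\<lambda>k w::'a::euclidean_space. m k *\<^sub>R w) C"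
  by (rule bounded_symbolI) (auto intro: linearI mult_right_mono assms(2) simp: scaleR_right_distrib)

lemma bounded_symbol_weight: "\<sigma> \<ge> 0 \<Longrightarrow> bounded_symbol (\<lambda>k w::'a::euclidean_space. sobolev_weight \<sigma> k *\<^sub>R w) 1"
  by (rule bounded_symbol_scaleR) (auto simp: abs_of_pos sobolev_weight_pos sobolev_weight_le_1)

lemma weight_op_factor:
  fixes G :: "'a::euclidean_space L2"
  assumes \<sigma>: "\<sigma> \<ge> 0" and int: "integrable lborel (\<lambda>k. (1 + (norm k)\<^sup>2) powr \<sigma> * (norm (rep_L2 G k))\<^sup>2)"
  shows "\<exists>H. G = weight_op \<sigma> H"
proof -
  let ?h = "\<lambda>k. inverse (sobolev_weight \<sigma> k) *\<^sub>R rep_L2 G k"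
  have h: "sobolev_weight \<sigma> k *\<^sub>R ?h k = rep_L2 G k" for k
    using sobolev_weight_pos[of \<sigma> k] by simp
  have "(norm (?h k))\<^sup>2 = (1 + (norm k)\<^sup>2) powr \<sigma> * (norm (rep_L2 G k))\<^sup>2" for k
    using sobolev_weight_square[of k \<sigma> "?h k"] unfolding h by simp
  then have sq: "square_integrable ?h"
    using int by (simp add: square_integrable_def)
  have "weight_op \<sigma> (abs_L2 ?h) = G"
    unfolding l2_mult_abs[OF bounded_symbol_weight[OF \<sigma>] sq] h by simp
  from this[symmetric] show ?thesis by (rule exI)
qed

text \<open>Reduces Sobolev norms to \<open>L2\<close> norms. The weight is written out instead of
  using \<open>weight_op\<close>, whose bounds need \<open>\<sigma> \<ge> 0\<close>, because the
  order \<open>r - 1\<close> may be negative.\<close>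

lemma Hs_norm_weight:
  fixes q :: "complex L2"
  assumes u: "has_fourier u (\<lambda>k. sobolev_weight \<sigma> k *\<^sub>R rep_L2 q k)"
  shows "Hs_norm \<sigma> u = norm q" "in_Hs \<sigma> u \<longleftrightarrow> tempered u"
proof -
  show "Hs_norm \<sigma> u = norm q"
    unfolding Hs_norm_eq[OF u] sobolev_weight_square norm_L2_rep[symmetric] by simp
  show "in_Hs \<sigma> u \<longleftrightarrow> tempered u"
    unfolding in_Hs_iff[OF u] sobolev_weight_square by simp
qed

section \<open>The rigid charge\<close>

definition complexify :: "real^3 \<Rightarrow> complex^3" where
  "complexify v = (\<chi> i. of_real (v $ i))"

lemma norm_complexify: "norm (complexify v) = norm v"
proof -
  have "(norm (complexify v))\<^sup>2 = (norm v)\<^sup>2" by (simp add: norm_vec3_sum complexify_def)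
  then show ?thesis by (rule power2_eq_imp_eq) simp_all
qed

lemma norm_mult_vec3: "norm (\<chi> i. z * w $ i) = norm z * norm (w :: complex^3)"
proof -
  have "(norm (\<chi> i. z * w $ i))\<^sup>2 = (norm z * norm w)\<^sup>2"
    by (simp add: norm_vec3_sum norm_mult power_mult_distrib sum_distrib_left)
  then show ?thesis by (rule power2_eq_imp_eq) simp_all
qed

lemma bounded_symbol_vec_mult:
  "bounded_symbol (\<lambda>_ z :: complex. \<chi> i. z * (w $ i)) (norm (w :: complex^3))"
  by (rule bounded_symbol_const)
    (auto simp: norm_mult_vec3 mult.commute vec_eq_iff algebra_simps intro!: linearI)

lemma bounded_symbol_cis: "bounded_symbol (\<lambda>k z. cis (- (k \<bullet> \<xi>)) * z) 1"
  by (rule bounded_symbol_mult) auto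

text \<open>Charge and current carry \<open>x \<mapsto> \<phi> (\<xi> - x)\<close>; this is its transform at \<open>\<xi> = 0\<close>, and a general
  \<open>\<xi>\<close> only contributes a phase.\<close>

definition charge_transform :: "(real^3 \<Rightarrow> real) \<Rightarrow> complex L2" where
  "charge_transform \<phi> = l2_affine (-1) 0 (fourier_L2 (abs_L2 (\<lambda>x. of_real (\<phi> x))))"

lemma l2_affine_comp:
  assumes "s \<noteq> 0" "s' \<noteq> 0"
  shows "l2_affine s h (l2_affine s' h' F) = l2_affine (s' * s) (h' + s' *\<^sub>R h) F"
  unfolding l2_affine_def[of s' h' F]
  by (subst l2_affine_abs) (auto simp: assms l2_affine_def scaleR_right_distrib add.assoc intro: square_integrable_affine)

lemma square_integrable_reflect_scale:
  assumes "square_integrable \<phi>"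
  shows "square_integrable (\<lambda>x. (e * \<phi> (\<xi> - x)) *\<^sub>R v)"
proof -
  have s: "square_integrable (\<lambda>x. \<phi> (\<xi> - x))" using square_integrable_affine[OF assms, of "-1" \<xi>] by simp
  have "bounded_symbol (\<lambda>_ z :: real. (e * z) *\<^sub>R v) (\<bar>e\<bar> * norm v)"
    by (rule bounded_symbol_const) (auto simp: abs_mult algebra_simps intro!: linearI)
  from square_integrable_mult[OF this s] show ?thesis by simp
qed

lemma fourier_current_component:
  assumes \<phi>: "square_integrable \<phi>"
  shows "fourier_L2 (l2_mult (\<lambda>_ w. of_real (w $ i)) (current e \<phi> \<xi> v)) =
    l2_mult (\<lambda>_ z. z * of_real (e * v $ i)) (l2_mult (\<lambda>k z. cis (- (k \<bullet> \<xi>)) * z) (charge_transform \<phi>))"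
proof -
  let ?\<Phi> = "abs_L2 (\<lambda>x. complex_of_real (\<phi> x))"
  have \<phi>c: "square_integrable (\<lambda>x. complex_of_real (\<phi> x))" by (rule square_integrable_of_real[OF \<phi>])
  have \<phi>r: "square_integrable (\<lambda>x. complex_of_real (\<phi> (\<xi> - x)))"
    using square_integrable_affine[OF \<phi>c, of "-1" \<xi>] by simp
  have "l2_mult (\<lambda>_ w. complex_of_real (w $ i)) (current e \<phi> \<xi> v) =
      abs_L2 (\<lambda>x. (e * v $ i) *\<^sub>R complex_of_real (\<phi> (\<xi> - x)))"
    unfolding current_def l2_mult_abs[OF bounded_symbol_of_real_nth square_integrable_reflect_scale[OF \<phi>]]
    by (simp add: scaleR_conv_of_real[where 'a = complex] mult_ac)
  also have "\<dots> = (e * v $ i) *\<^sub>R l2_affine (-1) \<xi> ?\<Phi>"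
    by (simp add: abs_L2_scaleR[OF \<phi>r] l2_affine_abs[OF \<phi>c])
  \<comment> \<open>Reflecting first isolates the dependence on \<xi> in a translation, which the
    transform turns into a phase.\<close>
  also have "l2_affine (-1) \<xi> ?\<Phi> = l2_affine 1 (- \<xi>) (l2_affine (-1) 0 ?\<Phi>)"
    by (simp add: l2_affine_comp)
  finally have "fourier_L2 (l2_mult (\<lambda>_ w. of_real (w $ i)) (current e \<phi> \<xi> v)) =
      (e * v $ i) *\<^sub>R l2_mult (\<lambda>k z. cis (- (k \<bullet> \<xi>)) * z) (charge_transform \<phi>)"
    by (simp add: linear_cmul[OF bounded_linear.linear[OF bounded_linear_fourier_L2]] fourier_L2_translate
        fourier_L2_reflect charge_transform_def)
  also have "\<dots> = l2_mult (\<lambda>_ z. z * of_real (e * v $ i)) (l2_mult (\<lambda>k z. cis (- (k \<bullet> \<xi>)) * z) (charge_transform \<phi>))"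
    unfolding l2_mult_def[of "\<lambda>_ z. z * of_real (e * v $ i)"]
    by (subst abs_rep_L2[symmetric], subst abs_L2_scaleR[symmetric], simp)
      (simp add: scaleR_conv_of_real mult_ac)
  finally show ?thesis .
qed

lemma vec_fourier_current:
  assumes \<phi>: "square_integrable \<phi>"
  shows "vec_fourier (current e \<phi> \<xi> v) =
    l2_mult (\<lambda>_ z. \<chi> i. z * complexify (e *\<^sub>R v) $ i) (l2_mult (\<lambda>k z. cis (- (k \<bullet> \<xi>)) * z) (charge_transform \<phi>))"
proof (rule L2_vec3_eqI)
  fix i
  show "l2_nth i (vec_fourier (current e \<phi> \<xi> v)) = l2_nth i (l2_mult (\<lambda>_ z. \<chi> i. z * complexify (e *\<^sub>R v) $ i)
      (l2_mult (\<lambda>k z. cis (- (k \<bullet> \<xi>)) * z) (charge_transform \<phi>)))"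
    unfolding l2_nth_vec_fourier fourier_current_component[OF \<phi>] l2_mult_comp[OF bounded_symbol_nth bounded_symbol_vec_mult]
    by (simp add: complexify_def)
qed

lemma norm_vec_mult_L2:
  "norm (l2_mult (\<lambda>_ z. \<chi> i. z * (w $ i)) X) \<le> norm (w :: complex^3) * norm X"
  by (rule l2_mult_norm_le[OF bounded_symbol_vec_mult])

lemma norm_cis_diff_le: "norm (cis a - cis b) \<le> \<bar>a - b\<bar>"
proof -
  have "cis a - cis b = cis b * (cis (a - b) - 1)" by (simp add: right_diff_distrib cis_mult)
  then have "norm (cis a - cis b) = norm (iexp (a - b) - 1)" by (simp add: norm_mult cis_conv_exp)
  also have "\<dots> \<le> \<bar>a - b\<bar>" using iexp_approx1[of "a - b" 0] by simp
  finally show ?thesis .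
qed

text \<open>The difference of the phases is at most \<open>norm k * norm (\<xi> - \<xi>')\<close>.
  The growth in \<open>k\<close> is compensated by one order of Sobolev weight, which is taken from
  \<open>X\<close>.\<close>

lemma cis_diff_op_bound:
  assumes X: "X = weight_op 1 X1"
  shows "norm (l2_mult (\<lambda>k z. cis (- (k \<bullet> \<xi>)) * z) X - l2_mult (\<lambda>k z. cis (- (k \<bullet> \<xi>')) * z) X) \<le> norm (\<xi> - \<xi>') * norm X1"
proof -
  have w: "bounded_symbol (\<lambda>k w :: complex. sobolev_weight 1 k *\<^sub>R w) 1" by (rule bounded_symbol_weight) simp
  let ?m = "\<lambda>k z. (sobolev_weight 1 k *\<^sub>R (cis (- (k \<bullet> \<xi>)) - cis (- (k \<bullet> \<xi>')))) * z"
  have m: "bounded_symbol ?m (norm (\<xi> - \<xi>'))"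
  proof (rule bounded_symbol_mult)
    show "norm (sobolev_weight 1 k *\<^sub>R (cis (- (k \<bullet> \<xi>)) - cis (- (k \<bullet> \<xi>')))) \<le> norm (\<xi> - \<xi>')" for k
    proof -
      have "norm (cis (- (k \<bullet> \<xi>)) - cis (- (k \<bullet> \<xi>'))) \<le> \<bar>- (k \<bullet> \<xi>) - - (k \<bullet> \<xi>')\<bar>"
        by (rule norm_cis_diff_le)
      also have "- (k \<bullet> \<xi>) - - (k \<bullet> \<xi>') = k \<bullet> (\<xi>' - \<xi>)" by (simp add: inner_diff_right)
      also have "\<bar>k \<bullet> (\<xi>' - \<xi>)\<bar> \<le> norm k * norm (\<xi> - \<xi>')"
        using Cauchy_Schwarz_ineq2[of k "\<xi>' - \<xi>"] by (simp add: norm_minus_commute)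
      finally have "sobolev_weight 1 k * norm (cis (- (k \<bullet> \<xi>)) - cis (- (k \<bullet> \<xi>'))) \<le> sobolev_weight 1 k * (norm k * norm (\<xi> - \<xi>'))"
        using sobolev_weight_pos[of 1 k] by (intro mult_left_mono) auto
      also have "\<dots> = (norm k * sobolev_weight 1 k) * norm (\<xi> - \<xi>')" by simp
      also have "\<dots> \<le> 1 * norm (\<xi> - \<xi>')" by (intro mult_right_mono norm_times_sobolev_weight_le) simp
      finally show ?thesis using sobolev_weight_pos[of 1 k] by (simp add: abs_of_pos)
    qed
  qed measurable
  have "l2_mult (\<lambda>k z. cis (- (k \<bullet> \<xi>)) * z) X - l2_mult (\<lambda>k z. cis (- (k \<bullet> \<xi>')) * z) X = l2_mult ?m X1"
  proof (rule L2_eqI)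
    show "AE x in lborel. rep_L2 (l2_mult (\<lambda>k z. cis (- (k \<bullet> \<xi>)) * z) X - l2_mult (\<lambda>k z. cis (- (k \<bullet> \<xi>')) * z) X) x = rep_L2 (l2_mult ?m X1) x"
      using rep_L2_diff[of "l2_mult (\<lambda>k z. cis (- (k \<bullet> \<xi>)) * z) X" "l2_mult (\<lambda>k z. cis (- (k \<bullet> \<xi>')) * z) X"]
        rep_l2_mult[OF bounded_symbol_cis, of \<xi> X] rep_l2_mult[OF bounded_symbol_cis, of \<xi>' X]
        rep_l2_mult[OF m, of X1] rep_l2_mult[OF w, of X1]
      unfolding X[symmetric]
    proof eventually_elim
      case (elim x)
      show ?case unfolding elim by (simp add: scaleR_conv_of_real algebra_simps)
    qed
  qed
  then show ?thesis using l2_mult_norm_le[OF m, of X1] by simp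
qed

lemma charge_transform_weight:
  assumes \<phi>: "square_integrable \<phi>" and H: "in_Hs \<sigma> (dist_of \<phi>)" and \<sigma>: "\<sigma> \<ge> 0"
  shows "\<exists>X. charge_transform \<phi> = weight_op \<sigma> X"
proof (rule weight_op_factor[OF \<sigma>])
  let ?F = "fourier_L2 (abs_L2 (\<lambda>x. complex_of_real (\<phi> x)))"
  let ?g = "\<lambda>k. (1 + (norm k)\<^sup>2) powr \<sigma> * (norm (rep_L2 ?F k))\<^sup>2"
  have "integrable lborel ?g" using H unfolding in_Hs_iff[OF has_fourier_dist_of[OF \<phi>]] by simp
  then have i: "integrable lborel (\<lambda>k. ?g (0 - k))" by (subst lborel_integral_reflect(1))
  have e: "AE k in lborel. ?g (0 - k) = (1 + (norm k)\<^sup>2) powr \<sigma> * (norm (rep_L2 (charge_transform \<phi>) k))\<^sup>2"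
    using rep_l2_affine[of "-1" 0 ?F, simplified] unfolding charge_transform_def by eventually_elim simp
  show "integrable lborel (\<lambda>k. (1 + (norm k)\<^sup>2) powr \<sigma> * (norm (rep_L2 (charge_transform \<phi>) k))\<^sup>2)"
    using i by (subst (asm) integrable_cong_AE[OF _ _ e]) measurable
qed

section \<open>Convolution and current as adjoint maps\<close>

lemma integrable_convolution:
  assumes \<phi>: "square_integrable \<phi>"
  shows "integrable lborel (\<lambda>y. \<phi> (\<xi> - y) *\<^sub>R rep_L2 E y)"
proof -
  have [measurable]: "\<phi> \<in> borel_measurable borel" using \<phi> by measurable
  have s: "square_integrable (\<lambda>x. \<bar>\<phi> (\<xi> - x)\<bar>)" using square_integrable_affine[OF \<phi>, of "-1" \<xi>]
    by (simp add: square_integrable_def)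
  have n: "square_integrable (\<lambda>x. norm (rep_L2 E x))"
    using square_integrable_rep_L2[of E] by (auto simp: square_integrable_def)
  show ?thesis
    by (rule Bochner_Integration.integrable_bound[OF square_integrable_inner[OF s n]]) auto
qed

lemma current_linear:
  assumes \<phi>: "square_integrable \<phi>"
  shows "linear (current e \<phi> \<xi>)"
proof (rule linearI)
  note s = square_integrable_reflect_scale[OF \<phi>]
  show "current e \<phi> \<xi> (v + w) = current e \<phi> \<xi> v + current e \<phi> \<xi> w" for v w
    by (simp add: current_def scaleR_right_distrib abs_L2_add[OF s s])
  show "current e \<phi> \<xi> (a *\<^sub>R v) = a *\<^sub>R current e \<phi> \<xi> v" for a v
    by (simp add: current_def abs_L2_scaleR[OF s, symmetric] mult_ac)
qed

text \<open>The same function \<open>\<phi> (\<xi> - x)\<close> smears the force and distributes the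
  current; including \<open>e\<close> on the force side makes the two maps exactly adjoint.\<close>

lemma convolution_adjoint:
  assumes \<phi>: "square_integrable \<phi>"
  shows "w \<bullet> (e *\<^sub>R L2_convolution \<phi> E \<xi>) = current e \<phi> \<xi> w \<bullet> E"
proof -
  note s = square_integrable_reflect_scale[OF \<phi>, of e \<xi> w]
  have "current e \<phi> \<xi> w \<bullet> abs_L2 (rep_L2 E) = (LINT x|lborel. ((e * \<phi> (\<xi> - x)) *\<^sub>R w) \<bullet> rep_L2 E x)"
    unfolding current_def by (rule inner_abs_L2[OF s]) simp
  also have "\<dots> = (LINT x|lborel. e * (w \<bullet> (\<phi> (\<xi> - x) *\<^sub>R rep_L2 E x)))" by (simp add: mult_ac)
  also have "\<dots> = e * (w \<bullet> L2_convolution \<phi> E \<xi>)"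
    unfolding L2_convolution_def using integrable_convolution[OF \<phi>, of \<xi> E]
    by (simp del: inner_scaleR_right)
  finally show ?thesis by simp
qed

lemma particle_field_maxwell:
  assumes \<phi>: "square_integrable \<phi>" and H1: "in_Hs 1 (dist_of \<phi>)"
  shows "\<exists>C. particle_field maxwell_group (current e \<phi>) (\<lambda>\<xi> E. e *\<^sub>R L2_convolution \<phi> E \<xi>) C"
proof -
  obtain X1 where X1: "charge_transform \<phi> = weight_op 1 X1"
    using charge_transform_weight[OF \<phi> H1] by auto
  \<comment> \<open>One summand serves the bound and the other the Lipschitz estimate; adding 1
    keeps \<open>C\<close> positive if the charge vanishes.\<close>
  define C where "C = \<bar>e\<bar> * (norm (charge_transform \<phi>) + norm X1) + 1"
  have C: "\<bar>e\<bar> * norm (charge_transform \<phi>) \<le> C" "\<bar>e\<bar> * norm X1 \<le> C" "C > 0"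
    by (simp_all add: C_def distrib_left add_nonneg_pos)
  show ?thesis
  proof (intro exI[of _ C] particle_field.intro)
    fix s t P Q \<xi> \<xi>' and w :: "real^3" and E
    show "bounded_linear (maxwell_group t)" by (rule bounded_linear_maxwell_group)
    show "maxwell_group t P \<bullet> Q = P \<bullet> maxwell_group (- t) Q" by (rule maxwell_group_adjoint)
    show "maxwell_group s (maxwell_group t P) = maxwell_group (s + t) P" by (rule maxwell_group_add)
    show "maxwell_group 0 P = P" by simp
    show "isCont (\<lambda>t. maxwell_group t P) t" by (rule maxwell_group_continuous)
    show "linear (current e \<phi> \<xi>)" by (rule current_linear[OF \<phi>])
    show "w \<bullet> (e *\<^sub>R L2_convolution \<phi> E \<xi>) = current e \<phi> \<xi> w \<bullet> E" by (rule convolution_adjoint[OF \<phi>])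
    show "C > 0" by (rule C)
    let ?c = "\<lambda>\<xi>. l2_mult (\<lambda>k z. cis (- (k \<bullet> \<xi>)) * z) (charge_transform \<phi>)"
    let ?m = "l2_mult (\<lambda>_ z. \<chi> i. z * complexify (e *\<^sub>R w) $ i)"
    have "norm (current e \<phi> \<xi> w) = norm (?m (?c \<xi>))"
      unfolding vec_fourier_current[OF \<phi>, symmetric] norm_vec_fourier ..
    also have "\<dots> \<le> (\<bar>e\<bar> * norm w) * norm (?c \<xi>)"
      using norm_vec_mult_L2[of "complexify (e *\<^sub>R w)"] by (simp add: norm_complexify)
    also have "norm (?c \<xi>) = norm (charge_transform \<phi>)"
      by (rule l2_mult_isometry[OF bounded_symbol_cis]) (simp add: norm_mult)
    also have "(\<bar>e\<bar> * norm w) * norm (charge_transform \<phi>) = (\<bar>e\<bar> * norm (charge_transform \<phi>)) * norm w" by simp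
    also have "\<dots> \<le> C * norm w" by (intro mult_right_mono C) simp
    finally show "norm (current e \<phi> \<xi> w) \<le> C * norm w" .
    have "norm (current e \<phi> \<xi> w - current e \<phi> \<xi>' w) = norm (?m (?c \<xi> - ?c \<xi>'))"
      unfolding norm_vec_fourier[symmetric, of "_ - _"]
        linear_diff[OF bounded_linear.linear[OF bounded_linear_vec_fourier]] vec_fourier_current[OF \<phi>]
        linear_diff[OF bounded_linear.linear[OF bounded_linear_l2_mult[OF bounded_symbol_vec_mult]]] ..
    also have "\<dots> \<le> (\<bar>e\<bar> * norm w) * norm (?c \<xi> - ?c \<xi>')"
      using norm_vec_mult_L2[of "complexify (e *\<^sub>R w)"] by (simp add: norm_complexify)
    also have "\<dots> \<le> (\<bar>e\<bar> * norm w) * (norm (\<xi> - \<xi>') * norm X1)"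
      by (intro mult_left_mono cis_diff_op_bound X1) simp
    also have "\<dots> = (\<bar>e\<bar> * norm X1) * (norm (\<xi> - \<xi>') * norm w)" by simp
    also have "\<dots> \<le> C * (norm (\<xi> - \<xi>') * norm w)" by (intro mult_right_mono C) simp
    finally show "norm (current e \<phi> \<xi> w - current e \<phi> \<xi>' w) \<le> C * norm (\<xi> - \<xi>') * norm w" by simp
  qed
qed

section \<open>Derivatives of the Fourier transform of Schwartz functions\<close>

text \<open>The second order Taylor remainder of the phase is at most half of
  \<open>(norm (y - x))^2 * (norm k)^2\<close>, and a Schwartz function is integrable against
  \<open>(norm k)^2\<close>. The resulting quadratic error gives the full derivative at
  once.\<close>

lemma schwartz_fourier_has_derivative:
  assumes \<phi>: "schwartz \<phi>"
  shows "(schwartz_fourier \<phi> has_derivative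
    (\<lambda>h. \<Sum>i\<in>UNIV. of_real (h $ i) * schwartz_fourier (\<lambda>k. - \<i> * of_real (k $ i) * \<phi> k) x)) (at x)"
proof -
  let ?c = "(2 * pi) powr (-3/2)"
  have i0: "integrable lborel \<phi>" using schwartz_L1_L2(1)[OF \<phi>, of "[]"] by simp
  have i1: "integrable lborel (\<lambda>k. (- \<i> * of_real (k $ i)) * \<phi> k)" for i
  proof (rule schwartz_power_mult_L1_L2(1)[OF \<phi>, where n = 1])
    show "(\<lambda>k. - \<i> * complex_of_real (k $ i)) \<in> borel_measurable borel"
      using bounded_symbol_measurable[OF bounded_symbol_nth, of "\<lambda>k :: real^3. k" i] by simp
    show "norm (- \<i> * complex_of_real (k $ i)) \<le> (1 + norm k) ^ 1" for k :: "real^3"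
      using component_le_norm_cart[of k i] by (simp add: norm_mult)
  qed
  have "integrable lborel (\<lambda>k. of_real ((norm k)\<^sup>2) * \<phi> k)"
  proof (rule schwartz_power_mult_L1_L2(1)[OF \<phi>, where n = 2])
    show "norm (complex_of_real ((norm k)\<^sup>2)) \<le> (1 + norm k) ^ 2" for k :: "real^3"
    proof -
      have "(norm k)\<^sup>2 \<le> (1 + norm k)\<^sup>2" by (intro power_mono) auto
      then show ?thesis by (simp del: of_real_power)
    qed
  qed measurable
  from integrable_norm[OF this] have i2: "integrable lborel (\<lambda>k. (norm k)\<^sup>2 * norm (\<phi> k))"
    by (simp add: norm_mult norm_power)
  define K where "K = ?c * (LINT k|lborel. (norm k)\<^sup>2 * norm (\<phi> k)) / 2"
  define D where "D h = (\<Sum>i\<in>UNIV. of_real (h $ i) * schwartz_fourier (\<lambda>k. - \<i> * of_real (k $ i) * \<phi> k) x)" for h :: "real^3"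
  have bl: "bounded_linear D"
    unfolding D_def[abs_def]
    by (intro bounded_linear_sum bounded_linear_compose[OF bounded_linear_mult_left]
        bounded_linear_compose[OF bounded_linear_of_real bounded_linear_vec_nth])
  have D: "D h = of_real ?c * (LINT k|lborel. cis (- (x \<bullet> k)) * (- \<i> * of_real (h \<bullet> k) * \<phi> k))" for h
  proof -
    have I: "integrable lborel (\<lambda>k. of_real (h $ i) * (cis (- (x \<bullet> k)) * (- \<i> * of_real (k $ i) * \<phi> k)))" for i
      by (intro integrable_mult_right integrable_cis_mult i1) measurable
    have "D h = of_real ?c * (\<Sum>i\<in>UNIV. (LINT k|lborel. of_real (h $ i) * (cis (- (x \<bullet> k)) * (- \<i> * of_real (k $ i) * \<phi> k))))"
      by (simp only: D_def schwartz_fourier_def integral_mult_right_zero sum_distrib_left mult.left_commute)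
    also have "(\<Sum>i\<in>UNIV. (LINT k|lborel. of_real (h $ i) * (cis (- (x \<bullet> k)) * (- \<i> * of_real (k $ i) * \<phi> k)))) =
        (LINT k|lborel. (\<Sum>i\<in>UNIV. of_real (h $ i) * (cis (- (x \<bullet> k)) * (- \<i> * of_real (k $ i) * \<phi> k))))"
      by (rule Bochner_Integration.integral_sum[symmetric]) (rule I)
    also have "\<dots> = (LINT k|lborel. cis (- (x \<bullet> k)) * (- \<i> * of_real (h \<bullet> k) * \<phi> k))"
      by (intro Bochner_Integration.integral_cong refl) (simp add: inner_vec_def sum_3 algebra_simps)
    finally show ?thesis .
  qed
  have taylor: "norm (cis (- (y \<bullet> k)) - cis (- (x \<bullet> k)) - cis (- (x \<bullet> k)) * (- \<i> * of_real ((y - x) \<bullet> k))) \<le> (norm (y - x))\<^sup>2 * (norm k)\<^sup>2 / 2" for y k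
  proof -
    let ?\<theta> = "- ((y - x) \<bullet> k)"
    have "cis (- (y \<bullet> k)) = cis (- (x \<bullet> k)) * cis ?\<theta>" by (simp add: cis_mult inner_diff_left)
    then have "cis (- (y \<bullet> k)) - cis (- (x \<bullet> k)) - cis (- (x \<bullet> k)) * (- \<i> * of_real ((y - x) \<bullet> k)) =
        cis (- (x \<bullet> k)) * (iexp ?\<theta> - (\<Sum>n\<le>1. (\<i> * of_real ?\<theta>) ^ n / fact n))"
      by (simp add: cis_conv_exp algebra_simps)
    then have "norm (cis (- (y \<bullet> k)) - cis (- (x \<bullet> k)) - cis (- (x \<bullet> k)) * (- \<i> * of_real ((y - x) \<bullet> k))) =
        norm (iexp ?\<theta> - (\<Sum>n\<le>1. (\<i> * of_real ?\<theta>) ^ n / fact n))"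
      by (simp only: norm_mult norm_cis mult_1_left)
    also have "\<dots> \<le> \<bar>?\<theta>\<bar>\<^sup>2 / 2"
      using iexp_approx1[of ?\<theta> 1] unfolding numeral_2_eq_2 by (simp only: One_nat_def fact_2) (simp add: numeral_2_eq_2)
    also have "\<bar>?\<theta>\<bar>\<^sup>2 \<le> (norm (y - x) * norm k)\<^sup>2"
      by (intro power_mono) (simp_all add: Cauchy_Schwarz_ineq2)
    finally show ?thesis by (simp add: power_mult_distrib)
  qed
  have quad: "norm (schwartz_fourier \<phi> y - schwartz_fourier \<phi> x - D (y - x)) \<le> K * (norm (y - x))\<^sup>2" for y
  proof -
    let ?R = "\<lambda>k. (cis (- (y \<bullet> k)) - cis (- (x \<bullet> k)) - cis (- (x \<bullet> k)) * (- \<i> * of_real ((y - x) \<bullet> k))) * \<phi> k"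
    have I: "integrable lborel (\<lambda>k. cis (- (x \<bullet> k)) * (- \<i> * of_real ((y - x) \<bullet> k) * \<phi> k))"
    proof (rule integrable_cis_mult)
      have "(\<lambda>k. - \<i> * of_real ((y - x) \<bullet> k) * \<phi> k) = (\<lambda>k. \<Sum>i\<in>UNIV. of_real ((y - x) $ i) * ((- \<i> * of_real (k $ i)) * \<phi> k))"
        by (rule ext) (simp add: inner_vec_def sum_3 algebra_simps)
      then show "integrable lborel (\<lambda>k. - \<i> * of_real ((y - x) \<bullet> k) * \<phi> k)"
        by (simp only:) (intro Bochner_Integration.integrable_sum integrable_mult_right i1)
    qed measurable
    have Ic: "integrable lborel (\<lambda>k. cis (- (z \<bullet> k)) * \<phi> k)" for z by (rule integrable_cis_mult[OF _ i0]) measurable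
    have eq: "?R = (\<lambda>k. cis (- (y \<bullet> k)) * \<phi> k - cis (- (x \<bullet> k)) * \<phi> k - cis (- (x \<bullet> k)) * (- \<i> * of_real ((y - x) \<bullet> k) * \<phi> k))"
      by (simp add: fun_eq_iff algebra_simps)
    have "schwartz_fourier \<phi> y - schwartz_fourier \<phi> x - D (y - x) = of_real ?c * (LINT k|lborel. ?R k)"
    proof -
      have "(LINT k|lborel. ?R k) = (LINT k|lborel. cis (- (y \<bullet> k)) * \<phi> k) - (LINT k|lborel. cis (- (x \<bullet> k)) * \<phi> k) -
          (LINT k|lborel. cis (- (x \<bullet> k)) * (- \<i> * of_real ((y - x) \<bullet> k) * \<phi> k))"
        unfolding eq
        by (simp only: Bochner_Integration.integral_diff[OF Bochner_Integration.integrable_diff[OF Ic Ic] I]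
            Bochner_Integration.integral_diff[OF Ic Ic])
      then show ?thesis unfolding D schwartz_fourier_def by (simp only: right_diff_distrib)
    qed
    then have "norm (schwartz_fourier \<phi> y - schwartz_fourier \<phi> x - D (y - x)) = ?c * norm (LINT k|lborel. ?R k)"
      by (simp add: norm_mult)
    also have "\<dots> \<le> ?c * (LINT k|lborel. ((norm (y - x))\<^sup>2 / 2) * ((norm k)\<^sup>2 * norm (\<phi> k)))"
    proof (intro mult_left_mono Bochner_Integration.integral_norm_bound_integral)
      show "integrable lborel ?R" unfolding eq using Ic I by simp
      show "norm (?R k) \<le> (norm (y - x))\<^sup>2 / 2 * ((norm k)\<^sup>2 * norm (\<phi> k))" for k
        using mult_right_mono[OF taylor[of y k], of "norm (\<phi> k)"] by (simp add: norm_mult mult.assoc)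
    qed (use i2 in auto)
    also have "\<dots> = K * (norm (y - x))\<^sup>2" by (simp add: K_def)
    finally show ?thesis .
  qed
  have "(schwartz_fourier \<phi> has_derivative D) (at x)"
  proof (rule has_derivativeI_sandwich[of 1 D UNIV x "schwartz_fourier \<phi>" "\<lambda>y. K * norm (y - x)", simplified])
    show "bounded_linear D" by (rule bl)
    show "norm (schwartz_fourier \<phi> y - schwartz_fourier \<phi> x - D (y - x)) / norm (y - x) \<le> K * norm (y - x)" if "y \<noteq> x" for y
      using quad[of y] that by (simp add: divide_le_eq power2_eq_square mult.assoc)
    have "((\<lambda>y. K * norm (y - x)) \<longlongrightarrow> K * norm (x - x)) (at x)" by (intro tendsto_intros)
    then show "((\<lambda>y. K * norm (y - x)) \<longlongrightarrow> 0) (at x)" by simp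
  qed
  then show ?thesis by (simp add: D_def[abs_def])
qed

lemma pderiv_at_schwartz_fourier:
  assumes "schwartz \<phi>"
  shows "pderiv_at j (schwartz_fourier \<phi>) x = schwartz_fourier (\<lambda>k. - \<i> * of_real (k $ j) * \<phi> k) x"
  by (rule frechet_derivative_sum_axis[OF schwartz_fourier_has_derivative[OF assms]])

text \<open>The witness is the distributional derivative: \<open>F\<close> is paired with the
  negative derivative of the test function. The derivative of a transform is the transform of a
  product with \<open>- \<i> * k\<close>, and the multiplication formula then moves the transform
  onto \<open>F\<close>.\<close>

lemma pderiv_distribution:
  fixes F :: "(real^3) L2"
  shows "\<exists>u. tempered u \<and> has_fourier u (\<lambda>k. \<i> * of_real (k $ j) * rep_L2 (vec_fourier F) k $ m)"
proof -
  let ?f = "\<lambda>x. rep_L2 F x $ m"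
  have f: "square_integrable ?f" by (rule square_integrable_mult[OF bounded_symbol_nth]) simp
  let ?u = "\<lambda>\<psi>. - (LINT x|lborel. of_real (?f x) * iter_pderiv [j] \<psi> x)"
  have t: "tempered ?u" by (intro tempered_uminus tempered_L2_pairing f) simp
  have nth [measurable]: "(\<lambda>k :: real^3. k $ j) \<in> borel_measurable borel"
    using bounded_symbol_measurable[OF bounded_symbol_nth, of "\<lambda>k :: real^3. k" j] by simp
  have [measurable]: "(\<lambda>k. rep_L2 (vec_fourier F) k $ m) \<in> borel_measurable borel"
    by (rule bounded_symbol_measurable[OF bounded_symbol_nth rep_L2_measurable])
  have "has_fourier ?u (\<lambda>k. \<i> * of_real (k $ j) * rep_L2 (vec_fourier F) k $ m)"
    unfolding has_fourier_def
  proof (intro conjI allI impI)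
    show "(\<lambda>k. \<i> * of_real (k $ j) * rep_L2 (vec_fourier F) k $ m) \<in> borel_measurable lborel" by measurable
    fix \<phi> assume \<phi>: "schwartz \<phi>"
    let ?h = "\<lambda>k. (- \<i> * of_real (k $ j)) * \<phi> k"
    have cl: "norm (- \<i> * complex_of_real (k $ j)) \<le> (1 + norm k) ^ 1" for k
      using component_le_norm_cart[of k j] by (simp add: norm_mult)
    have h: "integrable lborel ?h" "square_integrable ?h"
      by (rule schwartz_power_mult_L1_L2[OF \<phi> _ cl], measurable)+
    have [measurable]: "\<phi> \<in> borel_measurable borel"
      using schwartz_iter_pderiv_measurable[OF \<phi>, of "[]"] by simp
    have e: "- (rep_L2 (vec_fourier F) k $ m * ?h k) = \<i> * of_real (k $ j) * rep_L2 (vec_fourier F) k $ m * \<phi> k" for k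
      by simp
    have s: "square_integrable (\<lambda>k. rep_L2 (vec_fourier F) k $ m)"
      by (rule square_integrable_mult[OF bounded_symbol_nth]) simp
    show "integrable lborel (\<lambda>k. \<i> * of_real (k $ j) * rep_L2 (vec_fourier F) k $ m * \<phi> k)"
      unfolding e[symmetric] using integrable_mult_L2(1)[OF s h(2)] by (intro integrable_minus)
    have "(LINT x|lborel. of_real (?f x) * iter_pderiv [j] (schwartz_fourier \<phi>) x) =
        (LINT x|lborel. of_real (?f x) * schwartz_fourier ?h x)"
      by (simp add: pderiv_at_schwartz_fourier[OF \<phi>])
    also have "\<dots> = (LINT x|lborel. rep_L2 (abs_L2 (\<lambda>x. complex_of_real (?f x))) x * schwartz_fourier ?h x)"
    proof (rule integral_cong_AE)
      have [measurable]: "(\<lambda>x. rep_L2 F x $ m) \<in> borel_measurable borel" using f by measurable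
      show "(\<lambda>x. complex_of_real (?f x) * schwartz_fourier ?h x) \<in> borel_measurable lborel" by measurable
      show "AE x in lborel. complex_of_real (?f x) * schwartz_fourier ?h x =
          rep_L2 (abs_L2 (\<lambda>x. complex_of_real (?f x))) x * schwartz_fourier ?h x"
        using rep_abs_L2[OF square_integrable_of_real[OF f]] by eventually_elim simp
    qed measurable
    also have "\<dots> = (LINT k|lborel. rep_L2 (fourier_L2 (abs_L2 (\<lambda>x. complex_of_real (?f x)))) k * ?h k)"
      by (rule fourier_L2_multiplication[OF h, symmetric])
    also have "fourier_L2 (abs_L2 (\<lambda>x. complex_of_real (?f x))) = l2_nth m (vec_fourier F)"
      unfolding l2_nth_vec_fourier l2_mult_def[of _ F] ..
    also have "(LINT k|lborel. rep_L2 (l2_nth m (vec_fourier F)) k * ?h k) = (LINT k|lborel. rep_L2 (vec_fourier F) k $ m * ?h k)"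
      by (rule integral_cong_AE, measurable)
        (use rep_l2_mult[OF bounded_symbol_nth, of m "vec_fourier F"] in \<open>eventually_elim, simp\<close>)
    finally show "?u (schwartz_fourier \<phi>) = (LINT k|lborel. \<i> * of_real (k $ j) * rep_L2 (vec_fourier F) k $ m * \<phi> k)"
      unfolding e[symmetric] by simp
  qed
  with t show ?thesis by blast
qed

text \<open>Each component of the curl is a difference of two partial derivatives. An actual
  distribution is needed because membership in a Sobolev space of negative order is not a statement
  about the function of \<open>k\<close> alone.\<close>

lemma curl_distribution:
  "\<exists>u. tempered u \<and> has_fourier u (\<lambda>k. curl_symbol k (rep_L2 (vec_fourier F) k) $ i)"
proof -
  have d: "\<exists>u. tempered u \<and> has_fourier u (\<lambda>k. \<i> * of_real (k $ j) * rep_L2 (vec_fourier F) k $ m - \<i> * of_real (k $ m) * rep_L2 (vec_fourier F) k $ j)" for j m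
  proof -
    obtain u where u: "tempered u" "has_fourier u (\<lambda>k. \<i> * of_real (k $ j) * rep_L2 (vec_fourier F) k $ m)"
      using pderiv_distribution by blast
    obtain v where v: "tempered v" "has_fourier v (\<lambda>k. \<i> * of_real (k $ m) * rep_L2 (vec_fourier F) k $ j)"
      using pderiv_distribution by blast
    have "tempered (\<lambda>\<phi>. u \<phi> + - v \<phi>)" by (rule tempered_add[OF u(1) tempered_uminus[OF v(1)]])
    moreover have "has_fourier (\<lambda>\<phi>. u \<phi> + - v \<phi>)
        (\<lambda>k. \<i> * of_real (k $ j) * rep_L2 (vec_fourier F) k $ m - \<i> * of_real (k $ m) * rep_L2 (vec_fourier F) k $ j)"
      using has_fourier_add[OF u(2) has_fourier_uminus[OF v(2)]] by (simp only: add_uminus_conv_diff)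
    ultimately show ?thesis by blast
  qed
  consider "i = 1" | "i = 2" | "i = 3" using exhaust_3 by blast
  then show ?thesis
  proof cases
    case 1 then show ?thesis using d[of 2 3] by (simp add: curl_symbol_def ccross3_def vector_3)
  next
    case 2 then show ?thesis using d[of 3 1] by (simp add: curl_symbol_def ccross3_def vector_3)
  next
    case 3 then show ?thesis using d[of 1 2] by (simp add: curl_symbol_def ccross3_def vector_3)
  qed
qed

section \<open>Sobolev regularity of the field\<close>

lemma l2_mult_weight_commute:
  assumes m: "bounded_symbol m C" and \<sigma>: "\<sigma> \<ge> 0"
  shows "l2_mult m (weight_op \<sigma> F) = weight_op \<sigma> (l2_mult m F)"
proof -
  have "m k (c *\<^sub>R w) = c *\<^sub>R m k w" for k c w
    using m by (simp add: bounded_symbol_def linear_cmul)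
  then show ?thesis
    by (simp add: l2_mult_comp[OF m bounded_symbol_weight[OF \<sigma>]] l2_mult_comp[OF bounded_symbol_weight[OF \<sigma>] m])
qed

text \<open>Transform of a current with velocity \<open>w\<close> and scalar profile, placed in the
  electric slot. It is bilinear, so continuity in time follows from continuity of velocity and
  profile.\<close>

definition polarize :: "real^3 \<Rightarrow> complex L2 \<Rightarrow> ((complex^3) \<times> (complex^3)) L2" where
  "polarize w = l2_mult (\<lambda>_ z. (\<chi> i. z * complexify w $ i, 0))"

lemma bounded_symbol_polarize:
  "bounded_symbol (\<lambda>_ z. (\<chi> i. z * complexify w $ i, 0 :: complex^3)) (norm w)"
  using bounded_symbol_comp[OF bounded_symbol_Pair1 bounded_symbol_vec_mult, of "complexify w"]
  by (simp add: norm_complexify)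

lemma bounded_bilinear_polarize: "bounded_bilinear polarize"
proof (rule bounded_bilinear.intro)
  note L = bounded_linear.linear[OF bounded_linear_l2_mult[OF bounded_symbol_polarize]]
  show "polarize w (F + G) = polarize w F + polarize w G" for w F G
    unfolding polarize_def by (rule linear_add[OF L])
  show "polarize w (c *\<^sub>R F) = c *\<^sub>R polarize w F" for w c F
    unfolding polarize_def by (rule linear_cmul[OF L])
  show "polarize (w + w') F = polarize w F + polarize w' F" for w w' F
  proof (rule L2_eqI)
    show "AE k in lborel. rep_L2 (polarize (w + w') F) k = rep_L2 (polarize w F + polarize w' F) k"
      using rep_L2_add[of "polarize w F" "polarize w' F"] rep_l2_mult[OF bounded_symbol_polarize, of "w + w'" F]
        rep_l2_mult[OF bounded_symbol_polarize, of w F] rep_l2_mult[OF bounded_symbol_polarize, of w' F]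
      unfolding polarize_def[symmetric]
      by eventually_elim (simp add: complexify_def vec_eq_iff algebra_simps)
  qed
  show "polarize (c *\<^sub>R w) F = c *\<^sub>R polarize w F" for c w F
  proof (rule L2_eqI)
    show "AE k in lborel. rep_L2 (polarize (c *\<^sub>R w) F) k = rep_L2 (c *\<^sub>R polarize w F) k"
      using rep_L2_scaleR[of c "polarize w F"] rep_l2_mult[OF bounded_symbol_polarize, of "c *\<^sub>R w" F]
        rep_l2_mult[OF bounded_symbol_polarize, of w F]
      unfolding polarize_def[symmetric]
      by eventually_elim (simp add: complexify_def vec_eq_iff scaleR_conv_of_real[where 'a = complex] algebra_simps)
  qed
  show "\<exists>K. \<forall>w F. norm (polarize w F) \<le> norm w * norm F * K"
    using l2_mult_norm_le[OF bounded_symbol_polarize] unfolding polarize_def by (intro exI[of _ 1]) simp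
qed

lemma pair_fourier_current:
  assumes \<phi>: "square_integrable \<phi>"
  shows "pair_fourier (- current e \<phi> \<xi> v, 0) =
    polarize (- e *\<^sub>R v) (l2_mult (\<lambda>k z. cis (- (k \<bullet> \<xi>)) * z) (charge_transform \<phi>))"
proof -
  let ?Y = "l2_mult (\<lambda>k z. cis (- (k \<bullet> \<xi>)) * z) (charge_transform \<phi>)"
  have "pair_fourier (current e \<phi> \<xi> v, 0) = polarize (e *\<^sub>R v) ?Y"
    unfolding pair_fourier_def polarize_def
    by (simp add: vec_fourier_current[OF \<phi>] linear_0[OF bounded_linear.linear[OF bounded_linear_vec_fourier]]
        linear_0[OF bounded_linear.linear[OF bounded_linear_l2_mult[OF bounded_symbol_Pair2]]]
        l2_mult_comp[OF bounded_symbol_Pair1 bounded_symbol_vec_mult])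
  moreover have "pair_fourier (- (current e \<phi> \<xi> v, 0)) = - pair_fourier (current e \<phi> \<xi> v, 0)"
    by (rule linear_neg[OF bounded_linear.linear[OF bounded_linear_pair_fourier]])
  ultimately show ?thesis
    by (simp add: bounded_bilinear.minus_left[OF bounded_bilinear_polarize])
qed

lemma continuous_on_cis_op:
  assumes "continuous_on UNIV \<xi>"
  shows "continuous_on UNIV (\<lambda>t::real. l2_mult (\<lambda>k z. cis (- (k \<bullet> \<xi> t)) * z) X)"
  unfolding continuous_on_def
proof (intro ballI)
  fix t
  have \<xi>: "(\<xi> \<longlongrightarrow> \<xi> t) (at t)" using assms by (simp add: continuous_on_def)
  have "isCont cis x" for x using continuous_on_cis[OF continuous_on_id, of UNIV] by (simp add: continuous_on_eq_continuous_at)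
  then have c: "((\<lambda>s. cis (- (k \<bullet> \<xi> s))) \<longlongrightarrow> cis (- (k \<bullet> \<xi> t))) (at t)" for k
    by (rule isCont_tendsto_compose) (intro tendsto_intros \<xi>)
  show "((\<lambda>t. l2_mult (\<lambda>k z. cis (- (k \<bullet> \<xi> t)) * z) X) \<longlongrightarrow> l2_mult (\<lambda>k z. cis (- (k \<bullet> \<xi> t)) * z) X) (at t within UNIV)"
    by (rule l2_mult_tendsto_at[OF bounded_symbol_cis bounded_symbol_cis]) (intro AE_I2 allI tendsto_intros c)
qed

lemma continuous_on_maxwell_op:
  assumes "continuous_on UNIV h" "continuous_on UNIV p"
  shows "continuous_on UNIV (\<lambda>t::real. l2_mult (maxwell_symbol (h t)) (p t))"
  unfolding continuous_on_def
proof (intro ballI)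
  fix t
  note M = bounded_symbol_maxwell
  have h: "(h \<longlongrightarrow> h t) (at t)" and p: "(p \<longlongrightarrow> p t) (at t)"
    using assms by (simp_all add: continuous_on_def)
  have "((\<lambda>s. l2_mult (maxwell_symbol (h s)) (p t)) \<longlongrightarrow> l2_mult (maxwell_symbol (h t)) (p t)) (at t)"
    by (rule isCont_tendsto_compose[OF l2_mult_maxwell_continuous h])
  moreover have "((\<lambda>s. l2_mult (maxwell_symbol (h s)) (p s - p t)) \<longlongrightarrow> 0) (at t)"
  proof (rule Lim_null_comparison)
    show "\<forall>\<^sub>F s in at t. norm (l2_mult (maxwell_symbol (h s)) (p s - p t)) \<le> norm (p s - p t)"
      using l2_mult_norm_le[OF M] by simp
    show "((\<lambda>s. norm (p s - p t)) \<longlongrightarrow> 0) (at t)" using p by (simp add: LIM_zero tendsto_norm_zero)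
  qed
  ultimately have "((\<lambda>s. l2_mult (maxwell_symbol (h s)) (p t) + l2_mult (maxwell_symbol (h s)) (p s - p t)) \<longlongrightarrow>
      l2_mult (maxwell_symbol (h t)) (p t) + 0) (at t)"
    by (rule tendsto_add)
  then show "((\<lambda>t. l2_mult (maxwell_symbol (h t)) (p t)) \<longlongrightarrow> l2_mult (maxwell_symbol (h t)) (p t)) (at t within UNIV)"
    by (simp add: linear_diff[OF bounded_linear.linear[OF bounded_linear_l2_mult[OF M]]])
qed

definition generator_symbol :: "real^3 \<Rightarrow> (complex^3) \<times> (complex^3) \<Rightarrow> (complex^3) \<times> (complex^3)" where
  "generator_symbol k p = sobolev_weight 1 k *\<^sub>R (curl_symbol k (snd p), - curl_symbol k (fst p))"

lemma norm_curl_pair_le: "norm (curl_symbol k b, - curl_symbol k a) \<le> norm k * norm (a, b)"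
proof -
  have "(norm (curl_symbol k b, - curl_symbol k a))\<^sup>2 \<le> (norm k * norm b)\<^sup>2 + (norm k * norm a)\<^sup>2"
    unfolding norm_Pair using norm_curl_symbol_le[of k b] norm_curl_symbol_le[of k a]
    by (auto intro!: add_mono power_mono)
  also have "\<dots> = (norm k * norm (a, b))\<^sup>2"
    by (simp add: norm_Pair power_mult_distrib algebra_simps)
  finally show ?thesis by (rule power2_le_imp_le) simp
qed

lemma bounded_symbol_generator: "bounded_symbol generator_symbol 1"
proof (rule bounded_symbolI)
  show "linear (generator_symbol k)" for k
    by (rule linearI) (simp_all add: generator_symbol_def curl_symbol_linear algebra_simps)
  show "(\<lambda>k. generator_symbol k p) \<in> borel_measurable borel" for p
    unfolding generator_symbol_def by measurable
  show "norm (generator_symbol k p) \<le> 1 * norm p" for k p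
  proof -
    have "norm (generator_symbol k p) = sobolev_weight 1 k * norm (curl_symbol k (snd p), - curl_symbol k (fst p))"
      using sobolev_weight_pos[of 1 k] unfolding generator_symbol_def norm_scaleR by simp
    also have "\<dots> \<le> sobolev_weight 1 k * (norm k * norm p)"
      using norm_curl_pair_le[of k "snd p" "fst p"] sobolev_weight_pos[of 1 k] by (intro mult_left_mono) auto
    also have "\<dots> = (norm k * sobolev_weight 1 k) * norm p" by simp
    also have "\<dots> \<le> 1 * norm p" by (intro mult_right_mono norm_times_sobolev_weight_le) simp
    finally show ?thesis .
  qed
qed

text \<open>Mean value inequality along the flow: the flow is isometric and the curl has norm at
  most \<open>norm k\<close>, so its speed is constantly bounded.\<close>

lemma maxwell_symbol_diff_bound: "norm (maxwell_symbol h k p - p) \<le> \<bar>h\<bar> * (norm k * norm p)"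
proof (cases "k = 0")
  case True then show ?thesis by (cases p) (simp add: maxwell_symbol_def)
next
  case False
  have "norm (maxwell_symbol h k p - maxwell_symbol 0 k p) \<le> (norm k * norm p) * norm (h - 0)"
  proof (rule differentiable_bound[of UNIV])
    show "((\<lambda>t. maxwell_symbol t k p) has_derivative (\<lambda>s. s *\<^sub>R (curl_symbol k (snd (maxwell_symbol t k p)), - curl_symbol k (fst (maxwell_symbol t k p))))) (at t within UNIV)" for t
      using maxwell_symbol_ode[OF False, of p t] by (simp add: has_vector_derivative_def)
    show "onorm (\<lambda>s. s *\<^sub>R (curl_symbol k (snd (maxwell_symbol t k p)), - curl_symbol k (fst (maxwell_symbol t k p)))) \<le> norm k * norm p" for t
    proof (rule onorm_bound)
      fix s :: real
      have "norm (curl_symbol k (snd (maxwell_symbol t k p)), - curl_symbol k (fst (maxwell_symbol t k p))) \<le> norm k * norm p"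
        using norm_curl_pair_le[of k "snd (maxwell_symbol t k p)" "fst (maxwell_symbol t k p)"] by (simp add: norm_maxwell_symbol)
      from mult_left_mono[OF this abs_ge_zero[of s]]
      show "norm (s *\<^sub>R (curl_symbol k (snd (maxwell_symbol t k p)), - curl_symbol k (fst (maxwell_symbol t k p)))) \<le> norm k * norm p * norm s"
        by (simp only: norm_scaleR real_norm_def mult.commute)
    qed simp
  qed auto
  then show ?thesis by (simp add: maxwell_symbol_0 mult.commute)
qed

lemma has_derivative_quotient:
  fixes f :: "real \<Rightarrow> 'a::real_normed_vector"
  assumes "(f has_derivative (\<lambda>s. s *\<^sub>R f')) (at t)"
  shows "((\<lambda>h. inverse h *\<^sub>R (f (t + h) - f t)) \<longlongrightarrow> f') (at 0)"
proof -
  have "((\<lambda>h. norm (f (t + h) - f t - h *\<^sub>R f') / norm h) \<longlongrightarrow> 0) (at 0)"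
    using assms by (simp add: has_derivative_at)
  moreover have "\<forall>\<^sub>F h in at 0. norm (f (t + h) - f t - h *\<^sub>R f') / norm h = norm (inverse h *\<^sub>R (f (t + h) - f t) - f')"
    unfolding eventually_at_filter
  proof (intro always_eventually allI impI)
    fix h :: real assume "h \<noteq> 0"
    then have "inverse h *\<^sub>R (f (t + h) - f t - h *\<^sub>R f') = inverse h *\<^sub>R (f (t + h) - f t) - f'"
      by (simp add: scaleR_diff_right)
    then have "norm (inverse h *\<^sub>R (f (t + h) - f t) - f') = \<bar>inverse h\<bar> * norm (f (t + h) - f t - h *\<^sub>R f')"
      by (metis norm_scaleR)
    then show "norm (f (t + h) - f t - h *\<^sub>R f') / norm h = norm (inverse h *\<^sub>R (f (t + h) - f t) - f')"
      by (simp add: divide_inverse mult.commute)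
  qed
  ultimately have "((\<lambda>h. norm (inverse h *\<^sub>R (f (t + h) - f t) - f')) \<longlongrightarrow> 0) (at 0)"
    by (rule Lim_transform_eventually)
  then show ?thesis by (simp add: tendsto_norm_zero_iff LIM_zero_iff)
qed

text \<open>One order of weight compensates the factor \<open>norm k\<close> in the mean value
  bound, so the difference quotients have symbols bounded by 1 and dominated convergence
  applies.\<close>

lemma generator_limit:
  "((\<lambda>h. inverse h *\<^sub>R (l2_mult (maxwell_symbol h) (weight_op 1 q) - weight_op 1 q)) \<longlongrightarrow> l2_mult generator_symbol q) (at 0)"
proof -
  let ?m = "\<lambda>h k p. (inverse h * sobolev_weight 1 k) *\<^sub>R (maxwell_symbol h k p - p)"
  have w: "bounded_symbol (\<lambda>k p :: (complex^3) \<times> (complex^3). sobolev_weight 1 k *\<^sub>R p) 1" by (rule bounded_symbol_weight) simp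
  have m: "bounded_symbol (?m h) 1" for h
  proof (rule bounded_symbolI)
    show "linear (?m h k)" for k
      using linear_add[OF linear_maxwell_symbol] linear_cmul[OF linear_maxwell_symbol]
      by (intro linearI) (simp_all add: algebra_simps)
    have [measurable]: "(\<lambda>k. maxwell_symbol h k p) \<in> borel_measurable borel" for p by (rule maxwell_symbol_measurable)
    show "(\<lambda>k. ?m h k p) \<in> borel_measurable borel" for p by measurable
    show "norm (?m h k p) \<le> 1 * norm p" for k p
    proof -
      \<comment> \<open>Since \<open>inverse 0 = 0\<close>, the bound also covers
        \<open>h = 0\<close> and is uniform over all real \<open>h\<close>.\<close>
      have i: "\<bar>inverse h\<bar> * \<bar>h\<bar> \<le> 1" by (cases "h = 0") (auto simp: abs_inverse)
      have "norm (?m h k p) = (\<bar>inverse h\<bar> * sobolev_weight 1 k) * norm (maxwell_symbol h k p - p)"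
        using sobolev_weight_pos[of 1 k] by (simp add: abs_mult)
      also have "\<dots> \<le> (\<bar>inverse h\<bar> * sobolev_weight 1 k) * (\<bar>h\<bar> * (norm k * norm p))"
        using sobolev_weight_pos[of 1 k] by (intro mult_left_mono maxwell_symbol_diff_bound) auto
      also have "\<dots> = (\<bar>inverse h\<bar> * \<bar>h\<bar>) * ((norm k * sobolev_weight 1 k) * norm p)" by simp
      also have "\<dots> \<le> 1 * (1 * norm p)"
        using i norm_times_sobolev_weight_le[of k] sobolev_weight_pos[of 1 k]
        by (intro mult_mono mult_right_mono) auto
      finally show ?thesis by simp
    qed
  qed
  have "((\<lambda>h. l2_mult (?m h) q) \<longlongrightarrow> l2_mult generator_symbol q) (at 0)"
  proof (rule l2_mult_tendsto_at[OF m bounded_symbol_generator], intro AE_I2 allI)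
    fix k p
    show "((\<lambda>h. ?m h k p) \<longlongrightarrow> generator_symbol k p) (at 0)"
    proof (cases "k = 0")
      case True
      have "maxwell_symbol h 0 p - p = 0" for h by (cases p) (simp add: maxwell_symbol_def)
      then show ?thesis by (simp add: True generator_symbol_def flip: zero_prod_def)
    next
      case False
      have "((\<lambda>t. maxwell_symbol t k p) has_derivative (\<lambda>s. s *\<^sub>R (curl_symbol k (snd p), - curl_symbol k (fst p)))) (at 0)"
        using maxwell_symbol_ode[OF False, of p 0] by (simp add: has_vector_derivative_def maxwell_symbol_0)
      then have "((\<lambda>h. inverse h *\<^sub>R (maxwell_symbol h k p - p)) \<longlongrightarrow> (curl_symbol k (snd p), - curl_symbol k (fst p))) (at 0)"
        by (rule has_derivative_quotient[of "\<lambda>t. maxwell_symbol t k p" _ 0, simplified maxwell_symbol_0 add_0_left])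
      then have "((\<lambda>h. sobolev_weight 1 k *\<^sub>R (inverse h *\<^sub>R (maxwell_symbol h k p - p))) \<longlongrightarrow> generator_symbol k p) (at 0)"
        unfolding generator_symbol_def by (intro tendsto_intros)
      then show ?thesis by (simp add: mult.commute)
    qed
  qed
  moreover have "l2_mult (?m h) q = inverse h *\<^sub>R (l2_mult (maxwell_symbol h) (weight_op 1 q) - weight_op 1 q)" for h
  proof (rule L2_eqI)
    have cm: "maxwell_symbol h k (a *\<^sub>R p) = a *\<^sub>R maxwell_symbol h k p" for k a p
      by (rule linear_cmul[OF linear_maxwell_symbol])
    show "AE k in lborel. rep_L2 (l2_mult (?m h) q) k = rep_L2 (inverse h *\<^sub>R (l2_mult (maxwell_symbol h) (weight_op 1 q) - weight_op 1 q)) k"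
      using rep_l2_mult[OF m, of h q] rep_l2_mult[OF w, of q] rep_l2_mult[OF bounded_symbol_maxwell, of h "weight_op 1 q"]
        rep_L2_diff[of "l2_mult (maxwell_symbol h) (weight_op 1 q)" "weight_op 1 q"]
        rep_L2_scaleR[of "inverse h" "l2_mult (maxwell_symbol h) (weight_op 1 q) - weight_op 1 q"]
      by eventually_elim (simp add: cm scaleR_diff_right)
  qed
  ultimately show ?thesis by simp
qed

text \<open>Uniqueness for a right side that does not depend on the unknown, with Lipschitz constant
  0.\<close>

lemma eq_if_same_derivative:
  fixes f f' :: "real \<Rightarrow> 'a::real_inner"
  assumes "\<And>t. (f has_vector_derivative g t) (at t)" "\<And>t. (f' has_vector_derivative g t) (at t)" "f c = f' c"
  shows "f t = f' t"
  by (rule ode_unique[of "\<lambda>t x. g t" 0 f f' c]) (use assms in auto)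

text \<open>\<open>X\<close> and \<open>q0\<close> are the charge transform and the initial
  transforms divided by the weight of order \<open>r\<close>; they carry the Sobolev regularity of
  the data.\<close>

context
  fixes e r c :: real and \<phi> :: "real^3 \<Rightarrow> real"
    and F :: "real \<Rightarrow> (real^3) L2 \<times> (real^3) L2" and \<xi> v :: "real \<Rightarrow> real^3"
    and X :: "complex L2" and q0 :: "((complex^3) \<times> (complex^3)) L2"
  assumes \<phi>: "square_integrable \<phi>" and r: "r \<ge> 0"
    and X: "charge_transform \<phi> = weight_op r X"
    and q0: "pair_fourier (F c) = weight_op r q0"
    and dF: "\<And>t. (F has_vector_derivative maxwell_group (c - t) (- current e \<phi> (\<xi> t) (v t), 0)) (at t)"
    and \<xi>: "continuous_on UNIV \<xi>" and v: "continuous_on UNIV v"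
begin

definition weighted_current :: "real \<Rightarrow> ((complex^3) \<times> (complex^3)) L2" where
  "weighted_current t = polarize (- e *\<^sub>R v t) (l2_mult (\<lambda>k z. cis (- (k \<bullet> \<xi> t)) * z) X)"

lemma continuous_on_weighted_current: "continuous_on UNIV weighted_current"
  unfolding weighted_current_def[abs_def]
  by (intro bounded_bilinear.continuous_on[OF bounded_bilinear_polarize] continuous_intros v continuous_on_cis_op \<xi>)

lemma pair_fourier_weighted_current:
  "pair_fourier (- current e \<phi> (\<xi> t) (v t), 0) = weight_op r (weighted_current t)"
  unfolding pair_fourier_current[OF \<phi>] X weighted_current_def polarize_def
    l2_mult_weight_commute[OF bounded_symbol_cis r] l2_mult_weight_commute[OF bounded_symbol_polarize r] ..

text \<open>The equation is integrated once more for the quotients by the weight, where everything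
  lies in \<open>L2\<close>. Multiplying back gives a curve with the same derivative and initial
  value as the transform of \<open>F\<close>, so regularity of order \<open>r\<close> propagates
  without an a priori estimate.\<close>

lemma weighted_interaction_field:
  "\<exists>G. (\<forall>t. pair_fourier (F t) = weight_op r (G t)) \<and>
     (\<forall>t. (G has_vector_derivative l2_mult (maxwell_symbol (c - t)) (weighted_current t)) (at t))"
proof -
  have "continuous_on UNIV (\<lambda>t. l2_mult (maxwell_symbol (c - t)) (weighted_current t))"
    by (intro continuous_on_maxwell_op continuous_on_weighted_current continuous_intros)
  then obtain G0 where G0: "G0 c = 0"
    "\<And>t. (G0 has_vector_derivative l2_mult (maxwell_symbol (c - t)) (weighted_current t)) (at t)"
    using antiderivative_exists by blast
  define G where "G t = q0 + G0 t" for t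
  have G: "(G has_vector_derivative l2_mult (maxwell_symbol (c - t)) (weighted_current t)) (at t)" for t
    using has_vector_derivative_add[OF has_vector_derivative_const[of q0] G0(2)[of t]] by (simp add: G_def[abs_def])
  have "pair_fourier (F t) = weight_op r (G t)" for t
  proof (rule eq_if_same_derivative[where c = c])
    fix t
    have "pair_fourier (maxwell_group (c - t) (- current e \<phi> (\<xi> t) (v t), 0)) =
        weight_op r (l2_mult (maxwell_symbol (c - t)) (weighted_current t))"
      unfolding maxwell_group_pair_fourier pair_fourier_weighted_current
      by (rule l2_mult_weight_commute[OF bounded_symbol_maxwell r])
    then show "((\<lambda>t. pair_fourier (F t)) has_vector_derivative
        weight_op r (l2_mult (maxwell_symbol (c - t)) (weighted_current t))) (at t)"
      using bounded_linear.has_vector_derivative[OF bounded_linear_pair_fourier dF[of t]] by simp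
    show "((\<lambda>t. weight_op r (G t)) has_vector_derivative
        weight_op r (l2_mult (maxwell_symbol (c - t)) (weighted_current t))) (at t)"
      by (rule bounded_linear.has_vector_derivative[OF bounded_linear_l2_mult[OF bounded_symbol_weight[OF r]] G])
  qed (simp add: q0 G_def G0)
  with G show ?thesis by blast
qed

text \<open>The field equation holds in \<open>L\<^sup>2\<close> after both sides are multiplied by \<open>sobolev_weight 1\<close>,
  which turns the unbounded curl into the bounded symbol \<open>generator_symbol\<close>.\<close>

lemma weighted_field:
  "\<exists>Q. (\<forall>t. pair_fourier (maxwell_group (t - c) (F t)) = weight_op r (Q t)) \<and> continuous_on UNIV Q \<and>
     (\<forall>t. ((\<lambda>h. inverse h *\<^sub>R (weight_op 1 (Q (t + h)) - weight_op 1 (Q t))) \<longlongrightarrow>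
        l2_mult generator_symbol (Q t) + weight_op 1 (weighted_current t)) (at 0))"
proof -
  obtain G where FG: "\<And>t. pair_fourier (F t) = weight_op r (G t)"
    and G: "\<And>t. (G has_vector_derivative l2_mult (maxwell_symbol (c - t)) (weighted_current t)) (at t)"
    using weighted_interaction_field by blast
  define Q where "Q t = l2_mult (maxwell_symbol (t - c)) (G t)" for t
  note M = bounded_symbol_maxwell
  note Mlin = bounded_linear.linear[OF bounded_linear_l2_mult[OF M]]
  have w1: "bounded_symbol (\<lambda>k w :: (complex^3) \<times> (complex^3). sobolev_weight 1 k *\<^sub>R w) 1" by (rule bounded_symbol_weight) simp
  note Nlin = bounded_linear.linear[OF bounded_linear_l2_mult[OF w1]]
  have MN: "l2_mult (maxwell_symbol s) (weight_op 1 q) = weight_op 1 (l2_mult (maxwell_symbol s) q)" for s q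
    by (rule l2_mult_weight_commute[OF M]) simp
  have "continuous_on UNIV G"
    by (intro continuous_at_imp_continuous_on ballI has_vector_derivative_continuous[OF G])
  then have "continuous_on UNIV Q"
    unfolding Q_def by (intro continuous_on_maxwell_op continuous_intros)
  moreover have "pair_fourier (maxwell_group (t - c) (F t)) = weight_op r (Q t)" for t
    unfolding maxwell_group_pair_fourier FG Q_def by (rule l2_mult_weight_commute[OF M r])
  moreover have "((\<lambda>h. inverse h *\<^sub>R (weight_op 1 (Q (t + h)) - weight_op 1 (Q t))) \<longlongrightarrow>
        l2_mult generator_symbol (Q t) + weight_op 1 (weighted_current t)) (at 0)" for t
  proof -
    define x where "x h = inverse h *\<^sub>R (G (t + h) - G t)" for h
    define G' where "G' = l2_mult (maxwell_symbol (c - t)) (weighted_current t)"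
    have x: "(x \<longlongrightarrow> G') (at 0)"
      unfolding x_def G'_def using G[of t] unfolding has_vector_derivative_def by (rule has_derivative_quotient)
    \<comment> \<open>A discrete product rule: first the group moves with the field frozen at time
      \<open>t\<close>, then the interaction variable moves inside the group at the later
      time.\<close>
    have split: "inverse h *\<^sub>R (weight_op 1 (Q (t + h)) - weight_op 1 (Q t)) =
        inverse h *\<^sub>R (l2_mult (maxwell_symbol h) (weight_op 1 (Q t)) - weight_op 1 (Q t)) +
        weight_op 1 (l2_mult (maxwell_symbol (h + (t - c))) (x h))" for h
    proof -
      have "l2_mult (maxwell_symbol h) (weight_op 1 (Q t)) = weight_op 1 (l2_mult (maxwell_symbol (h + (t - c))) (G t))"
        by (simp add: MN Q_def l2_mult_maxwell_add)
      moreover have "Q (t + h) = l2_mult (maxwell_symbol (h + (t - c))) (G (t + h))"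
        by (simp add: Q_def algebra_simps)
      ultimately show ?thesis
        by (simp add: x_def linear_cmul[OF Mlin] linear_cmul[OF Nlin] linear_diff[OF Mlin] linear_diff[OF Nlin]
            flip: scaleR_add_right)
    qed
    have "((\<lambda>h. l2_mult (maxwell_symbol (h + (t - c))) G') \<longlongrightarrow> l2_mult (maxwell_symbol (0 + (t - c))) G') (at 0)"
      by (rule isCont_tendsto_compose[OF l2_mult_maxwell_continuous]) (intro tendsto_intros)
    moreover have "((\<lambda>h. l2_mult (maxwell_symbol (h + (t - c))) (x h - G')) \<longlongrightarrow> 0) (at 0)"
    proof (rule Lim_null_comparison)
      show "\<forall>\<^sub>F h in at 0. norm (l2_mult (maxwell_symbol (h + (t - c))) (x h - G')) \<le> norm (x h - G')"
        using l2_mult_norm_le[OF M] by simp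
      show "((\<lambda>h. norm (x h - G')) \<longlongrightarrow> 0) (at 0)" using x by (simp add: LIM_zero tendsto_norm_zero)
    qed
    ultimately have "((\<lambda>h. l2_mult (maxwell_symbol (h + (t - c))) G' + l2_mult (maxwell_symbol (h + (t - c))) (x h - G')) \<longlongrightarrow>
        l2_mult (maxwell_symbol (0 + (t - c))) G' + 0) (at 0)" by (rule tendsto_add)
    moreover have "l2_mult (maxwell_symbol (0 + (t - c))) G' = weighted_current t"
      unfolding G'_def l2_mult_maxwell_add by (simp add: maxwell_symbol_0[abs_def])
    ultimately have "((\<lambda>h. l2_mult (maxwell_symbol (h + (t - c))) (x h)) \<longlongrightarrow> weighted_current t) (at 0)"
      by (simp add: linear_diff[OF Mlin])
    from tendsto_add[OF generator_limit[of "Q t"] bounded_linear.tendsto[OF bounded_linear_l2_mult[OF w1] this]]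
    show ?thesis unfolding split .
  qed
  ultimately show ?thesis by blast
qed

end

section \<open>Sobolev regularity from curves in \<open>L2\<close>\<close>

lemma has_fourier_weight_diff:
  fixes a b :: "complex L2"
  assumes u: "has_fourier u (\<lambda>k. sobolev_weight \<sigma> k *\<^sub>R rep_L2 a k)"
    and v: "has_fourier v (\<lambda>k. sobolev_weight \<sigma> k *\<^sub>R rep_L2 b k)"
  shows "has_fourier (\<lambda>\<psi>. u \<psi> - v \<psi>) (\<lambda>k. sobolev_weight \<sigma> k *\<^sub>R rep_L2 (a - b) k)"
proof -
  have h: "has_fourier (\<lambda>\<psi>. u \<psi> - v \<psi>) (\<lambda>k. sobolev_weight \<sigma> k *\<^sub>R rep_L2 a k - sobolev_weight \<sigma> k *\<^sub>R rep_L2 b k)"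
    using has_fourier_add[OF u has_fourier_uminus[OF v]] by (simp only: add_uminus_conv_diff)
  show ?thesis
  proof (rule has_fourier_cong_AE[OF h])
    show "AE k in lborel. sobolev_weight \<sigma> k *\<^sub>R rep_L2 a k - sobolev_weight \<sigma> k *\<^sub>R rep_L2 b k = sobolev_weight \<sigma> k *\<^sub>R rep_L2 (a - b) k"
      using rep_L2_diff[of a b] by eventually_elim (simp add: scaleR_diff_right)
  qed measurable
qed

lemma has_fourier_weight_divide:
  fixes a :: "complex L2"
  assumes u: "has_fourier u (\<lambda>k. sobolev_weight \<sigma> k *\<^sub>R rep_L2 a k)"
  shows "has_fourier (\<lambda>\<psi>. u \<psi> / of_real h) (\<lambda>k. sobolev_weight \<sigma> k *\<^sub>R rep_L2 (inverse h *\<^sub>R a) k)"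
proof -
  have h: "has_fourier (\<lambda>\<psi>. u \<psi> / of_real h) (\<lambda>k. of_real (inverse h) * (sobolev_weight \<sigma> k *\<^sub>R rep_L2 a k))"
    using has_fourier_cmult[OF u, of "of_real (inverse h)"] by (simp add: divide_inverse mult.commute)
  show ?thesis
  proof (rule has_fourier_cong_AE[OF h])
    show "AE k in lborel. of_real (inverse h) * (sobolev_weight \<sigma> k *\<^sub>R rep_L2 a k) = sobolev_weight \<sigma> k *\<^sub>R rep_L2 (inverse h *\<^sub>R a) k"
      using rep_L2_scaleR[of "inverse h" a] by eventually_elim (simp add: scaleR_conv_of_real)
  qed measurable
qed

lemma Hs_C0_weight:
  fixes n :: "real \<Rightarrow> complex L2"
  assumes u: "\<And>t. has_fourier (u t) (\<lambda>k. sobolev_weight \<sigma> k *\<^sub>R rep_L2 (n t) k)"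
    and t: "\<And>t. tempered (u t)" and n: "continuous_on UNIV n"
  shows "Hs_C0 \<sigma> u"
  unfolding Hs_C0_def
proof (intro conjI allI)
  show "in_Hs \<sigma> (u s)" for s using Hs_norm_weight(2)[OF u] t by simp
  fix s
  have "((\<lambda>t. norm (n t - n s)) \<longlongrightarrow> 0) (at s)"
    using n by (intro tendsto_norm_zero LIM_zero) (simp add: continuous_on_def)
  then show "((\<lambda>t. Hs_norm \<sigma> (\<lambda>\<psi>. u t \<psi> - u s \<psi>)) \<longlongrightarrow> 0) (at s)"
    by (simp add: Hs_norm_weight(1)[OF has_fourier_weight_diff[OF u u]])
qed

lemma Hs_C1_weight:
  fixes n n' :: "real \<Rightarrow> complex L2"
  assumes u: "\<And>t. has_fourier (u t) (\<lambda>k. sobolev_weight \<sigma> k *\<^sub>R rep_L2 (n t) k)" and t: "\<And>t. tempered (u t)"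
    and u': "\<And>t. has_fourier (u' t) (\<lambda>k. sobolev_weight \<sigma> k *\<^sub>R rep_L2 (n' t) k)" and t': "\<And>t. tempered (u' t)"
    and n': "continuous_on UNIV n'"
    and lim: "\<And>t. ((\<lambda>h. inverse h *\<^sub>R (n (t + h) - n t)) \<longlongrightarrow> n' t) (at 0)"
  shows "Hs_C1 \<sigma> u"
  unfolding Hs_C1_def
proof (intro conjI allI exI[of _ u'])
  show "in_Hs \<sigma> (u s)" for s using Hs_norm_weight(2)[OF u] t by simp
  show "Hs_C0 \<sigma> u'" by (rule Hs_C0_weight[OF u' t' n'])
  fix s
  have "((\<lambda>h. norm (inverse h *\<^sub>R (n (s + h) - n s) - n' s)) \<longlongrightarrow> 0) (at 0)"
    using lim by (intro tendsto_norm_zero LIM_zero)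
  then show "((\<lambda>h. Hs_norm \<sigma> (\<lambda>\<psi>. (u (s + h) \<psi> - u s \<psi>) / complex_of_real h - u' s \<psi>)) \<longlongrightarrow> 0) (at 0)"
    by (simp add: Hs_norm_weight(1)[OF has_fourier_weight_diff[OF has_fourier_weight_divide[OF has_fourier_weight_diff[OF u u]] u']])
qed

text \<open>The same transform is read in two ways: with weight \<open>r\<close> and factor
  \<open>Q\<close> for continuity, and with weight \<open>r - 1\<close> and factor
  \<open>weight_op 1 (Q t)\<close> for differentiability. The second factor has a derivative in
  \<open>L2\<close> although \<open>Q\<close> itself need not.\<close>

lemma Hs_regularity:
  fixes \<pi> :: "(complex^3) \<times> (complex^3) \<Rightarrow> complex"
  assumes \<pi>: "bounded_symbol (\<lambda>_. \<pi>) 1" and r: "r \<ge> 0"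
    and u: "\<And>t. tempered (u t)" "\<And>t. has_fourier (u t) (\<lambda>k. \<pi> (rep_L2 (weight_op r (Q t)) k))"
    and u': "\<And>t. \<exists>w. tempered w \<and> has_fourier w (\<lambda>k. sobolev_weight (r - 1) k *\<^sub>R \<pi> (rep_L2 (Q' t) k))"
    and Q: "continuous_on UNIV Q" and Q': "continuous_on UNIV Q'"
    and lim: "\<And>t. ((\<lambda>h. inverse h *\<^sub>R (weight_op 1 (Q (t + h)) - weight_op 1 (Q t))) \<longlongrightarrow> Q' t) (at 0)"
  shows "Hs_C0 r u" "Hs_C1 (r - 1) u"
proof -
  let ?L = "l2_mult (\<lambda>_. \<pi>)"
  note Lb = bounded_linear_l2_mult[OF \<pi>]
  have lin: "\<pi> (a *\<^sub>R p) = a *\<^sub>R \<pi> p" for a p using \<pi> by (simp add: bounded_symbol_def linear_cmul)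
  have w1: "bounded_symbol (\<lambda>k w :: (complex^3) \<times> (complex^3). sobolev_weight 1 k *\<^sub>R w) 1" by (rule bounded_symbol_weight) simp
  have ur: "has_fourier (u t) (\<lambda>k. sobolev_weight r k *\<^sub>R rep_L2 (?L (Q t)) k)" for t
  proof (rule has_fourier_cong_AE[OF u(2)])
    show "AE k in lborel. \<pi> (rep_L2 (weight_op r (Q t)) k) = sobolev_weight r k *\<^sub>R rep_L2 (?L (Q t)) k"
      using rep_l2_mult[OF bounded_symbol_weight[OF r], of "Q t"] rep_l2_mult[OF \<pi>, of "Q t"]
      by eventually_elim (simp add: lin)
  qed measurable
  show "Hs_C0 r u"
    by (rule Hs_C0_weight[OF ur u(1)]) (rule bounded_linear.continuous_on[OF Lb Q])
  have ur1: "has_fourier (u t) (\<lambda>k. sobolev_weight (r - 1) k *\<^sub>R rep_L2 (?L (weight_op 1 (Q t))) k)" for t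
  proof (rule has_fourier_cong_AE[OF ur])
    have sw: "sobolev_weight (r - 1) k * sobolev_weight 1 k = sobolev_weight r k" for k
      by (simp add: sobolev_weight_add)
    show "AE k in lborel. sobolev_weight r k *\<^sub>R rep_L2 (?L (Q t)) k = sobolev_weight (r - 1) k *\<^sub>R rep_L2 (?L (weight_op 1 (Q t))) k"
      using rep_l2_mult[OF w1, of "Q t"] rep_l2_mult[OF \<pi>, of "Q t"] rep_l2_mult[OF \<pi>, of "weight_op 1 (Q t)"]
      by eventually_elim (simp add: lin sw)
  qed measurable
  obtain w where w: "\<And>t. tempered (w t)" "\<And>t. has_fourier (w t) (\<lambda>k. sobolev_weight (r - 1) k *\<^sub>R \<pi> (rep_L2 (Q' t) k))"
    using u' by metis
  have w': "has_fourier (w t) (\<lambda>k. sobolev_weight (r - 1) k *\<^sub>R rep_L2 (?L (Q' t)) k)" for t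
  proof (rule has_fourier_cong_AE[OF w(2)])
    show "AE k in lborel. sobolev_weight (r - 1) k *\<^sub>R \<pi> (rep_L2 (Q' t) k) = sobolev_weight (r - 1) k *\<^sub>R rep_L2 (?L (Q' t)) k"
      using rep_l2_mult[OF \<pi>, of "Q' t"] by eventually_elim simp
  qed measurable
  show "Hs_C1 (r - 1) u"
  proof (rule Hs_C1_weight[OF ur1 u(1) w' w(1)])
    show "continuous_on UNIV (\<lambda>t. ?L (Q' t))" by (rule bounded_linear.continuous_on[OF Lb Q'])
    show "((\<lambda>h. inverse h *\<^sub>R (?L (weight_op 1 (Q (t + h))) - ?L (weight_op 1 (Q t)))) \<longlongrightarrow> ?L (Q' t)) (at 0)" for t
      using bounded_linear.tendsto[OF Lb lim[of t]]
      by (simp add: linear_cmul[OF bounded_linear.linear[OF Lb]] linear_diff[OF bounded_linear.linear[OF Lb]])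
  qed
qed

lemma tempered_component: "tempered (component F i)"
  unfolding component_def by (rule tempered_dist_of) (rule square_integrable_mult[OF bounded_symbol_nth], simp)

lemma bounded_symbol_fst_nth: "bounded_symbol (\<lambda>_ p :: (complex^3) \<times> (complex^3). fst p $ i) 1"
  using bounded_symbol_comp[OF bounded_symbol_nth bounded_symbol_fst] by simp

lemma bounded_symbol_snd_nth: "bounded_symbol (\<lambda>_ p :: (complex^3) \<times> (complex^3). snd p $ i) 1"
  using bounded_symbol_comp[OF bounded_symbol_nth bounded_symbol_snd] by simp

lemma has_fourier_fst:
  "has_fourier (component (fst P) i) (\<lambda>k. fst (rep_L2 (pair_fourier P) k) $ i)"
proof (rule has_fourier_cong_AE[OF has_fourier_component])
  show "AE k in lborel. rep_L2 (vec_fourier (fst P)) k $ i = fst (rep_L2 (pair_fourier P) k) $ i"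
    using rep_pair_fourier[of P] by eventually_elim simp
qed (rule bounded_symbol_measurable[OF bounded_symbol_fst_nth rep_L2_measurable])

lemma has_fourier_snd:
  "has_fourier (component (snd P) i) (\<lambda>k. snd (rep_L2 (pair_fourier P) k) $ i)"
proof (rule has_fourier_cong_AE[OF has_fourier_component])
  show "AE k in lborel. rep_L2 (vec_fourier (snd P)) k $ i = snd (rep_L2 (pair_fourier P) k) $ i"
    using rep_pair_fourier[of P] by eventually_elim simp
qed (rule bounded_symbol_measurable[OF bounded_symbol_snd_nth rep_L2_measurable])

text \<open>Multiplied by the weight of order \<open>r - 1\<close>, the abstract derivative becomes
  the transform of curl plus source; in this form it belongs to a known tempered
  distribution.\<close>

lemma field_equation_transform:
  fixes Q J :: "((complex^3) \<times> (complex^3)) L2"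
  assumes P: "pair_fourier P = weight_op r Q" and j: "pair_fourier p = weight_op r J" and r: "r \<ge> 0"
  shows "AE k in lborel. sobolev_weight (r - 1) k *\<^sub>R rep_L2 (l2_mult generator_symbol Q + weight_op 1 J) k =
    (curl_symbol k (rep_L2 (vec_fourier (snd P)) k), - curl_symbol k (rep_L2 (vec_fourier (fst P)) k)) + rep_L2 (pair_fourier p) k"
proof -
  have w1: "bounded_symbol (\<lambda>k w :: (complex^3) \<times> (complex^3). sobolev_weight 1 k *\<^sub>R w) 1" by (rule bounded_symbol_weight) simp
  have sw: "sobolev_weight (r - 1) k * sobolev_weight 1 k = sobolev_weight r k" for k
    by (simp add: sobolev_weight_add)
  note wr = rep_l2_mult[OF bounded_symbol_weight[OF r], of Q, folded P] rep_l2_mult[OF bounded_symbol_weight[OF r], of J, folded j]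
  show ?thesis
    using wr rep_L2_add[of "l2_mult generator_symbol Q" "weight_op 1 J"] rep_l2_mult[OF bounded_symbol_generator, of Q]
      rep_l2_mult[OF w1, of J] rep_pair_fourier[of P]
  proof eventually_elim
    case (elim k)
    have s: "rep_L2 (vec_fourier (snd P)) k = sobolev_weight r k *\<^sub>R snd (rep_L2 Q k)"
      "rep_L2 (vec_fourier (fst P)) k = sobolev_weight r k *\<^sub>R fst (rep_L2 Q k)"
      using elim(1,6) by (metis snd_conv snd_scaleR) (use elim(1,6) in \<open>metis fst_conv fst_scaleR\<close>)
    show ?case
      unfolding elim(2,3,4,5) s generator_symbol_def curl_symbol_linear
      by (simp add: scaleR_add_right sw)
  qed
qed

lemma field_derivative_distribution:
  fixes Q J :: "((complex^3) \<times> (complex^3)) L2"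
  assumes P: "pair_fourier P = weight_op r Q" and j: "pair_fourier p = weight_op r J" and r: "r \<ge> 0"
  shows "\<exists>w. tempered w \<and> has_fourier w (\<lambda>k. sobolev_weight (r - 1) k *\<^sub>R fst (rep_L2 (l2_mult generator_symbol Q + weight_op 1 J) k) $ i)"
    "\<exists>w. tempered w \<and> has_fourier w (\<lambda>k. sobolev_weight (r - 1) k *\<^sub>R snd (rep_L2 (l2_mult generator_symbol Q + weight_op 1 J) k) $ i)"
proof -
  let ?D = "l2_mult generator_symbol Q + weight_op 1 J"
  note AE = field_equation_transform[OF P j r]
  have [measurable]: "(\<lambda>k. fst (rep_L2 ?D k) $ i) \<in> borel_measurable borel" "(\<lambda>k. snd (rep_L2 ?D k) $ i) \<in> borel_measurable borel"
    by (rule bounded_symbol_measurable[OF bounded_symbol_fst_nth rep_L2_measurable])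
      (rule bounded_symbol_measurable[OF bounded_symbol_snd_nth rep_L2_measurable])
  obtain u where u: "tempered u" "has_fourier u (\<lambda>k. curl_symbol k (rep_L2 (vec_fourier (snd P)) k) $ i)"
    using curl_distribution by blast
  have "has_fourier (\<lambda>\<psi>. u \<psi> + component (fst p) i \<psi>) (\<lambda>k. sobolev_weight (r - 1) k *\<^sub>R fst (rep_L2 ?D k) $ i)"
  proof (rule has_fourier_cong_AE[OF has_fourier_add[OF u(2) has_fourier_fst]])
    show "AE k in lborel. curl_symbol k (rep_L2 (vec_fourier (snd P)) k) $ i + fst (rep_L2 (pair_fourier p) k) $ i =
        sobolev_weight (r - 1) k *\<^sub>R fst (rep_L2 ?D k) $ i"
      using AE
    proof eventually_elim
      case (elim k)
      from arg_cong[OF elim, of "\<lambda>z. fst z $ i"] show ?case by simp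
    qed
  qed measurable
  then show "\<exists>w. tempered w \<and> has_fourier w (\<lambda>k. sobolev_weight (r - 1) k *\<^sub>R fst (rep_L2 ?D k) $ i)"
    using tempered_add[OF u(1) tempered_component] by blast
  obtain v where v: "tempered v" "has_fourier v (\<lambda>k. curl_symbol k (rep_L2 (vec_fourier (fst P)) k) $ i)"
    using curl_distribution by blast
  have "has_fourier (\<lambda>\<psi>. - v \<psi> + component (snd p) i \<psi>) (\<lambda>k. sobolev_weight (r - 1) k *\<^sub>R snd (rep_L2 ?D k) $ i)"
  proof (rule has_fourier_cong_AE[OF has_fourier_add[OF has_fourier_uminus[OF v(2)] has_fourier_snd]])
    show "AE k in lborel. - curl_symbol k (rep_L2 (vec_fourier (fst P)) k) $ i + snd (rep_L2 (pair_fourier p) k) $ i =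
        sobolev_weight (r - 1) k *\<^sub>R snd (rep_L2 ?D k) $ i"
      using AE
    proof eventually_elim
      case (elim k)
      from arg_cong[OF elim, of "\<lambda>z. snd z $ i"] show ?case by simp
    qed
  qed measurable
  then show "\<exists>w. tempered w \<and> has_fourier w (\<lambda>k. sobolev_weight (r - 1) k *\<^sub>R snd (rep_L2 ?D k) $ i)"
    using tempered_add[OF tempered_uminus[OF v(1)] tempered_component] by blast
qed

lemma pair_fourier_weight_factor:
  assumes r: "r \<ge> 0" and H: "\<forall>i. in_Hs r (component E i) \<and> in_Hs r (component B i)"
  shows "\<exists>q. pair_fourier (E, B) = weight_op r q"
proof (rule weight_op_factor[OF r])
  let ?w = "\<lambda>k. (1 + (norm k)\<^sup>2) powr r"
  have i: "integrable lborel (\<lambda>k. ?w k * (norm (rep_L2 (vec_fourier E) k $ i))\<^sup>2)"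
    "integrable lborel (\<lambda>k. ?w k * (norm (rep_L2 (vec_fourier B) k $ i))\<^sup>2)" for i
    using H in_Hs_iff[OF has_fourier_component] by blast+
  have "integrable lborel (\<lambda>k. (\<Sum>i\<in>UNIV. ?w k * (norm (rep_L2 (vec_fourier E) k $ i))\<^sup>2) + (\<Sum>i\<in>UNIV. ?w k * (norm (rep_L2 (vec_fourier B) k $ i))\<^sup>2))"
    by (intro Bochner_Integration.integrable_add Bochner_Integration.integrable_sum i)
  then have I: "integrable lborel (\<lambda>k. ?w k * (norm (rep_L2 (vec_fourier E) k))\<^sup>2 + ?w k * (norm (rep_L2 (vec_fourier B) k))\<^sup>2)"
    by (simp add: norm_vec3_sum sum_distrib_left)
  have e: "AE k in lborel. ?w k * (norm (rep_L2 (vec_fourier E) k))\<^sup>2 + ?w k * (norm (rep_L2 (vec_fourier B) k))\<^sup>2 =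
      ?w k * (norm (rep_L2 (pair_fourier (E, B)) k))\<^sup>2"
    using rep_pair_fourier[of "(E, B)"] by eventually_elim (simp add: norm_Pair distrib_left)
  show "integrable lborel (\<lambda>k. ?w k * (norm (rep_L2 (pair_fourier (E, B)) k))\<^sup>2)"
    using I by (subst (asm) integrable_cong_AE[OF _ _ e]) measurable
qed

text \<open>For \<open>r \<ge> 0\<close> the Sobolev weight is at least 1, so the Sobolev norm
  dominates the \<open>L2\<close> norm. This brings arbitrary members of the solution class into the
  \<open>L2\<close> setting where uniqueness is proved.\<close>

lemma Hs_C0_imp_continuous:
  assumes r: "r \<ge> 0" and E: "\<And>i. Hs_C0 r (\<lambda>t. component (E t) i)"
  shows "continuous_on UNIV E"
  unfolding continuous_on_def
proof (intro ballI)
  fix t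
  let ?w = "\<lambda>k. (1 + (norm k)\<^sup>2) powr r"
  have le: "norm (l2_nth i (vec_fourier (E s - E t))) \<le> Hs_norm r (\<lambda>\<psi>. component (E s) i \<psi> - component (E t) i \<psi>)" for s i
  proof -
    let ?d = "\<lambda>k. rep_L2 (vec_fourier (E s - E t)) k $ i"
    have [measurable]: "(\<lambda>k. rep_L2 (vec_fourier G) k $ i) \<in> borel_measurable borel" for G
      by (rule bounded_symbol_measurable[OF bounded_symbol_nth rep_L2_measurable])
    have h0: "has_fourier (\<lambda>\<psi>. component (E s) i \<psi> - component (E t) i \<psi>)
        (\<lambda>k. rep_L2 (vec_fourier (E s)) k $ i - rep_L2 (vec_fourier (E t)) k $ i)"
      using has_fourier_add[OF has_fourier_component[of "E s" i] has_fourier_uminus[OF has_fourier_component[of "E t" i]]]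
      by (simp only: add_uminus_conv_diff)
    have e: "AE k in lborel. rep_L2 (vec_fourier (E s)) k $ i - rep_L2 (vec_fourier (E t)) k $ i = ?d k"
      unfolding linear_diff[OF bounded_linear.linear[OF bounded_linear_vec_fourier]]
      using rep_L2_diff[of "vec_fourier (E s)" "vec_fourier (E t)"] by eventually_elim simp
    have h: "has_fourier (\<lambda>\<psi>. component (E s) i \<psi> - component (E t) i \<psi>) ?d"
      by (rule has_fourier_cong_AE[OF h0 e]) measurable
    have i: "integrable lborel (\<lambda>k. ?w k * (norm (rep_L2 (vec_fourier (E s)) k $ i))\<^sup>2)" for s
      using E[of i] in_Hs_iff[OF has_fourier_component] unfolding Hs_C0_def by blast
    have I: "integrable lborel (\<lambda>k. 2 * (?w k * (norm (rep_L2 (vec_fourier (E s)) k $ i))\<^sup>2) + 2 * (?w k * (norm (rep_L2 (vec_fourier (E t)) k $ i))\<^sup>2))"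
      by (intro Bochner_Integration.integrable_add integrable_mult_right i)
    \<comment> \<open>Without integrability the integral in \<open>Hs_norm\<close> would have the
      default value 0 and could not dominate anything.\<close>
    have int: "integrable lborel (\<lambda>k. ?w k * (norm (?d k))\<^sup>2)"
    proof (rule Bochner_Integration.integrable_bound[OF I])
      show "AE k in lborel. norm (?w k * (norm (?d k))\<^sup>2) \<le>
          norm (2 * (?w k * (norm (rep_L2 (vec_fourier (E s)) k $ i))\<^sup>2) + 2 * (?w k * (norm (rep_L2 (vec_fourier (E t)) k $ i))\<^sup>2))"
        using e
      proof eventually_elim
        case (elim k)
        let ?a = "rep_L2 (vec_fourier (E s)) k $ i" and ?b = "rep_L2 (vec_fourier (E t)) k $ i"
        have "(norm (?a - ?b))\<^sup>2 \<le> (norm ?a + norm ?b)\<^sup>2"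
          by (intro power_mono norm_triangle_ineq4) simp
        also have "\<dots> \<le> 2 * (norm ?a)\<^sup>2 + 2 * (norm ?b)\<^sup>2"
          using sum_squares_bound[of "norm ?a" "norm ?b"] by (simp add: power2_sum)
        finally have "?w k * (norm (?a - ?b))\<^sup>2 \<le> ?w k * (2 * (norm ?a)\<^sup>2 + 2 * (norm ?b)\<^sup>2)"
          by (intro mult_left_mono) auto
        then show ?case unfolding elim[symmetric] by (simp add: algebra_simps)
      qed
    qed measurable
    have d2: "integrable lborel (\<lambda>k. (norm (?d k))\<^sup>2)"
      using square_integrable_mult[OF bounded_symbol_nth, of "rep_L2 (vec_fourier (E s - E t))" i] by (simp add: square_integrable_def)
    have "(norm (l2_nth i (vec_fourier (E s - E t))))\<^sup>2 = (LINT k|lborel. (norm (?d k))\<^sup>2)"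
      unfolding l2_mult_def by (rule norm_abs_L2[OF square_integrable_mult[OF bounded_symbol_nth]]) simp
    also have "\<dots> \<le> (LINT k|lborel. ?w k * (norm (?d k))\<^sup>2)"
    proof (rule integral_mono[OF d2 int])
      fix k :: "real^3"
      have "1 \<le> ?w k" using r by (intro ge_one_powr_ge_zero) auto
      then show "(norm (?d k))\<^sup>2 \<le> ?w k * (norm (?d k))\<^sup>2"
        using mult_right_mono[of 1 "?w k" "(norm (?d k))\<^sup>2"] by simp
    qed
    finally show ?thesis unfolding Hs_norm_eq[OF h] by (rule real_le_rsqrt)
  qed
  have "norm (E s - E t) \<le> (\<Sum>i\<in>UNIV. Hs_norm r (\<lambda>\<psi>. component (E s) i \<psi> - component (E t) i \<psi>))" for s
  proof -
    have "norm (E s - E t) = norm (vec_fourier (E s - E t))" by (simp add: norm_vec_fourier)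
    also have "\<dots> = sqrt (\<Sum>i\<in>UNIV. (norm (l2_nth i (vec_fourier (E s - E t))))\<^sup>2)"
      unfolding norm_L2_vec3[symmetric] by simp
    also have "\<dots> = L2_set (\<lambda>i. norm (l2_nth i (vec_fourier (E s - E t)))) UNIV" by (simp add: L2_set_def)
    also have "\<dots> \<le> (\<Sum>i\<in>UNIV. norm (l2_nth i (vec_fourier (E s - E t))))" by (rule L2_set_le_sum) simp
    also have "\<dots> \<le> (\<Sum>i\<in>UNIV. Hs_norm r (\<lambda>\<psi>. component (E s) i \<psi> - component (E t) i \<psi>))" by (intro sum_mono le)
    finally show ?thesis .
  qed
  moreover have "((\<lambda>s. \<Sum>i\<in>UNIV. Hs_norm r (\<lambda>\<psi>. component (E s) i \<psi> - component (E t) i \<psi>)) \<longlongrightarrow> (\<Sum>i\<in>(UNIV :: 3 set). 0)) (at t)"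
    using E by (intro tendsto_sum) (simp add: Hs_C0_def)
  ultimately have "((\<lambda>s. E s - E t) \<longlongrightarrow> 0) (at t)"
    by (intro Lim_null_comparison[of "\<lambda>s. E s - E t"]) (auto intro: always_eventually)
  then show "(E \<longlongrightarrow> E t) (at t within UNIV)" by (simp add: LIM_zero_cancel)
qed

section \<open>The divergence equations\<close>

lemma test_function_iter_pderiv:
  assumes "test_function \<psi>"
  shows "iter_pderiv is \<psi> differentiable (at x)" "continuous_on S (iter_pderiv is \<psi>)"
    "\<exists>R. \<forall>x. R < norm x \<longrightarrow> iter_pderiv is \<psi> x = 0"
proof -
  show d: "iter_pderiv is \<psi> differentiable (at x)" for "is" x using assms by (simp add: test_function_def smooth_def)
  show "continuous_on S (iter_pderiv is \<psi>)"
    by (intro continuous_at_imp_continuous_on ballI differentiable_imp_continuous_within d)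
  obtain R where R: "\<And>x. R < norm x \<Longrightarrow> \<psi> x = 0" using assms by (auto simp: test_function_def)
  have "R < norm x \<Longrightarrow> iter_pderiv is \<psi> x = 0" for x
  proof (induction "is" arbitrary: x)
    case Nil then show ?case using R by simp
  next
    case (Cons i "is")
    have o: "open {x :: real^3. R < norm x}" by (intro open_Collect_less continuous_intros)
    have "(iter_pderiv is \<psi> has_derivative (\<lambda>h. 0)) (at x)"
      by (rule has_derivative_transform_within_open[OF has_derivative_const o]) (use Cons in auto)
    from frechet_derivative_at[OF this] show ?case by (simp add: pderiv_at_def fun_eq_iff)
  qed
  then show "\<exists>R. \<forall>x. R < norm x \<longrightarrow> iter_pderiv is \<psi> x = 0" by blast
qed

lemma compact_support_bounded:
  fixes f :: "real^3 \<Rightarrow> 'b::euclidean_space"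
  assumes c: "continuous_on UNIV f" and R: "\<And>x. R < norm x \<Longrightarrow> f x = 0"
  shows "\<exists>K. \<forall>x. norm (f x) \<le> K" "integrable lborel f" "square_integrable f"
proof -
  have "compact ((\<lambda>x. (1 + norm x) ^ 6 * norm (f x)) ` cball 0 R)"
    by (intro compact_continuous_image continuous_intros continuous_on_subset[OF c]) auto
  then obtain K where K: "\<And>x. x \<in> cball 0 R \<Longrightarrow> norm ((1 + norm x) ^ 6 * norm (f x)) \<le> K"
    by (meson bounded_iff compact_imp_bounded image_eqI)
  have b: "(1 + norm x) ^ 6 * norm (f x) \<le> max K 0" for x
  proof (cases "norm x \<le> R")
    case True then show ?thesis using K[of x] by simp
  next
    case False then show ?thesis using R[of x] by simp
  qed
  have m: "f \<in> borel_measurable borel" by (rule borel_measurable_continuous_onI[OF c])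
  show "integrable lborel f" "square_integrable f" using decay_integrable(1,2)[OF m b] by simp_all
  have "norm (f x) \<le> max K 0" for x
  proof -
    have "1 * norm (f x) \<le> (1 + norm x) ^ 6 * norm (f x)" by (intro mult_right_mono one_le_power) auto
    then show ?thesis using b[of x] by simp
  qed
  then show "\<exists>K. \<forall>x. norm (f x) \<le> K" by blast
qed

lemma test_function_bounded:
  assumes "test_function \<psi>"
  shows "\<exists>K. \<forall>x. norm (iter_pderiv is \<psi> x) \<le> K" "integrable lborel (iter_pderiv is \<psi>)"
    "square_integrable (iter_pderiv is \<psi>)"
proof -
  obtain R where "\<And>x. R < norm x \<Longrightarrow> iter_pderiv is \<psi> x = 0" using test_function_iter_pderiv(3)[OF assms, of "is"] by blast
  note * = compact_support_bounded[OF test_function_iter_pderiv(2)[OF assms] this]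
  show "\<exists>K. \<forall>x. norm (iter_pderiv is \<psi> x) \<le> K" "integrable lborel (iter_pderiv is \<psi>)"
    "square_integrable (iter_pderiv is \<psi>)"
    by (rule *(1); assumption) (rule *; assumption)+
qed

lemma test_function_has_derivative:
  assumes "test_function \<psi>"
  shows "(\<psi> has_derivative (\<lambda>h. h \<bullet> (\<chi> i. pderiv_at i \<psi> x))) (at x)"
proof -
  have d: "\<psi> differentiable (at x)" using test_function_iter_pderiv(1)[OF assms, of "[]"] by simp
  then have D: "(\<psi> has_derivative frechet_derivative \<psi> (at x)) (at x)" by (simp add: frechet_derivative_works)
  then have l: "linear (frechet_derivative \<psi> (at x))" by (rule has_derivative_linear)
  have "frechet_derivative \<psi> (at x) h = h \<bullet> (\<chi> i. pderiv_at i \<psi> x)" for h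
  proof -
    have "h = (\<Sum>i\<in>UNIV. h $ i *\<^sub>R axis i 1)"
      by (simp add: vec_eq_iff axis_def if_distrib cong: if_cong)
    then have "frechet_derivative \<psi> (at x) h = (\<Sum>i\<in>UNIV. h $ i *\<^sub>R frechet_derivative \<psi> (at x) (axis i 1))"
      using linear_sum[OF l, of "\<lambda>i. h $ i *\<^sub>R axis i 1" UNIV] linear_cmul[OF l] by simp
    then show ?thesis by (simp add: inner_vec_def pderiv_at_def)
  qed
  then have "frechet_derivative \<psi> (at x) = (\<lambda>h. h \<bullet> (\<chi> i. pderiv_at i \<psi> x))" by (rule ext)
  with D show ?thesis by simp
qed

lemma grad_continuous:
  assumes "test_function \<psi>"
  shows "continuous_on S (\<lambda>x. \<chi> i. pderiv_at i \<psi> x)"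
  using test_function_iter_pderiv(2)[OF assms, of S "[_]"] by (intro continuous_on_vec_lambda) simp

lemma grad_square_integrable:
  assumes "test_function \<psi>"
  shows "square_integrable (\<lambda>x. \<chi> i. pderiv_at i \<psi> x)" "\<exists>K. \<forall>x. norm (\<chi> i. pderiv_at i \<psi> x) \<le> K"
proof -
  have "\<exists>R. \<forall>x. R < norm x \<longrightarrow> pderiv_at i \<psi> x = 0" for i
    using test_function_iter_pderiv(3)[OF assms, of "[i]"] by simp
  then obtain R where R: "\<And>i x. R i < norm x \<Longrightarrow> pderiv_at i \<psi> x = 0" by metis
  have "(\<chi> i. pderiv_at i \<psi> x) = 0" if "max (R 1) (max (R 2) (R 3)) < norm x" for x
    using that R by (simp add: vec_eq_iff forall_3)
  note * = compact_support_bounded[OF grad_continuous[OF assms] this]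
  show "square_integrable (\<lambda>x. \<chi> i. pderiv_at i \<psi> x)" "\<exists>K. \<forall>x. norm (\<chi> i. pderiv_at i \<psi> x) \<le> K"
    using *(3) *(1) by blast+
qed

lemma test_function_lipschitz:
  assumes "test_function \<psi>"
  shows "\<exists>K\<ge>0. \<forall>x y. \<bar>\<psi> x - \<psi> y\<bar> \<le> K * norm (x - y)"
proof -
  obtain K where K: "\<And>x. norm (\<chi> i. pderiv_at i \<psi> x) \<le> K" using grad_square_integrable(2)[OF assms] by blast
  have K0: "K \<ge> 0" using K norm_ge_zero order_trans by blast
  have "norm (\<psi> x - \<psi> y) \<le> K * norm (x - y)" for x y
  proof (rule differentiable_bound[of UNIV])
    show "(\<psi> has_derivative (\<lambda>h. h \<bullet> (\<chi> i. pderiv_at i \<psi> x))) (at x within UNIV)" for x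
      using test_function_has_derivative[OF assms] by simp
    show "onorm (\<lambda>h. h \<bullet> (\<chi> i. pderiv_at i \<psi> x)) \<le> K" for x
    proof (rule onorm_bound[OF K0])
      fix h :: "real^3"
      have "norm (h \<bullet> (\<chi> i. pderiv_at i \<psi> x)) \<le> norm h * norm (\<chi> i. pderiv_at i \<psi> x)"
        by (simp add: Cauchy_Schwarz_ineq2)
      also have "\<dots> \<le> norm h * K" by (intro mult_left_mono K) simp
      finally show "norm (h \<bullet> (\<chi> i. pderiv_at i \<psi> x)) \<le> K * norm h" by (simp add: mult.commute)
    qed
  qed auto
  then show ?thesis using K0 by auto
qed

text \<open>Difference quotients take the place of integration by parts: their transforms are
  explicit by the translation rule, and both sides arise as their limits, on the left by dominated
  convergence.\<close>

lemma schwartz_fourier_pderiv_test_function: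
  assumes \<psi>: "test_function \<psi>"
  shows "schwartz_fourier (\<lambda>x. of_real (pderiv_at i \<psi> x)) k =
    \<i> * of_real (k $ i) * schwartz_fourier (\<lambda>x. of_real (\<psi> x)) k"
proof -
  define s where "s n = 1 / real (Suc n)" for n
  have s: "s n > 0" "s n \<le> 1" for n by (simp_all add: s_def)
  have "s \<longlonglongrightarrow> 0" unfolding s_def by (rule LIMSEQ_Suc[OF lim_1_over_n])
  then have slim: "filterlim s (at 0) sequentially"
    unfolding filterlim_at using s(1) by (auto intro!: always_eventually simp: less_imp_neq[symmetric])
  define a :: "real^3" where "a = axis i 1"
  have na: "norm a = 1" by (simp add: a_def norm_axis3)
  obtain K where K: "K \<ge> 0" "\<And>x y. \<bar>\<psi> x - \<psi> y\<bar> \<le> K * norm (x - y)" using test_function_lipschitz[OF \<psi>] by blast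
  obtain R where R: "\<And>x. R < norm x \<Longrightarrow> \<psi> x = 0" using \<psi> by (auto simp: test_function_def)
  have \<psi>i: "integrable lborel \<psi>" using test_function_bounded(2)[OF \<psi>, of "[]"] by simp
  then have \<psi>c: "integrable lborel (\<lambda>x. complex_of_real (\<psi> x))" by (rule integrable_of_real)
  have [measurable]: "\<psi> \<in> borel_measurable borel" using \<psi>i by measurable
  have [measurable]: "pderiv_at i \<psi> \<in> borel_measurable borel"
    using test_function_bounded(2)[OF \<psi>, of "[i]"] by (auto dest: borel_measurable_integrable)
  define d where "d n x = (\<psi> (x + s n *\<^sub>R a) - \<psi> x) / s n" for n x
  have dF: "schwartz_fourier (\<lambda>x. of_real (d n x)) k =
      of_real (inverse (s n)) * ((cis (s n * (k $ i)) - 1) * schwartz_fourier (\<lambda>x. of_real (\<psi> x)) k)" for n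
  proof -
    have t: "schwartz_fourier (\<lambda>x. of_real (\<psi> (x + s n *\<^sub>R a))) k = cis (s n * (k $ i)) * schwartz_fourier (\<lambda>x. of_real (\<psi> x)) k"
      using schwartz_fourier_translate[of "\<lambda>x. of_real (\<psi> x)" "- (s n *\<^sub>R a)" k]
      by (simp add: a_def inner_axis)
    have I: "integrable lborel (\<lambda>x. complex_of_real (\<psi> (x + s n *\<^sub>R a)))"
      using \<psi>c by (subst lborel_integral_translate(1))
    have "(\<lambda>x. complex_of_real (d n x)) = (\<lambda>x. of_real (inverse (s n)) * (of_real (\<psi> (x + s n *\<^sub>R a)) - of_real (\<psi> x)))"
      by (simp add: d_def fun_eq_iff divide_inverse mult.commute)
    then show ?thesis
      by (simp only: schwartz_fourier_cmult schwartz_fourier_linear(2)[OF I \<psi>c] t left_diff_distrib mult_1_left)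
  qed
  have dlim: "(\<lambda>n. d n x) \<longlonglongrightarrow> pderiv_at i \<psi> x" for x
  proof -
    have "((\<lambda>\<tau>. \<psi> (x + \<tau> *\<^sub>R a)) has_derivative (\<lambda>\<tau>. (\<tau> *\<^sub>R a) \<bullet> (\<chi> i. pderiv_at i \<psi> x))) (at 0)"
    proof (rule has_derivative_compose[where f = "\<lambda>\<tau>. x + \<tau> *\<^sub>R a" and g = \<psi>])
      show "((\<lambda>\<tau>. x + \<tau> *\<^sub>R a) has_derivative (\<lambda>\<tau>. \<tau> *\<^sub>R a)) (at 0)"
        by (auto intro!: derivative_eq_intros)
    qed (use test_function_has_derivative[OF \<psi>, of x] in simp)
    then have "((\<lambda>\<tau>. \<psi> (x + \<tau> *\<^sub>R a)) has_derivative (\<lambda>\<tau>. \<tau> *\<^sub>R pderiv_at i \<psi> x)) (at 0)"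
      by (rule has_derivative_eq_rhs) (simp add: a_def inner_axis' fun_eq_iff)
    from has_derivative_quotient[OF this]
    have "((\<lambda>h. inverse h *\<^sub>R (\<psi> (x + h *\<^sub>R a) - \<psi> x)) \<longlongrightarrow> pderiv_at i \<psi> x) (at 0)" by simp
    from filterlim_compose[OF this slim] show ?thesis by (simp add: d_def divide_inverse mult.commute)
  qed
  have "(\<lambda>n. LINT x|lborel. cis (- (k \<bullet> x)) * of_real (d n x)) \<longlonglongrightarrow> (LINT x|lborel. cis (- (k \<bullet> x)) * of_real (pderiv_at i \<psi> x))"
  \<comment> \<open>The Lipschitz constant bounds every difference quotient, and shifts of length at
    most 1 enlarge the support radius from \<open>R\<close> to \<open>R + 1\<close>.\<close>
  proof (rule integral_dominated_convergence[where w = "\<lambda>x. K * indicator (cball 0 (R + 1)) x"])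
    have "integrable lborel (indicator (cball 0 (R + 1)) :: real^3 \<Rightarrow> real)"
      by (rule integrable_real_indicator) (use emeasure_bounded_finite[OF bounded_cball, of "0 :: real^3" "R + 1"] in auto)
    then show "integrable lborel (\<lambda>x :: real^3. K * indicator (cball 0 (R + 1)) x)" by simp
    show "AE x in lborel. (\<lambda>n. cis (- (k \<bullet> x)) * of_real (d n x)) \<longlonglongrightarrow> cis (- (k \<bullet> x)) * of_real (pderiv_at i \<psi> x)"
      by (intro AE_I2 tendsto_intros dlim)
    show "AE x in lborel. norm (cis (- (k \<bullet> x)) * of_real (d n x)) \<le> K * indicator (cball 0 (R + 1)) x" for n
    proof (rule AE_I2)
      fix x :: "real^3"
      show "norm (cis (- (k \<bullet> x)) * of_real (d n x)) \<le> K * indicator (cball 0 (R + 1)) x"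
      proof (cases "norm x \<le> R + 1")
        case True
        have "\<bar>\<psi> (x + s n *\<^sub>R a) - \<psi> x\<bar> \<le> K * s n"
          using K(2)[of "x + s n *\<^sub>R a" x] s[of n] na by simp
        then have "\<bar>d n x\<bar> \<le> K" using s(1)[of n] by (simp add: d_def pos_divide_le_eq)
        then show ?thesis using True by (simp add: norm_mult)
      next
        case False
        have "norm x \<le> norm (x + s n *\<^sub>R a) + norm (s n *\<^sub>R a)" using norm_triangle_ineq4[of "x + s n *\<^sub>R a" "s n *\<^sub>R a"] by simp
        also have "norm (s n *\<^sub>R a) \<le> 1" using na s[of n] by simp
        finally have "R < norm (x + s n *\<^sub>R a)" using False by linarith
        then show ?thesis using False R by (simp add: d_def)
      qed
    qed
    show "(\<lambda>x. cis (- (k \<bullet> x)) * complex_of_real (d n x)) \<in> borel_measurable lborel" for n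
      unfolding d_def by measurable
  qed measurable
  then have 1: "(\<lambda>n. schwartz_fourier (\<lambda>x. of_real (d n x)) k) \<longlonglongrightarrow> schwartz_fourier (\<lambda>x. of_real (pderiv_at i \<psi> x)) k"
    unfolding schwartz_fourier_def by (intro tendsto_intros)
  have "((\<lambda>\<tau>. cis (\<tau> * (k $ i))) has_derivative (\<lambda>\<tau>. \<tau> *\<^sub>R (\<i> * of_real (k $ i)))) (at 0)"
  proof -
    have "((\<lambda>\<tau>. complex_of_real (cos (\<tau> * (k $ i))) + \<i> * of_real (sin (\<tau> * (k $ i)))) has_derivative
        (\<lambda>\<tau>. \<tau> *\<^sub>R (\<i> * of_real (k $ i)))) (at 0)"
      by (auto intro!: derivative_eq_intros simp: scaleR_conv_of_real)
    moreover have "cis a = of_real (cos a) + \<i> * of_real (sin a)" for a by (simp add: complex_eq_iff)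
    ultimately show ?thesis by (simp only:)
  qed
  from has_derivative_quotient[OF this]
  have "((\<lambda>h. inverse h *\<^sub>R (cis (h * (k $ i)) - 1)) \<longlongrightarrow> \<i> * of_real (k $ i)) (at 0)" by simp
  then have "(\<lambda>n. inverse (s n) *\<^sub>R (cis (s n * (k $ i)) - 1)) \<longlonglongrightarrow> \<i> * of_real (k $ i)"
    by (rule filterlim_compose[OF _ slim])
  then have "(\<lambda>n. (inverse (s n) *\<^sub>R (cis (s n * (k $ i)) - 1)) * schwartz_fourier (\<lambda>x. of_real (\<psi> x)) k) \<longlonglongrightarrow>
      \<i> * of_real (k $ i) * schwartz_fourier (\<lambda>x. of_real (\<psi> x)) k" by (intro tendsto_intros)
  then have "(\<lambda>n. schwartz_fourier (\<lambda>x. of_real (d n x)) k) \<longlonglongrightarrow> \<i> * of_real (k $ i) * schwartz_fourier (\<lambda>x. of_real (\<psi> x)) k"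
    unfolding dF by (simp add: scaleR_conv_of_real mult.assoc)
  with 1 show ?thesis by (rule LIMSEQ_unique)
qed

section \<open>Gradients, the free group and charge conservation\<close>

definition grad_L2 :: "(real^3 \<Rightarrow> real) \<Rightarrow> (real^3) L2" where
  "grad_L2 \<psi> = abs_L2 (\<lambda>x. \<chi> i. pderiv_at i \<psi> x)"

text \<open>The transform of a gradient is parallel to \<open>k\<close>, so its cross product with
  \<open>k\<close> vanishes.\<close>

lemma curl_symbol_vec_fourier_grad:
  assumes \<psi>: "test_function \<psi>"
  shows "AE k in lborel. curl_symbol k (rep_L2 (vec_fourier (grad_L2 \<psi>)) k) = 0"
proof -
  have c: "AE k in lborel. rep_L2 (vec_fourier (grad_L2 \<psi>)) k $ i = \<i> * of_real (k $ i) * schwartz_fourier (\<lambda>x. of_real (\<psi> x)) k" for i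
  proof -
    have p: "integrable lborel (\<lambda>x. complex_of_real (pderiv_at i \<psi> x))" "square_integrable (\<lambda>x. complex_of_real (pderiv_at i \<psi> x))"
      using test_function_bounded(2,3)[OF \<psi>, of "[i]"] by (auto intro: integrable_of_real square_integrable_of_real)
    have "l2_nth i (vec_fourier (grad_L2 \<psi>)) = fourier_L2 (abs_L2 (\<lambda>x. complex_of_real (pderiv_at i \<psi> x)))"
      unfolding l2_nth_vec_fourier grad_L2_def l2_mult_abs[OF bounded_symbol_of_real_nth grad_square_integrable(1)[OF \<psi>]]
      by simp
    also have "\<dots> = abs_L2 (schwartz_fourier (\<lambda>x. complex_of_real (pderiv_at i \<psi> x)))" by (rule fourier_L2_abs[OF p])
    finally have E: "l2_nth i (vec_fourier (grad_L2 \<psi>)) = abs_L2 (schwartz_fourier (\<lambda>x. complex_of_real (pderiv_at i \<psi> x)))" .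
    show ?thesis
      using rep_abs_L2[OF schwartz_fourier_contraction(1)[OF p]]
        rep_l2_mult[OF bounded_symbol_nth, of i "vec_fourier (grad_L2 \<psi>)", unfolded E]
      by eventually_elim (simp only: schwartz_fourier_pderiv_test_function[OF \<psi>])
  qed
  from c[of 1] c[of 2] c[of 3] show ?thesis
    by eventually_elim (simp add: curl_symbol_def ccross3_def vec_eq_iff forall_3 vector_3)
qed

lemma maxwell_group_grad:
  assumes \<psi>: "test_function \<psi>"
  shows "maxwell_group t (grad_L2 \<psi>, 0) = (grad_L2 \<psi>, 0)" "maxwell_group t (0, grad_L2 \<psi>) = (0, grad_L2 \<psi>)"
proof -
  have v0: "AE k in lborel. rep_L2 (vec_fourier 0) k = 0"
    using rep_L2_zero by (simp add: linear_0[OF bounded_linear.linear[OF bounded_linear_vec_fourier]])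
  show "maxwell_group t (grad_L2 \<psi>, 0) = (grad_L2 \<psi>, 0)"
  proof (rule maxwell_group_eqI, rule L2_eqI)
    show "AE k in lborel. rep_L2 (pair_fourier (grad_L2 \<psi>, 0)) k =
        rep_L2 (l2_mult (maxwell_symbol t) (pair_fourier (grad_L2 \<psi>, 0))) k"
      using rep_pair_fourier[of "(grad_L2 \<psi>, 0)"] rep_l2_mult[OF bounded_symbol_maxwell, of t "pair_fourier (grad_L2 \<psi>, 0)"]
        curl_symbol_vec_fourier_grad[OF \<psi>] v0
      by eventually_elim (simp add: maxwell_symbol_def)
  qed
  show "maxwell_group t (0, grad_L2 \<psi>) = (0, grad_L2 \<psi>)"
  proof (rule maxwell_group_eqI, rule L2_eqI)
    show "AE k in lborel. rep_L2 (pair_fourier (0, grad_L2 \<psi>)) k =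
        rep_L2 (l2_mult (maxwell_symbol t) (pair_fourier (0, grad_L2 \<psi>))) k"
      using rep_pair_fourier[of "(0, grad_L2 \<psi>)"] rep_l2_mult[OF bounded_symbol_maxwell, of t "pair_fourier (0, grad_L2 \<psi>)"]
        curl_symbol_vec_fourier_grad[OF \<psi>] v0
      by eventually_elim (simp add: maxwell_symbol_def)
  qed
qed

lemma weak_div_iff:
  "weak_div F \<rho> \<longleftrightarrow> (\<forall>\<psi>. test_function \<psi> \<longrightarrow> - (F \<bullet> grad_L2 \<psi>) = (LINT x|lborel. \<rho> x * \<psi> x))"
proof -
  have "F \<bullet> grad_L2 \<psi> = (LINT x|lborel. rep_L2 F x \<bullet> (\<chi> i. pderiv_at i \<psi> x))" if "test_function \<psi>" for \<psi>
    using inner_abs_L2[OF square_integrable_rep_L2[of F] grad_square_integrable(1)[OF that]]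
    by (simp add: grad_L2_def)
  then show ?thesis by (simp add: weak_div_def)
qed

text \<open>Charge conservation in weak form.\<close>

lemma charge_density_derivative:
  assumes \<phi>: "square_integrable \<phi>" and \<psi>: "test_function \<psi>"
    and \<xi>: "(\<xi> has_vector_derivative v) (at t)"
  shows "((\<lambda>t. LINT x|lborel. charge_density e \<phi> (\<xi> t) x * \<psi> x) has_real_derivative
    current e \<phi> (\<xi> t) v \<bullet> grad_L2 \<psi>) (at t)"
proof -
  have [measurable]: "\<phi> \<in> borel_measurable borel" using \<phi> by measurable
  have [measurable]: "\<psi> \<in> borel_measurable borel"
    using test_function_bounded(2)[OF \<psi>, of "[]"] by (auto dest: borel_measurable_integrable)
  have gm [measurable]: "(\<lambda>x. \<chi> i. pderiv_at i \<psi> x) \<in> borel_measurable borel"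
    by (rule borel_measurable_continuous_onI[OF grad_continuous[OF \<psi>]])
  let ?g = "\<lambda>x. \<chi> i. pderiv_at i \<psi> x"
  obtain K where K: "K \<ge> 0" "\<And>x y. \<bar>\<psi> x - \<psi> y\<bar> \<le> K * norm (x - y)" using test_function_lipschitz[OF \<psi>] by blast
  obtain R where R: "\<And>x. R < norm x \<Longrightarrow> \<psi> x = 0" using \<psi> by (auto simp: test_function_def)
  have \<psi>2: "square_integrable \<psi>" using test_function_bounded(3)[OF \<psi>, of "[]"] by simp
  \<comment> \<open>The substitution moves the dependence on the position from \<phi> to the smooth
    function \<psi>, so only \<psi> is differentiated.\<close>
  have sh: "(LINT x|lborel. charge_density e \<phi> z x * \<psi> x) = (LINT y|lborel. e * (\<phi> y * \<psi> (z - y)))" for z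
    using lborel_integral_reflect(2)[of "\<lambda>x. charge_density e \<phi> z x * \<psi> x" z, symmetric]
    by (simp add: charge_density_def mult.assoc)
  have int: "integrable lborel (\<lambda>y. e * (\<phi> y * \<psi> (z - y)))" for z
    using square_integrable_inner[OF \<phi>, of "\<lambda>y. \<psi> (z - y)"] square_integrable_affine[OF \<psi>2, of "-1" z] by simp
  have cur: "current e \<phi> (\<xi> t) v \<bullet> grad_L2 \<psi> = (LINT y|lborel. e * (\<phi> y * (v \<bullet> ?g (\<xi> t - y))))"
  proof -
    have "current e \<phi> (\<xi> t) v \<bullet> grad_L2 \<psi> = (LINT x|lborel. ((e * \<phi> (\<xi> t - x)) *\<^sub>R v) \<bullet> ?g x)"
      unfolding current_def grad_L2_def
      by (rule inner_abs_L2[OF square_integrable_reflect_scale[OF \<phi>] grad_square_integrable(1)[OF \<psi>]])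
    also have "\<dots> = (LINT y|lborel. e * (\<phi> y * (v \<bullet> ?g (\<xi> t - y))))"
      using lborel_integral_reflect(2)[of "\<lambda>x. ((e * \<phi> (\<xi> t - x)) *\<^sub>R v) \<bullet> ?g x" "\<xi> t", symmetric]
      by (simp add: mult.assoc)
    finally show ?thesis .
  qed
  show ?thesis
    unfolding has_field_derivative_iff sh cur tendsto_at_iff_sequentially o_def
  proof (intro allI impI)
    fix \<tau> assume "\<forall>n. \<tau> n \<in> UNIV - {t}" and \<tau>: "\<tau> \<longlonglongrightarrow> t"
    then have nt: "\<tau> n - t \<noteq> 0" for n by auto
    have q: "(\<lambda>n. inverse (\<tau> n - t) *\<^sub>R (\<xi> (\<tau> n) - \<xi> t)) \<longlonglongrightarrow> v"
    proof -
      have "((\<lambda>h. inverse h *\<^sub>R (\<xi> (t + h) - \<xi> t)) \<longlongrightarrow> v) (at 0)"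
        using \<xi> unfolding has_vector_derivative_def by (rule has_derivative_quotient)
      moreover have "filterlim (\<lambda>n. \<tau> n - t) (at 0) sequentially"
        unfolding filterlim_at using LIM_zero[OF \<tau>] nt by simp
      ultimately have "(\<lambda>n. inverse (\<tau> n - t) *\<^sub>R (\<xi> (t + (\<tau> n - t)) - \<xi> t)) \<longlonglongrightarrow> v"
        by (rule filterlim_compose)
      then show ?thesis by simp
    qed
    from convergent_imp_Bseq[OF convergentI[OF this]]
    obtain L where L: "\<And>n. norm (inverse (\<tau> n - t) *\<^sub>R (\<xi> (\<tau> n) - \<xi> t)) \<le> L"
      unfolding Bseq_def by blast
    have "isCont \<xi> t" by (rule has_vector_derivative_continuous[OF \<xi>])
    then have \<xi>\<tau>: "(\<lambda>n. \<xi> (\<tau> n)) \<longlonglongrightarrow> \<xi> t" using \<tau> by (rule isCont_tendsto_compose)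
    from convergent_imp_Bseq[OF convergentI[OF this]] obtain M where M: "\<And>n. norm (\<xi> (\<tau> n)) \<le> M"
      unfolding Bseq_def by blast
    have Mt: "norm (\<xi> t) \<le> M" by (rule LIMSEQ_le_const2[OF tendsto_norm[OF \<xi>\<tau>]]) (use M in blast)
    let ?d = "\<lambda>n y. (\<psi> (\<xi> (\<tau> n) - y) - \<psi> (\<xi> t - y)) / (\<tau> n - t)"
    have "(\<lambda>n. LINT y|lborel. e * (\<phi> y * ?d n y)) \<longlonglongrightarrow> (LINT y|lborel. e * (\<phi> y * (v \<bullet> ?g (\<xi> t - y))))"
    \<comment> \<open>\<open>K\<close> is the Lipschitz constant of \<psi> and \<open>L\<close>
      bounds the difference quotients of the trajectory. All positions have norm at most
      \<open>M\<close> and \<psi> vanishes beyond radius \<open>R\<close>, so only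
      \<open>norm y \<le> M + R\<close> contributes.\<close>
    proof (rule integral_dominated_convergence[where w = "\<lambda>y. \<bar>e\<bar> * ((K * L) * (\<bar>\<phi> y\<bar> * indicator (cball 0 (M + R)) y))"])
      have "square_integrable (indicator (cball 0 (M + R)) :: real^3 \<Rightarrow> real)"
      proof -
        have "integrable lborel (indicator (cball 0 (M + R)) :: real^3 \<Rightarrow> real)"
          by (rule integrable_real_indicator) (use emeasure_bounded_finite[OF bounded_cball, of "0 :: real^3" "M + R"] in auto)
        moreover have "(norm (indicator (cball 0 (M + R)) x :: real))\<^sup>2 = indicator (cball 0 (M + R)) x" for x :: "real^3"
          by (simp add: indicator_def)
        ultimately show ?thesis by (simp add: square_integrable_def)
      qed
      moreover have "square_integrable (\<lambda>y. \<bar>\<phi> y\<bar>)" using \<phi> by (simp add: square_integrable_def)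
      ultimately have "integrable lborel (\<lambda>y. \<bar>\<phi> y\<bar> * indicator (cball 0 (M + R)) y)"
        using square_integrable_inner[of "\<lambda>y. \<bar>\<phi> y\<bar>"] by fastforce
      then show "integrable lborel (\<lambda>y. \<bar>e\<bar> * ((K * L) * (\<bar>\<phi> y\<bar> * indicator (cball 0 (M + R)) y)))"
        by (intro integrable_mult_right)
      show "AE y in lborel. (\<lambda>n. e * (\<phi> y * ?d n y)) \<longlonglongrightarrow> e * (\<phi> y * (v \<bullet> ?g (\<xi> t - y)))"
      proof (intro AE_I2 tendsto_intros)
        fix y
        have "((\<lambda>s. \<psi> (\<xi> s - y)) has_derivative (\<lambda>s. (s *\<^sub>R v) \<bullet> ?g (\<xi> t - y))) (at t)"
        proof (rule has_derivative_compose[where f = "\<lambda>s. \<xi> s - y" and g = \<psi>])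
          show "((\<lambda>s. \<xi> s - y) has_derivative (\<lambda>s. s *\<^sub>R v)) (at t)"
            using has_derivative_diff[OF \<xi>[unfolded has_vector_derivative_def] has_derivative_const[of y]] by simp
        qed (use test_function_has_derivative[OF \<psi>] in simp)
        then have "((\<lambda>s. \<psi> (\<xi> s - y)) has_real_derivative v \<bullet> ?g (\<xi> t - y)) (at t)"
          unfolding has_field_derivative_def by (rule has_derivative_eq_rhs) (simp add: fun_eq_iff)
        then show "(\<lambda>n. ?d n y) \<longlonglongrightarrow> v \<bullet> ?g (\<xi> t - y)"
          using \<tau> nt unfolding has_field_derivative_iff tendsto_at_iff_sequentially o_def
          by (auto dest!: spec[of _ \<tau>])
      qed
      show "AE y in lborel. norm (e * (\<phi> y * ?d n y)) \<le> \<bar>e\<bar> * ((K * L) * (\<bar>\<phi> y\<bar> * indicator (cball 0 (M + R)) y))" for n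
      proof (rule AE_I2)
        fix y :: "real^3"
        have "\<bar>?d n y\<bar> \<le> K * L * indicator (cball 0 (M + R)) y"
        proof (cases "norm y \<le> M + R")
          case True
          have "\<bar>\<psi> (\<xi> (\<tau> n) - y) - \<psi> (\<xi> t - y)\<bar> \<le> K * norm (\<xi> (\<tau> n) - \<xi> t)"
            using K(2)[of "\<xi> (\<tau> n) - y" "\<xi> t - y"] by simp
          then have "\<bar>?d n y\<bar> \<le> K * (norm (\<xi> (\<tau> n) - \<xi> t) / \<bar>\<tau> n - t\<bar>)"
            using nt[of n] by (simp add: abs_divide divide_right_mono)
          also have "norm (\<xi> (\<tau> n) - \<xi> t) / \<bar>\<tau> n - t\<bar> = norm (inverse (\<tau> n - t) *\<^sub>R (\<xi> (\<tau> n) - \<xi> t))"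
            by (simp add: divide_inverse mult.commute abs_inverse)
          also have "K * \<dots> \<le> K * L" by (intro mult_left_mono L K)
          finally show ?thesis using True by simp
        next
          case False
          have "R < norm (z - y)" if "norm z \<le> M" for z
            using False that norm_triangle_ineq2[of y z] by (simp add: norm_minus_commute)
          then show ?thesis using R M Mt False by simp
        qed
        then have "\<bar>e\<bar> * (\<bar>\<phi> y\<bar> * \<bar>?d n y\<bar>) \<le> \<bar>e\<bar> * (\<bar>\<phi> y\<bar> * (K * L * indicator (cball 0 (M + R)) y))"
          by (intro mult_left_mono) auto
        then show "norm (e * (\<phi> y * ?d n y)) \<le> \<bar>e\<bar> * ((K * L) * (\<bar>\<phi> y\<bar> * indicator (cball 0 (M + R)) y))"
          by (simp only: real_norm_def abs_mult mult.left_commute mult.assoc)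
      qed
    qed measurable
    moreover have "(LINT y|lborel. e * (\<phi> y * ?d n y)) =
        ((LINT y|lborel. e * (\<phi> y * \<psi> (\<xi> (\<tau> n) - y))) - (LINT y|lborel. e * (\<phi> y * \<psi> (\<xi> t - y)))) / (\<tau> n - t)" for n
    proof -
      have "(LINT y|lborel. e * (\<phi> y * ?d n y)) = (LINT y|lborel. (e * (\<phi> y * \<psi> (\<xi> (\<tau> n) - y)) - e * (\<phi> y * \<psi> (\<xi> t - y))) / (\<tau> n - t))"
        by (intro Bochner_Integration.integral_cong refl) (simp add: right_diff_distrib diff_divide_distrib)
      also have "\<dots> = (LINT y|lborel. e * (\<phi> y * \<psi> (\<xi> (\<tau> n) - y)) - e * (\<phi> y * \<psi> (\<xi> t - y))) / (\<tau> n - t)"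
        by (rule integral_divide_zero)
      finally show ?thesis by (simp only: Bochner_Integration.integral_diff[OF int int])
    qed
    ultimately show "(\<lambda>n. ((LINT y|lborel. e * (\<phi> y * \<psi> (\<xi> (\<tau> n) - y))) - (LINT y|lborel. e * (\<phi> y * \<psi> (\<xi> t - y)))) / (\<tau> n - t))
        \<longlonglongrightarrow> (LINT y|lborel. e * (\<phi> y * (v \<bullet> ?g (\<xi> t - y))))"
      by (simp only:)
  qed
qed

lemma divergence_propagates:
  assumes \<phi>: "square_integrable \<phi>"
    and dF: "\<And>t. (F has_vector_derivative maxwell_group (c - t) (- current e \<phi> (\<xi> t) (v t), 0)) (at t)"
    and \<xi>: "\<And>t. (\<xi> has_vector_derivative v t) (at t)"
    and init: "weak_div (fst (F c)) (charge_density e \<phi> (\<xi> c))" "weak_div (snd (F c)) (\<lambda>x. 0)"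
  shows "weak_div (fst (maxwell_group (t - c) (F t))) (charge_density e \<phi> (\<xi> t))"
    "weak_div (snd (maxwell_group (t - c) (F t))) (\<lambda>x. 0)"
proof -
  have dI: "((\<lambda>t. F t \<bullet> G) has_real_derivative (- current e \<phi> (\<xi> t) (v t), 0) \<bullet> G) (at t)"
    if "\<And>t. maxwell_group t G = G" for t G
  proof -
    have "((\<lambda>t. F t \<bullet> G) has_vector_derivative maxwell_group (c - t) (- current e \<phi> (\<xi> t) (v t), 0) \<bullet> G) (at t)"
      by (rule bounded_linear.has_vector_derivative[OF bounded_linear_inner_left dF])
    then show ?thesis
      unfolding has_real_derivative_iff_has_vector_derivative maxwell_group_adjoint that .
  qed
  have eq: "maxwell_group (t - c) (F t) \<bullet> G = F t \<bullet> G" if "\<And>t. maxwell_group t G = G" for G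
    unfolding maxwell_group_adjoint that ..
  show "weak_div (fst (maxwell_group (t - c) (F t))) (charge_density e \<phi> (\<xi> t))"
    unfolding weak_div_iff
  proof (intro allI impI)
    fix \<psi> assume \<psi>: "test_function \<psi>"
    let ?G = "(grad_L2 \<psi>, 0 :: (real^3) L2)"
    let ?p = "\<lambda>t. LINT x|lborel. charge_density e \<phi> (\<xi> t) x * \<psi> x"
    note G = maxwell_group_grad(1)[OF \<psi>]
    \<comment> \<open>The group fixes \<open>?G\<close> and drops out of the derivative of the field
      term, which is then the negative of the derivative of the charge term.\<close>
    have "((\<lambda>t. F t \<bullet> ?G + ?p t) has_real_derivative 0) (at s)" for s
      using DERIV_add[OF dI[OF G, of s] charge_density_derivative[OF \<phi> \<psi> \<xi>[of s], of e]] by simp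
    then have "F t \<bullet> ?G + ?p t = F c \<bullet> ?G + ?p c" by (intro DERIV_isconst_all[of "\<lambda>t. F t \<bullet> ?G + ?p t"]) simp
    moreover have "F c \<bullet> ?G + ?p c = 0"
      using init(1) \<psi> unfolding weak_div_iff by (cases "F c") auto
    ultimately show "- (fst (maxwell_group (t - c) (F t)) \<bullet> grad_L2 \<psi>) = ?p t"
      using eq[OF G] by (cases "maxwell_group (t - c) (F t)") simp
  qed
  show "weak_div (snd (maxwell_group (t - c) (F t))) (\<lambda>x. 0)"
    unfolding weak_div_iff
  proof (intro allI impI)
    fix \<psi> assume \<psi>: "test_function \<psi>"
    let ?G = "(0 :: (real^3) L2, grad_L2 \<psi>)"
    note G = maxwell_group_grad(2)[OF \<psi>]
    have "((\<lambda>t. F t \<bullet> ?G) has_real_derivative 0) (at s)" for s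
      using dI[OF G, of s] by simp
    then have "F t \<bullet> ?G = F c \<bullet> ?G" by (intro DERIV_isconst_all[of "\<lambda>t. F t \<bullet> ?G"]) simp
    moreover have "F c \<bullet> ?G = 0"
      using init(2) \<psi> unfolding weak_div_iff by (cases "F c") auto
    ultimately show "- (snd (maxwell_group (t - c) (F t)) \<bullet> grad_L2 \<psi>) = (LINT x|lborel. 0 * \<psi> x)"
      using eq[OF G] by (cases "maxwell_group (t - c) (F t)") simp
  qed
qed

section \<open>Existence and uniqueness\<close>

lemma continuous_on_if_derivative:
  assumes "\<And>t. (f has_vector_derivative f' t) (at t)"
  shows "continuous_on UNIV f"
  by (intro continuous_at_imp_continuous_on ballI has_vector_derivative_continuous[OF assms])

lemma maxwell_solution_regularity:
  assumes \<phi>: "square_integrable \<phi>" and r: "r \<ge> 0" and H: "in_Hs r (dist_of \<phi>)"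
    and init: "\<forall>i. in_Hs r (component E0 i) \<and> in_Hs r (component B0 i)" "F c = (E0, B0)"
    and dF: "\<And>t. (F has_vector_derivative maxwell_group (c - t) (- current e \<phi> (\<xi> t) (v t), 0)) (at t)"
    and \<xi>: "continuous_on UNIV \<xi>" and v: "continuous_on UNIV v"
  defines "P \<equiv> \<lambda>t. maxwell_group (t - c) (F t)"
  shows "Hs_C0 r (\<lambda>t. component (fst (P t)) i)" "Hs_C1 (r - 1) (\<lambda>t. component (fst (P t)) i)"
    "Hs_C0 r (\<lambda>t. component (snd (P t)) i)" "Hs_C1 (r - 1) (\<lambda>t. component (snd (P t)) i)"
proof -
  obtain X where X: "charge_transform \<phi> = weight_op r X" using charge_transform_weight[OF \<phi> H r] by blast
  obtain q0 where q0: "pair_fourier (F c) = weight_op r q0"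
    unfolding init(2) using pair_fourier_weight_factor[OF r init(1)] by blast
  note weighted = \<phi> r X q0 dF \<xi> v
  let ?J = "weighted_current e \<xi> v X"
  obtain Q where QP: "\<And>t. pair_fourier (P t) = weight_op r (Q t)" and Q: "continuous_on UNIV Q"
    and lim: "\<And>t. ((\<lambda>h. inverse h *\<^sub>R (weight_op 1 (Q (t + h)) - weight_op 1 (Q t))) \<longlongrightarrow>
        l2_mult generator_symbol (Q t) + weight_op 1 (?J t)) (at 0)"
    unfolding P_def using weighted_field[OF weighted] by blast
  have w1: "bounded_symbol (\<lambda>k w :: (complex^3) \<times> (complex^3). sobolev_weight 1 k *\<^sub>R w) 1" by (rule bounded_symbol_weight) simp
  have Q': "continuous_on UNIV (\<lambda>t. l2_mult generator_symbol (Q t) + weight_op 1 (?J t))"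
    by (intro continuous_on_add bounded_linear.continuous_on[OF bounded_linear_l2_mult[OF bounded_symbol_generator] Q]
        bounded_linear.continuous_on[OF bounded_linear_l2_mult[OF w1] continuous_on_weighted_current[OF weighted]])
  note d = field_derivative_distribution[OF QP pair_fourier_weighted_current[OF weighted] r]
  have u: "has_fourier (component (fst (P t)) i) (\<lambda>k. fst (rep_L2 (weight_op r (Q t)) k) $ i)"
    "has_fourier (component (snd (P t)) i) (\<lambda>k. snd (rep_L2 (weight_op r (Q t)) k) $ i)" for t
    using has_fourier_fst[of "P t" i] has_fourier_snd[of "P t" i] by (simp_all only: QP)
  show "Hs_C0 r (\<lambda>t. component (fst (P t)) i)" "Hs_C1 (r - 1) (\<lambda>t. component (fst (P t)) i)"
    by (rule Hs_regularity[OF bounded_symbol_fst_nth r tempered_component u(1) d(1) Q Q' lim])+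
  show "Hs_C0 r (\<lambda>t. component (snd (P t)) i)" "Hs_C1 (r - 1) (\<lambda>t. component (snd (P t)) i)"
    by (rule Hs_regularity[OF bounded_symbol_snd_nth r tempered_component u(2) d(2) Q Q' lim])+
qed

theorem theorem2:
  fixes e t0 r :: real
    and \<phi> :: "real^3 \<Rightarrow> real"
    and E0 B0 :: "(real^3) L2"
    and \<xi>0 v0 :: "real^3"
  assumes "r \<ge> 0"
    and "\<forall>x. \<phi> differentiable (at x)"
    and "square_integrable \<phi>"
    and "in_Hs r (dist_of \<phi>)"
    and "in_Hs 1 (dist_of \<phi>)"
    and "\<forall>\<xi>. \<exists>E B. (\<forall>i. in_Hs r (component E i) \<and> in_Hs r (component B i)) \<and>
           weak_div E (charge_density e \<phi> \<xi>) \<and> weak_div B (\<lambda>x. 0)"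
    and "\<forall>i. in_Hs r (component E0 i) \<and> in_Hs r (component B0 i)"
    and "weak_div E0 (charge_density e \<phi> \<xi>0)"
    and "weak_div B0 (\<lambda>x. 0)"
  shows "\<exists>!(E, B, \<xi>, v).
           solution_space r E B \<xi> v \<and>
           maxwell_newton_solution e \<phi> t0 E0 B0 \<xi>0 v0 E B \<xi> v"
proof -
  note \<phi> = assms(3)
  obtain C where "particle_field maxwell_group (current e \<phi>) (\<lambda>\<xi> E. e *\<^sub>R L2_convolution \<phi> E \<xi>) C"
    using particle_field_maxwell[OF \<phi> assms(5)] by blast
  then interpret particle_field maxwell_group "current e \<phi>" "\<lambda>\<xi> E. e *\<^sub>R L2_convolution \<phi> E \<xi>" C t0 .
  have lorentz: "lorentz_force e \<phi> E B \<xi> v = force \<xi> v (E, B)" for E B \<xi> v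
    by (simp add: lorentz_force_def force_def scaleR_add_right cross_mult_right)
  have C1: "f C1_differentiable_on UNIV"
    if "\<And>t. (f has_vector_derivative f' t) (at t)" "continuous_on UNIV f'" for f f' :: "real \<Rightarrow> real^3"
    using that by (auto simp: C1_differentiable_on_def)
  have exists: "\<exists>E B \<xi> v. solution_space r E B \<xi> v \<and> maxwell_newton_solution e \<phi> t0 E0 B0 \<xi>0 v0 E B \<xi> v"
  proof -
    obtain F \<xi> v where s: "solves F \<xi> v" and init: "F t0 = (E0, B0)" "\<xi> t0 = \<xi>0" "v t0 = v0"
      using solves_exists by blast
    define P where "P t = maxwell_group (t - t0) (F t)" for t
    note d = solvesD[OF s]
    have F: "continuous_on UNIV F" by (rule continuous_on_if_derivative[OF d(1)])
    have \<xi>: "continuous_on UNIV \<xi>" by (rule continuous_on_if_derivative[OF d(2)])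
    have v: "continuous_on UNIV v" by (rule continuous_on_if_derivative[OF d(3)])
    have P: "continuous_on UNIV P"
      unfolding P_def by (intro continuous_on_U continuous_intros F)
    note regularity = maxwell_solution_regularity[OF \<phi> assms(1,4,7) init(1) d(1) \<xi> v, folded P_def]
    have "v C1_differentiable_on UNIV"
      by (rule C1[OF d(3)[folded P_def] continuous_on_force[OF \<xi> v P]])
    with C1[OF d(2) v] regularity
    have "solution_space r (\<lambda>t. fst (P t)) (\<lambda>t. snd (P t)) \<xi> v" by (simp add: solution_space_def)
    moreover have "weak_div (fst (P t)) (charge_density e \<phi> (\<xi> t))" "weak_div (snd (P t)) (\<lambda>x. 0)" for t
      unfolding P_def
      by (rule divergence_propagates[where e = e, OF \<phi> d(1,2)]; simp add: init assms)+
    then have "maxwell_newton_solution e \<phi> t0 E0 B0 \<xi>0 v0 (\<lambda>t. fst (P t)) (\<lambda>t. snd (P t)) \<xi> v"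
      using solves_duhamel[OF s, folded P_def] by (simp add: maxwell_newton_solution_def lorentz init)
    ultimately show ?thesis by blast
  qed
  \<comment> \<open>Any member of the solution class is continuous with values in \<open>L2\<close>,
    so its Duhamel formulas can be differentiated and uniqueness of the interaction equation applies
    to it.\<close>
  have interaction: "solves (\<lambda>t. maxwell_group (t0 - t) (E t, B t)) \<xi> v" "(E t0, B t0) = (E0, B0)" "\<xi> t0 = \<xi>0" "v t0 = v0"
    if "solution_space r E B \<xi> v \<and> maxwell_newton_solution e \<phi> t0 E0 B0 \<xi>0 v0 E B \<xi> v" for E B \<xi> v
  proof -
    have "continuous_on UNIV E" "continuous_on UNIV B"
      using that by (auto simp: solution_space_def intro!: Hs_C0_imp_continuous[OF assms(1)])
    then have EB: "continuous_on UNIV (\<lambda>t. (E t, B t))" by (rule continuous_on_Pair)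
    have \<xi>: "continuous_on UNIV \<xi>" and v: "continuous_on UNIV v"
      using that by (auto simp: solution_space_def intro: C1_differentiable_imp_continuous_on)
    have duhamel: "has_oriented_integral (\<lambda>\<tau>. maxwell_group (t - \<tau>) (- current e \<phi> (\<xi> \<tau>) (v \<tau>), 0))
        ((E t, B t) - maxwell_group (t - t0) (E0, B0)) t0 t"
      "has_oriented_integral (\<lambda>\<tau>. newton_group (t - \<tau>) (0, force (\<xi> \<tau>) (v \<tau>) (E \<tau>, B \<tau>)))
        ((\<xi> t, v t) - newton_group (t - t0) (\<xi>0, v0)) t0 t" for t
      using that by (simp_all add: maxwell_newton_solution_def lorentz)
    show "solves (\<lambda>t. maxwell_group (t0 - t) (E t, B t)) \<xi> v" "(E t0, B t0) = (E0, B0)" "\<xi> t0 = \<xi>0" "v t0 = v0"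
      by (rule duhamel_solves[of "\<lambda>t. (E t, B t)" \<xi> v "(E0, B0)" \<xi>0 v0, OF EB \<xi> v duhamel])+
  qed
  have unique: "(E, B, \<xi>, v) = (E', B', \<xi>', v')"
    if sol: "solution_space r E B \<xi> v \<and> maxwell_newton_solution e \<phi> t0 E0 B0 \<xi>0 v0 E B \<xi> v"
      and sol': "solution_space r E' B' \<xi>' v' \<and> maxwell_newton_solution e \<phi> t0 E0 B0 \<xi>0 v0 E' B' \<xi>' v'"
    for E B \<xi> v E' B' \<xi>' v'
  proof -
    note I = interaction[OF sol] and I' = interaction[OF sol']
    have *: "maxwell_group (t0 - t) (E t, B t) = maxwell_group (t0 - t) (E' t, B' t) \<and> \<xi> t = \<xi>' t \<and> v t = v' t" for t
      by (rule solves_unique[OF I(1) I'(1)]) (simp_all only: I I')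
    \<comment> \<open>The free group is invertible, so equal interaction fields come from equal
      fields.\<close>
    then have "(E t, B t) = (E' t, B' t)" for t by (metis U_inverse)
    then show ?thesis using * by (auto intro: ext)
  qed
  show ?thesis
  proof (rule ex_ex1I)
    show "\<exists>z. case z of (E, B, \<xi>, v) \<Rightarrow> solution_space r E B \<xi> v \<and> maxwell_newton_solution e \<phi> t0 E0 B0 \<xi>0 v0 E B \<xi> v"
      using exists by auto
  next
    fix z z'
    assume z: "case z of (E, B, \<xi>, v) \<Rightarrow> solution_space r E B \<xi> v \<and> maxwell_newton_solution e \<phi> t0 E0 B0 \<xi>0 v0 E B \<xi> v"
      and z': "case z' of (E, B, \<xi>, v) \<Rightarrow> solution_space r E B \<xi> v \<and> maxwell_newton_solution e \<phi> t0 E0 B0 \<xi>0 v0 E B \<xi> v"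
    obtain E B \<xi> v E' B' \<xi>' v' where eq: "z = (E, B, \<xi>, v)" "z' = (E', B', \<xi>', v')" by (cases z, cases z')
    show "z = z'" unfolding eq by (rule unique) (use z z' in \<open>simp_all only: eq prod.case\<close>)
  qed
qed

end
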